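(* The free $\mathbb{Z}$-module $\mathbb{M}^!_{5/2,\varrho}$ has a canonical basis $\{G_d: d\in\mathbb{N},\ d\equiv1,3,7\bmod 8\}$, where $G_d$ is characterized (as an element of $\mathbb{M}^!_{5/2,\varrho}$) by the property $$G_d(\tau)=q^{-d/8}\mathfrak{e}_{\ell(-d)}+O(q^{1/8}).$$ Moreover, writing $c(G_d,m)\in\mathbb{Z}$ for the Fourier coefficients of $G_d$, one has $$c(G_d,m^2)\in m\mathbb{Z}$$ for all $m\in\mathbb{N}$ and all square-free $d\in\mathbb{N}$ with $d\equiv1,3,7\bmod8$.
   Context: Notation: $q=e^{2\pi i\tau}$ for $\tau$ in the upper half plane $\mathcal{H}$, $\mathbb{N}=\{1,2,\dots\}$, $\zeta_8=e^{2\pi i/8}$. $\mathrm{Mp}_2(\mathbb{Z})$ is the group of pairs $(\gamma,\varphi)$ with $\gamma=\begin{pmatrix}a&b\\c&d\end{pmatrix}\in\mathrm{SL}_2(\mathbb{Z})$ and $\varphi$ holomorphic on $\mathcal{H}$ with $\varphi(\tau)^2=c\tau+d$; it is generated by $T=\left(\begin{pmatrix}1&1\\0&1\end{pmatrix},1\right)$ and $S=\left(\begin{pmatrix}0&-1\\1&0\end{pmatrix},\sqrt{\tau}\right)$ (principal branch). The representation $\varrho:\mathrm{Mp}_2(\mathbb{Z})\to\mathrm{GL}_3(\mathbb{C})$ is given, in the standard basis $\mathfrak{e}_0,\mathfrak{e}_1,\mathfrak{e}_2$ of $\mathbb{C}^3$, by $$\varrho(T)=\begin{pmatrix}\zeta_8&&\\&\zeta_8^7&\\&&\zeta_8^5\end{pmatrix},\qquad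 \varrho(S)=\frac{\overline{\zeta_8}}{2}\begin{pmatrix}1&2&1\\1&0&-1\\1&-2&1\end{pmatrix}.$$ $M^!_{5/2,\varrho}$ is the space of weakly holomorphic modular forms of weight $5/2$ and type $\varrho$: holomorphic $G:\mathcal{H}\to\mathbb{C}^3$, meromorphic at the cusp $i\infty$, with $\varphi(\tau)^{-5}G(\gamma\tau)=\varrho((\gamma,\varphi))G(\tau)$ for all $(\gamma,\varphi)\in\mathrm{Mp}_2(\mathbb{Z})$. For an integer $m\equiv1,7,5\bmod 8$ let $\ell(m)\in\{0,1,2\}$ be the unique index with $1-m\equiv2\ell(m)\bmod 8$. Every $G\in M^!_{5/2,\varrho}$ has a Fourier expansion $G(\tau)=\sum_{m}c(G,m)\,q^{m/8}\mathfrak{e}_{\ell(m)}$ over integers $m\equiv1,5,7\bmod 8$; put $c(G,m)=0$ for all other $m$. $\mathbb{M}^!_{5/2,\varrho}\subset M^!_{5/2,\varrho}$ is the $\mathbb{Z}$-submodule of forms all of whose Fourier coefficients $c(G,m)$ are integers. *)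

theory Defs
  imports
    "HOL-Complex_Analysis.Complex_Analysis"
    "HOL-Library.Function_Algebras"
    "HOL-Library.Landau_Symbols"
    "HOL-Computational_Algebra.Squarefree"
    "HOL-Number_Theory.Cong"
    "HOL-Algebra.Group"
begin

unbundle no fps_syntax

definition upper_half_plane :: "complex set" (\<open>\<H>\<close>) where
  "\<H> = {\<tau>. Im \<tau> > 0}"

text \<open>
  A function on the upper half plane is represented by a total function on \<^typ>\<open>complex\<close> that
  vanishes off the upper half plane, so that equality of the total functions is equality on the
  upper half plane.
\<close>

definition on_\<H> :: "(complex \<Rightarrow> 'a::zero) \<Rightarrow> complex \<Rightarrow> 'a" where
  "on_\<H> f = (\<lambda>\<tau>. if \<tau> \<in> \<H> then f \<tau> else 0)"

definition moebius_act :: "int^2^2 \<Rightarrow> complex \<Rightarrow> complex" where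
  "moebius_act \<gamma> \<tau> = (of_int (\<gamma>$1$1) * \<tau> + of_int (\<gamma>$1$2)) / (of_int (\<gamma>$2$1) * \<tau> + of_int (\<gamma>$2$2))"

definition Mp2Z :: "((int^2^2) \<times> (complex \<Rightarrow> complex)) monoid" where
  "Mp2Z = \<lparr>carrier = {(\<gamma>, \<phi>). det \<gamma> = 1 \<and> \<phi> holomorphic_on \<H> \<and>
              (\<forall>\<tau>\<in>\<H>. \<phi> \<tau> ^ 2 = of_int (\<gamma>$2$1) * \<tau> + of_int (\<gamma>$2$2)) \<and> \<phi> = on_\<H> \<phi>},
           monoid.mult = (\<lambda>(\<gamma>, \<phi>) (\<gamma>', \<phi>'). (\<gamma> ** \<gamma>', on_\<H> (\<lambda>\<tau>. \<phi> (moebius_act \<gamma>' \<tau>) * \<phi>' \<tau>))),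
           one = (mat 1, on_\<H> (\<lambda>_. 1))\<rparr>"

definition Mp2_T :: "(int^2^2) \<times> (complex \<Rightarrow> complex)" where
  "Mp2_T = (vector [vector [1, 1], vector [0, 1]], on_\<H> (\<lambda>_. 1))"

definition Mp2_S :: "(int^2^2) \<times> (complex \<Rightarrow> complex)" where
  "Mp2_S = (vector [vector [0, -1], vector [1, 0]], on_\<H> csqrt)"

definition GL3C :: "(complex^3^3) monoid" where
  "GL3C = \<lparr>carrier = {A. invertible A}, monoid.mult = (**), one = mat 1\<rparr>"

definition \<zeta>8 :: complex where
  "\<zeta>8 = exp (2 * pi * \<i> / 8)"

text \<open>The standard basis is numbered from 0 to 2, the coordinates of \<^typ>\<open>complex^3\<close> from 1 to 3.\<close>

definition coord :: "nat \<Rightarrow> 3" where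
  "coord l = of_nat (Suc l)"

definition basis_vec :: "nat \<Rightarrow> complex^3" (\<open>\<ee>\<close>) where
  "\<ee> l = axis (coord l) 1"

definition rho_T :: "complex^3^3" where
  "rho_T = vector [vector [\<zeta>8, 0, 0], vector [0, \<zeta>8 ^ 7, 0], vector [0, 0, \<zeta>8 ^ 5]]"

definition rho_S :: "complex^3^3" where
  "rho_S = mat (cnj \<zeta>8 / 2) ** vector [vector [1, 2, 1], vector [1, 0, -1], vector [1, -2, 1]]"

definition q8 :: "complex \<Rightarrow> complex" where
  "q8 \<tau> = exp (2 * pi * \<i> * \<tau> / 8)"

text \<open>The Laurent series \<open>F\<close> is the Fourier expansion of \<open>g\<close> in powers of \<open>q\<close> to the \<open>1/8\<close>.\<close>

definition has_q8_expansion :: "(complex \<Rightarrow> complex) \<Rightarrow> complex fls \<Rightarrow> bool"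
    (infixl \<open>(has'_q8'_expansion)\<close> 50) where
  "g has_q8_expansion F \<longleftrightarrow> (\<exists>f. f has_laurent_expansion F \<and> (\<forall>\<tau>\<in>\<H>. g \<tau> = f (q8 \<tau>)))"

definition meromorphic_at_cusp :: "(complex \<Rightarrow> complex) \<Rightarrow> bool" where
  "meromorphic_at_cusp g \<longleftrightarrow> (\<exists>f. f meromorphic_on {0} \<and> (\<forall>\<tau>\<in>\<H>. g \<tau> = f (q8 \<tau>)))"

text \<open>The space of weakly holomorphic modular forms of weight \<open>5/2\<close> and type \<open>\<rho>\<close>.\<close>

definition weak_forms :: "((int^2^2) \<times> (complex \<Rightarrow> complex) \<Rightarrow> complex^3^3) \<Rightarrow> (complex \<Rightarrow> complex^3) set"
  where
  "weak_forms \<rho> = {G. G = on_\<H> G \<and>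
     (\<forall>i. (\<lambda>\<tau>. G \<tau> $ i) holomorphic_on \<H> \<and> meromorphic_at_cusp (\<lambda>\<tau>. G \<tau> $ i)) \<and>
     (\<forall>(\<gamma>, \<phi>)\<in>carrier Mp2Z. \<forall>\<tau>\<in>\<H>.
        (\<phi> \<tau> powi (-5)) *s G (moebius_act \<gamma> \<tau>) = \<rho> (\<gamma>, \<phi>) *v G \<tau>)}"

definition ell :: "int \<Rightarrow> nat" where
  "ell m = (THE l. l \<in> {0, 1, 2} \<and> [1 - m = 2 * int l] (mod 8))"

definition fourier_coeff :: "(complex \<Rightarrow> complex^3) \<Rightarrow> int \<Rightarrow> complex" where
  "fourier_coeff G m =
     (if m mod 8 \<in> {1, 5, 7}
      then fls_nth (THE F. (\<lambda>\<tau>. G \<tau> $ coord (ell m)) has_q8_expansion F) m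
      else 0)"

definition integral_weak_forms ::
    "((int^2^2) \<times> (complex \<Rightarrow> complex) \<Rightarrow> complex^3^3) \<Rightarrow> (complex \<Rightarrow> complex^3) set" where
  "integral_weak_forms \<rho> = {G \<in> weak_forms \<rho>. \<forall>m. fourier_coeff G m \<in> \<int>}"

definition int_scale :: "int \<Rightarrow> (complex \<Rightarrow> complex^3) \<Rightarrow> complex \<Rightarrow> complex^3" where
  "int_scale k F = (\<lambda>\<tau>. of_int k *s F \<tau>)"

global_interpretation zmod: module int_scale
  by unfold_locales
    (auto simp: int_scale_def fun_eq_iff vec_eq_iff algebra_simps)

text \<open>\<open>G = q\<^sup>-\<^sup>d\<^sup>/\<^sup>8 \<ee> (\<ell>(-d)) + O(q\<^sup>1\<^sup>/\<^sup>8)\<close> as \<open>\<tau>\<close> tends to \<open>i\<infinity>\<close>.\<close>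

definition has_principal_part :: "nat \<Rightarrow> (complex \<Rightarrow> complex^3) \<Rightarrow> bool" where
  "has_principal_part d G \<longleftrightarrow>
     (\<lambda>\<tau>. norm (G \<tau> - (q8 \<tau> powi (- int d)) *s \<ee> (ell (- int d))))
       \<in> O[filtercomap Im at_top](\<lambda>\<tau>. norm (q8 \<tau>))"

definition admissible :: "nat set" where
  "admissible = {d. d \<ge> 1 \<and> d mod 8 \<in> {1, 3, 7}}"

end

(*
  The components of a form in the combinations a = (f0 + f2)/2, b = (f0 - f2)/2,
  c = f1 are permuted up to scalars by T and S exactly as the theta constants theta3, theta4, theta2.
  Products of theta constants therefore give integral forms with a single prescribed leading
  exponent; subtracting earlier forms produces the basis.  Uniqueness holds because for a form
  without principal part the function (a b c / (theta2 theta3 theta4)^5)^2 is invariant under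
  SL2(Z) and vanishes at the cusp.

  For an odd prime p the Hecke operator T(p^2) acts on the coefficients by
    c(m) |-> c(p^2 m) + p l(m) c(m) + p^3 c(m / p^2)
  with integers l(m).  Its modularity follows by evaluating the triple at 8b/N - 1/(N^2 w) through
  the quadratic Gauss sum in the transformation of h = theta2 theta3 theta4, because a h, b h, c h
  have weight 4 and depend on the transforming matrix only modulo 4.  Comparing principal parts expresses the image of
  G_D by G_(D/p^2), G_D and p^3 G_(p^2 D), and induction on k gives
  p^(k - j) | c(G_(d p^(2j)), p^(2k) n).
*)
theory Submission
  imports Defs "HOL-Probability.Probability"
begin

unbundle no Formal_Power_Series.fps_syntax and no Formal_Laurent_Series.fps_syntax

text \<open>The obstacle is the weight 5/2: branches of square roots would have to be followed
  through every matrix. Two devices avoid this. In the combinations a, b, c both generators act by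
  monomial matrices, so only T and S need checking. And h = theta2 theta3 theta4 has weight 3/2 and
  no zeros, so it moves questions to integral weight: 3 * 5/2 - 5 * 3/2 = 0 in the uniqueness
  argument, 5/2 + 3/2 = 4 for the Hecke operator. All theta transformations, including those with
  Gauss sums, come from one inversion formula for series with periodic coefficients, that is, from
  Poisson summation. In the Hecke operator p^3 is p^(2k-2) for k = 5/2. Starting from a square-free
  d, all forms that occur are indexed by d p^(2j), and nothing stands below j = 0. The induction
  runs over all j at once because the relation at j involves j + 1; the weight p^j in the claim is
  chosen so that each term gains at least one factor p. Divisibility at m^2 is the case j = 0, one
  odd prime at a time; for even m the number m^2 is 0 or 4 modulo 8 and the coefficient
  vanishes.\<close>

definition eexp :: "complex \<Rightarrow> complex" where
  "eexp z = exp (2 * of_real pi * \<i> * z)"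

lemma eexp_add: "eexp (x + y) = eexp x * eexp y"
  by (simp add: eexp_def ring_distribs exp_add)

lemma eexp_0 [simp]: "eexp 0 = 1"
  by (simp add: eexp_def)

lemma eexp_neq_0 [simp]: "eexp z \<noteq> 0"
  by (simp add: eexp_def)

lemma eexp_minus: "eexp (- z) = inverse (eexp z)"
  by (simp add: eexp_def exp_minus)

lemma eexp_diff: "eexp (x - y) = eexp x / eexp y"
  by (simp add: eexp_def ring_distribs exp_diff)

lemma eexp_of_int [simp]: "eexp (of_int n) = 1"
  unfolding eexp_def using exp_integer_2pi[of "of_int n"] by (simp add: mult_ac)

lemma eexp_of_nat [simp]: "eexp (of_nat n) = 1"
  using eexp_of_int[of "int n"] by simp

lemma eexp_1 [simp]: "eexp 1 = 1"
  using eexp_of_int[of 1] by simp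

lemma eexp_power: "eexp z ^ n = eexp (of_nat n * z)"
  by (simp add: eexp_def exp_of_nat_mult [symmetric] mult_ac)

lemma eexp_powi: "eexp z powi n = eexp (of_int n * z)"
  by (cases n rule: int_cases2)
     (auto simp: eexp_power eexp_minus power_int_minus)

lemma eexp_Ints: "z \<in> \<int> \<Longrightarrow> eexp z = 1"
  by (auto elim: Ints_cases)

lemma eexp_cong: "x - y \<in> \<int> \<Longrightarrow> eexp x = eexp y"
  by (metis div_by_1 divide_eq_1_iff eexp_Ints eexp_diff eexp_neq_0)

lemma eexp_eq_1_iff: "eexp z = 1 \<longleftrightarrow> z \<in> \<int>"
proof
  assume "eexp z = 1"
  then obtain n :: int where "Im (2 * of_real pi * \<i> * z) = real_of_int (2 * n) * pi"
      and "Re (2 * of_real pi * \<i> * z) = 0"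
    unfolding eexp_def exp_eq_1 by blast
  then have "z = of_int n" by (auto simp: complex_eq_iff)
  then show "z \<in> \<int>" by simp
qed (rule eexp_Ints)

lemma norm_eexp: "norm (eexp z) = exp (- 2 * pi * Im z)"
  by (simp add: eexp_def)

lemma norm_eexp_real [simp]: "norm (eexp (of_real x)) = 1"
  by (simp add: norm_eexp)

lemma eexp_holomorphic [holomorphic_intros]:
  "f holomorphic_on A \<Longrightarrow> (\<lambda>z. eexp (f z)) holomorphic_on A"
  unfolding eexp_def by (intro holomorphic_intros)

lemma eexp_continuous [continuous_intros]:
  "continuous_on A f \<Longrightarrow> continuous_on A (\<lambda>z. eexp (f z))"
  unfolding eexp_def by (intro continuous_intros)

lemma summable_on_int_power:
  fixes r :: real
  assumes "0 \<le> r" "r < 1"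
  shows "(\<lambda>k::int. r ^ nat \<bar>k\<bar>) summable_on UNIV"
proof -
  have s: "(\<lambda>n::nat. r ^ n) summable_on UNIV"
    using assms by (auto intro!: norm_summable_imp_summable_on summable_geometric)
  have 1: "(\<lambda>k::int. r ^ nat \<bar>k\<bar>) summable_on (range int)"
    by (subst summable_on_reindex) (use s in \<open>auto simp: o_def\<close>)
  have 2: "(\<lambda>k::int. r ^ nat \<bar>k\<bar>) summable_on (range (\<lambda>n. - int n))"
    by (subst summable_on_reindex) (use s in \<open>auto simp: o_def inj_def\<close>)
  have "UNIV = range int \<union> range (\<lambda>n. - int n)"
    by (auto simp: image_iff) (metis int_cases2)
  with summable_on_union[OF 1 2] show ?thesis by simp
qed

subsection \<open>Uniqueness of Fourier coefficients\<close>

text \<open>Stone-Weierstrass delivers polynomials in the real coordinates of the plane. On the unit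
  circle these coordinates are (w + cnj w) / 2 and (w - cnj w) / (2 i), so sums and products stay
  finite sums of characters. A list of coefficient-frequency pairs avoids collecting equal
  frequencies.\<close>

lemma trig_polynomial_of_real_polynomial:
  fixes r :: "complex \<Rightarrow> real"
  assumes "real_polynomial_function r"
  shows "\<exists>L :: (complex \<times> int) list. \<forall>x::real.
           of_real (r (eexp (of_real x))) = (\<Sum>(c, k)\<leftarrow>L. c * eexp (of_int k * of_real x))"
  using assms
proof induction
  case (linear f)
  have f: "f z = Re z * f 1 + Im z * f \<i>" for z
  proof -
    interpret bounded_linear f by fact
    have "z = Re z *\<^sub>R 1 + Im z *\<^sub>R \<i>"
      by (simp add: complex_eq_iff)
    then have "f z = f (Re z *\<^sub>R 1 + Im z *\<^sub>R \<i>)" by (rule arg_cong)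
    then show ?thesis by (simp only: add scaleR) simp
  qed
  have "of_real (f (eexp (of_real x))) =
      (of_real (f 1) - \<i> * of_real (f \<i>)) / 2 * eexp (of_int 1 * of_real x) +
      (of_real (f 1) + \<i> * of_real (f \<i>)) / 2 * eexp (of_int (-1) * of_real x)" for x :: real
  proof -
    let ?w = "eexp (of_real x)"
    have w: "eexp (- of_real x) = cnj ?w"
      by (simp add: eexp_def exp_cnj)
    have re: "of_real (Re ?w) = (?w + cnj ?w) / 2" and im: "of_real (Im ?w) = (?w - cnj ?w) / (2 * \<i>)"
      by (auto simp: complex_eq_iff)
    show ?thesis
      apply (subst f)
      apply (simp add: w)
      apply (simp add: re im)
      apply (simp add: field_simps)
      done
  qed
  then show ?case
    by (intro exI[of _ "[((of_real (f 1) - \<i> * of_real (f \<i>)) / 2, 1),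
          ((of_real (f 1) + \<i> * of_real (f \<i>)) / 2, -1)]"]) simp
next
  case (const c)
  show ?case by (intro exI[of _ "[(of_real c, 0)]"]) simp
next
  case (add f g)
  then obtain L M where
    "\<And>x. of_real (f (eexp (of_real x))) = (\<Sum>(c, k)\<leftarrow>L. c * eexp (of_int k * of_real x))"
    "\<And>x. of_real (g (eexp (of_real x))) = (\<Sum>(c, k)\<leftarrow>M. c * eexp (of_int k * of_real x))"
    by metis
  then show ?case by (intro exI[of _ "L @ M"]) simp
next
  case (mult f g)
  then obtain L M where LM:
    "\<And>x. of_real (f (eexp (of_real x))) = (\<Sum>(c, k)\<leftarrow>L. c * eexp (of_int k * of_real x))"
    "\<And>x. of_real (g (eexp (of_real x))) = (\<Sum>(c, k)\<leftarrow>M. c * eexp (of_int k * of_real x))"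
    by metis
  have one: "c * eexp (of_int k * z) * (\<Sum>(d, l)\<leftarrow>M. d * eexp (of_int l * z)) =
      (\<Sum>(d, l)\<leftarrow>map (\<lambda>(d, l). (c * d, k + l)) M. d * eexp (of_int l * z))" for c k z
    by (induction M) (auto simp: ring_distribs eexp_add)
  have "(\<Sum>(c, k)\<leftarrow>L. c * eexp (of_int k * z)) * (\<Sum>(d, l)\<leftarrow>M. d * eexp (of_int l * z)) =
      (\<Sum>(d, l)\<leftarrow>concat (map (\<lambda>(c, k). map (\<lambda>(d, l). (c * d, k + l)) M) L). d * eexp (of_int l * z))" for z
    by (induction L) (auto simp: ring_distribs one)
  then show ?case
    by (intro exI[of _ "concat (map (\<lambda>(c, k). map (\<lambda>(d, l). (c * d, k + l)) M) L)"]) (simp add: LM)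
qed

lemma periodic_int:
  fixes D :: "real \<Rightarrow> 'a"
  assumes "\<And>x. D (x + 1) = D x"
  shows "D (x + of_int n) = D x"
proof -
  have nat: "D (x + of_nat k) = D x" for x k
  proof (induction k)
    case (Suc k)
    have "D (x + of_nat (Suc k)) = D ((x + of_nat k) + 1)" by (simp add: add_ac)
    with Suc assms show ?case by metis
  qed simp
  show ?thesis
  proof (cases n rule: int_cases2)
    case (nonpos k)
    then show ?thesis using nat[of "x + of_int n" k] by simp
  qed (use nat in auto)
qed

text \<open>The conjugate of D, moved to the unit circle, is a uniform limit of trigonometric
  polynomials, and D is orthogonal to all of them. Hence the integral of |D|^2 vanishes.\<close>

lemma fourier_uniqueness:
  fixes D :: "real \<Rightarrow> complex"
  assumes cont: "continuous_on UNIV D" and per: "\<And>x. D (x + 1) = D x"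
    and zero: "\<And>s::int. integral {0..1} (\<lambda>x. D x * eexp (of_int s * of_real x)) = 0"
  shows "D x = 0"
proof -
  define f where "f = (\<lambda>z. cnj (D (Arg z / (2 * pi))))"
  have f_eexp: "f (eexp (of_real x)) = cnj (D x)" for x
  proof -
    have "eexp (of_real (Arg (eexp (of_real x)) / (2 * pi))) = eexp (of_real x)"
      using Arg_eq[of "eexp (of_real x)"] by (simp add: eexp_def mult_ac)
    then have "eexp (of_real (Arg (eexp (of_real x)) / (2 * pi) - x)) = 1"
      by (simp only: of_real_diff eexp_diff) simp
    then have "complex_of_real (Arg (eexp (of_real x)) / (2 * pi) - x) \<in> \<int>"
      by (simp only: eexp_eq_1_iff)
    then obtain n :: int where "complex_of_real (Arg (eexp (of_real x)) / (2 * pi) - x) = of_int n"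
      by (elim Ints_cases)
    then have "complex_of_real (Arg (eexp (of_real x)) / (2 * pi) - x) = of_real (of_int n)" by simp
    then have "Arg (eexp (of_real x)) / (2 * pi) - x = of_int n"
      unfolding of_real_eq_iff .
    then have "Arg (eexp (of_real x)) / (2 * pi) = x + of_int n" by simp
    with periodic_int[of D, OF per] show ?thesis by (simp add: f_def)
  qed
  have circle: "\<exists>x::real. z = eexp (of_real x)" if "z \<in> sphere 0 1" for z
    using Arg_eq[of z] that
    by (intro exI[of _ "Arg z / (2 * pi)"], cases "z = 0") (simp_all add: eexp_def mult_ac)
  have "continuous (at z0 within sphere 0 1) f" if z0: "z0 \<in> sphere 0 1" for z0
  proof -
    obtain x0 :: real where x0: "z0 = eexp (of_real x0)" using circle[OF z0] by blast
    \<comment> \<open>\<open>Arg\<close> jumps along the negative real axis. Dividing by the base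
      point z0 moves the relevant values close to 1, where \<open>Arg\<close> is continuous;
      periodicity of D makes this second formula for f agree with the first.\<close>
    have eq: "f z = cnj (D (x0 + Arg (z / z0) / (2 * pi)))" if z: "z \<in> sphere 0 1" for z
    proof -
      have "z / z0 = eexp (of_real (Arg (z / z0) / (2 * pi)))"
      proof -
        have "z \<noteq> 0" "z0 \<noteq> 0" using z z0 by auto
        with Arg_eq[of "z / z0"] show ?thesis
          using z z0 by (simp add: eexp_def mult_ac norm_divide)
      qed
      then have "z = eexp (of_real (x0 + Arg (z / z0) / (2 * pi)))"
        using x0 by (simp only: of_real_add eexp_add) (simp add: divide_eq_eq mult.commute)
      then show ?thesis using f_eexp by metis
    qed
    have z0': "z0 \<noteq> 0" by (simp add: x0)
    have "isCont Arg (z0 / z0)"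
      unfolding divide_self[OF z0'] by (rule continuous_at_Arg) simp
    moreover have "isCont (\<lambda>z. z / z0) z0"
      using z0' by (intro continuous_intros) simp
    ultimately have "isCont (\<lambda>z. Arg (z / z0)) z0"
      by (rule isCont_o2[rotated])
    then have "isCont (\<lambda>z. x0 + Arg (z / z0) / (2 * pi)) z0"
      by (intro isCont_add isCont_divide continuous_const) simp_all
    moreover have "isCont D y" for y
      using cont by (simp add: continuous_on_eq_continuous_at)
    ultimately have "isCont (\<lambda>z. D (x0 + Arg (z / z0) / (2 * pi))) z0"
      by (rule isCont_o2) 
    then have "isCont (\<lambda>z. cnj (D (x0 + Arg (z / z0) / (2 * pi)))) z0"
      by (rule continuous_cnj)
    then have "continuous (at z0 within sphere 0 1) (\<lambda>z. cnj (D (x0 + Arg (z / z0) / (2 * pi))))"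
      by (rule continuous_at_imp_continuous_at_within)
    then show ?thesis
      by (rule continuous_transform_within[of _ _ _ 1]) (use eq z0 in auto)
  qed
  then have contf: "continuous_on (sphere 0 1) f"
    by (simp add: continuous_on_eq_continuous_within)
  have contD: "continuous_on A D" for A
    using cont continuous_on_subset by blast
  define J where "J = integral {0..1} (\<lambda>x. norm (D x))"
  define I where "I = integral {0..1} (\<lambda>x. D x * cnj (D x))"
  have J: "J \<ge> 0" unfolding J_def by (intro integral_nonneg) (auto intro!: integrable_continuous_real continuous_intros contD)
  \<comment> \<open>The approximant g contributes nothing to the integral against D, so I is the
    integral of D (cnj D - g), at most e * J. The bound J + 1 can be divided by even when J =
    0.\<close>
  have key: "norm I \<le> e * (J + 1)" if e: "e > 0" for e
  proof -
    obtain g where g: "polynomial_function g" "\<And>z. z \<in> sphere 0 1 \<Longrightarrow> norm (f z - g z) < e"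
      using Stone_Weierstrass_polynomial_function[OF _ contf e] by (metis compact_sphere)
    have "real_polynomial_function (\<lambda>z. Re (g z))" "real_polynomial_function (\<lambda>z. Im (g z))"
      using g(1) bounded_linear_Re bounded_linear_Im by (auto simp: polynomial_function_def o_def)
    from this[THEN trig_polynomial_of_real_polynomial]
    obtain L M where L: "\<And>x::real. of_real (Re (g (eexp (of_real x)))) = (\<Sum>(c, k)\<leftarrow>L. c * eexp (of_int k * of_real x))"
      and M: "\<And>x::real. of_real (Im (g (eexp (of_real x)))) = (\<Sum>(c, k)\<leftarrow>M. c * eexp (of_int k * of_real x))"
      by blast
    have ann: "((\<lambda>x::real. D x * (\<Sum>(c, k)\<leftarrow>L. c * eexp (of_int k * of_real x))) has_integral 0) {0..1}" for L
    proof (induction L)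
      case (Cons a L)
      obtain c k where a: "a = (c, k)" by force
      have "((\<lambda>x::real. D x * eexp (of_int k * of_real x)) has_integral 0) {0..1}"
      proof -
        have "(\<lambda>x::real. D x * eexp (of_int k * of_real x)) integrable_on {0..1}"
          by (intro integrable_continuous_real continuous_intros contD)
        from integrable_integral[OF this] zero[of k] show ?thesis by simp
      qed
      then have "((\<lambda>x::real. c * (D x * eexp (of_int k * of_real x))) has_integral c * 0) {0..1}"
        by (rule has_integral_mult_right)
      from has_integral_add[OF this Cons] show ?case by (simp add: a algebra_simps)
    qed simp
    have "((\<lambda>x::real. D x * (\<Sum>(c, k)\<leftarrow>L. c * eexp (of_int k * of_real x)) +
       \<i> * (D x * (\<Sum>(c, k)\<leftarrow>M. c * eexp (of_int k * of_real x)))) has_integral 0 + \<i> * 0) {0..1}"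
      by (intro has_integral_add has_integral_mult_right ann)
    then have "((\<lambda>x::real. D x * (of_real (Re (g (eexp (of_real x)))) + \<i> * of_real (Im (g (eexp (of_real x)))))) has_integral 0) {0..1}"
      unfolding L M by (simp add: algebra_simps)
    then have g0: "((\<lambda>x::real. D x * g (eexp (of_real x))) has_integral 0) {0..1}"
      by (simp add: complex_eq [symmetric])
    have I: "((\<lambda>x. D x * cnj (D x)) has_integral I) {0..1}"
      unfolding I_def by (intro integrable_integral integrable_continuous_real continuous_intros contD)
    have "((\<lambda>x::real. D x * (cnj (D x) - g (eexp (of_real x)))) has_integral I) {0..1}"
      using has_integral_diff[OF I g0] by (simp add: algebra_simps)
    moreover have "((\<lambda>x::real. e * norm (D x)) has_integral e * J) {0..1}"
      unfolding J_def by (intro has_integral_mult_right integrable_integral integrable_continuous_real continuous_intros contD)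
    moreover have "norm (D x * (cnj (D x) - g (eexp (of_real x)))) \<le> e * norm (D x)" for x
      using g(2)[of "eexp (of_real x)"] mult_left_mono[of "norm (cnj (D x) - g (eexp (of_real x)))" e "norm (D x)"]
      by (simp add: norm_mult f_eexp mult.commute)
    ultimately have "norm I \<le> e * J"
      using integral_norm_bound_integral[of "\<lambda>x. D x * (cnj (D x) - g (eexp (of_real x)))" "{0..1}" "\<lambda>x. e * norm (D x)"]
      using e by (simp add: has_integral_iff)
    with e J show ?thesis by (simp add: algebra_simps)
  qed
  have "norm I \<le> 0"
  proof -
    have "norm I \<le> 0 + e" if "e > 0" for e
    proof -
      have "e / (J + 1) * (J + 1) = e" using J by simp
      with key[of "e / (J + 1)"] that J show ?thesis by simp
    qed
    then show ?thesis by (rule field_le_epsilon)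
  qed
  then have "I = 0" by simp
  have "((\<lambda>x. (norm (D x))\<^sup>2) has_integral 0) {0..1}"
  proof -
    have "((\<lambda>x. D x * cnj (D x)) has_integral I) {0..1}"
      unfolding I_def by (intro integrable_integral integrable_continuous_real continuous_intros contD)
    from has_integral_Re[OF this] \<open>I = 0\<close> show ?thesis
      by (simp add: complex_norm_square [symmetric] cmod_power2 power2_eq_square)
  qed
  then have int0: "((\<lambda>x. (norm (D x))\<^sup>2) has_integral 0) (cbox 0 1)" by simp
  have D0: "D x = 0" if "x \<in> {0..1}" for x
  proof -
    have "(norm (D x))\<^sup>2 = 0"
      by (rule has_integral_0_cbox_imp_0[OF _ _ int0]) (use that in \<open>auto intro!: continuous_intros contD\<close>)
    then show ?thesis by simp
  qed
  have "D x = D (frac x + of_int \<lfloor>x\<rfloor>)" by (simp add: frac_def)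
  also have "\<dots> = D (frac x)" by (rule periodic_int[of D, OF per])
  also have "\<dots> = 0" by (rule D0) (auto simp: frac_ge_0 less_imp_le[OF frac_lt_1])
  finally show ?thesis .
qed

subsection \<open>Poisson summation for Gaussians\<close>

text \<open>The substitution x = c y with c^2 = t / (2 pi) turns the Gaussian into the standard
  normal density, and the integral into its characteristic function exp(-u^2 / 2).\<close>

lemma integral_gaussian_eexp:
  fixes s :: int and t :: real
  assumes t: "t > 0"
  defines "g \<equiv> \<lambda>x::real. of_real (exp (- pi * x\<^sup>2 / t)) * eexp (of_int s * of_real x)"
  shows "integrable lborel g" "integral\<^sup>L lborel g = of_real (sqrt t * exp (- pi * (of_int s)\<^sup>2 * t))"
proof -
  define c where "c = sqrt (t / (2 * pi))"
  have c: "c > 0" "c\<^sup>2 = t / (2 * pi)" using t by (auto simp: c_def)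
  let ?u = "2 * pi * of_int s * c"
  have g: "g (0 + c * y) = sqrt (2 * pi) * (std_normal_density y *\<^sub>R iexp (?u * y))" for y
  proof -
    have "- pi * (c * y)\<^sup>2 / t = - (y\<^sup>2 / 2)"
      using t c by (simp add: power_mult_distrib field_simps)
    then show ?thesis
      by (simp add: g_def std_normal_density_def eexp_def scaleR_conv_of_real mult_ac)
  qed
  have i: "integrable std_normal_distribution (\<lambda>y. iexp (?u * y))"
    by (intro finite_measure.integrable_const_bound[where B = 1] prob_space.finite_measure
          real_distribution.axioms(1)[OF real_dist_normal_dist]) auto
  have int: "integrable lborel (\<lambda>y. std_normal_density y *\<^sub>R iexp (?u * y))"
    using i by (subst (asm) integrable_density) auto
  have "integrable lborel (\<lambda>y. g (0 + c * y))"
    unfolding g by (intro integrable_mult_right int)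
  then show "integrable lborel g"
    using lborel_integrable_real_affine_iff[of c g 0] c by simp
  have "integral\<^sup>L lborel g = c *\<^sub>R (\<integral>y. g (0 + c * y) \<partial>lborel)"
    using lborel_integral_real_affine[of c g 0] c by simp
  also have "\<dots> = c * (sqrt (2 * pi) * (\<integral>y. std_normal_density y *\<^sub>R iexp (?u * y) \<partial>lborel))"
    by (simp only: g integral_mult_right_zero) (simp add: scaleR_conv_of_real)
  also have "(\<integral>y. std_normal_density y *\<^sub>R iexp (?u * y) \<partial>lborel) = char std_normal_distribution ?u"
    by (simp add: char_def integral_density)
  also have "\<dots> = of_real (exp (- ?u\<^sup>2 / 2))"
    by (simp add: char_std_normal_distribution)
  also have "- ?u\<^sup>2 / 2 = - pi * (of_int s)\<^sup>2 * t"
    using c by (simp add: power_mult_distrib) (simp add: power2_eq_square)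
  also have "of_real c * (of_real (sqrt (2 * pi)) * z) = of_real (sqrt t) * z" for z :: complex
    using t by (simp add: c_def real_sqrt_divide)
  finally show "integral\<^sup>L lborel g = of_real (sqrt t * exp (- pi * (of_int s)\<^sup>2 * t))" by simp
qed

text \<open>With m = |k| one has (k + x)^2 >= m^2 - 2 R m >= m - (2 R + 1)^2 / 4, the last step
  being a completed square. The quadratic exponent is thus replaced by a linear one, and the
  majorant is geometric in |k| and uniform for |x| <= R, as the Weierstrass test requires.\<close>

lemma gauss_bound:
  fixes x t R :: real and k :: int
  assumes t: "t > 0" and x: "\<bar>x\<bar> \<le> R"
  shows "exp (- pi * (of_int k + x)\<^sup>2 / t) \<le> exp (pi * ((2 * R + 1)\<^sup>2 / 4) / t) * exp (- pi / t) ^ nat \<bar>k\<bar>"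
proof -
  define m where "m = real_of_int \<bar>k\<bar>"
  have "(of_int k + x)\<^sup>2 \<ge> m\<^sup>2 - 2 * R * m"
  proof -
    have "\<bar>of_int k * x\<bar> \<le> m * R" unfolding m_def abs_mult using x by (auto intro!: mult_left_mono)
    then have "- (m * R) \<le> of_int k * x" by linarith
    moreover have "m\<^sup>2 = (of_int k)\<^sup>2" by (simp add: m_def)
    moreover have "(of_int k + x)\<^sup>2 = (of_int k)\<^sup>2 + 2 * (of_int k * x) + x\<^sup>2"
      by (simp add: power2_eq_square algebra_simps)
    moreover have "x\<^sup>2 \<ge> 0" by simp
    moreover have "2 * R * m = 2 * (m * R)" by simp
    ultimately show ?thesis by linarith
  qed
  moreover have "m\<^sup>2 - 2 * R * m \<ge> m - (2 * R + 1)\<^sup>2 / 4"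
    using zero_le_power2[of "m - (2 * R + 1) / 2"] by (simp add: power2_eq_square algebra_simps)
  ultimately have "pi * (m - (2 * R + 1)\<^sup>2 / 4) / t \<le> pi * (of_int k + x)\<^sup>2 / t"
    using t by (intro divide_right_mono mult_left_mono) auto
  then have "exp (- pi * (of_int k + x)\<^sup>2 / t) \<le> exp (- (pi * (m - (2 * R + 1)\<^sup>2 / 4) / t))"
    by simp
  also have "\<dots> = exp (pi * ((2 * R + 1)\<^sup>2 / 4) / t) * exp (- pi / t * m)"
    by (simp add: exp_add [symmetric] field_simps add_divide_distrib [symmetric])
  also have "exp (- pi / t * m) = exp (- pi / t) ^ nat \<bar>k\<bar>"
    by (simp add: exp_of_nat_mult [symmetric] m_def mult_ac)
  finally show ?thesis .
qed

lemma summable_gauss_majorant: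
  fixes t C :: real
  assumes "t > 0"
  shows "(\<lambda>k::int. C * exp (- pi / t) ^ nat \<bar>k\<bar>) summable_on UNIV"
  using assms by (intro summable_on_cmult_right summable_on_int_power) auto

lemma integral_eexp_int:
  "((\<lambda>x::real. eexp (of_int n * of_real x)) has_integral (if n = 0 then 1 else 0)) {0..1}"
proof (cases "n = 0")
  case True
  then show ?thesis using has_integral_const_real[of "1::complex" 0 1] by simp
next
  case False
  let ?c = "2 * of_real pi * \<i> * of_int n"
  have c: "?c \<noteq> 0" using False by simp
  have "((\<lambda>x::real. exp (?c * of_real x)) has_integral exp (?c * of_real 1) / ?c - exp (?c * of_real 0) / ?c) {0..1}"
  proof (rule fundamental_theorem_of_calculus)
    fix x :: real
    have "((\<lambda>z. exp (?c * z) / ?c) has_field_derivative exp (?c * of_real x)) (at (of_real x))"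
      using c by (auto intro!: derivative_eq_intros)
    from has_vector_derivative_real_field[OF this]
    show "((\<lambda>x. exp (?c * of_real x) / ?c) has_vector_derivative exp (?c * of_real x)) (at x within {0..1})" .
  qed simp
  moreover have "exp ?c = 1" using eexp_of_int[of n] by (simp only: eexp_def)
  ultimately show ?thesis using False by (simp add: eexp_def mult_ac)
qed

text \<open>Unfolding: integrating the periodization over [0, 1] against a 1-periodic character is
  integrating the Gaussian over the whole line, whose Fourier transform is already known.\<close>

lemma gauss_periodization_integral:
  fixes s :: int and t :: real
  assumes t: "t > 0"
  defines "F \<equiv> \<lambda>x::real. \<Sum>\<^sub>\<infinity>k::int. complex_of_real (exp (- pi * (of_int k + x)\<^sup>2 / t))"
  shows "integral {0..1} (\<lambda>x. F x * eexp (of_int s * of_real x)) =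
           of_real (sqrt t * exp (- pi * (of_int s)\<^sup>2 * t))"
proof -
  define g where "g = (\<lambda>x::real. complex_of_real (exp (- pi * x\<^sup>2 / t)) * eexp (of_int s * of_real x))"
  note g = integral_gaussian_eexp[OF t, of s, folded g_def]
  have gk: "g (x + of_int k) = complex_of_real (exp (- pi * (of_int k + x)\<^sup>2 / t)) * eexp (of_int s * of_real x)" for x k
  proof -
    have "eexp (of_int s * of_real (x + of_int k)) = eexp (of_int s * of_real x)"
      by (intro eexp_cong) (auto simp: algebra_simps)
    then show ?thesis by (simp add: g_def add.commute)
  qed
  let ?M = "\<lambda>k::int. exp (pi * ((2 * 1 + 1)\<^sup>2 / 4) / t) * exp (- pi / t) ^ nat \<bar>k\<bar>"
  have ul: "uniform_limit {0..1::real} (\<lambda>X x. \<Sum>k\<in>X. g (x + of_int k)) (\<lambda>x. \<Sum>\<^sub>\<infinity>k. g (x + of_int k))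
            (finite_subsets_at_top UNIV)"
  proof (rule Weierstrass_m_test_general[of _ _ _ ?M])
    fix k :: int and x :: real assume "x \<in> {0..1}"
    then show "norm (g (x + of_int k)) \<le> ?M k"
      using norm_eexp_real[of "of_int s * x"] gauss_bound[OF t, of x 1 k] by (simp add: gk norm_mult)
  qed (rule summable_gauss_majorant[OF t])
  have cont_g: "continuous_on A g" for A
    unfolding g_def using t by (auto intro!: continuous_intros)
  have cont_gk: "continuous_on A (\<lambda>x. g (x + c))" for A c
    by (rule continuous_on_compose2[OF cont_g[of UNIV]]) (auto intro!: continuous_intros)
  obtain I J where I: "\<And>X. ((\<lambda>x. \<Sum>k\<in>X. g (x + of_int k)) has_integral I X) {0..1}"
    and J: "((\<lambda>x. \<Sum>\<^sub>\<infinity>k. g (x + of_int k)) has_integral J) {0..1}"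
    and lim: "(I \<longlongrightarrow> J) (finite_subsets_at_top UNIV)"
    by (rule uniform_limit_integral[OF ul]) (auto intro!: continuous_on_sum cont_gk)
  have FJ: "((\<lambda>x. F x * eexp (of_int s * of_real x)) has_integral J) {0..1}"
    using J by (rule has_integral_eq[rotated])
      (simp only: gk F_def infsum_cmult_left')
  \<comment> \<open>The unit intervals starting at the members of X n tile [-n, n], so these finite
    sums are truncated integrals over the line. The sets exhaust the integers, which identifies the
    limit along n with the unordered limit J.\<close>
  define X where "X = (\<lambda>n::nat. {- int n ..< int n})"
  have IX: "(g has_integral I (X n)) {- real n .. real n}" for n
  proof (induction n)
    case 0
    have "I {} = 0" using I[of "{}"] by (simp add: has_integral_is_0 has_integral_0_eq)
    then show ?case using has_integral_refl(2)[of g 0] by (simp add: X_def)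
  next
    case (Suc n)
    have X: "X (Suc n) = insert (- int (Suc n)) (insert (int n) (X n))" by (auto simp: X_def)
    have sh: "(g has_integral integral {0..1} (\<lambda>x. g (x + of_int k))) {of_int k..of_int k + 1}" for k
    proof -
      have "((\<lambda>x. g (x + of_int k)) has_integral integral {0..1} (\<lambda>x. g (x + of_int k))) {of_int k - of_int k..of_int k + 1 - of_int k}"
        by (simp add: integrable_integral integrable_continuous_real cont_gk)
      then show ?thesis using has_integral_shift_real_ivl_iff by blast
    qed
    have "((\<lambda>x. g (x + of_int (- int (Suc n))) + (g (x + of_int (int n)) + (\<Sum>k\<in>X n. g (x + of_int k))))
        has_integral integral {0..1} (\<lambda>x. g (x + of_int (- int (Suc n)))) +
          (integral {0..1} (\<lambda>x. g (x + of_int (int n))) + I (X n))) {0..1}"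
      by (intro has_integral_add integrable_integral integrable_continuous_real cont_gk I)
    moreover have "(\<lambda>x. g (x + of_int (- int (Suc n))) + (g (x + of_int (int n)) + (\<Sum>k\<in>X n. g (x + of_int k))))
        = (\<lambda>x. \<Sum>k\<in>X (Suc n). g (x + of_int k))"
    proof -
      have "finite (X n)" "int n \<notin> X n" "- int (Suc n) \<notin> insert (int n) (X n)" by (auto simp: X_def)
      then show ?thesis unfolding X by (simp only: sum.insert finite_insert simp_thms)
    qed
    ultimately have "((\<lambda>x. \<Sum>k\<in>X (Suc n). g (x + of_int k)) has_integral
        integral {0..1} (\<lambda>x. g (x + of_int (- int (Suc n)))) +
          (integral {0..1} (\<lambda>x. g (x + of_int (int n))) + I (X n))) {0..1}"
      by (simp only:)
    with I have eq: "I (X (Suc n)) = integral {0..1} (\<lambda>x. g (x + of_int (- int (Suc n)))) +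
          (integral {0..1} (\<lambda>x. g (x + of_int (int n))) + I (X n))"
      by (rule has_integral_unique)
    have "(g has_integral integral {0..1} (\<lambda>x. g (x + of_int (int n)))) {real n .. real (Suc n)}"
      using sh[of "int n"] by (simp add: add.commute)
    then have 1: "(g has_integral I (X n) + integral {0..1} (\<lambda>x. g (x + of_int (int n)))) {- real n .. real (Suc n)}"
      by (intro has_integral_combine[OF _ _ Suc]) simp_all
    have "(g has_integral integral {0..1} (\<lambda>x. g (x + of_int (- int (Suc n))))) {- real (Suc n) .. - real n}"
      using sh[of "- int (Suc n)"] by (simp add: algebra_simps)
    then have "(g has_integral integral {0..1} (\<lambda>x. g (x + of_int (- int (Suc n)))) +
        (I (X n) + integral {0..1} (\<lambda>x. g (x + of_int (int n))))) {- real (Suc n) .. real (Suc n)}"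
      by (intro has_integral_combine[OF _ _ _ 1]) simp_all
    then show ?case by (simp only: eq add_ac)
  qed
  have "filterlim X (finite_subsets_at_top UNIV) sequentially"
    unfolding filterlim_finite_subsets_at_top
  proof safe
    fix S :: "int set" assume "finite S"
    then have *: "k \<in> S \<Longrightarrow> \<bar>k\<bar> \<le> Max (abs ` S)" for k by simp
    show "\<forall>\<^sub>F n in sequentially. finite (X n) \<and> S \<subseteq> X n \<and> X n \<subseteq> UNIV"
      using eventually_gt_at_top[of "nat (Max (abs ` S))"]
    proof eventually_elim
      case (elim n)
      then show ?case using * by (force simp: X_def)
    qed
  qed
  with lim have limX: "(\<lambda>n. I (X n)) \<longlonglongrightarrow> J"
    by (rule filterlim_compose)
  have UN: "(\<Union>n. {- real n .. real n}) = UNIV"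
  proof -
    have "\<exists>n. x \<in> {- real n .. real n}" for x
    proof -
      obtain n :: nat where "\<bar>x\<bar> \<le> real n" using real_arch_simple by blast
      then show ?thesis by (intro exI[of _ n]) auto
    qed
    then show ?thesis by blast
  qed
  have si: "set_integrable lborel A g" if "A \<in> sets borel" for A
    using g(1) that integrable_mult_indicator[of A lborel g] by (simp add: set_integrable_def)
  have "(\<lambda>n. LINT x:{- real n .. real n}|lborel. g x) \<longlonglongrightarrow> (LINT x:(\<Union>n. {- real n .. real n})|lborel. g x)"
    by (rule set_integral_cont_up) (use si in \<open>auto simp: incseq_def UN\<close>)
  also have "(\<lambda>n. LINT x:{- real n .. real n}|lborel. g x) = (\<lambda>n. I (X n))"
    using IX by (intro ext, subst set_borel_integral_eq_integral) (auto intro!: si integral_unique)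
  finally have "(\<lambda>n. I (X n)) \<longlonglongrightarrow> integral\<^sup>L lborel g"
    unfolding UN by (simp add: set_lebesgue_integral_def)
  with limX have "J = integral\<^sup>L lborel g"
    by (rule LIMSEQ_unique)
  with FJ g(2) show ?thesis by (simp add: integral_unique)
qed

text \<open>Both sides are continuous and 1-periodic in x and have the same Fourier coefficients: on
  the left by unfolding, on the right by termwise integration.\<close>

theorem poisson_gauss:
  fixes t x :: real
  assumes t: "t > 0"
  shows "(\<Sum>\<^sub>\<infinity>k::int. complex_of_real (exp (- pi * (of_int k + x)\<^sup>2 / t))) =
         of_real (sqrt t) * (\<Sum>\<^sub>\<infinity>s::int. complex_of_real (exp (- pi * (of_int s)\<^sup>2 * t)) * eexp (of_int s * of_real x))"
proof -
  define F where "F = (\<lambda>x::real. \<Sum>\<^sub>\<infinity>k::int. complex_of_real (exp (- pi * (of_int k + x)\<^sup>2 / t)))"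
  define q where "q = (\<lambda>(s::int) x::real. complex_of_real (exp (- pi * (of_int s)\<^sup>2 * t)) * eexp (of_int s * of_real x))"
  define G where "G = (\<lambda>x::real. \<Sum>\<^sub>\<infinity>s. q s x)"
  have Fcont: "isCont F x" for x
  proof -
    define R where "R = \<bar>x\<bar> + 1"
    have "uniform_limit {-R..R} (\<lambda>X x. \<Sum>k\<in>X. complex_of_real (exp (- pi * (of_int k + x)\<^sup>2 / t))) F (finite_subsets_at_top UNIV)"
      unfolding F_def
      by (rule Weierstrass_m_test_general[OF _ summable_gauss_majorant[OF t, of "exp (pi * ((2 * R + 1)\<^sup>2 / 4) / t)"]])
         (use gauss_bound[OF t] in \<open>auto simp: abs_le_iff\<close>)
    then have "continuous_on {-R..R} F"
      using t by (intro uniform_limit_theorem[where F = "finite_subsets_at_top UNIV"])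
         (auto intro!: always_eventually continuous_intros)
    then have "continuous_on {-R<..<R} F" by (rule continuous_on_subset) auto
    moreover have "x \<in> {-R<..<R}" by (auto simp: R_def)
    ultimately show ?thesis using continuous_on_eq_continuous_at[of "{-R<..<R}" F] by auto
  qed
  have qb: "norm (q s x) \<le> exp (pi * (1 / 4) / (1 / t)) * exp (- pi / (1 / t)) ^ nat \<bar>s\<bar>" for s x
    using norm_eexp_real[of "of_int s * x"] gauss_bound[of "1 / t" 0 0 s] t by (simp add: q_def norm_mult)
  have Gul: "uniform_limit A (\<lambda>X x. \<Sum>s\<in>X. q s x) G (finite_subsets_at_top UNIV)" for A
    unfolding G_def
    by (rule Weierstrass_m_test_general[OF qb summable_gauss_majorant]) (use t in auto)
  have qcont: "continuous_on A (q s)" for A s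
    unfolding q_def by (intro continuous_intros)
  have Gcont: "continuous_on UNIV G"
    by (rule uniform_limit_theorem[OF _ Gul]) (auto intro!: always_eventually continuous_on_sum qcont)
  have Gint: "integral {0..1} (\<lambda>x. G x * eexp (of_int s * of_real x)) = of_real (exp (- pi * (of_int s)\<^sup>2 * t))" for s
  proof -
    let ?e = "\<lambda>x::real. eexp (of_int s * of_real x)"
    have ul: "uniform_limit {0..1} (\<lambda>X x. \<Sum>r\<in>X. q r x * ?e x) (\<lambda>x. \<Sum>\<^sub>\<infinity>r. q r x * ?e x) (finite_subsets_at_top UNIV)"
      by (rule Weierstrass_m_test_general[OF _ summable_gauss_majorant, where t1 = "1 / t"])
         (use qb t norm_eexp_real[of "of_int s * _"] in \<open>auto simp: norm_mult\<close>)
    obtain I J where I: "\<And>X. ((\<lambda>x. \<Sum>r\<in>X. q r x * ?e x) has_integral I X) {0..1}"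
      and J: "((\<lambda>x. \<Sum>\<^sub>\<infinity>r. q r x * ?e x) has_integral J) {0..1}"
      and lim: "(I \<longlongrightarrow> J) (finite_subsets_at_top UNIV)"
      by (rule uniform_limit_integral[OF ul]) (auto intro!: continuous_on_sum continuous_intros qcont)
    have "I X = of_real (exp (- pi * (of_int s)\<^sup>2 * t))" if X: "finite X" "-s \<in> X" for X
    proof -
      have "((\<lambda>x. q r x * ?e x) has_integral (if r = -s then of_real (exp (- pi * (of_int s)\<^sup>2 * t)) else 0)) {0..1}" for r
        using has_integral_mult_right[OF integral_eexp_int[of "r + s"], of "of_real (exp (- pi * (of_int r)\<^sup>2 * t))"]
        by (auto simp: q_def eexp_add ring_distribs mult_ac add_eq_0_iff2 split: if_splits)
      then have "((\<lambda>x. \<Sum>r\<in>X. q r x * ?e x) has_integral (\<Sum>r\<in>X. if r = -s then of_real (exp (- pi * (of_int s)\<^sup>2 * t)) else 0)) {0..1}"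
        using X by (intro has_integral_sum) auto
      then show ?thesis using I[of X] X by (simp add: has_integral_unique)
    qed
    then have "\<forall>\<^sub>F X in finite_subsets_at_top UNIV. I X = of_real (exp (- pi * (of_int s)\<^sup>2 * t))"
      by (intro eventually_finite_subsets_at_top[THEN iffD2] exI[of _ "{-s}"]) auto
    then have "(I \<longlongrightarrow> of_real (exp (- pi * (of_int s)\<^sup>2 * t))) (finite_subsets_at_top UNIV)"
      by (rule tendsto_eventually)
    with lim have "J = of_real (exp (- pi * (of_int s)\<^sup>2 * t))"
      using tendsto_unique by (metis finite_subsets_at_top_neq_bot)
    moreover have "(\<lambda>x. \<Sum>\<^sub>\<infinity>r. q r x * ?e x) = (\<lambda>x. G x * ?e x)"
      by (simp add: G_def infsum_cmult_left')
    ultimately show ?thesis using J by (simp add: integral_unique)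
  qed
  have Fcont': "continuous_on A F" and Gcont': "continuous_on A G" for A
    using Fcont Gcont continuous_at_imp_continuous_on continuous_on_subset by blast+
  have "F x - of_real (sqrt t) * G x = 0"
  proof (rule fourier_uniqueness)
    show "continuous_on UNIV (\<lambda>x. F x - complex_of_real (sqrt t) * G x)"
      by (intro continuous_intros Fcont' Gcont')
    fix x
    have "F (x + 1) = F x"
      unfolding F_def
      by (rule infsum_reindex_bij_witness[of _ "\<lambda>k. k - 1" "\<lambda>k. k + 1"]) (auto simp: add_ac)
    moreover have "q s (x + 1) = q s x" for s
      by (simp add: q_def ring_distribs eexp_add)
    ultimately show "F (x + 1) - complex_of_real (sqrt t) * G (x + 1) = F x - complex_of_real (sqrt t) * G x"
      by (simp add: G_def)
  next
    fix s :: int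
    let ?e = "\<lambda>x::real. eexp (of_int s * of_real x)"
    have i: "(\<lambda>x. F x * ?e x) integrable_on {0..1}" "(\<lambda>x. complex_of_real (sqrt t) * (G x * ?e x)) integrable_on {0..1}"
      by (intro integrable_continuous_real continuous_intros Fcont' Gcont')+
    have "integral {0..1} (\<lambda>x. (F x - complex_of_real (sqrt t) * G x) * ?e x) =
        integral {0..1} (\<lambda>x. F x * ?e x - complex_of_real (sqrt t) * (G x * ?e x))"
      by (simp add: algebra_simps)
    also have "\<dots> = integral {0..1} (\<lambda>x. F x * ?e x) - integral {0..1} (\<lambda>x. complex_of_real (sqrt t) * (G x * ?e x))"
      by (rule integral_diff[OF i])
    also have "\<dots> = 0"
      using gauss_periodization_integral[OF t, of s] by (simp add: Gint F_def)
    finally show "integral {0..1} (\<lambda>x. (F x - complex_of_real (sqrt t) * G x) * ?e x) = 0" .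
  qed
  then show ?thesis by (simp add: F_def G_def q_def)
qed

section \<open>The modular group acting on the upper half plane\<close>

text \<open>Euclid's algorithm on the lower row: d is reduced modulo |c| by powers of T, then S
  exchanges the columns, until c = 0 and a translation remains up to sign. Generators are multiplied
  on the right, so that they act on the point first. The inverse of T is a case of its own, because
  a general predicate need not be closed under inverses.\<close>

lemma sl2_induct [consumes 1, case_names one T T' S]:
  fixes P :: "int \<Rightarrow> int \<Rightarrow> int \<Rightarrow> int \<Rightarrow> bool"
  assumes det: "a * d - b * c = 1"
    and one: "P 1 0 0 1"
    and T: "\<And>a b c d. a * d - b * c = 1 \<Longrightarrow> P a b c d \<Longrightarrow> P a (b + a) c (d + c)"
    and T': "\<And>a b c d. a * d - b * c = 1 \<Longrightarrow> P a b c d \<Longrightarrow> P a (b - a) c (d - c)"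
    and S: "\<And>a b c d. a * d - b * c = 1 \<Longrightarrow> P a b c d \<Longrightarrow> P b (- a) d (- c)"
  shows "P a b c d"
proof -
  have Tk: "P a (b + k * a) c (d + k * c)" if "a * d - b * c = 1" "P a b c d" for a b c d k
  proof (induction k rule: int_induct[where k = 0])
    case base
    then show ?case using that by simp
  next
    case (step1 i)
    from T[OF _ step1(2)] that(1) show ?case by (simp add: algebra_simps)
  next
    case (step2 i)
    from T'[OF _ step2(2)] that(1) show ?case by (simp add: algebra_simps)
  qed
  have S2: "P (- a) (- b) (- c) (- d)" if "a * d - b * c = 1" "P a b c d" for a b c d
    using S[OF _ S[OF that]] that(1) by (simp add: algebra_simps)
  have S3: "P (- b) a (- d) c" if "a * d - b * c = 1" "P a b c d" for a b c d
    using S[OF _ S2[OF that]] that(1) by (simp add: algebra_simps)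
  show ?thesis using det
  proof (induction "nat \<bar>c\<bar>" arbitrary: a b c d rule: less_induct)
    case less
    show ?case
    proof (cases "c = 0")
      case True
      with less.prems have "a * d = 1" by simp
      then have "a = 1 \<and> d = 1 \<or> a = -1 \<and> d = -1" by (simp add: zmult_eq_1_iff)
      then show ?thesis
      proof (elim disjE conjE)
        assume "a = 1" "d = 1"
        then show ?thesis using Tk[OF _ one, of b] True by simp
      next
        assume "a = -1" "d = -1"
        then show ?thesis using Tk[OF _ S2[OF _ one], of "- b"] True by simp
      qed
    next
      case False
      define r where "r = d mod \<bar>c\<bar>"
      have r: "0 \<le> r" "r < \<bar>c\<bar>" using False by (auto simp: r_def)
      have "\<bar>c\<bar> dvd d - r" unfolding r_def by (rule dvd_minus_mod)
      then have "c dvd d - r" by simp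
      then obtain q where q: "d = r + q * c" by (metis dvd_def add.commute diff_add_cancel mult.commute)
      have det': "(b - q * a) * (- c) - (- a) * r = 1"
        using less.prems by (simp add: q algebra_simps)
      have "P (b - q * a) (- a) r (- c)"
        by (rule less.hyps) (use r det' in auto)
      from S3[OF det' this] have "P a (b - q * a) c r" by simp
      from Tk[OF _ this, of q] less.prems show ?thesis by (simp add: q algebra_simps)
    qed
  qed
qed

definition mob :: "int \<Rightarrow> int \<Rightarrow> int \<Rightarrow> int \<Rightarrow> complex \<Rightarrow> complex" where
  "mob a b c d \<tau> = (of_int a * \<tau> + of_int b) / (of_int c * \<tau> + of_int d)"

lemma in_H_iff: "\<tau> \<in> \<H> \<longleftrightarrow> Im \<tau> > 0"
  by (simp add: upper_half_plane_def)

lemma H_not_0: "\<tau> \<in> \<H> \<Longrightarrow> \<tau> \<noteq> 0"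
  by (auto simp: in_H_iff)

lemma open_H: "open \<H>" and convex_H: "convex \<H>"
  unfolding upper_half_plane_def by (auto intro: open_halfspace_Im_gt convex_halfspace_Im_gt)

lemma connected_H: "connected \<H>"
  by (rule convex_connected[OF convex_H])

lemma linear_nonzero_on_H:
  assumes "a * d - b * c = (1::int)" "\<tau> \<in> \<H>"
  shows "of_int c * \<tau> + of_int d \<noteq> 0"
proof
  assume *: "of_int c * \<tau> + of_int d = 0"
  from arg_cong[OF this, of Im] have "real_of_int c * Im \<tau> = 0" by simp
  then have "c = 0" using assms(2) by (auto simp: in_H_iff)
  with * assms(1) show False by auto
qed

lemma Im_mob:
  assumes "a * d - b * c = (1::int)"
  shows "Im (mob a b c d \<tau>) = Im \<tau> / (norm (of_int c * \<tau> + of_int d))\<^sup>2"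
proof -
  have "real_of_int a * real_of_int d - real_of_int b * real_of_int c = 1"
    using assms by (metis of_int_1 of_int_diff of_int_mult)
  then have num: "Im \<tau> * (real_of_int a * real_of_int d - real_of_int b * real_of_int c) = Im \<tau>" by simp
  have "Im (mob a b c d \<tau>) = (Im \<tau> * (real_of_int a * real_of_int d - real_of_int b * real_of_int c)) /
      (norm (of_int c * \<tau> + of_int d))\<^sup>2"
    unfolding mob_def Im_divide cmod_power2 by (rule arg_cong2[of _ _ _ _ "(/)"]) (simp_all add: algebra_simps)
  then show ?thesis unfolding num .
qed

lemma mob_in_H:
  assumes "a * d - b * c = (1::int)" "\<tau> \<in> \<H>"
  shows "mob a b c d \<tau> \<in> \<H>"
  using Im_mob[OF assms(1)] linear_nonzero_on_H[OF assms] assms(2) by (simp add: in_H_iff)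

lemma add_real_in_H [simp]: "\<tau> + of_real x \<in> \<H> \<longleftrightarrow> \<tau> \<in> \<H>" "\<tau> - of_real x \<in> \<H> \<longleftrightarrow> \<tau> \<in> \<H>"
  by (auto simp: in_H_iff)

lemma add_1_in_H [simp]: "\<tau> + 1 \<in> \<H> \<longleftrightarrow> \<tau> \<in> \<H>" "\<tau> - 1 \<in> \<H> \<longleftrightarrow> \<tau> \<in> \<H>"
  by (auto simp: in_H_iff)

lemma add_int_in_H [simp]: "\<tau> + of_int n \<in> \<H> \<longleftrightarrow> \<tau> \<in> \<H>"
  by (auto simp: in_H_iff)

lemma minus_inverse_in_H: "\<tau> \<in> \<H> \<Longrightarrow> - 1 / \<tau> \<in> \<H>"
  using mob_in_H[of 0 0 "-1" 1 \<tau>] by (simp add: mob_def)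

lemma mob_T: "mob a (b + a) c (d + c) \<tau> = mob a b c d (\<tau> + 1)"
  by (simp add: mob_def algebra_simps)

lemma mob_T': "mob a (b - a) c (d - c) \<tau> = mob a b c d (\<tau> - 1)"
  by (simp add: mob_def algebra_simps)

lemma mob_S:
  assumes "\<tau> \<in> \<H>"
  shows "mob b (- a) d (- c) \<tau> = mob a b c d (- 1 / \<tau>)"
proof -
  note nz = H_not_0[OF assms]
  have "of_int a * (- 1 / \<tau>) + of_int b = (of_int b * \<tau> - of_int a) / \<tau>"
    "of_int c * (- 1 / \<tau>) + of_int d = (of_int d * \<tau> - of_int c) / \<tau>"
    using nz by (simp_all add: field_simps)
  then show ?thesis using nz by (simp add: mob_def)
qed

text \<open>A weak substitute for the fundamental domain. A point of the orbit with imaginary part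
  below 1/2 is translated to |Re| <= 1/2; then its norm squared is at most 1/2 and -1/\<rho> at
  least doubles the imaginary part. The doubling must stop, since imaginary parts on the orbit are
  bounded by max y (1/y).\<close>

lemma exists_mob_Im_ge_half:
  assumes \<tau>: "\<tau> \<in> \<H>"
  shows "\<exists>a b c d. a * d - b * c = 1 \<and> Im (mob a b c d \<tau>) \<ge> 1 / 2"
proof -
  define X where "X = {mob a b c d \<tau> |a b c d. a * d - b * c = 1}"
  have y: "Im \<tau> > 0" using \<tau> by (simp add: in_H_iff)
  have X_H: "\<sigma> \<in> \<H>" if "\<sigma> \<in> X" for \<sigma>
    using that mob_in_H[OF _ \<tau>] by (auto simp: X_def)
  have "\<tau> \<in> X" unfolding X_def
    by (rule CollectI, intro exI[of _ 1] exI[of _ 0]) (simp add: mob_def)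
  have X_add: "\<sigma> + of_int n \<in> X" if "\<sigma> \<in> X" for \<sigma> n
  proof -
    from that obtain a b c d where *: "a * d - b * c = 1" "\<sigma> = mob a b c d \<tau>" by (auto simp: X_def)
    have "\<sigma> + of_int n = mob (a + n * c) (b + n * d) c d \<tau>"
      using linear_nonzero_on_H[OF *(1) \<tau>] by (simp add: *(2) mob_def field_simps)
    moreover have "(a + n * c) * d - (b + n * d) * c = 1" using *(1) by (simp add: algebra_simps)
    ultimately show ?thesis by (auto simp: X_def)
  qed
  have X_inv: "- 1 / \<sigma> \<in> X" if "\<sigma> \<in> X" for \<sigma>
  proof -
    from that obtain a b c d where *: "a * d - b * c = 1" "\<sigma> = mob a b c d \<tau>" by (auto simp: X_def)
    have "- 1 / \<sigma> = mob (- c) (- d) a b \<tau>"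
      by (simp add: *(2) mob_def minus_divide_left [symmetric] add.commute)
    moreover have "(- c) * b - (- d) * a = 1" using *(1) by (simp add: algebra_simps)
    ultimately show ?thesis unfolding X_def by blast
  qed
  have double: "\<exists>\<sigma>'\<in>X. Im \<sigma>' \<ge> 2 * Im \<sigma>" if \<sigma>: "\<sigma> \<in> X" "Im \<sigma> < 1 / 2" for \<sigma>
  proof -
    define \<rho> where "\<rho> = \<sigma> + of_int (- round (Re \<sigma>))"
    have \<rho>: "\<rho> \<in> X" "Im \<rho> = Im \<sigma>" using X_add[OF \<sigma>(1)] by (auto simp: \<rho>_def simp del: of_int_minus)
    have im: "0 < Im \<sigma>" using X_H[OF \<sigma>(1)] by (simp add: in_H_iff)
    have "\<bar>Re \<rho>\<bar> \<le> 1 / 2" using of_int_round_abs_le[of "Re \<sigma>"] by (simp add: \<rho>_def abs_minus_commute)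
    then have "(Re \<rho>)\<^sup>2 \<le> (1 / 2)\<^sup>2" by (metis abs_le_square_iff abs_of_nonneg zero_le_divide_1_iff zero_le_numeral)
    moreover have "(Im \<rho>)\<^sup>2 \<le> (1 / 2)\<^sup>2" using \<sigma>(2) im \<rho>(2) by (intro power_mono) auto
    ultimately have "(Re \<rho>)\<^sup>2 + (Im \<rho>)\<^sup>2 \<le> 1 / 2" by (simp add: power2_eq_square)
    then have n: "(norm \<rho>)\<^sup>2 \<le> 1 / 2" by (simp only: cmod_power2)
    have p: "(norm \<rho>)\<^sup>2 > 0" using im \<rho>(2) by (auto intro: zero_less_power)
    have "Im (- 1 / \<rho>) = Im \<rho> / (norm \<rho>)\<^sup>2" by (simp add: Im_divide cmod_power2)
    also have "\<dots> \<ge> 2 * Im \<sigma>"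
      using n p im \<rho>(2) mult_left_mono[OF n, of "2 * Im \<sigma>"] by (simp add: field_simps)
    finally show ?thesis using X_inv[OF \<rho>(1)] by blast
  qed
  have grow: "\<exists>\<sigma>\<in>X. Im \<sigma> \<ge> 1 / 2 \<or> Im \<sigma> \<ge> 2 ^ n * Im \<tau>" for n
  proof (induction n)
    case 0
    then show ?case using \<open>\<tau> \<in> X\<close> by auto
  next
    case (Suc n)
    then obtain \<sigma> where \<sigma>: "\<sigma> \<in> X" "Im \<sigma> \<ge> 1 / 2 \<or> Im \<sigma> \<ge> 2 ^ n * Im \<tau>" by blast
    show ?case
    proof (cases "Im \<sigma> \<ge> 1 / 2")
      case False
      with double[OF \<sigma>(1)] obtain \<sigma>' where "\<sigma>' \<in> X" "Im \<sigma>' \<ge> 2 * Im \<sigma>" by auto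
      then show ?thesis using \<sigma> False by (intro bexI[of _ \<sigma>']) auto
    qed (use \<sigma> in blast)
  qed
  have bound: "Im \<sigma> \<le> max (Im \<tau>) (1 / Im \<tau>)" if "\<sigma> \<in> X" for \<sigma>
  proof -
    from that obtain a b c d where *: "a * d - b * c = 1" "\<sigma> = mob a b c d \<tau>" by (auto simp: X_def)
    show ?thesis
    proof (cases "c = 0")
      case True
      then have "a * d = 1" using * by simp
      then have "d = 1 \<or> d = -1" by (auto simp: zmult_eq_1_iff)
      then show ?thesis using * True by (auto simp: Im_mob)
    next
      case False
      have "Im \<tau> \<le> \<bar>of_int c\<bar> * Im \<tau>" using False y by simp
      also have "\<dots> = \<bar>Im (of_int c * \<tau> + of_int d)\<bar>" using y by (simp add: abs_mult)
      also have "\<dots> \<le> norm (of_int c * \<tau> + of_int d)" by (rule abs_Im_le_cmod)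
      finally have "(Im \<tau>)\<^sup>2 \<le> (norm (of_int c * \<tau> + of_int d))\<^sup>2" using y by (intro power_mono) auto
      then have "Im \<tau> / (norm (of_int c * \<tau> + of_int d))\<^sup>2 \<le> Im \<tau> / (Im \<tau>)\<^sup>2"
        using y by (intro divide_left_mono mult_pos_pos) (auto intro: less_le_trans[of _ "(Im \<tau>)\<^sup>2"])
      then show ?thesis using * y by (simp add: Im_mob power2_eq_square)
    qed
  qed
  obtain n where "max (Im \<tau>) (1 / Im \<tau>) / Im \<tau> < 2 ^ n"
    using real_arch_pow[of 2] by auto
  then have "max (Im \<tau>) (1 / Im \<tau>) < 2 ^ n * Im \<tau>" using y by (simp add: divide_less_eq)
  with grow[of n] bound have "\<exists>\<sigma>\<in>X. Im \<sigma> \<ge> 1 / 2" by force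
  then show ?thesis by (auto simp: X_def)
qed

lemma sl2_invariant_mob:
  assumes T: "\<And>\<tau>. \<tau> \<in> \<H> \<Longrightarrow> f (\<tau> + 1) = f \<tau>"
    and S: "\<And>\<tau>. \<tau> \<in> \<H> \<Longrightarrow> f (- 1 / \<tau>) = f \<tau>"
    and det: "a * d - b * c = 1" and \<tau>: "\<tau> \<in> \<H>"
  shows "f (mob a b c d \<tau>) = f \<tau>"
proof -
  from det have "\<forall>\<tau>\<in>\<H>. f (mob a b c d \<tau>) = f \<tau>"
  proof (induction rule: sl2_induct)
    case one
    then show ?case by (simp add: mob_def)
  next
    case (T a b c d)
    then show ?case by (simp add: mob_T assms(1))
  next
    case (T' a b c d)
    have "f (\<tau> - 1) = f \<tau>" if "\<tau> \<in> \<H>" for \<tau>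
      using assms(1)[of "\<tau> - 1"] that by simp
    with T' show ?case by (simp add: mob_T')
  next
    case (S a b c d)
    show ?case
    proof
      fix \<tau> assume "\<tau> \<in> \<H>"
      with S(2) show "f (mob b (- a) d (- c) \<tau>) = f \<tau>"
        by (simp only: mob_S minus_inverse_in_H assms(2))
    qed
  qed
  with \<tau> show ?thesis by blast
qed

text \<open>Suppose f \<tau> is nonzero, of modulus e. High up |f| stays below e, and every orbit
  reaches either that region or the compact rectangle K. The maximum over K is therefore a maximum
  over the half plane, f is constant by the maximum modulus principle, and this contradicts the
  small values high up.\<close>

lemma sl2_invariant_vanishing_at_cusp:
  assumes hol: "f holomorphic_on \<H>"
    and T: "\<And>\<tau>. \<tau> \<in> \<H> \<Longrightarrow> f (\<tau> + 1) = f \<tau>"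
    and S: "\<And>\<tau>. \<tau> \<in> \<H> \<Longrightarrow> f (- 1 / \<tau>) = f \<tau>"
    and lim: "\<And>e. e > 0 \<Longrightarrow> \<exists>Y. \<forall>\<tau>. Im \<tau> \<ge> Y \<longrightarrow> norm (f \<tau>) < e"
    and \<tau>: "\<tau> \<in> \<H>"
  shows "f \<tau> = (0::complex)"
proof (rule ccontr)
  assume nz: "f \<tau> \<noteq> 0"
  define e where "e = norm (f \<tau>)"
  have "e > 0" using nz by (simp add: e_def)
  from lim[OF this] obtain Y0 where Y0: "\<And>\<tau>. Im \<tau> \<ge> Y0 \<Longrightarrow> norm (f \<tau>) < e" by blast
  define Y where "Y = max Y0 1"
  have Y: "\<And>\<tau>. Im \<tau> \<ge> Y \<Longrightarrow> norm (f \<tau>) < e" "Y \<ge> 1" using Y0 by (auto simp: Y_def)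
  define K where "K = cbox (Complex 0 (1/2)) (Complex 1 Y)"
  have KH: "K \<subseteq> \<H>" by (auto simp: K_def in_cbox_complex_iff in_H_iff)
  have "continuous_on K (\<lambda>z. norm (f z))"
    by (intro continuous_on_norm holomorphic_on_imp_continuous_on holomorphic_on_subset[OF hol] KH)
  moreover have "compact K" "K \<noteq> {}"
    using Y(2) unfolding K_def by (auto simp: box_ne_empty Basis_complex_def)
  ultimately obtain \<xi> where \<xi>: "\<xi> \<in> K" "\<And>z. z \<in> K \<Longrightarrow> norm (f z) \<le> norm (f \<xi>)"
    by (meson continuous_attains_sup)
  have cases: "norm (f z) < e \<or> norm (f z) \<le> norm (f \<xi>)" if zH: "z \<in> \<H>" for z
  proof -
    obtain a b c d where *: "a * d - b * c = 1" "Im (mob a b c d z) \<ge> 1 / 2"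
      using exists_mob_Im_ge_half[OF zH] by blast
    define \<sigma> where "\<sigma> = mob a b c d z"
    have fz: "f z = f \<sigma>" using sl2_invariant_mob[OF T S *(1) zH] by (simp add: \<sigma>_def)
    define \<rho> where "\<rho> = mob 1 (- \<lfloor>Re \<sigma>\<rfloor>) 0 1 \<sigma>"
    have "f \<rho> = f \<sigma>" unfolding \<rho>_def
      by (rule sl2_invariant_mob[OF T S]) (use mob_in_H[OF *(1) zH] in \<open>auto simp: \<sigma>_def\<close>)
    with fz have fr: "f z = f \<rho>" by simp
    have "Re \<rho> = frac (Re \<sigma>)" "Im \<rho> = Im \<sigma>" by (auto simp: \<rho>_def mob_def frac_def)
    then have "Im \<rho> \<ge> Y \<or> \<rho> \<in> K"
      using *(2) frac_ge_0[of "Re \<sigma>"] frac_lt_1[of "Re \<sigma>"]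
      by (auto simp: K_def in_cbox_complex_iff \<sigma>_def)
    then show ?thesis using Y(1) \<xi>(2) fr by auto
  qed
  have eM: "e \<le> norm (f \<xi>)" using cases[OF \<tau>] by (auto simp: e_def)
  have \<xi>H: "\<xi> \<in> \<H>" using \<xi>(1) KH by blast
  have "f constant_on \<H>"
    by (rule maximum_modulus_principle[OF hol open_H connected_H open_H subset_refl \<xi>H])
       (use cases eM in fastforce)
  then obtain k where k: "\<And>z. z \<in> \<H> \<Longrightarrow> f z = k" by (auto simp: constant_on_def)
  have "norm (f (Complex 0 Y)) < e" by (rule Y(1)) simp
  moreover have "Complex 0 Y \<in> \<H>" using Y(2) by (simp add: in_H_iff)
  ultimately show False using k[OF \<open>Complex 0 Y \<in> \<H>\<close>] k[OF \<xi>H] eM by simp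
qed

section \<open>Theta series with bounded coefficients as power series in \<open>q8\<close>\<close>

lemma q8_eexp: "q8 \<tau> = eexp (\<tau> / 8)"
  by (simp add: q8_def eexp_def)

lemma norm_q8: "norm (q8 \<tau>) = exp (- (pi * Im \<tau> / 4))"
  by (simp add: q8_eexp norm_eexp)

lemma q8_nonzero [simp]: "q8 \<tau> \<noteq> 0"
  by (simp add: q8_def)

lemma norm_q8_less_1: "\<tau> \<in> \<H> \<Longrightarrow> norm (q8 \<tau>) < 1"
  by (simp add: norm_q8 in_H_iff)

lemma q8_holomorphic: "q8 holomorphic_on A"
  unfolding q8_eexp [abs_def] by (intro holomorphic_intros) auto

text \<open>The exponent n^2 / 8 puts all three theta constants into one family: odd n gives the
  half-integral lattice shift of theta2, even n = 2 k gives the powers q^(k^2 / 2) of theta3 and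
  theta4.\<close>

definition theta_series :: "(int \<Rightarrow> complex) \<Rightarrow> complex \<Rightarrow> complex" where
  "theta_series \<kappa> \<tau> = (\<Sum>\<^sub>\<infinity>n. \<kappa> n * eexp (of_int (n\<^sup>2) * \<tau> / 8))"

lemma eexp_square_q8: "eexp (of_int (n\<^sup>2) * \<tau> / 8) = q8 \<tau> ^ nat (n\<^sup>2)"
  by (simp add: q8_eexp eexp_power)

lemma nat_abs_le_nat_square: "nat \<bar>n\<bar> \<le> nat (n\<^sup>2)" for n :: int
proof -
  have "nat \<bar>n\<bar> \<le> nat \<bar>n\<bar> * nat \<bar>n\<bar>" by (rule le_square)
  also have "\<dots> = nat (\<bar>n\<bar> * \<bar>n\<bar>)" by (rule nat_mult_distrib [symmetric]) simp
  finally show ?thesis by (simp add: power2_eq_square)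
qed

lemma theta_power_summable:
  assumes \<kappa>: "bounded (range \<kappa>)" and x: "norm x < 1"
  shows "(\<lambda>n::int. \<kappa> n * x ^ nat (n\<^sup>2) :: complex) summable_on UNIV"
proof -
  from \<kappa> obtain B where B: "\<And>n. norm (\<kappa> n) \<le> B" by (auto simp: bounded_iff)
  have "(\<lambda>n::int. B * norm x ^ nat \<bar>n\<bar>) summable_on UNIV"
    using x by (intro summable_on_cmult_right summable_on_int_power) auto
  moreover have "norm (\<kappa> n * x ^ nat (n\<^sup>2)) \<le> B * norm x ^ nat \<bar>n\<bar>" for n :: int
  proof -
    have "norm x ^ nat (n\<^sup>2) \<le> norm x ^ nat \<bar>n\<bar>"
      using x by (intro power_decreasing nat_abs_le_nat_square) auto
    then show ?thesis
      unfolding norm_mult norm_power using B[of n] by (intro mult_mono) (auto intro: order_trans[OF norm_ge_zero B])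
  qed
  ultimately show ?thesis
    by (rule abs_summable_summable[OF Infinite_Sum.abs_summable_on_comparison_test'])
qed

lemma theta_series_summable:
  assumes "bounded (range \<kappa>)" "\<tau> \<in> \<H>"
  shows "(\<lambda>n. \<kappa> n * eexp (of_int (n\<^sup>2) * \<tau> / 8)) summable_on UNIV"
  unfolding eexp_square_q8 by (intro theta_power_summable assms norm_q8_less_1)

definition theta_fps :: "(int \<Rightarrow> complex) \<Rightarrow> complex fps" where
  "theta_fps \<kappa> = Abs_fps (\<lambda>k. \<Sum>n\<in>{n. n\<^sup>2 = int k}. \<kappa> n)"

lemma finite_int_sqrt: "finite {n::int. n\<^sup>2 = int k}"
proof (rule finite_subset)
  show "{n::int. n\<^sup>2 = int k} \<subseteq> {- int k..int k}"
  proof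
    fix n :: int assume "n \<in> {n. n\<^sup>2 = int k}"
    then show "n \<in> {- int k..int k}" using nat_abs_le_nat_square[of n] by auto
  qed
qed simp

lemma theta_fps_sums:
  assumes \<kappa>: "bounded (range \<kappa>)" and x: "norm x < 1"
  shows "(\<lambda>k. fps_nth (theta_fps \<kappa>) k * x ^ k) sums (\<Sum>\<^sub>\<infinity>n::int. \<kappa> n * x ^ nat (n\<^sup>2))"
proof -
  let ?f = "\<lambda>n::int. \<kappa> n * x ^ nat (n\<^sup>2)"
  let ?S = "Sigma (UNIV :: nat set) (\<lambda>k. {n::int. n\<^sup>2 = int k})"
  have 1: "(?f has_sum infsum ?f UNIV) UNIV"
    by (intro has_sum_infsum theta_power_summable assms)
  have 2: "bij_betw snd ?S UNIV"
    by (rule bij_betwI[where g = "\<lambda>n. (nat (n\<^sup>2), n)"]) auto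
  have "((\<lambda>p. ?f (snd p)) has_sum infsum ?f UNIV) ?S"
    unfolding has_sum_reindex_bij_betw[OF 2, of ?f] by (rule 1)
  then have "((\<lambda>(k, n). ?f n) has_sum infsum ?f UNIV) ?S"
    by (simp add: case_prod_beta')
  moreover have "((\<lambda>n. ?f n) has_sum fps_nth (theta_fps \<kappa>) k * x ^ k) {n::int. n\<^sup>2 = int k}" for k
  proof -
    have "((\<lambda>n. ?f n) has_sum (\<Sum>n\<in>{n::int. n\<^sup>2 = int k}. ?f n)) {n::int. n\<^sup>2 = int k}"
      by (rule has_sum_finite[OF finite_int_sqrt])
    also have "(\<Sum>n\<in>{n::int. n\<^sup>2 = int k}. ?f n) = fps_nth (theta_fps \<kappa>) k * x ^ k"
      by (simp add: theta_fps_def sum_distrib_right)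
    finally show ?thesis .
  qed
  ultimately have "((\<lambda>k. fps_nth (theta_fps \<kappa>) k * x ^ k) has_sum infsum ?f UNIV) UNIV"
    using has_sum_SigmaD[where A = UNIV and f = "\<lambda>(k, n). ?f n" and B = "\<lambda>k. {n::int. n\<^sup>2 = int k}"] by simp
  then show ?thesis by (rule has_sum_imp_sums)
qed

lemma theta_fps_conv_radius:
  assumes "bounded (range \<kappa>)"
  shows "fps_conv_radius (theta_fps \<kappa>) \<ge> 1"
  unfolding fps_conv_radius_def
proof (rule conv_radius_geI_ex)
  fix r :: real assume "0 < r" "ereal r < 1"
  then show "\<exists>z. norm z = r \<and> summable (\<lambda>n. fps_nth (theta_fps \<kappa>) n * z ^ n)"
    using theta_fps_sums[OF assms, of "of_real r"]
    by (intro exI[of _ "of_real r"]) (auto simp: sums_iff)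
qed

lemma theta_series_eval_fps:
  assumes "bounded (range \<kappa>)" "\<tau> \<in> \<H>"
  shows "theta_series \<kappa> \<tau> = eval_fps (theta_fps \<kappa>) (q8 \<tau>)"
  using theta_fps_sums[OF assms(1) norm_q8_less_1[OF assms(2)]]
  unfolding theta_series_def eval_fps_def eexp_square_q8 by (simp add: sums_iff)

lemma theta_series_holomorphic:
  assumes "bounded (range \<kappa>)"
  shows "theta_series \<kappa> holomorphic_on \<H>"
proof -
  have "(eval_fps (theta_fps \<kappa>) \<circ> q8) holomorphic_on \<H>"
  proof (rule holomorphic_on_compose_gen[OF q8_holomorphic])
    show "eval_fps (theta_fps \<kappa>) holomorphic_on eball 0 1"
    proof (rule holomorphic_on_eval_fps, rule subsetI)
      fix x :: complex assume "x \<in> eball 0 1"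
      then have "ereal (norm x) < 1" by (simp add: in_eball_iff)
      also note theta_fps_conv_radius[OF assms]
      finally show "x \<in> eball 0 (fps_conv_radius (theta_fps \<kappa>))" by (simp add: in_eball_iff)
    qed
  qed (use norm_q8_less_1 in \<open>auto simp: in_eball_iff one_ereal_def\<close>)
  then show ?thesis
    by (rule holomorphic_transform) (simp add: theta_series_eval_fps[OF assms])
qed

lemma theta_series_shift:
  "theta_series \<kappa> (\<tau> + 8 * x) = theta_series (\<lambda>n. \<kappa> n * eexp (of_int (n\<^sup>2) * x)) \<tau>"
proof -
  have "eexp (of_int (n\<^sup>2) * (\<tau> + 8 * x) / 8) = eexp (of_int (n\<^sup>2) * x) * eexp (of_int (n\<^sup>2) * \<tau> / 8)" for n
    by (simp add: eexp_add [symmetric] algebra_simps add_divide_distrib)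
  then show ?thesis by (simp add: theta_series_def mult_ac)
qed

lemma theta_series_cmult: "theta_series (\<lambda>n. c * \<kappa> n) \<tau> = c * theta_series \<kappa> \<tau>"
  by (simp add: theta_series_def infsum_cmult_right' mult.assoc)

subsection \<open>The inversion formula\<close>

definition dft :: "int \<Rightarrow> (int \<Rightarrow> complex) \<Rightarrow> int \<Rightarrow> complex" where
  "dft M \<kappa> s = (\<Sum>r\<in>{0..<M}. \<kappa> r * eexp (of_int (r * s) / of_int M))"

lemma periodic_mod:
  fixes f :: "int \<Rightarrow> 'a"
  assumes "\<And>n. f (n + M) = f n"
  shows "f (n mod M) = f n"
proof -
  have 1: "f (n + k * M) = f n" for n k
  proof (induction k rule: int_induct[where k = 0])
    case (step1 i)
    then show ?case using assms[of "n + i * M"] by (simp add: algebra_simps)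
  next
    case (step2 i)
    then show ?case using assms[of "n + (i - 1) * M"] by (simp add: algebra_simps)
  qed simp
  show ?thesis using 1[of "n mod M" "n div M"] by (simp add: mult.commute)
qed

lemma bounded_range_periodic:
  fixes \<kappa> :: "int \<Rightarrow> complex"
  assumes "M > 0" "\<And>n. \<kappa> (n + M) = \<kappa> n"
  shows "bounded (range \<kappa>)"
proof -
  have "range \<kappa> \<subseteq> \<kappa> ` {0..<M}"
    using assms by (auto intro!: image_eqI[of _ \<kappa>, OF periodic_mod[of \<kappa> M, symmetric]])
  then show ?thesis by (meson bounded_subset finite_imp_bounded finite_imageI finite_atLeastLessThan_int)
qed

lemma dft_periodic: "dft M \<kappa> (s + M) = dft M \<kappa> s"
proof (cases "M = 0")
  case False
  then have "eexp (of_int (r * (s + M)) / of_int M) = eexp (of_int (r * s) / of_int M)" for r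
    by (intro eexp_cong) (simp add: field_simps)
  then show ?thesis by (simp add: dft_def)
qed (simp add: dft_def)

lemma has_sum_sum:
  fixes f :: "'a \<Rightarrow> 'b \<Rightarrow> complex"
  assumes "\<And>i. i \<in> I \<Longrightarrow> (f i has_sum S i) A"
  shows "((\<lambda>x. \<Sum>i\<in>I. f i x) has_sum (\<Sum>i\<in>I. S i)) A"
  using assms by (induction I rule: infinite_finite_induct) (simp_all add: has_sum_add)

lemma infsum_residue_classes:
  fixes f :: "int \<Rightarrow> complex"
  assumes M: "M > 0" and f: "f summable_on UNIV"
  shows "infsum f UNIV = (\<Sum>r\<in>{0..<M}. \<Sum>\<^sub>\<infinity>k. f (r + M * k))"
proof -
  have bij: "bij_betw (\<lambda>(r, k). r + M * k) ({0..<M} \<times> UNIV) UNIV"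
    by (rule bij_betwI[where g = "\<lambda>n. (n mod M, n div M)"]) (use M in auto)
  have "(\<lambda>p. f (case p of (r, k) \<Rightarrow> r + M * k)) summable_on ({0..<M} \<times> UNIV)"
    using summable_on_reindex_bij_betw[OF bij, of f] f by simp
  then have s: "(\<lambda>(r, k). f (r + M * k)) summable_on ({0..<M} \<times> UNIV)"
    by (simp add: case_prod_beta')
  have "infsum f UNIV = infsum (\<lambda>p. f (case p of (r, k) \<Rightarrow> r + M * k)) ({0..<M} \<times> UNIV)"
    using infsum_reindex_bij_betw[OF bij, of f] by simp
  also have "\<dots> = infsum (\<lambda>(r, k). f (r + M * k)) ({0..<M} \<times> UNIV)"
    by (simp add: case_prod_beta')
  also have "\<dots> = (\<Sum>\<^sub>\<infinity>r\<in>{0..<M}. \<Sum>\<^sub>\<infinity>k. f (r + M * k))"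
    by (rule infsum_Sigma'_banach[symmetric, OF s])
  finally show ?thesis by simp
qed

text \<open>On the imaginary axis every term is a real Gaussian. Splitting n into residues r modulo
  M, Poisson summation applies at x = r / M with parameter T = 4 t / M^2, and the finite sum over r
  that remains in front of each dual term is the discrete Fourier transform.\<close>

lemma theta_series_inversion_imaginary:
  fixes t :: real
  assumes M: "M > 0" and per: "\<And>n. \<kappa> (n + M) = \<kappa> n" and t: "t > 0"
  shows "theta_series \<kappa> (\<i> / of_real t) =
    2 / of_int M * of_real (sqrt t) * theta_series (dft M \<kappa>) (16 * (\<i> * of_real t) / (of_int M)\<^sup>2)"
proof -
  define T where "T = 4 * t / (of_int M)\<^sup>2"
  have T: "T > 0" using M t by (simp add: T_def)
  have M0: "real_of_int M \<noteq> 0" using M by simp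
  have sT: "sqrt T = 2 / of_int M * sqrt t"
    using M by (simp add: T_def real_sqrt_divide real_sqrt_mult)
  define q where "q = (\<lambda>s::int. complex_of_real (exp (- pi * (of_int s)\<^sup>2 * T)))"
  have e1: "eexp (of_int (n\<^sup>2) * (\<i> / of_real t) / 8) = complex_of_real (exp (- pi * (of_int n)\<^sup>2 / (4 * t)))" for n
    using t by (simp add: eexp_def exp_of_real [symmetric] field_simps)
  have e2: "eexp (of_int (s\<^sup>2) * (16 * (\<i> * of_real t) / (of_int M)\<^sup>2) / 8) = q s" for s
    using M by (simp add: eexp_def exp_of_real [symmetric] field_simps q_def T_def)
  have b: "bounded (range \<kappa>)" by (rule bounded_range_periodic[of M, OF M], rule per)
  have it: "\<i> / of_real t \<in> \<H>" using t by (simp add: in_H_iff Im_divide)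
  have mt: "16 * (\<i> * of_real t) / (of_int M)\<^sup>2 \<in> \<H>"
  proof -
    have "16 * (\<i> * of_real t) / (of_int M)\<^sup>2 = of_real (16 * t / (of_int M)\<^sup>2) * \<i>" by simp
    moreover have "Im (of_real (16 * t / (of_int M)\<^sup>2) * \<i>) > 0" using M t by (simp del: of_real_divide)
    ultimately show ?thesis by (simp add: in_H_iff)
  qed
  have qs: "(\<lambda>s. c * (q s * eexp (of_int s * of_real x))) summable_on UNIV" for c x
  proof -
    have 1: "(\<lambda>s. 1 * eexp (of_int (s\<^sup>2) * (16 * (\<i> * of_real t) / (of_int M)\<^sup>2) / 8)) summable_on UNIV"
      by (rule theta_series_summable[OF _ mt]) auto
    have "(\<lambda>s. norm (q s)) summable_on UNIV"
      using 1[unfolded e2 mult_1] by (rule summable_on_iff_abs_summable_on_complex[THEN iffD1])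
    moreover have "norm (q s * eexp (of_int s * of_real x)) = norm (q s)" for s
      using norm_eexp_real[of "of_int s * x"] by (simp add: norm_mult)
    ultimately have "(\<lambda>s. norm (q s * eexp (of_int s * of_real x))) summable_on UNIV"
      by (simp only:)
    then show ?thesis by (rule summable_on_cmult_right[OF abs_summable_summable])
  qed
  have "theta_series \<kappa> (\<i> / of_real t) =
      (\<Sum>r\<in>{0..<M}. \<Sum>\<^sub>\<infinity>k. \<kappa> (r + M * k) * eexp (of_int ((r + M * k)\<^sup>2) * (\<i> / of_real t) / 8))"
    unfolding theta_series_def
    by (rule infsum_residue_classes[OF M theta_series_summable[OF b it]])
  also have "\<dots> = (\<Sum>r\<in>{0..<M}. \<kappa> r * (\<Sum>\<^sub>\<infinity>k. complex_of_real (exp (- pi * (of_int k + of_int r / of_int M)\<^sup>2 / T))))"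
  proof (rule sum.cong[OF refl])
    fix r assume r: "r \<in> {0..<M}"
    have "\<kappa> (r + M * k) = \<kappa> r" for k
      using periodic_mod[of \<kappa> M, OF per, of "r + M * k"] r by simp
    moreover have "- pi * (of_int (r + M * k))\<^sup>2 / (4 * t) = - pi * (of_int k + of_int r / of_int M)\<^sup>2 / T" for k
    proof -
      have "of_int (r + M * k) = of_int M * (of_int k + of_int r / of_int M :: real)"
        using M0 by (simp add: field_simps)
      then show ?thesis using M0 t by (simp add: T_def power_mult_distrib)
    qed
    ultimately show "(\<Sum>\<^sub>\<infinity>k. \<kappa> (r + M * k) * eexp (of_int ((r + M * k)\<^sup>2) * (\<i> / of_real t) / 8)) =
        \<kappa> r * (\<Sum>\<^sub>\<infinity>k. complex_of_real (exp (- pi * (of_int k + of_int r / of_int M)\<^sup>2 / T)))"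
      by (simp only: e1 infsum_cmult_right')
  qed
  also have "\<dots> = (\<Sum>r\<in>{0..<M}. of_real (sqrt T) * (\<Sum>\<^sub>\<infinity>s. \<kappa> r * (q s * eexp (of_int s * of_real (of_int r / of_int M)))))"
    unfolding poisson_gauss[OF T] q_def infsum_cmult_right' by (simp add: mult_ac)
  also have "\<dots> = of_real (sqrt T) * (\<Sum>\<^sub>\<infinity>s. \<Sum>r\<in>{0..<M}. \<kappa> r * (q s * eexp (of_int s * of_real (of_int r / of_int M))))"
  proof -
    have "((\<lambda>s. \<Sum>r\<in>{0..<M}. \<kappa> r * (q s * eexp (of_int s * of_real (of_int r / of_int M)))) has_sum
        (\<Sum>r\<in>{0..<M}. \<Sum>\<^sub>\<infinity>s. \<kappa> r * (q s * eexp (of_int s * of_real (of_int r / of_int M))))) UNIV"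
      by (intro has_sum_sum has_sum_infsum qs)
    from infsumI[OF this] show ?thesis by (simp only: sum_distrib_left)
  qed
  also have "(\<lambda>s. \<Sum>r\<in>{0..<M}. \<kappa> r * (q s * eexp (of_int s * of_real (of_int r / of_int M)))) = (\<lambda>s. dft M \<kappa> s * q s)"
    by (auto simp: dft_def sum_distrib_right sum_distrib_left mult_ac intro!: sum.cong)
  also have "(\<Sum>\<^sub>\<infinity>s. dft M \<kappa> s * q s) = theta_series (dft M \<kappa>) (16 * (\<i> * of_real t) / (of_int M)\<^sup>2)"
    by (simp only: theta_series_def e2)
  finally show ?thesis by (simp add: sT)
qed

lemma csqrt_minus_i_holomorphic: "(\<lambda>\<tau>. csqrt (- \<i> * \<tau>)) holomorphic_on \<H>"
  by (intro holomorphic_intros) (auto simp: in_H_iff complex_nonpos_Reals_iff)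

text \<open>Identity theorem: both sides are holomorphic, and they agree on the positive imaginary
  axis, where \<open>csqrt (- \<i> * \<tau>)\<close> is the positive real root.\<close>

theorem theta_series_inversion:
  assumes M: "M > 0" and per: "\<And>n. \<kappa> (n + M) = \<kappa> n" and \<tau>: "\<tau> \<in> \<H>"
  shows "theta_series \<kappa> (- 1 / \<tau>) =
    2 / of_int M * csqrt (- \<i> * \<tau>) * theta_series (dft M \<kappa>) (16 * \<tau> / (of_int M)\<^sup>2)"
proof -
  define f where "f = (\<lambda>\<tau>. theta_series \<kappa> (- 1 / \<tau>) -
    2 / of_int M * csqrt (- \<i> * \<tau>) * theta_series (dft M \<kappa>) (16 * \<tau> / (of_int M)\<^sup>2))"
  have b: "bounded (range \<kappa>)" "bounded (range (dft M \<kappa>))"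
    by (rule bounded_range_periodic[OF M], rule per dft_periodic)+
  have h1: "(\<lambda>\<tau>. theta_series \<kappa> (- 1 / \<tau>)) holomorphic_on \<H>"
    by (rule holomorphic_on_compose_gen[OF _ theta_series_holomorphic[OF b(1)], unfolded o_def])
       (use minus_inverse_in_H H_not_0 in \<open>auto intro!: holomorphic_intros\<close>)
  have "16 * \<tau> / (of_int M)\<^sup>2 \<in> \<H>" if "\<tau> \<in> \<H>" for \<tau>
  proof -
    have "16 * \<tau> / (of_int M)\<^sup>2 = \<tau> * of_real (16 / (of_int M)\<^sup>2)" by simp
    then show ?thesis using that M by (simp add: in_H_iff del: of_real_divide)
  qed
  then have h2: "(\<lambda>\<tau>. theta_series (dft M \<kappa>) (16 * \<tau> / (of_int M)\<^sup>2)) holomorphic_on \<H>"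
    by (intro holomorphic_on_compose_gen[OF _ theta_series_holomorphic[OF b(2)], unfolded o_def])
       (use M in \<open>auto intro!: holomorphic_intros\<close>)
  have hol: "f holomorphic_on \<H>"
    unfolding f_def by (intro holomorphic_intros h1 h2 csqrt_minus_i_holomorphic)
  have zero: "f z = 0" if "z \<in> (\<lambda>t. \<i> * of_real t) ` {0<..}" for z
  proof -
    from that obtain t :: real where t: "t > 0" "z = \<i> * of_real t" by auto
    have "- 1 / z = \<i> / of_real t" using t by (simp add: field_simps)
    moreover have "csqrt (- \<i> * z) = of_real (sqrt t)"
      using t csqrt_of_real_nonneg[of "complex_of_real t"] by (simp add: mult.assoc [symmetric])
    ultimately show ?thesis
      using theta_series_inversion_imaginary[of M \<kappa>, OF M per t(1)] t(2) by (simp add: f_def)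
  qed
  have lim: "\<i> islimpt ((\<lambda>t. \<i> * of_real t) ` {0<..})"
    unfolding islimpt_sequential
  proof (intro exI conjI allI)
    let ?x = "\<lambda>n. \<i> * of_real (1 + 1 / real (Suc n))"
    show "?x n \<in> (\<lambda>t. \<i> * of_real t) ` {0<..} - {\<i>}" for n
      by (auto simp: complex_eq_iff add_pos_pos simp del: of_nat_Suc intro!: image_eqI[of _ _ "1 + 1 / real (Suc n)"])
    have "(\<lambda>n. 1 + 1 / real (Suc n)) \<longlonglongrightarrow> 1 + 0"
      using tendsto_add[OF tendsto_const[of "1::real"] LIMSEQ_inverse_real_of_nat]
      unfolding inverse_eq_divide .
    then have "?x \<longlonglongrightarrow> \<i> * of_real (1 + 0)" by (intro tendsto_mult_left tendsto_of_real)
    then show "?x \<longlonglongrightarrow> \<i>" by simp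
  qed
  have sub: "(\<lambda>t. \<i> * of_real t) ` {0<..} \<subseteq> \<H>" "\<i> \<in> \<H>"
    by (auto simp: in_H_iff)
  have "f \<tau> = 0"
    by (rule analytic_continuation[OF hol open_H connected_H sub lim zero \<tau>])
  then show ?thesis by (simp add: f_def)
qed

lemma csqrt_of_int_square_mult:
  assumes "N > 0"
  shows "csqrt ((of_int N)\<^sup>2 * z) = of_int N * csqrt z"
proof (rule csqrt_unique)
  have "0 < Re (csqrt z) \<or> Re (csqrt z) = 0 \<and> 0 \<le> Im (csqrt z)" by (rule csqrt_principal)
  with assms show "0 < Re (of_int N * csqrt z) \<or> Re (of_int N * csqrt z) = 0 \<and> 0 \<le> Im (of_int N * csqrt z)"
    by (auto simp: zero_less_mult_iff zero_le_mult_iff simp del: csqrt.sel)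
qed (simp add: power_mult_distrib)

lemma scale_in_H: "r > 0 \<Longrightarrow> \<tau> \<in> \<H> \<Longrightarrow> of_real r * \<tau> \<in> \<H>"
  by (simp add: in_H_iff)

section \<open>Transformation of theta series at rational points, with Gauss sums\<close>

definition gauss_sum :: "int \<Rightarrow> int \<Rightarrow> complex" where
  "gauss_sum N a = (\<Sum>u\<in>{0..<N}. eexp (of_int (a * u\<^sup>2) / of_int N))"

lemma eexp_cong_int_div:
  assumes "N \<noteq> 0" "[a = b] (mod N)"
  shows "eexp (of_int a / of_int N) = eexp (of_int b / of_int N)"
proof (rule eexp_cong)
  from assms(2) obtain k where "a - b = N * k" by (auto simp: cong_iff_dvd_diff)
  then have "of_int a - of_int b = (of_int N * of_int k :: complex)"
    by (metis of_int_diff of_int_mult)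
  then have "of_int a / of_int N - of_int b / of_int N = (of_int k :: complex)"
    using assms(1) by (simp add: diff_divide_distrib [symmetric])
  then show "of_int a / of_int N - of_int b / of_int N \<in> (\<int> :: complex set)" by simp
qed

lemma sum_shift_periodic:
  fixes f :: "int \<Rightarrow> 'a::comm_monoid_add"
  assumes N: "N > 0" and per: "\<And>n. f (n + N) = f n"
  shows "(\<Sum>u\<in>{0..<N}. f (u + e)) = (\<Sum>u\<in>{0..<N}. f u)"
proof -
  have bij: "bij_betw (\<lambda>u. (u + e) mod N) {0..<N} {0..<N}"
    by (rule bij_betwI[where g = "\<lambda>u. (u - e) mod N"]) (use N in \<open>auto simp: mod_simps\<close>)
  have "(\<Sum>u\<in>{0..<N}. f u) = (\<Sum>u\<in>{0..<N}. f ((u + e) mod N))"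
    by (rule sum.reindex_bij_betw[OF bij, symmetric])
  then show ?thesis by (simp add: periodic_mod[of f N, OF per])
qed

text \<open>Chinese remainder theorem: N v + 4 u determines v modulo 4 and u modulo N because 4 and
  N are coprime; counting gives surjectivity.\<close>

lemma sum_crt_4:
  fixes f :: "int \<Rightarrow> 'a::comm_monoid_add"
  assumes N: "N > 0" "odd N" and per: "\<And>n. f (n + 4 * N) = f n"
  shows "(\<Sum>r\<in>{0..<4 * N}. f r) = (\<Sum>v\<in>{0..<4}. \<Sum>u\<in>{0..<N}. f (N * v + 4 * u))"
proof -
  let ?h = "\<lambda>(v, u). (N * v + 4 * u) mod (4 * N)"
  let ?A = "{0..<4} \<times> {0..<N} :: (int \<times> int) set"
  have cop: "coprime 4 N"
  proof -
    have "coprime (2 ^ 2) N" using N(2) by (simp only: coprime_power_left_iff coprime_left_2_iff_odd simp_thms)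
    then show ?thesis by simp
  qed
  have inj: "inj_on ?h ?A"
  proof (rule inj_onI, clarify)
    fix v u v' u' :: int
    assume r: "v \<in> {0..<4}" "u \<in> {0..<N}" "v' \<in> {0..<4}" "u' \<in> {0..<N}"
      and eq: "(N * v + 4 * u) mod (4 * N) = (N * v' + 4 * u') mod (4 * N)"
    from eq have dvd: "4 * N dvd (N * v + 4 * u) - (N * v' + 4 * u')" by (simp add: mod_eq_dvd_iff)
    have "4 dvd (N * v + 4 * u) - (N * v' + 4 * u')" by (rule dvd_trans[OF _ dvd]) simp
    then have "4 dvd (N * v + 4 * u) - (N * v' + 4 * u') - 4 * (u - u')" by (rule dvd_diff) simp
    then have "4 dvd N * (v - v')" by (simp add: algebra_simps)
    then have "4 dvd v - v'" using cop by (simp add: coprime_dvd_mult_right_iff)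
    moreover from r have "0 \<le> v" "v < 4" "0 \<le> v'" "v' < 4" by auto
    ultimately have v: "v = v'" by presburger
    have "N dvd (N * v + 4 * u) - (N * v' + 4 * u')" by (rule dvd_trans[OF _ dvd]) simp
    then have "N dvd 4 * (u - u')" by (simp add: v algebra_simps)
    moreover have "coprime N 4" using cop by (simp add: coprime_commute)
    ultimately have "N dvd u - u'" using coprime_dvd_mult_right_iff[of N 4 "u - u'"] by blast
    then have "u = u'" using r by (metis atLeastLessThan_iff mod_eq_dvd_iff mod_pos_pos_trivial)
    with v show "v = v' \<and> u = u'" by simp
  qed
  have "bij_betw ?h ?A {0..<4 * N}"
    unfolding bij_betw_def
  proof (intro conjI inj card_subset_eq)
    show "?h ` ?A \<subseteq> {0..<4 * N}" using N by auto
    show "card (?h ` ?A) = card {0..<4 * N}"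
      using N by (simp add: card_image[OF inj] card_cartesian_product nat_mult_distrib)
  qed simp
  from sum.reindex_bij_betw[OF this, of f]
  have "(\<Sum>r\<in>{0..<4 * N}. f r) = (\<Sum>(v, u)\<in>?A. f ((N * v + 4 * u) mod (4 * N)))"
    by (simp add: case_prod_beta')
  also have "\<dots> = (\<Sum>(v, u)\<in>?A. f (N * v + 4 * u))"
    by (simp add: periodic_mod[of f "4 * N", OF per])
  finally show ?thesis by (simp add: sum.cartesian_product)
qed

text \<open>Translation by 8 b / N twists \<kappa> by e(n^2 b / N), which produces a sequence of
  period 4 N. Inversion applies to this twist, and its transform of length 4 N factors by the
  Chinese remainder theorem into the transform of length 4 and a Gauss sum. The number b' is -1 /
  (64 b) modulo N; the factor e(s^2 b' / N) left by completing the square is a translation by 8 b' /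
  N.\<close>

theorem theta_series_gauss:
  assumes N: "N > 0" "odd N" and bb': "N dvd 64 * b * b' + 1"
    and per: "\<And>n. \<kappa> (n + 4) = \<kappa> n" and even: "\<And>n. \<kappa> (- n) = \<kappa> n"
    and dft4: "\<And>s. dft 4 \<kappa> s = 2 * \<kappa>' s" and w: "w \<in> \<H>"
  shows "theta_series \<kappa> (8 * of_int b / of_int N - 1 / ((of_int N)\<^sup>2 * w)) =
    csqrt (- \<i> * w) * gauss_sum N (16 * b) * theta_series \<kappa>' (w + 8 * of_int b' / of_int N)"
proof -
  define n where "n = (of_int N :: complex)"
  have n0: "n \<noteq> 0" using N by (simp add: n_def)
  define \<psi> where "\<psi> = (\<lambda>k. \<kappa> k * eexp (of_int (k\<^sup>2) * (of_int b / n)))"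
  have per4: "\<kappa> (k + 4 * N) = \<kappa> k" for k
    using periodic_mod[of \<kappa> 4, OF per, of "k + 4 * N"] periodic_mod[of \<kappa> 4, OF per, of k] by simp
  have \<psi>_per: "\<psi> (k + 4 * N) = \<psi> k" for k
  proof -
    have "of_int ((k + 4 * N)\<^sup>2) * (of_int b / n) - of_int (k\<^sup>2) * (of_int b / n) =
        of_int (8 * k * b + 16 * N * b)"
      using n0 by (simp add: n_def field_simps power2_eq_square)
    then have "eexp (of_int ((k + 4 * N)\<^sup>2) * (of_int b / n)) = eexp (of_int (k\<^sup>2) * (of_int b / n))"
      by (intro eexp_cong) (simp only: Ints_of_int)
    then show ?thesis by (simp add: \<psi>_def per4)
  qed
  have \<kappa>_mod: "\<kappa> k = \<kappa> l" if "[k = l] (mod 4)" for k l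
    using that periodic_mod[of \<kappa> 4, OF per] by (metis cong_def)
  \<comment> \<open>An odd N is 1 or -1 modulo 4, and \<kappa> is even.\<close>
  have \<kappa>N: "\<kappa> (N * v) = \<kappa> v" for v
  proof -
    have "N mod 4 = 1 \<or> N mod 4 = 3" using N(2) by presburger
    then have "[N = 1] (mod 4) \<or> [N = -1] (mod 4)" by (auto simp: cong_def)
    then have "[N * v = v] (mod 4) \<or> [N * v = - v] (mod 4)"
      using cong_scalar_right[of N _ 4 v] by fastforce
    then show ?thesis using \<kappa>_mod even by metis
  qed
  from bb' obtain k where k: "64 * b * b' + 1 = N * k" by (elim dvdE)
  have dft\<psi>: "dft (4 * N) \<psi> s = 2 * gauss_sum N (16 * b) * (\<kappa>' s * eexp (of_int (s\<^sup>2) * (of_int b' / n)))" for s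
  proof -
    define f where "f = (\<lambda>r. \<psi> r * eexp (of_int (r * s) / of_int (4 * N)))"
    have "eexp (of_int ((r + 4 * N) * s) / of_int (4 * N)) = eexp (of_int (r * s) / of_int (4 * N))" for r
    proof (rule eexp_cong_int_div)
      have "(r + 4 * N) * s - r * s = (4 * N) * s" by (simp add: algebra_simps)
      then show "[(r + 4 * N) * s = r * s] (mod 4 * N)" by (simp only: cong_iff_dvd_diff dvd_triv_left)
    qed (use N in simp)
    then have f_per: "f (r + 4 * N) = f r" for r by (simp add: f_def \<psi>_per)
    \<comment> \<open>Expanding 16 b (u - 2 b' s)^2 gives 16 b u^2 - 64 b b' u s + 64 b b'^2 s^2.
      Since 64 b b' is -1 modulo N, this is 16 b u^2 + u s - b' s^2, so the shift by -2 b' s absorbs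
      the linear term at the price of the factor with s^2 b'.\<close>
    have f: "f (N * v + 4 * u) = (\<kappa> v * eexp (of_int (v * s) / of_int 4)) *
        (eexp (of_int (16 * b * (u + - 2 * b' * s)\<^sup>2) / of_int N) * eexp (of_int (s\<^sup>2) * (of_int b' / n)))" for v u
    proof -
      have "\<kappa> (N * v + 4 * u) = \<kappa> v" using \<kappa>_mod[of "N * v + 4 * u" "N * v"] \<kappa>N by (simp add: cong_def)
      moreover have "eexp (of_int ((N * v + 4 * u)\<^sup>2) * (of_int b / n)) * eexp (of_int ((N * v + 4 * u) * s) / of_int (4 * N))
          = eexp (of_int (v * s) / of_int 4) *
            (eexp (of_int (16 * b * (u + - 2 * b' * s)\<^sup>2) / of_int N) * eexp (of_int (s\<^sup>2) * (of_int b' / n)))"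
        unfolding eexp_add [symmetric]
      proof (rule eexp_cong)
        have "of_int ((N * v + 4 * u)\<^sup>2) * (of_int b / n) + of_int ((N * v + 4 * u) * s) / of_int (4 * N) -
           (of_int (v * s) / of_int 4 +
             (of_int (16 * b * (u + - 2 * b' * s)\<^sup>2) / of_int N + of_int (s\<^sup>2) * (of_int b' / n))) =
           of_int (N * v\<^sup>2 * b + 8 * v * u * b) + of_int (64 * b * b' + 1) * of_int (u * s - b' * s\<^sup>2) / n"
          using n0 unfolding n_def [symmetric]
          by (simp add: field_simps power2_eq_square n_def [symmetric])
        also have "\<dots> = of_int (N * v\<^sup>2 * b + 8 * v * u * b + k * (u * s - b' * s\<^sup>2))"
          using n0 unfolding k by (simp add: n_def [symmetric])
        finally show "of_int ((N * v + 4 * u)\<^sup>2) * (of_int b / n) + of_int ((N * v + 4 * u) * s) / of_int (4 * N) -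
           (of_int (v * s) / of_int 4 +
             (of_int (16 * b * (u + - 2 * b' * s)\<^sup>2) / of_int N + of_int (s\<^sup>2) * (of_int b' / n))) \<in> (\<int> :: complex set)"
          by (simp only: Ints_of_int)
      qed
      ultimately show ?thesis by (simp add: f_def \<psi>_def mult_ac)
    qed
    have g: "(\<Sum>u\<in>{0..<N}. eexp (of_int (16 * b * (u + - 2 * b' * s)\<^sup>2) / of_int N)) = gauss_sum N (16 * b)"
      unfolding gauss_sum_def
    proof (rule sum_shift_periodic[OF N(1)])
      fix m :: int
      show "eexp (of_int (16 * b * (m + N)\<^sup>2) / of_int N) = eexp (of_int (16 * b * m\<^sup>2) / of_int N)"
        by (rule eexp_cong_int_div) (use N in \<open>auto simp: cong_iff_dvd_diff power2_eq_square algebra_simps\<close>)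
    qed
    have "dft (4 * N) \<psi> s = (\<Sum>r\<in>{0..<4 * N}. f r)" by (simp add: dft_def f_def)
    also have "\<dots> = (\<Sum>v\<in>{0..<4}. \<Sum>u\<in>{0..<N}. f (N * v + 4 * u))"
      by (rule sum_crt_4[of N f, OF N f_per])
    also have "\<dots> = dft 4 \<kappa> s * (gauss_sum N (16 * b) * eexp (of_int (s\<^sup>2) * (of_int b' / n)))"
      unfolding f g [symmetric] dft_def sum_distrib_left [symmetric] sum_distrib_right [symmetric] by simp
    finally show ?thesis by (simp add: dft4 mult_ac)
  qed
  have Nw: "n\<^sup>2 * w \<in> \<H>"
  proof -
    have eq: "n\<^sup>2 * w = of_real ((of_int N)\<^sup>2) * w" by (simp add: n_def)
    show ?thesis unfolding eq by (rule scale_in_H[OF _ w]) (use N in simp)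
  qed
  have "theta_series \<kappa> (8 * of_int b / n - 1 / (n\<^sup>2 * w)) = theta_series \<kappa> (- 1 / (n\<^sup>2 * w) + 8 * (of_int b / n))"
    by (rule arg_cong[where f = "theta_series \<kappa>"]) simp
  also have "\<dots> = theta_series \<psi> (- 1 / (n\<^sup>2 * w))"
    by (simp only: theta_series_shift \<psi>_def)
  also have "\<dots> = 2 / of_int (4 * N) * csqrt (- \<i> * (n\<^sup>2 * w)) * theta_series (dft (4 * N) \<psi>) (16 * (n\<^sup>2 * w) / (of_int (4 * N))\<^sup>2)"
    using N by (intro theta_series_inversion \<psi>_per Nw) simp
  also have "16 * (n\<^sup>2 * w) / (of_int (4 * N))\<^sup>2 = w"
    using n0 by (simp add: n_def [symmetric] power_mult_distrib)
  also have "csqrt (- \<i> * (n\<^sup>2 * w)) = n * csqrt (- \<i> * w)"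
    using csqrt_of_int_square_mult[OF N(1), of "- \<i> * w"] by (simp add: n_def mult_ac)
  also have "theta_series (dft (4 * N) \<psi>) w = 2 * gauss_sum N (16 * b) * theta_series \<kappa>' (w + 8 * (of_int b' / n))"
    unfolding theta_series_shift theta_series_cmult [symmetric] by (simp add: dft\<psi> [abs_def])
  finally show ?thesis using n0 by (simp add: n_def [symmetric])
qed

subsection \<open>The three theta constants\<close>

text \<open>With n = 2 k + 1 or n = 2 k the resulting series are Jacobi's theta2 = sum q^((k +
  1/2)^2 / 2), theta3 = sum q^(k^2 / 2) and theta4 = sum (-1)^k q^(k^2 / 2). All three coefficient
  sequences are even with period 4.\<close>

definition chi2 :: "int \<Rightarrow> complex" where "chi2 n = (if odd n then 1 else 0)"
definition chi3 :: "int \<Rightarrow> complex" where "chi3 n = (if even n then 1 else 0)"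
definition chi4 :: "int \<Rightarrow> complex" where "chi4 n = (if 4 dvd n then 1 else if even n then - 1 else 0)"

abbreviation theta2 :: "complex \<Rightarrow> complex" (\<open>\<theta>2\<close>) where "\<theta>2 \<equiv> theta_series chi2"
abbreviation theta3 :: "complex \<Rightarrow> complex" (\<open>\<theta>3\<close>) where "\<theta>3 \<equiv> theta_series chi3"
abbreviation theta4 :: "complex \<Rightarrow> complex" (\<open>\<theta>4\<close>) where "\<theta>4 \<equiv> theta_series chi4"

lemma chi_periodic: "chi2 (n + 4) = chi2 n" "chi3 (n + 4) = chi3 n" "chi4 (n + 4) = chi4 n"
  by (auto simp: chi2_def chi3_def chi4_def)

lemma chi_even: "chi2 (- n) = chi2 n" "chi3 (- n) = chi3 n" "chi4 (- n) = chi4 n"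
  by (auto simp: chi2_def chi3_def chi4_def)

lemma chi_bounded: "bounded (range chi2)" "bounded (range chi3)" "bounded (range chi4)"
  by (auto intro!: bounded_range_periodic[of 4] simp: chi_periodic)

lemma zeta8_eexp: "\<zeta>8 = eexp (1 / 8)"
  by (simp add: \<zeta>8_def eexp_def)

lemma eexp_half: "eexp (1 / 2) = - 1" and eexp_quarter: "eexp (1 / 4) = \<i>" and eexp_3_quarter: "eexp (3 / 4) = - \<i>"
proof -
  show q: "eexp (1 / 4) = \<i>"
    by (simp add: eexp_def exp_Euler[of "of_real (pi / 2)", simplified] complex_eq_iff cis_conv_exp [symmetric])
  have "eexp (1 / 2) = eexp (1 / 4) ^ 2" "eexp (3 / 4) = eexp (1 / 4) ^ 3"
    by (simp_all add: eexp_power)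
  then show "eexp (1 / 2) = - 1" "eexp (3 / 4) = - \<i>" by (simp_all add: q power3_eq_cube)
qed

lemma mod4_cases:
  fixes s :: int
  obtains "s mod 4 = 0" | "s mod 4 = 1" | "s mod 4 = 2" | "s mod 4 = 3"
proof -
  have "s mod 4 = 0 \<or> s mod 4 = 1 \<or> s mod 4 = 2 \<or> s mod 4 = 3" by presburger
  with that show ?thesis by blast
qed

text \<open>This finite computation is the reason why S fixes theta3 and exchanges theta2 and
  theta4.\<close>

lemma dft_chi: "dft 4 chi3 s = 2 * chi3 s" "dft 4 chi4 s = 2 * chi2 s" "dft 4 chi2 s = 2 * chi4 s"
proof -
  have set: "{0..<4} = {0, 1, 2, 3::int}" by auto
  have red: "eexp (of_int a / of_int 4) = eexp (of_int (a mod 4) / of_int 4)" for a :: int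
    by (rule eexp_cong_int_div) (auto simp: cong_def)
  have m: "(3 * s) mod 4 = (3 * (s mod 4)) mod 4" "(2 * s) mod 4 = (2 * (s mod 4)) mod 4"
    by (simp_all add: mod_mult_right_eq)
  have s: "odd s \<longleftrightarrow> odd (s mod 4)" "4 dvd s \<longleftrightarrow> s mod 4 = 0" by presburger+
  have d: "dft 4 \<kappa> s = \<kappa> 0 + \<kappa> 1 * eexp (of_int (s mod 4) / 4) + \<kappa> 2 * eexp (of_int ((2 * (s mod 4)) mod 4) / 4) +
      \<kappa> 3 * eexp (of_int ((3 * (s mod 4)) mod 4) / 4)" for \<kappa>
    using red[of s] red[of "2 * s"] red[of "3 * s"] by (simp add: dft_def set m add.assoc)
  show "dft 4 chi3 s = 2 * chi3 s" "dft 4 chi4 s = 2 * chi2 s" "dft 4 chi2 s = 2 * chi4 s"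
    by (rule mod4_cases[of s]; simp add: d chi2_def chi3_def chi4_def s eexp_half eexp_quarter eexp_3_quarter)+
qed

text \<open>Translation by 1 multiplies the term at n by e(n^2 / 8), and n^2 modulo 8 is 1 for odd
  n, 0 for n divisible by 4 and 4 otherwise.\<close>

lemma theta_T:
  shows theta2_T: "\<theta>2 (\<tau> + 1) = \<zeta>8 * \<theta>2 \<tau>"
    and theta3_T: "\<theta>3 (\<tau> + 1) = \<theta>4 \<tau>"
    and theta4_T: "\<theta>4 (\<tau> + 1) = \<theta>3 \<tau>"
proof -
  have sh: "theta_series \<kappa> (\<tau> + 1) = theta_series (\<lambda>n. \<kappa> n * eexp (of_int (n\<^sup>2) / 8)) \<tau>" for \<kappa>
    using theta_series_shift[of \<kappa> \<tau> "1 / 8"] by simp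
  have e: "eexp ((of_int n)\<^sup>2 / 8) = (if odd n then \<zeta>8 else if 4 dvd n then 1 else - 1)" for n
  proof -
    have "odd n \<or> (\<exists>k. n = 4 * k) \<or> (\<exists>k. n = 4 * k + 2)" by presburger
    then consider (odd) k where "n = 2 * k + 1" | (four) k where "n = 4 * k" | (two) k where "n = 4 * k + 2"
      by (auto elim: oddE)
    then show ?thesis
    proof cases
      case odd
      have "even (k * (k + 1))" by simp
      then obtain l where l: "k * (k + 1) = 2 * l" by (elim evenE)
      then have "n\<^sup>2 = 8 * l + 1" by (simp add: odd power2_eq_square algebra_simps)
      then have "[n\<^sup>2 = 1] (mod 8)" by (simp add: cong_iff_dvd_diff)
      with eexp_cong_int_div[of 8 "n\<^sup>2" 1] show ?thesis by (simp add: odd zeta8_eexp)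
    next
      case four
      then have "[n\<^sup>2 = 0] (mod 8)" by (simp add: cong_def power2_eq_square)
      with eexp_cong_int_div[of 8 "n\<^sup>2" 0] show ?thesis by (simp add: four)
    next
      case two
      then have "n\<^sup>2 - 4 = 8 * (2 * k\<^sup>2 + 2 * k)" by (simp add: power2_eq_square algebra_simps)
      then have "[n\<^sup>2 = 4] (mod 8)" by (simp only: cong_iff_dvd_diff dvd_triv_left)
      moreover have "\<not> 4 dvd n" "even n" unfolding two by presburger+
      ultimately show ?thesis using eexp_cong_int_div[of 8 "n\<^sup>2" 4] by (simp add: eexp_half)
    qed
  qed
  have "(\<lambda>n. chi2 n * eexp (of_int (n\<^sup>2) / 8)) = (\<lambda>n. \<zeta>8 * chi2 n)"
    by (auto simp: e chi2_def)
  then show "\<theta>2 (\<tau> + 1) = \<zeta>8 * \<theta>2 \<tau>" by (simp add: sh theta_series_cmult)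
  have "(\<lambda>n. chi3 n * eexp (of_int (n\<^sup>2) / 8)) = chi4"
    by (rule ext) (auto simp: e chi3_def chi4_def)
  then show "\<theta>3 (\<tau> + 1) = \<theta>4 \<tau>" by (simp add: sh)
  have "(\<lambda>n. chi4 n * eexp (of_int (n\<^sup>2) / 8)) = chi3"
    by (rule ext) (auto simp: e chi3_def chi4_def)
  then show "\<theta>4 (\<tau> + 1) = \<theta>3 \<tau>" by (simp add: sh)
qed

lemma theta_S:
  assumes "\<tau> \<in> \<H>"
  shows theta2_S: "\<theta>2 (- 1 / \<tau>) = csqrt (- \<i> * \<tau>) * \<theta>4 \<tau>"
    and theta3_S: "\<theta>3 (- 1 / \<tau>) = csqrt (- \<i> * \<tau>) * \<theta>3 \<tau>"
    and theta4_S: "\<theta>4 (- 1 / \<tau>) = csqrt (- \<i> * \<tau>) * \<theta>2 \<tau>"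
proof -
  have inv: "theta_series \<kappa> (- 1 / \<tau>) = csqrt (- \<i> * \<tau>) * theta_series \<kappa>' \<tau>"
    if "\<And>n. \<kappa> (n + 4) = \<kappa> n" "\<And>s. dft 4 \<kappa> s = 2 * \<kappa>' s" for \<kappa> \<kappa>'
  proof -
    have "dft 4 \<kappa> = (\<lambda>s. 2 * \<kappa>' s)" using that(2) by blast
    with theta_series_inversion[of 4 \<kappa>, OF _ that(1) assms] show ?thesis
      by (simp add: theta_series_cmult [of 2 \<kappa>'])
  qed
  show "\<theta>2 (- 1 / \<tau>) = csqrt (- \<i> * \<tau>) * \<theta>4 \<tau>" "\<theta>3 (- 1 / \<tau>) = csqrt (- \<i> * \<tau>) * \<theta>3 \<tau>"
    "\<theta>4 (- 1 / \<tau>) = csqrt (- \<i> * \<tau>) * \<theta>2 \<tau>"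
    by (rule inv; simp add: chi_periodic dft_chi)+
qed

text \<open>Classically 2 eta^3, of weight 3/2. It is handled here only through its transformation
  rules, its order at the cusp and the absence of zeros.\<close>

definition theta_prod :: "complex \<Rightarrow> complex" where
  "theta_prod \<tau> = \<theta>2 \<tau> * \<theta>3 \<tau> * \<theta>4 \<tau>"

lemma theta_prod_holomorphic: "theta_prod holomorphic_on \<H>"
  unfolding theta_prod_def [abs_def] by (intro holomorphic_intros theta_series_holomorphic chi_bounded)

lemma theta_prod_T: "theta_prod (\<tau> + 1) = \<zeta>8 * theta_prod \<tau>"
  by (simp add: theta_prod_def theta_T)

lemma theta_prod_S: "\<tau> \<in> \<H> \<Longrightarrow> theta_prod (- 1 / \<tau>) = csqrt (- \<i> * \<tau>) ^ 3 * theta_prod \<tau>"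
  unfolding theta_prod_def theta_S by (simp add: power3_eq_cube mult_ac)

lemma theta_prod_gauss:
  assumes "N > 0" "odd N" "N dvd 64 * b * b' + 1" "w \<in> \<H>"
  shows "theta_prod (8 * of_int b / of_int N - 1 / ((of_int N)\<^sup>2 * w)) =
    csqrt (- \<i> * w) ^ 3 * gauss_sum N (16 * b) ^ 3 * theta_prod (w + 8 * of_int b' / of_int N)"
proof -
  note g = theta_series_gauss[OF assms(1-3) _ _ _ assms(4)]
  show ?thesis
    unfolding theta_prod_def
      g[of chi2 chi4, OF chi_periodic(1) chi_even(1) dft_chi(3)]
      g[of chi3 chi3, OF chi_periodic(2) chi_even(2) dft_chi(1)]
      g[of chi4 chi2, OF chi_periodic(3) chi_even(3) dft_chi(2)]
    by (simp add: power3_eq_cube mult_ac)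
qed

section \<open>The theta constants have no zeros\<close>

lemma infsum_int_symmetric:
  fixes f :: "int \<Rightarrow> complex"
  assumes "f summable_on UNIV"
  shows "infsum f UNIV = (\<Sum>\<^sub>\<infinity>n::nat. f (int n)) + (\<Sum>\<^sub>\<infinity>n::nat. f (- int n - 1))"
proof -
  have U: "UNIV = range int \<union> range (\<lambda>n. - int n - 1)"
  proof -
    have "x \<in> range int \<union> range (\<lambda>n. - int n - 1)" for x
      by (cases "x \<ge> 0") (auto intro: range_eqI[of _ _ "nat x"] range_eqI[of _ _ "nat (- x - 1)"])
    then show ?thesis by blast
  qed
  have s: "f summable_on A" for A using assms summable_on_subset_banach by blast
  have "infsum f UNIV = infsum f (range int) + infsum f (range (\<lambda>n. - int n - 1))"
    by (subst U, rule infsum_Un_disjoint[OF s s]) auto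
  then show ?thesis by (simp add: infsum_reindex inj_def o_def)
qed

text \<open>The tail is at most C R / (1 - R), and R < 1/3 is exactly what brings this below C / 2.
  Pairing n with its mirror image doubles the tail, so that C / 2 is the threshold needed.\<close>

lemma infsum_small_tail:
  fixes a :: "nat \<Rightarrow> complex"
  assumes a: "\<And>n. norm (a (Suc n)) \<le> C * R ^ Suc n" and R: "0 \<le> R" "R < 1 / 3" and C: "C > 0"
  shows "a summable_on UNIV" "norm (infsum a UNIV - a 0) < C / 2"
proof -
  have g: "(\<lambda>n. C * R ^ Suc n) sums (C * R * (1 / (1 - R)))"
    using sums_mult[OF geometric_sums[of R], of "C * R"] R by (simp add: mult_ac)
  then have gs: "((\<lambda>n. C * R ^ Suc n) has_sum (C * R * (1 / (1 - R)))) UNIV"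
    using C R by (intro sums_nonneg_imp_has_sum) auto
  have s: "summable (\<lambda>n. norm (a (Suc n)))"
    by (rule summable_comparison_test'[OF sums_summable[OF g], of 0]) (use a in simp)
  then have sn: "summable (\<lambda>n. norm (a n))" by (subst (asm) summable_Suc_iff)
  then show sum_a: "a summable_on UNIV" by (rule norm_summable_imp_summable_on)
  have as: "a sums infsum a UNIV"
    by (rule has_sum_imp_sums[OF has_sum_infsum[OF sum_a]])
  then have "(\<lambda>n. a (Suc n)) sums (infsum a UNIV - a 0)" by (subst sums_Suc_iff) simp
  with s have "((\<lambda>n. a (Suc n)) has_sum (infsum a UNIV - a 0)) UNIV"
    by (rule norm_summable_imp_has_sum)
  from norm_infsum_le[OF this gs a] have "norm (infsum a UNIV - a 0) \<le> C * R * (1 / (1 - R))" .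
  also have "\<dots> < C / 2" using C R by (simp add: field_simps)
  finally show "norm (infsum a UNIV - a 0) < C / 2" .
qed

text \<open>Here R = exp(-pi Im \<tau>) is below 1/3, since exp(pi / 2) >= exp(3 / 2) >= (3 / 2)^3 >
  3. Hence theta3 lies within distance less than 1 of its constant term 1, and theta2 within
  distance less than |q8| of its leading term 2 q8.\<close>

lemma theta_constants_nonzero_high:
  assumes \<tau>: "Im \<tau> \<ge> 1 / 2"
  shows "\<theta>3 \<tau> \<noteq> 0" "\<theta>2 \<tau> \<noteq> 0"
proof -
  define R where "R = exp (- pi * Im \<tau>)"
  have "(3::real) < (3 / 2) ^ 3" by (simp add: power3_eq_cube)
  also have "\<dots> \<le> exp (1 / 2) ^ 3" using exp_ge_add_one_self[of "1/2"] by (intro power_mono) auto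
  also have "\<dots> = exp (3 * (1 / 2))" by (simp add: exp_of_nat_mult [symmetric])
  also have "\<dots> \<le> exp (pi * Im \<tau>)"
    using mult_mono[of 3 pi "1/2" "Im \<tau>"] pi_gt3 \<tau> by simp
  finally have R: "0 \<le> R" "R < 1 / 3" by (auto simp: R_def exp_minus field_simps)
  have H: "\<tau> \<in> \<H>" using \<tau> by (simp add: in_H_iff)
  show "\<theta>3 \<tau> \<noteq> 0"
  proof -
    define f where "f = (\<lambda>k::int. eexp (of_int (k\<^sup>2) * \<tau> / 2))"
    have n: "norm (f k) = R ^ nat (k\<^sup>2)" for k
      by (simp add: f_def norm_eexp R_def exp_of_nat_mult [symmetric] mult_ac)
    have n': "norm (f (int n)) \<le> 1 * R ^ n" for n
      unfolding n mult_1 using R nat_abs_le_nat_square[of "int n"] by (intro power_decreasing) auto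
    have "theta_series chi3 \<tau> = infsum (\<lambda>n. eexp (of_int (n\<^sup>2) * \<tau> / 8)) (range ((*) 2))"
      unfolding theta_series_def by (rule infsum_cong_neutral) (auto simp: chi3_def)
    also have "\<dots> = infsum f UNIV"
      by (subst infsum_reindex) (auto simp: inj_def o_def f_def power2_eq_square mult_ac)
    finally have th: "\<theta>3 \<tau> = infsum f UNIV" .
    have fs: "f summable_on UNIV"
      using theta_series_summable[of "\<lambda>_. 1" "4 * \<tau>"] H by (simp add: f_def in_H_iff mult_ac)
    have t: "(\<lambda>n. f (int n)) summable_on UNIV" "norm (infsum (\<lambda>n. f (int n)) UNIV - f 0) < 1 / 2"
      using infsum_small_tail[of "\<lambda>n. f (int n)", OF n' R zero_less_one] by simp_all
    define A where "A = infsum (\<lambda>n. f (int n)) UNIV"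
    have sA: "(\<lambda>n. f (int n)) sums A" unfolding A_def by (rule has_sum_imp_sums[OF has_sum_infsum[OF t(1)]])
    have "(\<lambda>n. f (- int n - 1)) = (\<lambda>n. f (int (Suc n)))"
      by (rule ext) (simp add: f_def power2_eq_square algebra_simps)
    moreover have "(\<Sum>\<^sub>\<infinity>n. f (int (Suc n))) = A - f 0"
    proof -
      have s': "(\<lambda>n. f (int (Suc n))) sums (A - f 0)"
        using sA by (subst sums_Suc_iff) simp
      have bd: "norm (norm (f (int (Suc n)))) \<le> R ^ Suc n" for n using n'[of "Suc n"] by simp
      have "summable (\<lambda>n. R ^ n)" using R by (intro summable_geometric) simp
      then have "summable (\<lambda>n. R ^ Suc n)" by (subst summable_Suc_iff)
      then have "summable (\<lambda>n. norm (f (int (Suc n))))"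
        by (rule summable_comparison_test') (rule bd)
      from norm_summable_imp_has_sum[OF this s'] show ?thesis by (rule infsumI)
    qed
    ultimately have eq: "\<theta>3 \<tau> = f 0 + 2 * (A - f 0)"
      unfolding th infsum_int_symmetric[OF fs] A_def [symmetric] by simp
    have "norm (2 * (A - f 0)) < 1" using t(2) unfolding A_def [symmetric] norm_mult by simp
    moreover have "f 0 = 1" by (simp add: f_def)
    ultimately show ?thesis using eq by (metis add_eq_0_iff2 norm_minus_cancel norm_one order_less_irrefl)
  qed
  show "\<theta>2 \<tau> \<noteq> 0"
  proof -
    define f where "f = (\<lambda>k::int. eexp (of_int ((2 * k + 1)\<^sup>2) * \<tau> / 8))"
    have "theta_series chi2 \<tau> = infsum (\<lambda>n. eexp (of_int (n\<^sup>2) * \<tau> / 8)) (range (\<lambda>k. 2 * k + 1))"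
    proof -
      have "odd n \<Longrightarrow> n \<in> range (\<lambda>k::int. 2 * k + 1)" for n
        by (elim oddE) (simp add: image_iff)
      then show ?thesis
        unfolding theta_series_def by (intro infsum_cong_neutral) (auto simp: chi2_def)
    qed
    also have "\<dots> = infsum f UNIV"
      by (subst infsum_reindex) (auto simp: inj_def o_def f_def)
    finally have th: "\<theta>2 \<tau> = infsum f UNIV" .
    have "(\<lambda>n. eexp (of_int (n\<^sup>2) * \<tau> / 8)) summable_on range (\<lambda>k. 2 * k + 1)"
      using summable_on_subset_banach[OF theta_series_summable[of "\<lambda>_. 1" \<tau>, OF _ H], of "range (\<lambda>k. 2 * k + 1)"] by simp
    then have fs: "f summable_on UNIV"
      by (subst (asm) summable_on_reindex) (auto simp: inj_def o_def f_def)
    have n: "norm (f (int n)) \<le> norm (q8 \<tau>) * R ^ n" for n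
    proof -
      have "f (int n) = q8 \<tau> * eexp (of_int (int n * (int n + 1)) * \<tau> / 2)"
        unfolding q8_eexp eexp_add [symmetric] f_def
        by (rule arg_cong[where f = eexp]) (simp add: field_simps power2_eq_square)
      then have "norm (f (int n)) = norm (q8 \<tau>) * R ^ nat (int n * (int n + 1))"
        by (simp add: norm_mult norm_eexp R_def exp_of_nat_mult [symmetric] mult_ac)
      also have "\<dots> \<le> norm (q8 \<tau>) * R ^ n"
        using R by (intro mult_left_mono power_decreasing) (auto simp: nat_mult_distrib nat_add_distrib)
      finally show ?thesis .
    qed
    have t: "norm (infsum (\<lambda>n. f (int n)) UNIV - f 0) < norm (q8 \<tau>) / 2"
      using infsum_small_tail(2)[of "\<lambda>n. f (int n)", OF n R] by simp
    have "(\<lambda>n. f (- int n - 1)) = (\<lambda>n. f (int n))"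
      by (rule ext) (simp add: f_def power2_eq_square algebra_simps)
    then have eq: "\<theta>2 \<tau> = 2 * infsum (\<lambda>n. f (int n)) UNIV"
      unfolding th infsum_int_symmetric[OF fs] by simp
    have "f 0 = q8 \<tau>" by (simp add: f_def q8_eexp)
    with t have "infsum (\<lambda>n. f (int n)) UNIV \<noteq> 0" by auto
    with eq show ?thesis by simp
  qed
qed

text \<open>The truth value of vanishing is invariant under T and S, so it can be tested at an orbit
  point with imaginary part at least 1/2. There theta4 is the value of theta3 at the translate by
  1.\<close>

theorem theta_prod_nonzero:
  assumes "\<tau> \<in> \<H>"
  shows "theta_prod \<tau> \<noteq> 0"
proof -
  obtain a b c d where *: "a * d - b * c = 1" "Im (mob a b c d \<tau>) \<ge> 1 / 2"
    using exists_mob_Im_ge_half[OF assms] by blast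
  have "(theta_prod (mob a b c d \<tau>) = 0) = (theta_prod \<tau> = 0)"
  proof (rule sl2_invariant_mob[OF _ _ *(1) assms])
    show "(theta_prod (\<tau> + 1) = 0) = (theta_prod \<tau> = 0)" for \<tau>
      by (simp add: theta_prod_T zeta8_eexp)
    show "(theta_prod (- 1 / \<tau>) = 0) = (theta_prod \<tau> = 0)" if "\<tau> \<in> \<H>" for \<tau>
      using that H_not_0[OF that] by (simp only: theta_prod_S) (simp del: csqrt.simps)
  qed
  moreover have "\<theta>4 (mob a b c d \<tau>) \<noteq> 0"
    using theta_constants_nonzero_high(1)[of "mob a b c d \<tau> + 1"] *(2) by (simp add: theta_T)
  ultimately show ?thesis
    using theta_constants_nonzero_high[OF *(2)] by (auto simp: theta_prod_def)
qed

section \<open>Expansions in powers of q to the 1/8, convergent on the whole half plane\<close>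

text \<open>
  Convergence on the whole upper half plane is part of the definition, so that the operators on
  \<open>q\<close>-expansions below need no analysis beyond manipulations of unconditional sums.
\<close>

definition has_q8_series :: "(complex \<Rightarrow> complex) \<Rightarrow> (int \<Rightarrow> complex) \<Rightarrow> bool"
    (infixl \<open>(has'_q8'_series)\<close> 50) where
  "g has_q8_series c \<longleftrightarrow> (\<exists>K. \<forall>m<K. c m = 0) \<and>
     (\<forall>\<tau>\<in>\<H>. ((\<lambda>m. c m * q8 \<tau> powi m) has_sum g \<tau>) UNIV)"

lemma q8_surj:
  assumes "x \<noteq> 0" "norm x < 1"
  obtains \<tau> where "\<tau> \<in> \<H>" "q8 \<tau> = x"
proof
  let ?t = "Ln x * 8 / (2 * pi * \<i>)"
  show "q8 ?t = x" using assms by (simp add: q8_def)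
  have "norm (q8 ?t) < 1" using assms \<open>q8 ?t = x\<close> by simp
  then show "?t \<in> \<H>" by (simp add: norm_q8 in_H_iff zero_less_mult_iff)
qed

lemma has_q8_expansion_unique:
  assumes "g has_q8_expansion F" "g has_q8_expansion G"
  shows "F = G"
proof -
  from assms obtain f h where f: "f has_laurent_expansion F" "\<And>\<tau>. \<tau> \<in> \<H> \<Longrightarrow> g \<tau> = f (q8 \<tau>)"
    and h: "h has_laurent_expansion G" "\<And>\<tau>. \<tau> \<in> \<H> \<Longrightarrow> g \<tau> = h (q8 \<tau>)"
    unfolding has_q8_expansion_def by blast
  have "f x = h x" if "x \<in> ball 0 1 - {0}" for x
    using that f(2) h(2) by (auto elim!: q8_surj[of x])
  moreover have "\<forall>\<^sub>F x in at 0. x \<in> ball 0 1 - {0 :: complex}"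
    by (rule eventually_at_in_open) auto
  ultimately have "\<forall>\<^sub>F x in at 0. f x = h x"
    by (auto elim: eventually_mono)
  with f(1) have "h has_laurent_expansion F"
    using has_laurent_expansion_cong by blast
  with h(1) show ?thesis by (blast intro: has_laurent_expansion_unique)
qed

text \<open>A Laurent expansion controls g only near the cusp. Since \<open>q8\<close> has local
  holomorphic inverses, the function f with g = f o q8 is holomorphic on the whole punctured unit
  disc. After removal of the pole its Taylor series converges on the full disc, absolutely, and so
  gives an unconditional sum.\<close>

lemma has_q8_expansion_imp_series:
  assumes hol: "g holomorphic_on \<H>" and exp: "g has_q8_expansion F"
  shows "g has_q8_series fls_nth F"
proof -
  from exp obtain f where f: "f has_laurent_expansion F" "\<And>\<tau>. \<tau> \<in> \<H> \<Longrightarrow> g \<tau> = f (q8 \<tau>)"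
    unfolding has_q8_expansion_def by blast
  have hol_f: "f holomorphic_on ball 0 1 - {0}"
  proof -
    have "f field_differentiable (at x)" if x: "x \<in> ball 0 1 - {0}" for x
    proof -
      obtain \<tau> where \<tau>: "\<tau> \<in> \<H>" "q8 \<tau> = x" using q8_surj[of x] x by auto
      \<comment> \<open>A local inverse of \<open>q8\<close> through \<tau>. The logarithm is taken
        of z / x, which is close to 1 and far from the cut.\<close>
      define t where "t = (\<lambda>z. \<tau> + 8 / (2 * pi * \<i>) * Ln (z / x))"
      have x0: "x \<noteq> 0" using x by simp
      have "((\<lambda>z. z / x) has_field_derivative 1 / x) (at x)"
        using x0 by (auto intro!: derivative_eq_intros)
      moreover have "(Ln has_field_derivative inverse (x / x)) (at (x / x))"
        using x0 by (intro has_field_derivative_Ln) simp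
      ultimately have "((\<lambda>z. Ln (z / x)) has_field_derivative inverse (x / x) * (1 / x)) (at x)"
        by (rule DERIV_chain2[rotated])
      then have "(t has_field_derivative 0 + 8 / (2 * pi * \<i>) * (inverse (x / x) * (1 / x))) (at x)"
        unfolding t_def by (intro DERIV_add DERIV_const DERIV_cmult)
      then have t_diff: "t field_differentiable (at x)"
        unfolding field_differentiable_def by blast
      have tx: "t x = \<tau>" using x by (simp add: t_def)
      have "g field_differentiable (at (t x))"
        unfolding tx by (rule holomorphic_on_imp_differentiable_at[OF hol open_H \<tau>(1)])
      then have gt: "(g \<circ> t) field_differentiable (at x)"
        by (rule field_differentiable_compose[OF t_diff])
      have ev: "\<forall>\<^sub>F z in nhds x. z \<in> ball 0 1 - {0}"
        using x by (intro eventually_nhds_in_open) auto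
      then have ev': "\<forall>\<^sub>F z in nhds x. (g \<circ> t) z = f z"
      proof eventually_elim
        case (elim z)
        have q: "q8 (t z) = z"
        proof -
          have "2 * pi * \<i> * t z / 8 = 2 * pi * \<i> * \<tau> / 8 + Ln (z / x)"
            by (simp add: t_def field_simps)
          then have "q8 (t z) = q8 \<tau> * exp (Ln (z / x))"
            unfolding q8_def exp_add [symmetric] by (rule arg_cong)
          then show ?thesis using elim x \<tau> by simp
        qed
        have "norm (q8 (t z)) < 1" using elim q by simp
        then have "t z \<in> \<H>" by (simp add: norm_q8 in_H_iff zero_less_mult_iff)
        then show ?case using f(2) q by simp
      qed
      from gt obtain D where "((g \<circ> t) has_field_derivative D) (at x)"
        unfolding field_differentiable_def by blast
      then have "(f has_field_derivative D) (at x)"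
        by (rule DERIV_cong_ev[OF refl ev' refl, THEN iffD1])
      then show ?thesis unfolding field_differentiable_def by blast
    qed
    then show ?thesis by (simp add: holomorphic_on_def field_differentiable_at_within)
  qed
  define N where "N = nat (- fls_subdegree F)"
  define F' where "F' = fls_shift (- int N) F"
  have F'_nth: "fls_nth F' m = fls_nth F (m - int N)" for m by (simp add: F'_def)
  have sub: "fls_nth F m = 0" if "m < - int N" for m
  proof (rule fls_eq0_below_subdegree)
    have "- fls_subdegree F \<le> int N" by (simp add: N_def)
    with that show "m < fls_subdegree F" by linarith
  qed
  have sub': "fls_subdegree F' \<ge> 0"
  proof (cases "F' = 0")
    case False
    then have "fls_nth F (fls_subdegree F' - int N) \<noteq> 0"
      using nth_fls_subdegree_nonzero F'_nth by metis
    then show ?thesis using sub[of "fls_subdegree F' - int N"] by linarith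
  qed simp
  \<comment> \<open>The value at 0 is set to the limit, so that the singularity there is removable
    by continuity.\<close>
  define h where "h = (\<lambda>x. if x = 0 then fls_nth F' 0 else f x * x ^ N)"
  have h_exp: "h has_laurent_expansion F'"
  proof -
    have "(\<lambda>x. f x * x powi int N) has_laurent_expansion F'"
      unfolding F'_def by (rule has_laurent_expansion_shift[OF f(1)])
    moreover have "\<forall>\<^sub>F x in at 0. f x * x powi int N = h x"
      by (auto simp: eventually_at_filter h_def)
    from has_laurent_expansion_cong[OF this refl, of F']
    have "((\<lambda>x. f x * x powi int N) has_laurent_expansion F') = (h has_laurent_expansion F')" .
    ultimately show ?thesis by (simp only:)
  qed
  have "h \<midarrow>0\<rightarrow> h 0"
    using has_laurent_expansion_imp_tendsto_0[OF h_exp sub'] by (simp add: h_def)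
  then have cont0: "isCont h 0" by (simp add: isCont_def)
  have hol_h': "h holomorphic_on ball 0 1 - {0}"
    by (rule holomorphic_transform[of "\<lambda>x. f x * x ^ N"]) (auto intro!: holomorphic_intros hol_f simp: h_def)
  have "continuous_on (ball 0 1) h"
  proof (rule continuous_at_imp_continuous_on, rule ballI)
    fix x :: complex assume x: "x \<in> ball 0 1"
    show "isCont h x"
    proof (cases "x = 0")
      case False
      have "open (ball 0 1 - {0 :: complex})" by auto
      then show ?thesis
        using holomorphic_on_imp_continuous_on[OF hol_h'] x False by (simp add: continuous_on_eq_continuous_at)
    qed (use cont0 in simp)
  qed
  then have hol_h: "h holomorphic_on ball 0 1"
    by (rule no_isolated_singularity[OF _ hol_h']) auto
  define A where "A = fps_expansion h 0"
  have "h has_fps_expansion A"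
    unfolding A_def by (rule has_fps_expansion_fps_expansion[OF _ _ hol_h]) auto
  then have "h has_laurent_expansion fps_to_fls A"
    by (rule has_laurent_expansion_fps)
  with h_exp have F'A: "F' = fps_to_fls A" by (rule has_laurent_expansion_unique)
  have sums_h: "(\<lambda>n. fps_nth A n * x ^ n) sums h x" if "norm x < 1" for x
    using holomorphic_power_series[OF hol_h, of x] that by (simp add: A_def fps_expansion_def)
  have "((\<lambda>m. fls_nth F m * q8 \<tau> powi m) has_sum g \<tau>) UNIV" if \<tau>: "\<tau> \<in> \<H>" for \<tau>
  proof -
    define x where "x = q8 \<tau>"
    have x: "x \<noteq> 0" "norm x < 1" using norm_q8_less_1[OF \<tau>] by (auto simp: x_def)
    \<comment> \<open>Convergence at a larger radius r gives absolute convergence at x, which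
      \<open>has_sum\<close> demands.\<close>
    obtain r where r: "norm x < r" "r < 1" using x(2) dense by blast
    then have r0: "norm (of_real r :: complex) = r" using norm_ge_zero[of x] by (simp del: norm_ge_zero)
    have "summable (\<lambda>n. fps_nth A n * of_real r ^ n)"
      using sums_h[of "of_real r"] r r0 by (auto simp: sums_iff)
    from powser_insidea[OF this, of x] have "summable (\<lambda>n. norm (fps_nth A n * x ^ n))" using r r0 by simp
    from norm_summable_imp_has_sum[OF this sums_h[OF x(2)]]
    have "((\<lambda>n. fps_nth A n * x ^ n) has_sum h x) UNIV" .
    then have "((\<lambda>n. fps_nth A n * x ^ n * inverse (x ^ N)) has_sum h x * inverse (x ^ N)) UNIV"
      by (rule has_sum_cmult_left)
    moreover have "h x * inverse (x ^ N) = g \<tau>" using x f(2)[OF \<tau>] by (simp add: h_def x_def)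
    moreover have "fps_nth A n * x ^ n * inverse (x ^ N) = fls_nth F (int n - int N) * x powi (int n - int N)" for n
    proof -
      have "fps_nth A n = fls_nth F (int n - int N)" using F'_nth[of "int n"] by (simp add: F'A)
      then show ?thesis using x by (simp add: power_int_diff field_simps)
    qed
    ultimately have "((\<lambda>n. fls_nth F (int n - int N) * x powi (int n - int N)) has_sum g \<tau>) UNIV" by simp
    moreover have "bij_betw (\<lambda>n. int n - int N) UNIV {- int N..}"
      by (rule bij_betwI[where g = "\<lambda>m. nat (m + int N)"]) auto
    ultimately have "((\<lambda>m. fls_nth F m * x powi m) has_sum g \<tau>) {- int N..}"
      using has_sum_reindex_bij_betw[of "\<lambda>n. int n - int N" UNIV "{- int N..}" "\<lambda>m. fls_nth F m * x powi m"] by simp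
    then show ?thesis unfolding x_def
      by (rule has_sum_cong_neutral[THEN iffD1, rotated -1]) (auto simp: sub)
  qed
  with sub show ?thesis unfolding has_q8_series_def by blast
qed

lemma has_q8_series_imp_expansion:
  assumes g: "g has_q8_series c"
  shows "\<exists>F. g has_q8_expansion F \<and> fls_nth F = c" "g holomorphic_on \<H>"
proof -
  from g obtain K where K: "\<And>m. m < K \<Longrightarrow> c m = 0"
    and s: "\<And>\<tau>. \<tau> \<in> \<H> \<Longrightarrow> ((\<lambda>m. c m * q8 \<tau> powi m) has_sum g \<tau>) UNIV"
    unfolding has_q8_series_def by blast
  define A where "A = Abs_fps (\<lambda>n. c (int n + K))"
  have sA: "(\<lambda>n. fps_nth A n * x ^ n) sums (g \<tau> * x powi (- K))" if "\<tau> \<in> \<H>" "x = q8 \<tau>" for x \<tau>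
  proof -
    have x: "x \<noteq> 0" using that by simp
    have "((\<lambda>m. c m * x powi m) has_sum g \<tau>) {K..}"
      using s[OF that(1)] unfolding that(2)
      by (rule has_sum_cong_neutral[THEN iffD1, rotated -1]) (auto simp: K)
    moreover have "bij_betw (\<lambda>n. int n + K) UNIV {K..}"
      by (rule bij_betwI[where g = "\<lambda>m. nat (m - K)"]) auto
    ultimately have "((\<lambda>n. c (int n + K) * x powi (int n + K)) has_sum g \<tau>) UNIV"
      using has_sum_reindex_bij_betw[of "\<lambda>n. int n + K" UNIV "{K..}" "\<lambda>m. c m * x powi m"] by simp
    then have "((\<lambda>n. c (int n + K) * x powi (int n + K) * x powi (- K)) has_sum g \<tau> * x powi (- K)) UNIV"
      by (rule has_sum_cmult_left)
    moreover have "c (int n + K) * x powi (int n + K) * x powi (- K) = fps_nth A n * x ^ n" for n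
    proof -
      have "x powi (int n + K) * x powi (- K) = x powi (int n)"
        using x by (simp add: power_int_add [symmetric])
      then show ?thesis by (simp add: A_def mult.assoc)
    qed
    ultimately show ?thesis by (simp add: has_sum_imp_sums)
  qed
  have radius: "fps_conv_radius A \<ge> 1"
    unfolding fps_conv_radius_def
  proof (rule conv_radius_geI_ex)
    fix r :: real assume r: "0 < r" "ereal r < 1"
    then obtain \<tau> where "\<tau> \<in> \<H>" "q8 \<tau> = of_real r" using q8_surj[of "of_real r"] by auto
    with sA[of \<tau> "of_real r"] r show "\<exists>z. norm z = r \<and> summable (\<lambda>n. fps_nth A n * z ^ n)"
      by (intro exI[of _ "of_real r"]) (auto simp: sums_iff)
  qed
  define F where "F = fls_shift (- K) (fps_to_fls A)"
  define f where "f = (\<lambda>x. eval_fps A x * x powi K)"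
  have "0 < fps_conv_radius A" by (rule less_le_trans[OF _ radius]) simp
  then have "eval_fps A has_fps_expansion A"
    by (simp add: has_fps_expansion_def)
  then have fF: "f has_laurent_expansion F"
    unfolding f_def F_def by (intro has_laurent_expansion_shift has_laurent_expansion_fps)
  have gf: "g \<tau> = f (q8 \<tau>)" if "\<tau> \<in> \<H>" for \<tau>
    using sA[OF that refl] by (simp add: f_def eval_fps_def sums_iff power_int_minus)
  have "fls_nth F m = c m" for m
    using K[of m] by (auto simp: F_def A_def)
  with fF gf show "\<exists>F. g has_q8_expansion F \<and> fls_nth F = c"
    unfolding has_q8_expansion_def by blast
  have "(\<lambda>\<tau>. eval_fps A (q8 \<tau>) * q8 \<tau> powi K) holomorphic_on \<H>"
  proof (intro holomorphic_intros q8_holomorphic)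
    have "eval_fps A holomorphic_on eball 0 1"
    proof (rule holomorphic_on_eval_fps, rule subsetI)
      fix x :: complex assume "x \<in> eball 0 1"
      then have "ereal (norm x) < 1" by (simp add: in_eball_iff)
      also note radius
      finally show "x \<in> eball 0 (fps_conv_radius A)" by (simp add: in_eball_iff)
    qed
    moreover have "q8 ` \<H> \<subseteq> eball 0 1"
      by (auto simp: in_eball_iff one_ereal_def norm_q8_less_1)
    ultimately show "(\<lambda>\<tau>. eval_fps A (q8 \<tau>)) holomorphic_on \<H>"
      using holomorphic_on_compose_gen[OF q8_holomorphic, of "eval_fps A" "eball 0 1" \<H>]
      unfolding o_def by blast
  qed auto
  then show "g holomorphic_on \<H>"
    by (rule holomorphic_transform) (simp add: gf f_def)
qed

lemma has_q8_series_the: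
  assumes "g has_q8_series c"
  shows "fls_nth (THE F. g has_q8_expansion F) = c"
proof -
  obtain F where F: "g has_q8_expansion F" "fls_nth F = c"
    using has_q8_series_imp_expansion(1)[OF assms] by blast
  then have "(THE F. g has_q8_expansion F) = F"
    using has_q8_expansion_unique by blast
  with F show ?thesis by simp
qed

lemma has_q8_series_unique: "g has_q8_series c \<Longrightarrow> g has_q8_series d \<Longrightarrow> c = d"
  using has_q8_series_the by metis

lemma meromorphic_at_cusp_iff: "meromorphic_at_cusp g \<longleftrightarrow> (\<exists>F. g has_q8_expansion F)"
  unfolding meromorphic_at_cusp_def has_q8_expansion_def meromorphic_on_def by auto

lemma has_q8_series_cong:
  assumes "\<And>\<tau>. \<tau> \<in> \<H> \<Longrightarrow> g \<tau> = h \<tau>" "\<And>m. c m = d m" "g has_q8_series c"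
  shows "h has_q8_series d"
  using assms by (simp add: has_q8_series_def)

lemma has_q8_series_0: "(\<lambda>_. 0) has_q8_series (\<lambda>_. 0)"
  by (simp add: has_q8_series_def)

lemma has_q8_series_add:
  assumes "g has_q8_series c" "h has_q8_series d"
  shows "(\<lambda>\<tau>. g \<tau> + h \<tau>) has_q8_series (\<lambda>m. c m + d m)"
proof -
  from assms obtain K L where "\<forall>m<K. c m = 0" "\<forall>m<L. d m = 0"
    by (auto simp: has_q8_series_def)
  then have "\<exists>K. \<forall>m<K. c m + d m = 0" by (intro exI[of _ "min K L"]) auto
  with assms show ?thesis by (auto simp: has_q8_series_def ring_distribs intro!: has_sum_add)
qed

lemma has_q8_series_cmult:
  assumes "g has_q8_series c"
  shows "(\<lambda>\<tau>. a * g \<tau>) has_q8_series (\<lambda>m. a * c m)"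
  using assms by (auto simp: has_q8_series_def mult.assoc intro!: has_sum_cmult_right)

lemma has_q8_series_sum:
  assumes "\<And>i. i \<in> I \<Longrightarrow> g i has_q8_series c i"
  shows "(\<lambda>\<tau>. \<Sum>i\<in>I. g i \<tau>) has_q8_series (\<lambda>m. \<Sum>i\<in>I. c i m)"
  using assms
  by (induction I rule: infinite_finite_induct) (simp_all add: has_q8_series_0 has_q8_series_add)

lemma eexp_real_shift_q8: "q8 (\<tau> + x) powi m = eexp (of_int m * x / 8) * q8 \<tau> powi m"
  by (simp add: q8_eexp eexp_powi eexp_add [symmetric] add_divide_distrib ring_distribs add.commute)

lemma has_q8_series_shift:
  assumes "g has_q8_series c"
  shows "(\<lambda>\<tau>. g (\<tau> + of_real x)) has_q8_series (\<lambda>m. eexp (of_int m * of_real x / 8) * c m)"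
  unfolding has_q8_series_def
proof (intro conjI ballI)
  from assms obtain K where "\<forall>m<K. c m = 0" by (auto simp: has_q8_series_def)
  then show "\<exists>K. \<forall>m<K. eexp (of_int m * of_real x / 8) * c m = 0" by (intro exI[of _ K]) simp
  fix \<tau> :: complex assume "\<tau> \<in> \<H>"
  with assms have "((\<lambda>m. c m * q8 (\<tau> + of_real x) powi m) has_sum g (\<tau> + of_real x)) UNIV"
    by (simp add: has_q8_series_def)
  then show "((\<lambda>m. eexp (of_int m * of_real x / 8) * c m * q8 \<tau> powi m) has_sum g (\<tau> + of_real x)) UNIV"
    by (simp add: eexp_real_shift_q8 mult_ac)
qed

lemma has_q8_series_dilate:
  assumes g: "g has_q8_series c" and P: "P > 0"
  shows "(\<lambda>\<tau>. g (of_int P * \<tau>)) has_q8_series (\<lambda>m. if P dvd m then c (m div P) else 0)"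
proof -
  from g obtain K where K: "\<And>m. m < K \<Longrightarrow> c m = 0" by (auto simp: has_q8_series_def)
  have "(if P dvd m then c (m div P) else 0) = 0" if "m < P * K" for m
    using that P K[of "m div P"] by (auto simp: dvd_def)
  moreover have "((\<lambda>m. (if P dvd m then c (m div P) else 0) * q8 \<tau> powi m) has_sum g (of_int P * \<tau>)) UNIV"
    if \<tau>: "\<tau> \<in> \<H>" for \<tau>
  proof -
    have "of_int P * \<tau> \<in> \<H>" using scale_in_H[of "of_int P" \<tau>] \<tau> P by simp
    then have "((\<lambda>m. c m * q8 (of_int P * \<tau>) powi m) has_sum g (of_int P * \<tau>)) UNIV"
      using g by (simp add: has_q8_series_def)
    also have "(\<lambda>m. c m * q8 (of_int P * \<tau>) powi m) = (\<lambda>m. c ((P * m) div P) * q8 \<tau> powi (P * m))"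
      using P by (simp add: q8_eexp eexp_powi mult_ac)
    finally have "((\<lambda>m. c (m div P) * q8 \<tau> powi m) has_sum g (of_int P * \<tau>)) (range ((*) P))"
      using P by (subst has_sum_reindex) (auto simp: inj_def o_def)
    then show ?thesis
      by (rule has_sum_cong_neutral[THEN iffD1, rotated -1]) (auto simp: dvd_def)
  qed
  ultimately show ?thesis unfolding has_q8_series_def by blast
qed

lemma sum_roots_of_unity:
  assumes P: "P > 0"
  shows "(\<Sum>b\<in>{0..<P}. eexp (of_int (m * b) / of_int P)) = (if P dvd m then of_int P else 0)"
proof (cases "P dvd m")
  case True
  then obtain k where k: "m = P * k" by (elim dvdE)
  have "eexp (of_int (m * b) / of_int P) = 1" for b
    using P eexp_of_int[of "k * b"] by (simp add: k)
  with True P show ?thesis by simp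
next
  case False
  let ?S = "\<Sum>b\<in>{0..<P}. eexp (of_int (m * b) / of_int P)"
  have "?S * eexp (of_int m / of_int P) = (\<Sum>b\<in>{0..<P}. eexp (of_int (m * (b + 1)) / of_int P))"
    by (simp add: sum_distrib_right eexp_add [symmetric] add_divide_distrib [symmetric] ring_distribs)
  also have "\<dots> = ?S"
  proof (rule sum_shift_periodic[OF P])
    fix n :: int
    have "[m * (n + P) = m * n] (mod P)" by (simp add: cong_iff_dvd_diff ring_distribs)
    then show "eexp (of_int (m * (n + P)) / of_int P) = eexp (of_int (m * n) / of_int P)"
      using P by (intro eexp_cong_int_div) auto
  qed
  finally have "?S = 0 \<or> eexp (of_int m / of_int P) = 1" by simp
  moreover have "eexp (of_int m / of_int P) \<noteq> 1"
  proof
    assume "eexp (of_int m / of_int P) = 1"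
    then obtain k where "of_int m / of_int P = (of_int k :: complex)"
      unfolding eexp_eq_1_iff by (elim Ints_cases)
    then have "of_int m = (of_int (k * P) :: complex)" using P by (simp add: field_simps)
    then have "m = k * P" by (simp only: of_int_eq_iff)
    with False show False by simp
  qed
  ultimately show ?thesis using False by simp
qed

text \<open>The U operator: averaging over the translates by 8 b / P keeps only the exponents
  divisible by P, by orthogonality of roots of unity.\<close>

lemma has_q8_series_contract:
  assumes g: "g has_q8_series c" and P: "P > 0"
  shows "(\<lambda>\<tau>. inverse (of_int P) * (\<Sum>b\<in>{0..<P}. g ((\<tau> + 8 * of_int b) / of_int P))) has_q8_series (\<lambda>m. c (P * m))"
proof -
  from g obtain K where K: "\<And>m. m < K \<Longrightarrow> c m = 0" by (auto simp: has_q8_series_def)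
  have "c (P * m) = 0" if "m < - \<bar>K\<bar>" for m
  proof -
    have "P * m \<le> 1 * m" using P that by (intro mult_right_mono_neg) auto
    then show ?thesis using that by (intro K) auto
  qed
  moreover have "((\<lambda>m. c (P * m) * q8 \<tau> powi m) has_sum
      (inverse (of_int P) * (\<Sum>b\<in>{0..<P}. g ((\<tau> + 8 * of_int b) / of_int P)))) UNIV" if \<tau>: "\<tau> \<in> \<H>" for \<tau>
  proof -
    have q: "q8 ((\<tau> + 8 * of_int b) / of_int P) powi m = eexp (of_int (m * b) / of_int P) * q8 (\<tau> / of_int P) powi m" for m b
      using P by (simp add: q8_eexp eexp_powi eexp_add [symmetric] field_simps)
    have "(\<tau> + 8 * of_int b) / of_int P \<in> \<H>" for b
    proof -
      have "(\<tau> + 8 * of_int b) / of_int P = of_real (1 / of_int P) * (\<tau> + of_int (8 * b))" by simp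
      then show ?thesis using scale_in_H[of "1 / of_int P" "\<tau> + of_int (8 * b)"] \<tau> P
        by (simp only: add_int_in_H) simp
    qed
    then have "((\<lambda>m. c m * q8 ((\<tau> + 8 * of_int b) / of_int P) powi m) has_sum g ((\<tau> + 8 * of_int b) / of_int P)) UNIV" for b
      using g by (simp add: has_q8_series_def)
    then have "((\<lambda>m. inverse (of_int P) * (\<Sum>b\<in>{0..<P}. c m * q8 ((\<tau> + 8 * of_int b) / of_int P) powi m)) has_sum
        (inverse (of_int P) * (\<Sum>b\<in>{0..<P}. g ((\<tau> + 8 * of_int b) / of_int P)))) UNIV"
      by (intro has_sum_cmult_right has_sum_sum)
    also have "(\<lambda>m. inverse (of_int P) * (\<Sum>b\<in>{0..<P}. c m * q8 ((\<tau> + 8 * of_int b) / of_int P) powi m)) =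
        (\<lambda>m. if P dvd m then c m * q8 (\<tau> / of_int P) powi m else 0)"
    proof
      fix m
      have "(\<Sum>b\<in>{0..<P}. c m * q8 ((\<tau> + 8 * of_int b) / of_int P) powi m) =
          c m * q8 (\<tau> / of_int P) powi m * (\<Sum>b\<in>{0..<P}. eexp (of_int (m * b) / of_int P))"
        unfolding q sum_distrib_left by (simp add: mult_ac)
      then show "inverse (of_int P) * (\<Sum>b\<in>{0..<P}. c m * q8 ((\<tau> + 8 * of_int b) / of_int P) powi m) =
        (if P dvd m then c m * q8 (\<tau> / of_int P) powi m else 0)"
        unfolding sum_roots_of_unity[OF P] using P by simp
    qed
    finally have "((\<lambda>m. if P dvd m then c m * q8 (\<tau> / of_int P) powi m else 0) has_sum
        (inverse (of_int P) * (\<Sum>b\<in>{0..<P}. g ((\<tau> + 8 * of_int b) / of_int P)))) UNIV" .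
    then have "((\<lambda>m. c m * q8 (\<tau> / of_int P) powi m) has_sum
        (inverse (of_int P) * (\<Sum>b\<in>{0..<P}. g ((\<tau> + 8 * of_int b) / of_int P)))) (range ((*) P))"
      by (rule has_sum_cong_neutral[THEN iffD1, rotated -1]) (auto simp: dvd_def)
    then have "((\<lambda>m. c (P * m) * q8 (\<tau> / of_int P) powi (P * m)) has_sum
        (inverse (of_int P) * (\<Sum>b\<in>{0..<P}. g ((\<tau> + 8 * of_int b) / of_int P)))) UNIV"
      using P by (subst (asm) has_sum_reindex) (auto simp: inj_def o_def)
    moreover have "q8 (\<tau> / of_int P) powi (P * m) = q8 \<tau> powi m" for m
      using P by (simp add: q8_eexp eexp_powi)
    ultimately show ?thesis by simp
  qed
  ultimately show ?thesis unfolding has_q8_series_def by blast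
qed

text \<open>Two expansions of the translated function, one by shifting and one from the
  transformation law, must have equal coefficients.\<close>

lemma has_q8_series_class:
  assumes g: "g has_q8_series c" and T: "\<And>\<tau>. \<tau> \<in> \<H> \<Longrightarrow> g (\<tau> + 1) = eexp (of_int r / 8) * g \<tau>"
    and m: "c m \<noteq> 0"
  shows "[m = r] (mod 8)"
proof -
  have "(\<lambda>\<tau>. eexp (of_int r / 8) * g \<tau>) has_q8_series (\<lambda>m. eexp (of_int m / 8) * c m)"
    by (rule has_q8_series_cong[OF _ _ has_q8_series_shift[OF g, of 1]]) (auto simp: T)
  from has_q8_series_unique[OF this has_q8_series_cmult[OF g]]
  have "eexp (of_int m / 8) * c m = eexp (of_int r / 8) * c m" by metis
  then have "eexp (of_int m / 8 - of_int r / 8) = 1" using m by (simp add: eexp_diff)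
  then obtain k where "of_int m / 8 - of_int r / 8 = (of_int k :: complex)"
    unfolding eexp_eq_1_iff by (elim Ints_cases)
  then have "of_int m - of_int r = (of_int (8 * k) :: complex)" by (simp add: field_simps)
  then have "m - r = 8 * k" by (metis of_int_diff of_int_eq_iff)
  then show ?thesis by (simp add: cong_iff_dvd_diff)
qed

text \<open>Comparison with the point i: for Im \<tau> >= 1 one has |q8 \<tau>| <= |q8 i|, so after
  extracting the power k the absolutely convergent sum at i bounds all the rest.\<close>

lemma has_q8_series_bound:
  assumes g: "g has_q8_series c" and k: "\<And>m. m < k \<Longrightarrow> c m = 0"
  shows "\<exists>C. \<forall>\<tau>. Im \<tau> \<ge> 1 \<longrightarrow> norm (g \<tau>) \<le> C * norm (q8 \<tau>) powi k"
proof -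
  define y where "y = norm (q8 \<i>)"
  have y: "0 < y" by (simp add: y_def)
  have "((\<lambda>m. c m * q8 \<i> powi m) has_sum g \<i>) UNIV"
    using g by (simp add: has_q8_series_def in_H_iff)
  then have "(\<lambda>m. norm (c m * q8 \<i> powi m)) summable_on UNIV"
    by (rule summable_on_iff_abs_summable_on_complex[THEN iffD1, OF has_sum_imp_summable])
  then have sm: "(\<lambda>m. norm (c m) * y powi m) summable_on UNIV"
    by (simp add: norm_mult norm_power_int y_def)
  define S where "S = infsum (\<lambda>m. norm (c m) * y powi m) UNIV"
  have S: "((\<lambda>m. norm (c m) * y powi m) has_sum S) UNIV" unfolding S_def by (rule has_sum_infsum[OF sm])
  show ?thesis
  proof (intro exI allI impI)
    fix \<tau> :: complex assume \<tau>: "Im \<tau> \<ge> 1"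
    define x where "x = norm (q8 \<tau>)"
    have x: "0 < x" "x \<le> y" using \<tau> by (auto simp: x_def y_def norm_q8)
    have s: "((\<lambda>m. c m * q8 \<tau> powi m) has_sum g \<tau>) UNIV"
      using g \<tau> by (simp add: has_q8_series_def in_H_iff)
    have "norm (g \<tau>) \<le> x powi k * y powi (- k) * S"
    proof (rule norm_infsum_le[OF s has_sum_cmult_right[OF S]])
      fix m
      show "norm (c m * q8 \<tau> powi m) \<le> x powi k * y powi (- k) * (norm (c m) * y powi m)"
      proof (cases "m < k")
        case False
        have "x powi m = x powi k * x powi (m - k)" using x by (simp add: power_int_add [symmetric])
        also have "x powi (m - k) \<le> y powi (m - k)"
          using False x by (intro power_int_mono) auto
        also have "x powi k * y powi (m - k) = x powi k * (y powi (- k) * y powi m)"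
          using y by (simp add: power_int_add [symmetric])
        finally have "x powi m \<le> x powi k * (y powi (- k) * y powi m)" using x by simp
        then have "norm (c m) * x powi m \<le> norm (c m) * (x powi k * (y powi (- k) * y powi m))"
          by (rule mult_left_mono) simp
        then show ?thesis by (simp add: norm_mult norm_power_int x_def mult_ac)
      qed (simp add: k)
    qed
    then show "norm (g \<tau>) \<le> y powi (- k) * S * norm (q8 \<tau>) powi k" by (simp add: x_def mult_ac)
  qed
qed

lemma has_q8_series_powi: "(\<lambda>\<tau>. q8 \<tau> powi k) has_q8_series (\<lambda>j. if j = k then 1 else 0)"
  unfolding has_q8_series_def
proof (intro conjI ballI)
  show "\<exists>K. \<forall>m<K. (if m = k then 1 else 0) = (0 :: complex)" by (rule exI[of _ k]) auto
  fix \<tau> :: complex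
  have "((\<lambda>m. (if m = k then 1 else 0) * q8 \<tau> powi m) has_sum (\<Sum>m\<in>{k}. (if m = k then 1 else 0) * q8 \<tau> powi m)) {k}"
    by (rule has_sum_finite) simp
  then have "((\<lambda>m. (if m = k then 1 else 0) * q8 \<tau> powi m) has_sum q8 \<tau> powi k) {k}" by simp
  then show "((\<lambda>m. (if m = k then 1 else 0) * q8 \<tau> powi m) has_sum q8 \<tau> powi k) UNIV"
    by (rule has_sum_cong_neutral[THEN iffD1, rotated -1]) auto
qed

text \<open>If k <= 0 were the first exponent with a nonzero coefficient, then g - c k q8^k would be
  O(q8^(k+1)). Together with g = O(q8) this bounds |c k| by a constant times |q8|, which tends to 0
  along the imaginary axis.\<close>

lemma has_q8_series_growth:
  assumes g: "g has_q8_series c"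
    and bd: "\<And>\<tau>. Im \<tau> \<ge> Y \<Longrightarrow> norm (g \<tau>) \<le> C * norm (q8 \<tau>)" and m: "m \<le> 0"
  shows "c m = 0"
proof (rule ccontr)
  assume "c m \<noteq> 0"
  from g obtain K where K: "\<And>m. m < K \<Longrightarrow> c m = 0" by (auto simp: has_q8_series_def)
  define n where "n = (LEAST n. c (K + int n) \<noteq> 0)"
  have ex: "c (K + int (nat (m - K))) \<noteq> 0"
    using \<open>c m \<noteq> 0\<close> K[of m] by (cases "m < K") auto
  define k where "k = K + int n"
  have ck: "c k \<noteq> 0" unfolding k_def n_def by (rule LeastI[of "\<lambda>n. c (K + int n) \<noteq> 0", OF ex])
  have below: "c j = 0" if "j < k" for j
  proof (cases "j < K")
    case False
    then have "nat (j - K) < n" using that by (auto simp: k_def)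
    then have "\<not> c (K + int (nat (j - K))) \<noteq> 0" unfolding n_def by (rule not_less_Least)
    then show ?thesis using False by simp
  qed (rule K)
  have k0: "k \<le> 0" using below[of m] \<open>c m \<noteq> 0\<close> m by force
  define h where "h = (\<lambda>\<tau>. g \<tau> + (- c k) * q8 \<tau> powi k)"
  have "h has_q8_series (\<lambda>j. c j + (- c k) * (if j = k then 1 else 0))"
    unfolding h_def by (intro has_q8_series_add g has_q8_series_cmult has_q8_series_powi)
  from has_q8_series_bound[OF this, of "k + 1"] below obtain D where
    D: "\<And>\<tau>. Im \<tau> \<ge> 1 \<Longrightarrow> norm (h \<tau>) \<le> D * norm (q8 \<tau>) powi (k + 1)" by force
  have main: "norm (c k) \<le> (\<bar>C\<bar> + D) * exp (- (pi * y / 4))" if y: "y \<ge> max Y 1" for y :: real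
  proof -
    define \<tau> where "\<tau> = Complex 0 y"
    define x where "x = norm (q8 \<tau>)"
    have x: "x = exp (- (pi * y / 4))" "0 < x" by (simp_all add: x_def \<tau>_def norm_q8)
    have "x \<le> 1" using y by (simp add: x(1))
    have "norm (c k) * x powi k = norm (g \<tau> - h \<tau>)" by (simp add: h_def norm_mult norm_power_int x_def)
    also have "\<dots> \<le> norm (g \<tau>) + norm (h \<tau>)" by (rule norm_triangle_ineq4)
    also have "\<dots> \<le> \<bar>C\<bar> * x + D * x powi (k + 1)"
    proof (rule add_mono)
      have "norm (g \<tau>) \<le> C * x" using bd[of \<tau>] y by (simp add: \<tau>_def x_def)
      also have "\<dots> \<le> \<bar>C\<bar> * x" using x by (intro mult_right_mono) auto
      finally show "norm (g \<tau>) \<le> \<bar>C\<bar> * x" .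
      show "norm (h \<tau>) \<le> D * x powi (k + 1)" using D[of \<tau>] y by (simp add: \<tau>_def x_def)
    qed
    also have "\<bar>C\<bar> * x \<le> \<bar>C\<bar> * x powi (k + 1)"
    proof (rule mult_left_mono)
      have "x powi 1 \<le> x powi (k + 1)" using x \<open>x \<le> 1\<close> k0 by (intro power_int_decreasing) auto
      then show "x \<le> x powi (k + 1)" by simp
    qed simp
    finally have "norm (c k) * x powi k \<le> ((\<bar>C\<bar> + D) * x) * x powi k"
      using x by (simp add: power_int_add algebra_simps)
    then show ?thesis using x by (simp add: mult_le_cancel_right_pos zero_less_power_int)
  qed
  have "((\<lambda>y::real. (\<bar>C\<bar> + D) * exp (- (pi * y / 4))) \<longlongrightarrow> (\<bar>C\<bar> + D) * 0) at_top"
    by (intro tendsto_mult_left) real_asymp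
  then have "norm (c k) \<le> (\<bar>C\<bar> + D) * 0"
    by (rule tendsto_lowerbound) (use main eventually_ge_at_top[of "max Y 1"] in \<open>auto elim: eventually_mono\<close>)
  with ck show False by simp
qed

section \<open>Eighth roots of unity and branches of the square root\<close>

lemma zeta8_squared: "\<zeta>8\<^sup>2 = \<i>"
  by (simp add: zeta8_eexp eexp_power eexp_quarter)

lemma zeta8_power4: "\<zeta>8 ^ 4 = - 1"
proof -
  have "\<zeta>8 ^ 4 = (\<zeta>8\<^sup>2)\<^sup>2" by (simp add: power_mult [symmetric])
  then show ?thesis by (simp add: zeta8_squared)
qed

lemma zeta8_power8: "\<zeta>8 ^ 8 = 1"
proof -
  have "\<zeta>8 ^ 8 = (\<zeta>8 ^ 4)\<^sup>2" by (simp add: power_mult [symmetric])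
  then show ?thesis by (simp add: zeta8_power4)
qed

lemma zeta8_nonzero [simp]: "\<zeta>8 \<noteq> 0"
  by (simp add: zeta8_eexp)

lemma zeta8_power_reduce: "\<zeta>8 ^ 5 = - \<zeta>8" "\<zeta>8 ^ 7 = inverse \<zeta>8"
proof -
  have "\<zeta>8 ^ 5 = \<zeta>8 ^ 4 * \<zeta>8" by (simp add: eval_nat_numeral)
  then show "\<zeta>8 ^ 5 = - \<zeta>8" by (simp add: zeta8_power4)
  have "\<zeta>8 ^ 7 * \<zeta>8 = \<zeta>8 ^ 8" by (simp add: eval_nat_numeral)
  then show "\<zeta>8 ^ 7 = inverse \<zeta>8" unfolding zeta8_power8 by (simp add: field_simps)
qed

lemma cnj_zeta8: "cnj \<zeta>8 = inverse \<zeta>8"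
  by (simp add: zeta8_eexp eexp_def exp_cnj exp_minus [symmetric])

lemma csqrt_in_quadrant:
  assumes "\<tau> \<in> \<H>"
  shows "Re (csqrt \<tau>) > 0" "Im (csqrt \<tau>) > 0"
proof -
  define w where "w = csqrt \<tau>"
  have w: "w\<^sup>2 = \<tau>" by (simp add: w_def)
  have "Im (w\<^sup>2) = 2 * Re w * Im w" by (simp add: power2_eq_square)
  then have *: "Re w * Im w > 0" using assms unfolding w by (auto simp: in_H_iff zero_less_mult_iff)
  moreover have "0 < Re w \<or> Re w = 0 \<and> 0 \<le> Im w" unfolding w_def by (rule csqrt_principal)
  ultimately show "Re (csqrt \<tau>) > 0" "Im (csqrt \<tau>) > 0"
    unfolding w_def [symmetric] by (auto simp: zero_less_mult_iff)
qed

lemma csqrt_nonzero: "\<tau> \<in> \<H> \<Longrightarrow> csqrt \<tau> \<noteq> 0"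
  using csqrt_in_quadrant(1)[of \<tau>] by auto

lemma zeta8_eq: "\<zeta>8 = (1 + \<i>) / of_real (sqrt 2)"
proof -
  have "\<zeta>8 = cis (pi / 4)" by (simp add: \<zeta>8_def cis_conv_exp mult_ac)
  also have "\<dots> = (1 + \<i>) / of_real (sqrt 2)"
    by (simp add: complex_eq_iff cos_45 sin_45 real_div_sqrt field_simps)
  finally show ?thesis .
qed

text \<open>The squares agree, and \<open>csqrt \<tau>\<close> lies in the open first quadrant;
  rotation by -pi/4 leaves its real part positive, so it is still the principal root.\<close>

lemma csqrt_minus_i:
  assumes "\<tau> \<in> \<H>"
  shows "csqrt (- \<i> * \<tau>) = inverse \<zeta>8 * csqrt \<tau>"
proof (rule csqrt_unique)
  have "(inverse \<zeta>8 * csqrt \<tau>)\<^sup>2 = inverse (\<zeta>8\<^sup>2) * \<tau>"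
    by (simp add: power_mult_distrib power_inverse)
  then show "(inverse \<zeta>8 * csqrt \<tau>)\<^sup>2 = - \<i> * \<tau>" by (simp add: zeta8_squared)
  have "inverse \<zeta>8 = (1 - \<i>) / of_real (sqrt 2)"
    unfolding cnj_zeta8 [symmetric] by (simp add: zeta8_eq)
  then have "Re (inverse \<zeta>8 * csqrt \<tau>) = (Re (csqrt \<tau>) + Im (csqrt \<tau>)) / sqrt 2"
    by (simp add: add_divide_distrib del: csqrt.sel)
  also have "\<dots> > 0" using csqrt_in_quadrant[OF assms] by (simp del: csqrt.sel)
  finally show "0 < Re (inverse \<zeta>8 * csqrt \<tau>) \<or> Re (inverse \<zeta>8 * csqrt \<tau>) = 0 \<and> 0 \<le> Im (inverse \<zeta>8 * csqrt \<tau>)" by blast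
qed

lemma csqrt_minus_inverse:
  assumes "\<tau> \<in> \<H>"
  shows "csqrt (- 1 / \<tau>) = \<i> / csqrt \<tau>"
proof (rule csqrt_unique)
  show "(\<i> / csqrt \<tau>)\<^sup>2 = - 1 / \<tau>" by (simp add: power_divide)
  have "Re (\<i> / w) = Im w / (norm w)\<^sup>2" for w
    by (simp add: Re_divide cmod_power2)
  then have "Re (\<i> / csqrt \<tau>) = Im (csqrt \<tau>) / (norm (csqrt \<tau>))\<^sup>2" .
  also have "\<dots> > 0"
    using csqrt_in_quadrant(2)[OF assms] csqrt_nonzero[OF assms] by (intro divide_pos_pos zero_less_power) simp_all
  finally show "0 < Re (\<i> / csqrt \<tau>) \<or> Re (\<i> / csqrt \<tau>) = 0 \<and> 0 \<le> Im (\<i> / csqrt \<tau>)" by blast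
qed

section \<open>The metaplectic group and the representation in monomial form\<close>

text \<open>
  In the basis \<open>(\<ee> 0 + \<ee> 2) / 2\<close>, \<open>(\<ee> 0 - \<ee> 2) / 2\<close>, \<open>\<ee> 1\<close> the two generators act by monomial matrices,
  in the same way as on the triple of theta constants \<open>\<theta>3\<close>, \<open>\<theta>4\<close>, \<open>\<theta>2\<close>.
\<close>

definition modular_triple :: "(complex \<Rightarrow> complex) \<Rightarrow> (complex \<Rightarrow> complex) \<Rightarrow> (complex \<Rightarrow> complex) \<Rightarrow> bool" where
  "modular_triple a b c \<longleftrightarrow> (\<forall>\<tau>\<in>\<H>.
     a (\<tau> + 1) = \<zeta>8 * b \<tau> \<and> b (\<tau> + 1) = \<zeta>8 * a \<tau> \<and> c (\<tau> + 1) = inverse \<zeta>8 * c \<tau> \<and>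
     a (- 1 / \<tau>) = - (csqrt (- \<i> * \<tau>) ^ 5) * a \<tau> \<and>
     b (- 1 / \<tau>) = - (csqrt (- \<i> * \<tau>) ^ 5) * c \<tau> \<and>
     c (- 1 / \<tau>) = - (csqrt (- \<i> * \<tau>) ^ 5) * b \<tau>)"

definition mat22 :: "int \<Rightarrow> int \<Rightarrow> int \<Rightarrow> int \<Rightarrow> int^2^2" where
  "mat22 a b c d = vector [vector [a, b], vector [c, d]]"

lemma mat22_nth [simp]:
  "mat22 a b c d $ 1 $ 1 = a" "mat22 a b c d $ 1 $ 2 = b"
  "mat22 a b c d $ 2 $ 1 = c" "mat22 a b c d $ 2 $ 2 = d"
  by (simp_all add: mat22_def)

lemma mat22_mult:
  "mat22 a b c d ** mat22 a' b' c' d' = mat22 (a * a' + b * c') (a * b' + b * d') (c * a' + d * c') (c * b' + d * d')"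
  by (simp add: vec_eq_iff forall_2 matrix_matrix_mult_def sum_2)

lemma mat22_eta: "\<gamma> = mat22 (\<gamma>$1$1) (\<gamma>$1$2) (\<gamma>$2$1) (\<gamma>$2$2)"
  by (simp add: vec_eq_iff forall_2)

lemma det_mat22: "det (mat22 a b c d) = a * d - b * c"
  by (simp add: det_2)

lemma moebius_act_mat22: "moebius_act (mat22 a b c d) = mob a b c d"
  by (simp add: moebius_act_def mob_def fun_eq_iff)

lemma Mp2Z_carrier_iff:
  "(mat22 a b c d, \<phi>) \<in> carrier Mp2Z \<longleftrightarrow> a * d - b * c = 1 \<and> \<phi> holomorphic_on \<H> \<and>
     (\<forall>\<tau>\<in>\<H>. \<phi> \<tau> ^ 2 = of_int c * \<tau> + of_int d) \<and> \<phi> = on_\<H> \<phi>"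
  by (simp add: Mp2Z_def det_mat22)

lemma Mp2Z_mult:
  "(mat22 a b c d, \<phi>) \<otimes>\<^bsub>Mp2Z\<^esub> (mat22 a' b' c' d', \<phi>') =
     (mat22 (a * a' + b * c') (a * b' + b * d') (c * a' + d * c') (c * b' + d * d'),
      on_\<H> (\<lambda>\<tau>. \<phi> (mob a' b' c' d' \<tau>) * \<phi>' \<tau>))"
  by (simp add: Mp2Z_def mat22_mult moebius_act_mat22)

lemma on_H_in [simp]: "\<tau> \<in> \<H> \<Longrightarrow> on_\<H> f \<tau> = f \<tau>"
  by (simp add: on_\<H>_def)

lemma on_H_idem [simp]: "on_\<H> (on_\<H> f) = on_\<H> f"
  by (simp add: on_\<H>_def fun_eq_iff)

lemma on_H_cong: "(\<And>\<tau>. \<tau> \<in> \<H> \<Longrightarrow> f \<tau> = g \<tau>) \<Longrightarrow> on_\<H> f = on_\<H> g"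
  by (simp add: on_\<H>_def fun_eq_iff)

lemma on_H_holomorphic: "f holomorphic_on \<H> \<Longrightarrow> on_\<H> f holomorphic_on \<H>"
  by (rule holomorphic_transform) auto

lemma csqrt_holomorphic_H: "csqrt holomorphic_on \<H>"
  by (intro holomorphic_intros) (auto simp: in_H_iff complex_nonpos_Reals_iff)

lemma Mp2_T_eq: "Mp2_T = (mat22 1 1 0 1, on_\<H> (\<lambda>_. 1))"
  by (simp add: Mp2_T_def mat22_def)

lemma Mp2_S_eq: "Mp2_S = (mat22 0 (-1) 1 0, on_\<H> csqrt)"
  by (simp add: Mp2_S_def mat22_def)

lemma Mp2_T_carrier: "Mp2_T \<in> carrier Mp2Z" and Mp2_S_carrier: "Mp2_S \<in> carrier Mp2Z"
  unfolding Mp2_T_eq Mp2_S_eq Mp2Z_carrier_iff by (auto intro!: on_H_holomorphic csqrt_holomorphic_H)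

lemma rho_T_mult: "rho_T *v x = vector [\<zeta>8 * x$1, inverse \<zeta>8 * x$2, - \<zeta>8 * x$3]"
  by (simp add: rho_T_def vec_eq_iff forall_3 matrix_vector_mult_def sum_3 zeta8_power_reduce)

lemma rho_S_mult: "rho_S *v x = (inverse \<zeta>8 / 2) *s vector [x$1 + 2 * x$2 + x$3, x$1 - x$3, x$1 - 2 * x$2 + x$3]"
  by (simp add: rho_S_def vec_eq_iff forall_3 matrix_vector_mult_def matrix_matrix_mult_def mat_def
      sum_3 cnj_zeta8 algebra_simps)

text \<open>In the metaplectic group S^4 is the identity matrix with the root -1. Its action by -1
  is what cancels the sign (-1)^5 of the automorphy factor.\<close>

lemma rho_S_power4: "rho_S *v (rho_S *v (rho_S *v (rho_S *v x))) = - x"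
proof -
  have "rho_S *v (rho_S *v x) = inverse (\<zeta>8\<^sup>2) *s x" for x
    unfolding rho_S_mult by (simp add: vec_eq_iff forall_3 power2_eq_square field_simps)
  then have "rho_S *v (rho_S *v x) = (- \<i>) *s x" for x by (simp add: zeta8_squared)
  then show ?thesis by (simp add: vec_eq_iff)
qed

lemma matrix_vector_mult_scale: "A *v (k *s x) = k *s (A *v (x :: complex^3))"
  by (simp add: vec_eq_iff matrix_vector_mult_def sum_distrib_left mult_ac)

lemma holomorphic_square_eq_1:
  assumes hol: "\<phi> holomorphic_on \<H>" and sq: "\<And>\<tau>. \<tau> \<in> \<H> \<Longrightarrow> \<phi> \<tau> ^ 2 = 1"
  shows "(\<forall>\<tau>\<in>\<H>. \<phi> \<tau> = 1) \<or> (\<forall>\<tau>\<in>\<H>. \<phi> \<tau> = - 1)"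
proof -
  have vals: "\<phi> \<tau> = 1 \<or> \<phi> \<tau> = - 1" if "\<tau> \<in> \<H>" for \<tau>
    using sq[OF that] by (simp add: power2_eq_1_iff)
  have "\<phi> constant_on \<H>"
  proof (rule continuous_finite_range_constant)
    show "connected \<H>" by (rule connected_H)
    show "continuous_on \<H> \<phi>" by (rule holomorphic_on_imp_continuous_on[OF hol])
    show "finite (\<phi> ` \<H>)" by (rule finite_subset[of _ "{1, - 1}"]) (use vals in auto)
  qed
  then obtain k where k: "\<And>\<tau>. \<tau> \<in> \<H> \<Longrightarrow> \<phi> \<tau> = k" by (auto simp: constant_on_def)
  have "\<i> \<in> \<H>" by (simp add: in_H_iff)
  with vals[of \<i>] k show ?thesis by auto
qed

lemma half_sum_half_diff:
  fixes x y :: complex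
  assumes "(x + y) / 2 = p" "(x - y) / 2 = q"
  shows "x = p + q" "y = p - q"
  unfolding assms [symmetric] by (simp_all add: field_simps)

text \<open>Linear algebra only: the x are the components at \<tau> + 1, the y those at -1/\<tau>,
  the g those at \<tau>, and s stands for \<open>csqrt \<tau> ^ 5\<close>. The left side is the
  monomial form of the two transformation rules.\<close>

lemma half_sum_transformation:
  fixes x1 x2 x3 y1 y2 y3 g1 g2 g3 s :: complex
  shows "((x1 + x3) / 2 = \<zeta>8 * ((g1 - g3) / 2) \<and> (x1 - x3) / 2 = \<zeta>8 * ((g1 + g3) / 2) \<and>
      x2 = inverse \<zeta>8 * g2 \<and>
      (y1 + y3) / 2 = (inverse \<zeta>8 * s) * ((g1 + g3) / 2) \<and>
      (y1 - y3) / 2 = (inverse \<zeta>8 * s) * g2 \<and>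
      y2 = (inverse \<zeta>8 * s) * ((g1 - g3) / 2)) \<longleftrightarrow>
    (x1 = \<zeta>8 * g1 \<and> x2 = inverse \<zeta>8 * g2 \<and> x3 = - \<zeta>8 * g3) \<and>
    (y1 = s * (inverse \<zeta>8 / 2 * (g1 + 2 * g2 + g3)) \<and> y2 = s * (inverse \<zeta>8 / 2 * (g1 - g3)) \<and>
     y3 = s * (inverse \<zeta>8 / 2 * (g1 - 2 * g2 + g3)))" (is "?L \<longleftrightarrow> ?R")
proof
  assume *: ?L
  note x = half_sum_half_diff[OF *[THEN conjunct1] *[THEN conjunct2, THEN conjunct1]]
  note x2 = *[THEN conjunct2, THEN conjunct2, THEN conjunct1]
  note ** = *[THEN conjunct2, THEN conjunct2, THEN conjunct2]
  note y = half_sum_half_diff[OF **[THEN conjunct1] **[THEN conjunct2, THEN conjunct1]]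
  note y2 = **[THEN conjunct2, THEN conjunct2]
  show ?R
    unfolding x x2 y y2 by (simp add: field_simps)
next
  assume ?R
  then show ?L by (elim conjE) (simp only:, simp add: field_simps)
qed

lemma eq_rho_T_mult:
  "x = rho_T *v g \<longleftrightarrow> x$1 = \<zeta>8 * g$1 \<and> x$2 = inverse \<zeta>8 * g$2 \<and> x$3 = - \<zeta>8 * g$3"
  by (simp add: rho_T_mult vec_eq_iff forall_3)

lemma eq_rho_S_mult:
  "y = s *s (rho_S *v g) \<longleftrightarrow> y$1 = s * (inverse \<zeta>8 / 2 * (g$1 + 2 * g$2 + g$3)) \<and>
    y$2 = s * (inverse \<zeta>8 / 2 * (g$1 - g$3)) \<and> y$3 = s * (inverse \<zeta>8 / 2 * (g$1 - 2 * g$2 + g$3))"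
  unfolding rho_S_mult vec_eq_iff forall_3 by (simp add: mult.assoc)

locale weil_representation =
  fixes \<rho> :: "(int^2^2) \<times> (complex \<Rightarrow> complex) \<Rightarrow> complex^3^3"
  assumes hom: "\<rho> \<in> hom Mp2Z GL3C" and rho_T: "\<rho> Mp2_T = rho_T" and rho_S: "\<rho> Mp2_S = rho_S"
begin

lemma rho_mult: "x \<in> carrier Mp2Z \<Longrightarrow> y \<in> carrier Mp2Z \<Longrightarrow> \<rho> (x \<otimes>\<^bsub>Mp2Z\<^esub> y) = \<rho> x ** \<rho> y"
  using hom_mult[OF hom] by (simp add: GL3C_def)

text \<open>The image of the neutral pair is idempotent and invertible, hence the identity matrix.
  The argument does not go through a proof that \<open>Mp2Z\<close> is a group.\<close>

lemma rho_one: "\<rho> (mat22 1 0 0 1, on_\<H> (\<lambda>_. 1)) = mat 1"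
proof -
  let ?e = "(mat22 1 0 0 1, on_\<H> (\<lambda>_. 1))"
  have c: "?e \<in> carrier Mp2Z" unfolding Mp2Z_carrier_iff by (auto intro!: on_H_holomorphic)
  have "?e \<otimes>\<^bsub>Mp2Z\<^esub> ?e = ?e"
    unfolding Mp2Z_mult by (auto intro!: on_H_cong simp: mob_def)
  with rho_mult[OF c c] have idem: "\<rho> ?e ** \<rho> ?e = \<rho> ?e" by simp
  have "\<rho> ?e \<in> carrier GL3C" using hom c by (auto simp: hom_def)
  then obtain B where "\<rho> ?e ** B = mat 1" by (auto simp: GL3C_def invertible_def)
  with idem show ?thesis by (metis matrix_mul_assoc matrix_mul_rid)
qed

text \<open>Induction along words in T and S with the root \<phi> quantified inside: every step
  splits a generator off on the right and exhibits the root belonging to the shorter word. The base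
  case has to treat both roots over the identity matrix.\<close>

lemma transformation_from_generators:
  assumes T: "\<And>\<tau>. \<tau> \<in> \<H> \<Longrightarrow> G (\<tau> + 1) = rho_T *v G \<tau>"
    and S: "\<And>\<tau>. \<tau> \<in> \<H> \<Longrightarrow> G (- 1 / \<tau>) = (csqrt \<tau> ^ 5) *s (rho_S *v G \<tau>)"
    and det: "a * d - b * c = 1"
    and \<phi>: "(mat22 a b c d, \<phi>) \<in> carrier Mp2Z" and \<tau>: "\<tau> \<in> \<H>"
  shows "G (mob a b c d \<tau>) = (\<phi> \<tau> ^ 5) *s (\<rho> (mat22 a b c d, \<phi>) *v G \<tau>)"
proof -
  from det have "\<forall>\<phi>. (mat22 a b c d, \<phi>) \<in> carrier Mp2Z \<longrightarrow>
      (\<forall>\<tau>\<in>\<H>. G (mob a b c d \<tau>) = (\<phi> \<tau> ^ 5) *s (\<rho> (mat22 a b c d, \<phi>) *v G \<tau>))"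
  proof (induction rule: sl2_induct)
    case one
    show ?case
    proof (intro allI impI ballI)
      fix \<phi> :: "complex \<Rightarrow> complex" and \<tau> assume \<phi>: "(mat22 1 0 0 1, \<phi>) \<in> carrier Mp2Z" and \<tau>: "\<tau> \<in> \<H>"
      then have "\<phi> holomorphic_on \<H>" and sq: "\<And>\<tau>. \<tau> \<in> \<H> \<Longrightarrow> \<phi> \<tau> ^ 2 = 1" and on: "\<phi> = on_\<H> \<phi>"
        unfolding Mp2Z_carrier_iff by auto
      from holomorphic_square_eq_1[OF this(1,2)]
      show "G (mob 1 0 0 1 \<tau>) = (\<phi> \<tau> ^ 5) *s (\<rho> (mat22 1 0 0 1, \<phi>) *v G \<tau>)"
      proof
        assume 1: "\<forall>\<tau>\<in>\<H>. \<phi> \<tau> = 1"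
        have "\<phi> = on_\<H> (\<lambda>_. 1)" by (subst on, rule on_H_cong) (use 1 in simp)
        then show ?thesis using 1 \<tau> by (simp add: rho_one mob_def)
      next
        assume 1: "\<forall>\<tau>\<in>\<H>. \<phi> \<tau> = - 1"
        have \<phi>_eq: "\<phi> = on_\<H> (\<lambda>_. - 1)" by (subst on, rule on_H_cong) (use 1 in simp)
        \<comment> \<open>The root attached to S^2 is the constant i because
          \<open>csqrt (- 1 / \<tau>) = \<i> / csqrt \<tau>\<close>. Squaring once more gives the
          root -1 over the identity, so this element is S^4.\<close>
        have SS: "Mp2_S \<otimes>\<^bsub>Mp2Z\<^esub> Mp2_S = (mat22 (-1) 0 0 (-1), on_\<H> (\<lambda>_. \<i>))"
          unfolding Mp2_S_eq Mp2Z_mult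
        proof (simp, rule on_H_cong)
          fix \<tau> assume \<tau>: "\<tau> \<in> \<H>"
          have "mob 0 (- 1) 1 0 \<tau> = - 1 / \<tau>" by (simp add: mob_def)
          then show "on_\<H> csqrt (mob 0 (- 1) 1 0 \<tau>) * on_\<H> csqrt \<tau> = \<i>"
            using \<tau> minus_inverse_in_H[OF \<tau>] csqrt_minus_inverse[OF \<tau>] csqrt_nonzero[OF \<tau>] by simp
        qed
        have SSc: "Mp2_S \<otimes>\<^bsub>Mp2Z\<^esub> Mp2_S \<in> carrier Mp2Z"
          unfolding SS Mp2Z_carrier_iff by (auto intro!: on_H_holomorphic)
        have "(mat22 1 0 0 1, \<phi>) = (Mp2_S \<otimes>\<^bsub>Mp2Z\<^esub> Mp2_S) \<otimes>\<^bsub>Mp2Z\<^esub> (Mp2_S \<otimes>\<^bsub>Mp2Z\<^esub> Mp2_S)"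
          unfolding SS Mp2Z_mult \<phi>_eq by (auto intro!: on_H_cong simp: mob_def)
        then have "\<rho> (mat22 1 0 0 1, \<phi>) = (rho_S ** rho_S) ** (rho_S ** rho_S)"
          by (simp add: rho_mult SSc Mp2_S_carrier rho_S)
        then have "\<rho> (mat22 1 0 0 1, \<phi>) *v G \<tau> = - G \<tau>"
          using rho_S_power4[of "G \<tau>"] by (simp add: matrix_vector_mul_assoc matrix_mul_assoc)
        then show ?thesis using 1 \<tau> by (simp add: mob_def vec_eq_iff)
      qed
    qed
  next
    case (T a b c d)
    show ?case
    proof (intro allI impI ballI)
      fix \<phi> :: "complex \<Rightarrow> complex" and \<tau>
      assume \<phi>: "(mat22 a (b + a) c (d + c), \<phi>) \<in> carrier Mp2Z" and \<tau>: "\<tau> \<in> \<H>"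
      define \<phi>' where "\<phi>' = on_\<H> (\<lambda>\<tau>. \<phi> (\<tau> - 1))"
      from \<phi> have hol: "\<phi> holomorphic_on \<H>" and sq: "\<And>\<tau>. \<tau> \<in> \<H> \<Longrightarrow> \<phi> \<tau> ^ 2 = of_int c * \<tau> + of_int (d + c)"
        and on: "\<phi> = on_\<H> \<phi>" unfolding Mp2Z_carrier_iff by auto
      have "(\<lambda>\<tau>. \<phi> (\<tau> - 1)) holomorphic_on \<H>"
        by (rule holomorphic_on_compose_gen[OF _ hol, unfolded o_def]) (auto intro!: holomorphic_intros)
      then have c': "(mat22 a b c d, \<phi>') \<in> carrier Mp2Z"
        using T(1) sq[of "_ - 1"] unfolding Mp2Z_carrier_iff \<phi>'_def
        by (auto intro!: on_H_holomorphic simp: algebra_simps)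
      have "(mat22 a (b + a) c (d + c), \<phi>) = (mat22 a b c d, \<phi>') \<otimes>\<^bsub>Mp2Z\<^esub> Mp2_T"
        unfolding Mp2_T_eq Mp2Z_mult by (subst on) (auto intro!: on_H_cong simp: \<phi>'_def mob_def add.commute)
      then have "\<rho> (mat22 a (b + a) c (d + c), \<phi>) = \<rho> (mat22 a b c d, \<phi>') ** rho_T"
        by (simp add: rho_mult c' Mp2_T_carrier rho_T)
      moreover have "G (mob a b c d (\<tau> + 1)) = (\<phi>' (\<tau> + 1) ^ 5) *s (\<rho> (mat22 a b c d, \<phi>') *v G (\<tau> + 1))"
        using T(2) c' \<tau> by simp
      moreover have "\<phi>' (\<tau> + 1) = \<phi> \<tau>" using \<tau> by (simp add: \<phi>'_def)
      ultimately show "G (mob a (b + a) c (d + c) \<tau>) = (\<phi> \<tau> ^ 5) *s (\<rho> (mat22 a (b + a) c (d + c), \<phi>) *v G \<tau>)"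
        using \<tau> by (simp add: mob_T assms(1) matrix_vector_mul_assoc)
    qed
  next
    case (T' a b c d)
    show ?case
    proof (intro allI impI ballI)
      fix \<phi> :: "complex \<Rightarrow> complex" and \<tau>
      assume \<phi>: "(mat22 a (b - a) c (d - c), \<phi>) \<in> carrier Mp2Z" and \<tau>: "\<tau> \<in> \<H>"
      define \<phi>' where "\<phi>' = on_\<H> (\<lambda>\<tau>. \<phi> (\<tau> + 1))"
      from \<phi> have hol: "\<phi> holomorphic_on \<H>" and sq: "\<And>\<tau>. \<tau> \<in> \<H> \<Longrightarrow> \<phi> \<tau> ^ 2 = of_int c * \<tau> + of_int (d - c)"
        and on: "\<phi> = on_\<H> \<phi>" unfolding Mp2Z_carrier_iff by auto
      have "(\<lambda>\<tau>. \<phi> (\<tau> + 1)) holomorphic_on \<H>"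
        by (rule holomorphic_on_compose_gen[OF _ hol, unfolded o_def]) (auto intro!: holomorphic_intros)
      then have c': "(mat22 a b c d, \<phi>') \<in> carrier Mp2Z"
        using T'(1) sq[of "_ + 1"] unfolding Mp2Z_carrier_iff \<phi>'_def
        by (auto intro!: on_H_holomorphic simp: algebra_simps)
      \<comment> \<open>The factorization is read backwards: the element already treated is the new
        one times T. With G \<tau> expressed through G (\<tau> - 1), no inverse of
        \<open>rho_T\<close> is required.\<close>
      have "(mat22 a b c d, \<phi>') = (mat22 a (b - a) c (d - c), \<phi>) \<otimes>\<^bsub>Mp2Z\<^esub> Mp2_T"
        unfolding Mp2_T_eq Mp2Z_mult by (auto intro!: on_H_cong simp: \<phi>'_def mob_def)
      then have "\<rho> (mat22 a b c d, \<phi>') = \<rho> (mat22 a (b - a) c (d - c), \<phi>) ** rho_T"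
        by (simp add: rho_mult \<phi> Mp2_T_carrier rho_T)
      moreover have "G (mob a b c d (\<tau> - 1)) = (\<phi>' (\<tau> - 1) ^ 5) *s (\<rho> (mat22 a b c d, \<phi>') *v G (\<tau> - 1))"
        using T'(2) c' \<tau> by simp
      moreover have "\<phi>' (\<tau> - 1) = \<phi> \<tau>" using \<tau> by (simp add: \<phi>'_def)
      moreover have "G \<tau> = rho_T *v G (\<tau> - 1)" using assms(1)[of "\<tau> - 1"] \<tau> by simp
      ultimately show "G (mob a (b - a) c (d - c) \<tau>) = (\<phi> \<tau> ^ 5) *s (\<rho> (mat22 a (b - a) c (d - c), \<phi>) *v G \<tau>)"
        by (simp add: mob_T' matrix_vector_mul_assoc)
    qed
  next
    case (S a b c d)
    show ?case
    proof (intro allI impI ballI)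
      fix \<phi> :: "complex \<Rightarrow> complex" and \<tau>
      assume \<phi>: "(mat22 b (- a) d (- c), \<phi>) \<in> carrier Mp2Z" and \<tau>: "\<tau> \<in> \<H>"
      \<comment> \<open>Solves \<phi> \<tau> = \<phi>' (-1/\<tau>) * csqrt \<tau>, the cocycle rule
        for multiplication by S on the right; \<phi>' is evaluated after the substitution \<tau> to
        -1/\<tau>, which is its own inverse.\<close>
      define \<phi>' where "\<phi>' = on_\<H> (\<lambda>\<tau>. \<phi> (- 1 / \<tau>) / csqrt (- 1 / \<tau>))"
      from \<phi> have hol: "\<phi> holomorphic_on \<H>" and sq: "\<And>\<tau>. \<tau> \<in> \<H> \<Longrightarrow> \<phi> \<tau> ^ 2 = of_int d * \<tau> + of_int (- c)"
        and on: "\<phi> = on_\<H> \<phi>" unfolding Mp2Z_carrier_iff by auto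
      have inv_hol: "(\<lambda>\<tau>. - 1 / \<tau>) holomorphic_on \<H>"
        using H_not_0 by (auto intro!: holomorphic_intros)
      have inv_sub: "(\<lambda>\<tau>. - 1 / \<tau>) ` \<H> \<subseteq> \<H>" using minus_inverse_in_H by blast
      have "(\<lambda>\<tau>. \<phi> (- 1 / \<tau>)) holomorphic_on \<H>" "(\<lambda>\<tau>. csqrt (- 1 / \<tau>)) holomorphic_on \<H>"
        using holomorphic_on_compose_gen[OF inv_hol hol inv_sub]
          holomorphic_on_compose_gen[OF inv_hol csqrt_holomorphic_H inv_sub] unfolding o_def by blast+
      then have hol': "(\<lambda>\<tau>. \<phi> (- 1 / \<tau>) / csqrt (- 1 / \<tau>)) holomorphic_on \<H>"
        using csqrt_nonzero[OF minus_inverse_in_H] by (rule holomorphic_on_divide)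
      have sq': "(\<phi> (- 1 / \<tau>) / csqrt (- 1 / \<tau>))\<^sup>2 = of_int c * \<tau> + of_int d" if "\<tau> \<in> \<H>" for \<tau>
      proof -
        have "(\<phi> (- 1 / \<tau>) / csqrt (- 1 / \<tau>))\<^sup>2 = (of_int d * (- 1 / \<tau>) + of_int (- c)) / (- 1 / \<tau>)"
          unfolding power_divide power2_csqrt using sq[OF minus_inverse_in_H[OF that]] by (rule arg_cong)
        also have "\<dots> = of_int c * \<tau> + of_int d" using H_not_0[OF that] by (simp add: field_simps)
        finally show ?thesis .
      qed
      have c': "(mat22 a b c d, \<phi>') \<in> carrier Mp2Z"
        unfolding Mp2Z_carrier_iff \<phi>'_def
      proof (intro conjI ballI on_H_holomorphic hol')
        show "(on_\<H> (\<lambda>\<tau>. \<phi> (- 1 / \<tau>) / csqrt (- 1 / \<tau>)) \<tau>)\<^sup>2 = of_int c * \<tau> + of_int d" if "\<tau> \<in> \<H>" for \<tau>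
          using sq'[OF that] that by (simp only: on_H_in)
      qed (use S(1) in simp_all)
      have inv_inv: "- 1 / (- 1 / \<tau>) = \<tau>" for \<tau> :: complex by simp
      have \<phi>'_eq: "\<phi>' (- 1 / \<tau>) * csqrt \<tau> = \<phi> \<tau>" if "\<tau> \<in> \<H>" for \<tau>
        unfolding \<phi>'_def on_H_in[OF minus_inverse_in_H[OF that]] inv_inv using csqrt_nonzero[OF that] by simp
      have "(mat22 b (- a) d (- c), \<phi>) = (mat22 a b c d, \<phi>') \<otimes>\<^bsub>Mp2Z\<^esub> Mp2_S"
        unfolding Mp2_S_eq Mp2Z_mult
      proof (subst on, simp, rule on_H_cong)
        fix \<tau> assume \<tau>: "\<tau> \<in> \<H>"
        have "mob 0 (- 1) 1 0 \<tau> = - 1 / \<tau>" by (simp add: mob_def)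
        then show "\<phi> \<tau> = \<phi>' (mob 0 (- 1) 1 0 \<tau>) * on_\<H> csqrt \<tau>"
          using \<phi>'_eq[OF \<tau>] \<tau> by (simp only: on_H_in)
      qed
      then have rho: "\<rho> (mat22 b (- a) d (- c), \<phi>) = \<rho> (mat22 a b c d, \<phi>') ** rho_S"
        by (simp add: rho_mult c' Mp2_S_carrier rho_S)
      have "G (mob b (- a) d (- c) \<tau>) = G (mob a b c d (- 1 / \<tau>))" by (simp only: mob_S[OF \<tau>])
      also have "\<dots> = (\<phi>' (- 1 / \<tau>) ^ 5) *s (\<rho> (mat22 a b c d, \<phi>') *v G (- 1 / \<tau>))"
        using S(2) c' minus_inverse_in_H[OF \<tau>] by blast
      also have "\<dots> = (\<phi>' (- 1 / \<tau>) ^ 5) *s (\<rho> (mat22 a b c d, \<phi>') *v ((csqrt \<tau> ^ 5) *s (rho_S *v G \<tau>)))"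
        by (simp only: assms(2)[OF \<tau>])
      also have "\<dots> = ((\<phi>' (- 1 / \<tau>) * csqrt \<tau>) ^ 5) *s (\<rho> (mat22 b (- a) d (- c), \<phi>) *v G \<tau>)"
        by (simp only: rho matrix_vector_mult_scale vector_smult_assoc matrix_vector_mul_assoc power_mult_distrib)
      finally show "G (mob b (- a) d (- c) \<tau>) = (\<phi> \<tau> ^ 5) *s (\<rho> (mat22 b (- a) d (- c), \<phi>) *v G \<tau>)"
        by (simp only: \<phi>'_eq[OF \<tau>])
    qed
  qed
  with \<phi> \<tau> show ?thesis by blast
qed

text \<open>Since \<zeta>8^5 = -\<zeta>8, passing from \<open>csqrt \<tau>\<close> to
  \<open>csqrt (- \<i> * \<tau>)\<close> puts the minus sign into
  \<open>modular_triple\<close>.\<close>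

lemma csqrt_power5: "\<tau> \<in> \<H> \<Longrightarrow> - (csqrt (- \<i> * \<tau>) ^ 5) = inverse \<zeta>8 * csqrt \<tau> ^ 5"
proof -
  assume "\<tau> \<in> \<H>"
  then have "- (csqrt (- \<i> * \<tau>) ^ 5) = - inverse (\<zeta>8 ^ 5) * csqrt \<tau> ^ 5"
    by (subst csqrt_minus_i) (simp_all add: power_mult_distrib power_inverse)
  then show ?thesis by (simp add: zeta8_power_reduce)
qed

text \<open>The law for all metaplectic elements follows from the law for the two generators, and
  that is the monomial law for the combinations. In this shape theta products and Hecke images are
  recognized as weak forms.\<close>

lemma weak_forms_iff:
  "G \<in> weak_forms \<rho> \<longleftrightarrow> G = on_\<H> G \<and>
     (\<forall>i. (\<lambda>\<tau>. G \<tau> $ i) holomorphic_on \<H> \<and> meromorphic_at_cusp (\<lambda>\<tau>. G \<tau> $ i)) \<and>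
     modular_triple (\<lambda>\<tau>. (G \<tau> $ 1 + G \<tau> $ 3) / 2) (\<lambda>\<tau>. (G \<tau> $ 1 - G \<tau> $ 3) / 2) (\<lambda>\<tau>. G \<tau> $ 2)"
proof -
  let ?TS = "\<forall>\<tau>\<in>\<H>. G (\<tau> + 1) = rho_T *v G \<tau> \<and> G (- 1 / \<tau>) = (csqrt \<tau> ^ 5) *s (rho_S *v G \<tau>)"
  have triple: "modular_triple (\<lambda>\<tau>. (G \<tau> $ 1 + G \<tau> $ 3) / 2) (\<lambda>\<tau>. (G \<tau> $ 1 - G \<tau> $ 3) / 2) (\<lambda>\<tau>. G \<tau> $ 2) \<longleftrightarrow> ?TS"
    unfolding modular_triple_def
  proof (rule ball_cong[OF refl], goal_cases)
    case (1 \<tau>)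
    show ?case unfolding csqrt_power5[OF 1] half_sum_transformation eq_rho_T_mult eq_rho_S_mult
      by (rule conj_assoc[symmetric, THEN trans]) (simp only: conj_assoc)
  qed
  have "(\<forall>(\<gamma>, \<phi>)\<in>carrier Mp2Z. \<forall>\<tau>\<in>\<H>. (\<phi> \<tau> powi (-5)) *s G (moebius_act \<gamma> \<tau>) = \<rho> (\<gamma>, \<phi>) *v G \<tau>) \<longleftrightarrow> ?TS"
    (is "?all \<longleftrightarrow> _")
  proof
    assume ?all
    then have all: "(\<phi> \<tau> powi (-5)) *s G (mob a b c d \<tau>) = \<rho> (mat22 a b c d, \<phi>) *v G \<tau>"
      if "(mat22 a b c d, \<phi>) \<in> carrier Mp2Z" "\<tau> \<in> \<H>" for a b c d \<phi> \<tau>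
      using that by (force simp: moebius_act_mat22)
    show ?TS
    proof (intro ballI conjI)
      fix \<tau> assume \<tau>: "\<tau> \<in> \<H>"
      have "mob 1 1 0 1 \<tau> = \<tau> + 1" by (simp add: mob_def)
      then show "G (\<tau> + 1) = rho_T *v G \<tau>"
        using all[OF Mp2_T_carrier[unfolded Mp2_T_eq] \<tau>] rho_T \<tau> by (simp add: Mp2_T_eq)
      have "mob 0 (- 1) 1 0 \<tau> = - 1 / \<tau>" by (simp add: mob_def)
      then have "(csqrt \<tau> powi (-5)) *s G (- 1 / \<tau>) = rho_S *v G \<tau>"
        using all[OF Mp2_S_carrier[unfolded Mp2_S_eq] \<tau>] rho_S \<tau> by (simp only: Mp2_S_eq on_H_in)
      then have "(csqrt \<tau> ^ 5) *s ((csqrt \<tau> powi (-5)) *s G (- 1 / \<tau>)) = (csqrt \<tau> ^ 5) *s (rho_S *v G \<tau>)"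
        by (rule arg_cong)
      moreover have "csqrt \<tau> ^ 5 * csqrt \<tau> powi (-5) = 1"
        using csqrt_nonzero[OF \<tau>] by (simp add: power_int_minus)
      ultimately show "G (- 1 / \<tau>) = (csqrt \<tau> ^ 5) *s (rho_S *v G \<tau>)"
        by (simp only: vector_smult_assoc vector_smult_lid)
    qed
  next
    assume TS: ?TS
    show ?all
    proof (intro ballI, clarify)
      fix \<gamma> :: "int^2^2" and \<phi> :: "complex \<Rightarrow> complex" and \<tau>
      assume c: "(\<gamma>, \<phi>) \<in> carrier Mp2Z" and \<tau>: "\<tau> \<in> \<H>"
      obtain a b c d where \<gamma>: "\<gamma> = mat22 a b c d" using mat22_eta by blast
      have c': "(mat22 a b c d, \<phi>) \<in> carrier Mp2Z" using c by (simp add: \<gamma>)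
      then have det: "a * d - b * c = 1" and sq: "\<phi> \<tau> ^ 2 = of_int c * \<tau> + of_int d"
        using \<tau> by (auto simp: Mp2Z_carrier_iff)
      have "\<phi> \<tau> \<noteq> 0" using sq linear_nonzero_on_H[OF det \<tau>] by auto
      then have "\<phi> \<tau> powi (-5) * \<phi> \<tau> ^ 5 = 1" by (simp add: power_int_minus)
      moreover have "G (mob a b c d \<tau>) = (\<phi> \<tau> ^ 5) *s (\<rho> (mat22 a b c d, \<phi>) *v G \<tau>)"
        by (rule transformation_from_generators[OF _ _ det c' \<tau>]) (use TS in blast)+
      ultimately show "(\<phi> \<tau> powi (-5)) *s G (moebius_act \<gamma> \<tau>) = \<rho> (\<gamma>, \<phi>) *v G \<tau>"
        by (simp only: \<gamma> moebius_act_mat22 vector_smult_assoc vector_smult_lid)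
    qed
  qed
  with triple show ?thesis unfolding weak_forms_def by auto
qed

end

lemma has_q8_expansion_const: "(\<lambda>_. a) has_q8_expansion fls_const a"
  unfolding has_q8_expansion_def by (intro exI[of _ "\<lambda>_. a"]) simp

lemma has_q8_expansion_add:
  assumes "g has_q8_expansion F" "h has_q8_expansion G"
  shows "(\<lambda>\<tau>. g \<tau> + h \<tau>) has_q8_expansion F + G"
proof -
  from assms obtain f1 f2 where "f1 has_laurent_expansion F" "\<forall>\<tau>\<in>\<H>. g \<tau> = f1 (q8 \<tau>)"
    "f2 has_laurent_expansion G" "\<forall>\<tau>\<in>\<H>. h \<tau> = f2 (q8 \<tau>)" unfolding has_q8_expansion_def by blast
  then show ?thesis unfolding has_q8_expansion_def
    by (intro exI[of _ "\<lambda>x. f1 x + f2 x"]) (auto intro: has_laurent_expansion_add)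
qed

lemma has_q8_expansion_mult:
  assumes "g has_q8_expansion F" "h has_q8_expansion G"
  shows "(\<lambda>\<tau>. g \<tau> * h \<tau>) has_q8_expansion F * G"
proof -
  from assms obtain f1 f2 where "f1 has_laurent_expansion F" "\<forall>\<tau>\<in>\<H>. g \<tau> = f1 (q8 \<tau>)"
    "f2 has_laurent_expansion G" "\<forall>\<tau>\<in>\<H>. h \<tau> = f2 (q8 \<tau>)" unfolding has_q8_expansion_def by blast
  then show ?thesis unfolding has_q8_expansion_def
    by (intro exI[of _ "\<lambda>x. f1 x * f2 x"]) (auto intro: has_laurent_expansion_mult)
qed

lemma has_q8_expansion_cmult:
  "g has_q8_expansion F \<Longrightarrow> (\<lambda>\<tau>. a * g \<tau>) has_q8_expansion fls_const a * F"
  by (rule has_q8_expansion_mult[OF has_q8_expansion_const])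

lemma has_q8_expansion_power_int:
  assumes "g has_q8_expansion F"
  shows "(\<lambda>\<tau>. g \<tau> powi n) has_q8_expansion F powi n"
proof -
  from assms obtain f where "f has_laurent_expansion F" "\<forall>\<tau>\<in>\<H>. g \<tau> = f (q8 \<tau>)"
    unfolding has_q8_expansion_def by blast
  then show ?thesis unfolding has_q8_expansion_def
    by (intro exI[of _ "\<lambda>x. f x powi n"]) (auto intro: has_laurent_expansion_power_int)
qed

lemma has_q8_expansion_power:
  "g has_q8_expansion F \<Longrightarrow> (\<lambda>\<tau>. g \<tau> ^ n) has_q8_expansion F ^ n"
  using has_q8_expansion_power_int[of g F "int n"] by simp

lemma has_q8_expansion_inverse:
  "g has_q8_expansion F \<Longrightarrow> (\<lambda>\<tau>. inverse (g \<tau>)) has_q8_expansion inverse F"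
  using has_q8_expansion_power_int[of g F "-1"] by simp

lemma theta_series_has_q8_expansion:
  assumes "bounded (range \<kappa>)"
  shows "theta_series \<kappa> has_q8_expansion fps_to_fls (theta_fps \<kappa>)"
proof -
  have "0 < fps_conv_radius (theta_fps \<kappa>)"
    by (rule less_le_trans[OF _ theta_fps_conv_radius[OF assms]]) simp
  then have "eval_fps (theta_fps \<kappa>) has_laurent_expansion fps_to_fls (theta_fps \<kappa>)"
    by (intro has_laurent_expansion_fps) (simp add: has_fps_expansion_def)
  then show ?thesis
    unfolding has_q8_expansion_def using theta_series_eval_fps[OF assms] by blast
qed

section \<open>Vanishing of forms without principal part\<close>

lemma theta_fps_nth: "fps_nth (theta_fps \<kappa>) k = (\<Sum>n\<in>{n. n\<^sup>2 = int k}. \<kappa> n)"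
  by (simp add: theta_fps_def)

lemma theta_fps_nth_0: "fps_nth (theta_fps \<kappa>) 0 = \<kappa> 0"
  by (simp add: theta_fps_nth)

lemma theta_fps_nth_1: "fps_nth (theta_fps \<kappa>) 1 = \<kappa> 1 + \<kappa> (- 1)"
proof -
  have "{n::int. n\<^sup>2 = int 1} = {1, - 1}" by (auto simp: power2_eq_1_iff)
  then show ?thesis by (simp add: theta_fps_nth)
qed

text \<open>Only theta2 vanishes at the cusp, to first order in \<open>q8\<close>, so the inverse of
  the product has exact order -1; it is holomorphic because the product has no zeros.\<close>

lemma theta_prod_inverse_bound:
  "\<exists>C. \<forall>\<tau>. Im \<tau> \<ge> 1 \<longrightarrow> norm (inverse (theta_prod \<tau>)) \<le> C * norm (q8 \<tau>) powi (- 1)"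
proof -
  let ?F = "fps_to_fls (theta_fps chi2) * fps_to_fls (theta_fps chi3) * fps_to_fls (theta_fps chi4)"
  have e: "theta_prod has_q8_expansion ?F"
    unfolding theta_prod_def [abs_def]
    by (intro has_q8_expansion_mult theta_series_has_q8_expansion chi_bounded)
  have "subdegree (theta_fps chi2) = 1"
    by (rule subdegreeI) (auto simp: theta_fps_nth_0 theta_fps_nth_1[unfolded One_nat_def] chi2_def)
  moreover have "subdegree (theta_fps chi3) = 0" "subdegree (theta_fps chi4) = 0"
    by (rule subdegreeI; simp add: theta_fps_nth_0 chi3_def chi4_def)+
  moreover have "theta_fps chi2 \<noteq> 0" "theta_fps chi3 \<noteq> 0" "theta_fps chi4 \<noteq> 0"
    using theta_fps_nth_0[of chi3] theta_fps_nth_0[of chi4] theta_fps_nth_1[of chi2]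
    by (auto simp: chi2_def chi3_def chi4_def)
  ultimately have "fls_subdegree ?F = 1" by (simp add: fls_subdegree_fls_to_fps)
  then have sub: "fls_subdegree (inverse ?F) = - 1" unfolding fls_inverse_subdegree by simp
  have hol: "(\<lambda>\<tau>. inverse (theta_prod \<tau>)) holomorphic_on \<H>"
    by (intro holomorphic_intros theta_prod_holomorphic theta_prod_nonzero)
  show ?thesis
    by (rule has_q8_series_bound[OF has_q8_expansion_imp_series[OF hol has_q8_expansion_inverse[OF e]]])
       (use sub in \<open>metis fls_eq0_below_subdegree\<close>)
qed

lemma holomorphic_mult_eq_0:
  assumes f: "f holomorphic_on \<H>" and g: "g holomorphic_on \<H>" and fg: "\<And>\<tau>. \<tau> \<in> \<H> \<Longrightarrow> f \<tau> * g \<tau> = 0"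
  shows "(\<forall>\<tau>\<in>\<H>. f \<tau> = 0) \<or> (\<forall>\<tau>\<in>\<H>. g \<tau> = 0)"
proof (rule disjCI)
  assume "\<not> (\<forall>\<tau>\<in>\<H>. g \<tau> = 0)"
  then obtain z where z: "z \<in> \<H>" "g z \<noteq> 0" by blast
  define U where "U = \<H> \<inter> g -` (- {0})"
  have "open U" unfolding U_def
    by (rule continuous_open_preimage[OF holomorphic_on_imp_continuous_on[OF g] open_H]) auto
  moreover have "z \<in> U" using z by (simp add: U_def)
  ultimately have lim: "z islimpt U" by (simp add: interior_limit_point interior_open)
  have zero: "f w = 0" if "w \<in> U" for w using fg[of w] that by (auto simp: U_def)
  have "U \<subseteq> \<H>" by (auto simp: U_def)
  from analytic_continuation[OF f open_H connected_H this z(1) lim zero] show "\<forall>\<tau>\<in>\<H>. f \<tau> = 0" by blast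
qed

lemma ell_eq: "m mod 8 = 1 \<Longrightarrow> ell m = 0" "m mod 8 = 7 \<Longrightarrow> ell m = 1" "m mod 8 = 5 \<Longrightarrow> ell m = 2"
  unfolding ell_def by (rule the_equality; auto simp: cong_iff_dvd_diff; presburger)+

lemma coord_eq: "coord 0 = 1" "coord 1 = 2" "coord 2 = 3"
  by (simp_all add: coord_def)

lemma basis_vec_ell:
  assumes "m mod 8 = 1 \<or> m mod 8 = 7 \<or> m mod 8 = 5"
  shows "\<ee> (ell m) $ 1 = (if m mod 8 = 1 then 1 else 0)" "\<ee> (ell m) $ 2 = (if m mod 8 = 7 then 1 else 0)"
    "\<ee> (ell m) $ 3 = (if m mod 8 = 5 then 1 else 0)"
  unfolding basis_vec_def
  by (use assms in \<open>elim disjE; simp add: ell_eq coord_eq coord_eq[unfolded One_nat_def] axis_def\<close>)+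

text \<open>Both T and S multiply a b c / h^5 by -1, with h = \<open>theta_prod\<close>, which is
  why W is a square. The bounds give it the order 2 (1 + 1 + 7 - 5) = 8 in \<open>q8\<close>, so W
  vanishes at the cusp and hence everywhere. Then one of a, b, c vanishes identically, and T and S
  carry this to the other two.\<close>

lemma modular_triple_eq_0:
  assumes abc: "modular_triple a b c"
    and hol: "a holomorphic_on \<H>" "b holomorphic_on \<H>" "c holomorphic_on \<H>"
    and bd: "\<And>\<tau>. Im \<tau> \<ge> 1 \<Longrightarrow> norm (a \<tau>) \<le> C * norm (q8 \<tau>)"
      "\<And>\<tau>. Im \<tau> \<ge> 1 \<Longrightarrow> norm (b \<tau>) \<le> C * norm (q8 \<tau>)"
      "\<And>\<tau>. Im \<tau> \<ge> 1 \<Longrightarrow> norm (c \<tau>) \<le> C * norm (q8 \<tau>) ^ 7"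
    and \<tau>: "\<tau> \<in> \<H>"
  shows "a \<tau> = 0" "b \<tau> = 0" "c \<tau> = 0"
proof -
  define r where "r = (\<lambda>\<tau>. csqrt (- \<i> * \<tau>))"
  have r: "r \<tau> \<noteq> 0" if "\<tau> \<in> \<H>" for \<tau> using H_not_0[OF that] by (simp add: r_def del: csqrt.simps)
  have T: "a (\<tau> + 1) = \<zeta>8 * b \<tau>" "b (\<tau> + 1) = \<zeta>8 * a \<tau>" "c (\<tau> + 1) = inverse \<zeta>8 * c \<tau>"
    and S: "a (- 1 / \<tau>) = - (r \<tau> ^ 5) * a \<tau>" "b (- 1 / \<tau>) = - (r \<tau> ^ 5) * c \<tau>" "c (- 1 / \<tau>) = - (r \<tau> ^ 5) * b \<tau>"
    if "\<tau> \<in> \<H>" for \<tau> using abc that unfolding modular_triple_def r_def by blast+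
  define W where "W = (\<lambda>\<tau>. (a \<tau> * b \<tau> * c \<tau> * inverse (theta_prod \<tau>) ^ 5)\<^sup>2)"
  obtain C' where C': "\<And>\<tau>. Im \<tau> \<ge> 1 \<Longrightarrow> norm (inverse (theta_prod \<tau>)) \<le> C' * norm (q8 \<tau>) powi (- 1)"
    using theta_prod_inverse_bound by blast
  have W0: "W \<tau> = 0" if "\<tau> \<in> \<H>" for \<tau>
  proof (rule sl2_invariant_vanishing_at_cusp[OF _ _ _ _ that])
    show "W holomorphic_on \<H>"
      unfolding W_def by (intro holomorphic_intros hol theta_prod_holomorphic theta_prod_nonzero)
    show "W (\<tau> + 1) = W \<tau>" if "\<tau> \<in> \<H>" for \<tau>
    proof -
      have "a (\<tau> + 1) * b (\<tau> + 1) * c (\<tau> + 1) * inverse (theta_prod (\<tau> + 1)) ^ 5 =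
          (\<zeta>8 * inverse (\<zeta>8 ^ 5)) * (a \<tau> * b \<tau> * c \<tau> * inverse (theta_prod \<tau>) ^ 5)"
        unfolding T[OF that] theta_prod_T by (simp add: power_mult_distrib power_inverse)
      also have "\<zeta>8 * inverse (\<zeta>8 ^ 5) = - 1" by (simp add: zeta8_power_reduce)
      finally show ?thesis by (simp add: W_def)
    qed
    show "W (- 1 / \<tau>) = W \<tau>" if "\<tau> \<in> \<H>" for \<tau>
    proof -
      have gen: "(- s * x) * (- s * z) * (- s * y) * inverse (t * h) ^ 5 =
          - (s ^ 3 * inverse (t ^ 5)) * (x * y * z * inverse h ^ 5)" for s t x y z h :: complex
        by (simp add: power_mult_distrib power_inverse power3_eq_cube)
      have "a (- 1 / \<tau>) * b (- 1 / \<tau>) * c (- 1 / \<tau>) * inverse (theta_prod (- 1 / \<tau>)) ^ 5 =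
          - ((r \<tau> ^ 5) ^ 3 * inverse ((r \<tau> ^ 3) ^ 5)) * (a \<tau> * b \<tau> * c \<tau> * inverse (theta_prod \<tau>) ^ 5)"
        unfolding S[OF that] theta_prod_S[OF that] r_def [THEN fun_cong, symmetric] by (rule gen)
      also have "(r \<tau> ^ 5) ^ 3 * inverse ((r \<tau> ^ 3) ^ 5) = 1"
        using r[OF that] by (simp add: power_mult [symmetric])
      finally show ?thesis by (simp add: W_def)
    qed
    fix e :: real assume e: "e > 0"
    let ?K = "(C * C * C * C' ^ 5)\<^sup>2"
    have "((\<lambda>y. ?K * exp (- (pi * y / 4)) ^ 8) \<longlongrightarrow> ?K * 0) at_top"
      by (intro tendsto_mult_left) real_asymp
    then have "\<forall>\<^sub>F y in at_top. ?K * exp (- (pi * y / 4)) ^ 8 < e"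
      using e by (intro order_tendstoD(2)) auto
    then obtain Y where Y: "\<And>y. y \<ge> Y \<Longrightarrow> ?K * exp (- (pi * y / 4)) ^ 8 < e"
      by (auto simp: eventually_at_top_linorder)
    have "norm (W \<tau>) < e" if "Im \<tau> \<ge> max Y 1" for \<tau>
    proof -
      define x where "x = norm (q8 \<tau>)"
      have x: "x > 0" "x = exp (- (pi * Im \<tau> / 4))" by (simp_all add: x_def norm_q8)
      have i: "Im \<tau> \<ge> 1" using that by simp
      have n: "norm (a \<tau>) \<le> C * x" "norm (b \<tau>) \<le> C * x" "norm (c \<tau>) \<le> C * x ^ 7"
        "norm (inverse (theta_prod \<tau>)) \<le> C' * inverse x"
        using bd[OF i] C'[OF i] by (simp_all add: x_def power_int_minus)
      have Cx: "0 \<le> C * x" by (rule order_trans[OF norm_ge_zero n(1)])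
      have C7: "0 \<le> C * x ^ 7" by (rule order_trans[OF norm_ge_zero n(3)])
      have gen: "p * q * s * t ^ 5 \<le> u * u * v * w ^ 5"
        if "0 \<le> p" "0 \<le> q" "0 \<le> s" "0 \<le> t" "p \<le> u" "q \<le> u" "s \<le> v" "t \<le> w" "0 \<le> u" "0 \<le> v" for p q s t u v w :: real
        using that by (intro mult_mono power_mono mult_nonneg_nonneg) auto
      have "norm (a \<tau> * b \<tau> * c \<tau> * inverse (theta_prod \<tau>) ^ 5) \<le> (C * x) * (C * x) * (C * x ^ 7) * (C' * inverse x) ^ 5"
        unfolding norm_mult norm_power by (rule gen[OF _ _ _ _ n Cx C7]) auto
      also have "\<dots> = C * C * C * C' ^ 5 * x ^ 4"
        using x(1) by (simp add: power_mult_distrib power_inverse field_simps eval_nat_numeral)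
      finally have "norm (W \<tau>) \<le> (C * C * C * C' ^ 5 * x ^ 4)\<^sup>2"
        unfolding W_def norm_power by (intro power_mono) auto
      also have "\<dots> = ?K * x ^ 8" by (simp add: power_mult_distrib power_mult [symmetric])
      also have "\<dots> < e" using Y[of "Im \<tau>"] that by (simp add: x(2))
      finally show ?thesis .
    qed
    then show "\<exists>Y. \<forall>\<tau>. Im \<tau> \<ge> Y \<longrightarrow> norm (W \<tau>) < e" by blast
  qed
  have abc0: "(a \<tau> * b \<tau>) * c \<tau> = 0" if "\<tau> \<in> \<H>" for \<tau>
    using W0[OF that] theta_prod_nonzero[OF that] by (simp add: W_def)
  have b_a: "a \<tau> = 0" if "\<forall>\<tau>\<in>\<H>. b \<tau> = 0" "\<tau> \<in> \<H>" for \<tau>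
    using T(2)[OF that(2)] that by simp
  have a_b: "b \<tau> = 0" if "\<forall>\<tau>\<in>\<H>. a \<tau> = 0" "\<tau> \<in> \<H>" for \<tau>
    using T(1)[OF that(2)] that by simp
  have b_c: "c \<tau> = 0" if "\<forall>\<tau>\<in>\<H>. b \<tau> = 0" "\<tau> \<in> \<H>" for \<tau>
  proof -
    have "b (- 1 / \<tau>) = 0" using that(1) minus_inverse_in_H[OF that(2)] by blast
    then show ?thesis using S(2)[OF that(2)] r[OF that(2)] by simp
  qed
  have c_b: "b \<tau> = 0" if "\<forall>\<tau>\<in>\<H>. c \<tau> = 0" "\<tau> \<in> \<H>" for \<tau>
  proof -
    have "c (- 1 / \<tau>) = 0" using that(1) minus_inverse_in_H[OF that(2)] by blast
    then show ?thesis using S(3)[OF that(2)] r[OF that(2)] by simp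
  qed
  have "(\<forall>\<tau>\<in>\<H>. a \<tau> = 0) \<or> (\<forall>\<tau>\<in>\<H>. b \<tau> = 0) \<or> (\<forall>\<tau>\<in>\<H>. c \<tau> = 0)"
    using holomorphic_mult_eq_0[OF holomorphic_on_mult[OF hol(1,2)] hol(3) abc0]
      holomorphic_mult_eq_0[OF hol(1,2)] by blast
  then have b0: "\<forall>\<tau>\<in>\<H>. b \<tau> = 0" using a_b c_b by (elim disjE) simp_all
  show "a \<tau> = 0" by (rule b_a[OF b0 \<tau>])
  show "b \<tau> = 0" using b0 \<tau> by blast
  show "c \<tau> = 0" by (rule b_c[OF b0 \<tau>])
qed

section \<open>Fourier coefficients and principal parts of weak forms\<close>

context weil_representation
begin

lemma weak_form_T:
  assumes "G \<in> weak_forms \<rho>" "\<tau> \<in> \<H>"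
  shows "G (\<tau> + 1) $ 1 = eexp (of_int 1 / 8) * G \<tau> $ 1" "G (\<tau> + 1) $ 2 = eexp (of_int 7 / 8) * G \<tau> $ 2"
    "G (\<tau> + 1) $ 3 = eexp (of_int 5 / 8) * G \<tau> $ 3"
proof -
  from assms have t: "(G (\<tau> + 1) $ 1 + G (\<tau> + 1) $ 3) / 2 = \<zeta>8 * ((G \<tau> $ 1 - G \<tau> $ 3) / 2)"
      "(G (\<tau> + 1) $ 1 - G (\<tau> + 1) $ 3) / 2 = \<zeta>8 * ((G \<tau> $ 1 + G \<tau> $ 3) / 2)"
      "G (\<tau> + 1) $ 2 = inverse \<zeta>8 * G \<tau> $ 2"
    unfolding weak_forms_iff modular_triple_def by blast+
  have z: "eexp (of_int 1 / 8) = \<zeta>8" "eexp (of_int 7 / 8) = inverse \<zeta>8" "eexp (of_int 5 / 8) = - \<zeta>8"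
    using zeta8_power_reduce by (simp_all add: zeta8_eexp eexp_power)
  note h = half_sum_half_diff[OF t(1,2)]
  show "G (\<tau> + 1) $ 1 = eexp (of_int 1 / 8) * G \<tau> $ 1" "G (\<tau> + 1) $ 3 = eexp (of_int 5 / 8) * G \<tau> $ 3"
    unfolding z h by (simp_all add: field_simps)
  show "G (\<tau> + 1) $ 2 = eexp (of_int 7 / 8) * G \<tau> $ 2" unfolding z by (rule t(3))
qed

lemma fourier_series_aux:
  assumes G: "G \<in> weak_forms \<rho>" and T: "\<And>\<tau>. \<tau> \<in> \<H> \<Longrightarrow> G (\<tau> + 1) $ i = eexp (of_int r / 8) * G \<tau> $ i"
    and r: "r \<in> {1, 5, 7}" and i: "\<And>m. m mod 8 = r \<Longrightarrow> coord (ell m) = i"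
  shows "(\<lambda>\<tau>. G \<tau> $ i) has_q8_series (\<lambda>m. if m mod 8 = r then fourier_coeff G m else 0)"
proof -
  from G have hol: "(\<lambda>\<tau>. G \<tau> $ i) holomorphic_on \<H>" and "meromorphic_at_cusp (\<lambda>\<tau>. G \<tau> $ i)"
    unfolding weak_forms_iff by blast+
  then obtain F where "(\<lambda>\<tau>. G \<tau> $ i) has_q8_expansion F" unfolding meromorphic_at_cusp_iff by blast
  from has_q8_expansion_imp_series[OF hol this]
  have s: "(\<lambda>\<tau>. G \<tau> $ i) has_q8_series fls_nth F" .
  have "fls_nth F m = (if m mod 8 = r then fourier_coeff G m else 0)" for m
  proof (cases "m mod 8 = r")
    case True
    then have "fourier_coeff G m = fls_nth (THE F. (\<lambda>\<tau>. G \<tau> $ i) has_q8_expansion F) m"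
      using r i[OF True] by (auto simp: fourier_coeff_def)
    then show ?thesis using has_q8_series_the[OF s] True by simp
  next
    case False
    moreover have "r mod 8 = r" using r by auto
    ultimately show ?thesis using has_q8_series_class[OF s T, of m] by (auto simp: cong_def)
  qed
  then show ?thesis by (intro has_q8_series_cong[OF _ _ s]) auto
qed

lemma fourier_series:
  assumes "G \<in> weak_forms \<rho>"
  shows "(\<lambda>\<tau>. G \<tau> $ 1) has_q8_series (\<lambda>m. if m mod 8 = 1 then fourier_coeff G m else 0)"
    "(\<lambda>\<tau>. G \<tau> $ 2) has_q8_series (\<lambda>m. if m mod 8 = 7 then fourier_coeff G m else 0)"
    "(\<lambda>\<tau>. G \<tau> $ 3) has_q8_series (\<lambda>m. if m mod 8 = 5 then fourier_coeff G m else 0)"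
  by (rule fourier_series_aux[OF assms]; simp add: weak_form_T[OF assms] ell_eq coord_eq coord_eq[unfolded One_nat_def])+

lemma fourier_coeff_eqI:
  assumes G: "G \<in> weak_forms \<rho>"
    and s: "(\<lambda>\<tau>. G \<tau> $ 1) has_q8_series c1" "(\<lambda>\<tau>. G \<tau> $ 2) has_q8_series c2" "(\<lambda>\<tau>. G \<tau> $ 3) has_q8_series c3"
  shows "fourier_coeff G m = (if m mod 8 = 1 then c1 m else if m mod 8 = 7 then c2 m else if m mod 8 = 5 then c3 m else 0)"
proof -
  have *: "c1 = (\<lambda>m. if m mod 8 = 1 then fourier_coeff G m else 0)"
    "c2 = (\<lambda>m. if m mod 8 = 7 then fourier_coeff G m else 0)"
    "c3 = (\<lambda>m. if m mod 8 = 5 then fourier_coeff G m else 0)"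
    using s fourier_series[OF G] by (blast intro: has_q8_series_unique)+
  show ?thesis unfolding * by (auto simp: fourier_coeff_def)
qed

lemma fourier_coeff_other: "m mod 8 \<notin> {1, 5, 7} \<Longrightarrow> fourier_coeff G m = 0"
  by (simp add: fourier_coeff_def)

lemma weak_forms_eq_0:
  assumes G: "G \<in> weak_forms \<rho>" and zero: "\<And>m. m \<le> 0 \<Longrightarrow> fourier_coeff G m = 0"
  shows "G = (\<lambda>_. 0)"
proof -
  note s = fourier_series[OF G]
  obtain C1 C2 C3 where
    C1: "\<And>\<tau>. Im \<tau> \<ge> 1 \<Longrightarrow> norm (G \<tau> $ 1) \<le> C1 * norm (q8 \<tau>) powi 1" and
    C2: "\<And>\<tau>. Im \<tau> \<ge> 1 \<Longrightarrow> norm (G \<tau> $ 2) \<le> C2 * norm (q8 \<tau>) powi 7" and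
    C3: "\<And>\<tau>. Im \<tau> \<ge> 1 \<Longrightarrow> norm (G \<tau> $ 3) \<le> C3 * norm (q8 \<tau>) powi 1"
  proof -
    \<comment> \<open>Exponents of the second component are 7 modulo 8, so the absence of
      nonpositive ones means order 7 and not merely 1. The vanishing argument depends on this gain:
      1 + 1 + 1 - 5 would be negative.\<close>
    have z2: "(if m mod 8 = 7 then fourier_coeff G m else 0) = 0" if "m < 7" for m
    proof (cases "m \<le> 0")
      case False
      with that have "m mod 8 = m" by simp
      with that show ?thesis by simp
    qed (simp add: zero)
    have z: "(if m mod 8 = r then fourier_coeff G m else 0) = 0" if "m < 1" for m r
      using that by (simp add: zero)
    from has_q8_series_bound[OF s(1), of 1] has_q8_series_bound[OF s(2), of 7] has_q8_series_bound[OF s(3), of 1] z z2 that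
    show thesis by blast
  qed
  define C where "C = max (\<bar>C1\<bar> + \<bar>C3\<bar>) \<bar>C2\<bar>"
  from G have abc: "modular_triple (\<lambda>\<tau>. (G \<tau> $ 1 + G \<tau> $ 3) / 2) (\<lambda>\<tau>. (G \<tau> $ 1 - G \<tau> $ 3) / 2) (\<lambda>\<tau>. G \<tau> $ 2)"
    and hol: "\<And>i. (\<lambda>\<tau>. G \<tau> $ i) holomorphic_on \<H>" and on: "G = on_\<H> G"
    unfolding weak_forms_iff by blast+
  have bd13: "norm (G \<tau> $ 1) + norm (G \<tau> $ 3) \<le> C * norm (q8 \<tau>)" if "Im \<tau> \<ge> 1" for \<tau>
  proof -
    have "norm (G \<tau> $ 1) + norm (G \<tau> $ 3) \<le> (C1 + C3) * norm (q8 \<tau>)"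
      using C1[OF that] C3[OF that] by (simp add: ring_distribs)
    also have "\<dots> \<le> C * norm (q8 \<tau>)" by (intro mult_right_mono) (auto simp: C_def)
    finally show ?thesis .
  qed
  have half: "norm ((G \<tau> $ 1 + G \<tau> $ 3) / 2) \<le> norm (G \<tau> $ 1) + norm (G \<tau> $ 3)"
    "norm ((G \<tau> $ 1 - G \<tau> $ 3) / 2) \<le> norm (G \<tau> $ 1) + norm (G \<tau> $ 3)" for \<tau>
    using norm_triangle_ineq[of "G \<tau> $ 1" "G \<tau> $ 3"] norm_triangle_ineq4[of "G \<tau> $ 1" "G \<tau> $ 3"]
      norm_ge_zero[of "G \<tau> $ 1"] norm_ge_zero[of "G \<tau> $ 3"] by (simp_all add: norm_divide del: norm_ge_zero)
  have bd2: "norm (G \<tau> $ 2) \<le> C * norm (q8 \<tau>) ^ 7" if "Im \<tau> \<ge> 1" for \<tau>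
  proof -
    have "norm (G \<tau> $ 2) \<le> C2 * norm (q8 \<tau>) ^ 7" using C2[OF that] by simp
    also have "\<dots> \<le> C * norm (q8 \<tau>) ^ 7" by (intro mult_right_mono) (auto simp: C_def)
    finally show ?thesis .
  qed
  have "G \<tau> $ 1 = 0 \<and> G \<tau> $ 2 = 0 \<and> G \<tau> $ 3 = 0" if \<tau>: "\<tau> \<in> \<H>" for \<tau>
  proof -
    have h: "(\<lambda>\<tau>. (G \<tau> $ 1 + G \<tau> $ 3) / 2) holomorphic_on \<H>" "(\<lambda>\<tau>. (G \<tau> $ 1 - G \<tau> $ 3) / 2) holomorphic_on \<H>"
      by (intro holomorphic_intros hol; simp)+
    note z = modular_triple_eq_0[OF abc h hol order_trans[OF half(1) bd13] order_trans[OF half(2) bd13] bd2 \<tau>]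
    from half_sum_half_diff[OF z(1,2)] z(3) show ?thesis by simp
  qed
  then have "G \<tau> = 0" for \<tau>
    by (subst on) (auto simp: on_\<H>_def vec_eq_iff forall_3)
  then show ?thesis by blast
qed

text \<open>The difference D has the coefficients e, and being O(q^(1/8)) means that none of them
  sits at an exponent <= 0. The exponent 0 lies in none of the classes 1, 5, 7 modulo 8, so only
  negative exponents appear on the right.\<close>

lemma has_principal_part_iff:
  assumes G: "G \<in> weak_forms \<rho>" and d: "d \<in> admissible"
  shows "has_principal_part d G \<longleftrightarrow> (\<forall>m<0. fourier_coeff G m = (if m = - int d then 1 else 0))"
proof -
  define l where "l = ell (- int d)"
  define e where "e = (\<lambda>m. fourier_coeff G m - (if m = - int d then 1 else 0))"
  define D where "D = (\<lambda>\<tau>. G \<tau> - (q8 \<tau> powi (- int d)) *s \<ee> l)"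
  have cases: "(- int d) mod 8 = 1 \<or> (- int d) mod 8 = 7 \<or> (- int d) mod 8 = 5"
  proof -
    have "int d mod 8 = 1 \<or> int d mod 8 = 3 \<or> int d mod 8 = 7"
    proof -
      have "d mod 8 = 1 \<or> d mod 8 = 3 \<or> d mod 8 = 7" using d by (auto simp: admissible_def)
      then show ?thesis by presburger
    qed
    then show ?thesis by (auto simp: zmod_zminus1_eq_if)
  qed
  have el: "\<ee> l $ 1 = (if (- int d) mod 8 = 1 then 1 else 0)" "\<ee> l $ 2 = (if (- int d) mod 8 = 7 then 1 else 0)"
    "\<ee> l $ 3 = (if (- int d) mod 8 = 5 then 1 else 0)"
    unfolding l_def by (rule basis_vec_ell, use cases in blast)+
  have D_series: "(\<lambda>\<tau>. D \<tau> $ i) has_q8_series (\<lambda>m. if m mod 8 = r then e m else 0)"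
    if s: "(\<lambda>\<tau>. G \<tau> $ i) has_q8_series (\<lambda>m. if m mod 8 = r then fourier_coeff G m else 0)"
      and el: "\<ee> l $ i = (if (- int d) mod 8 = r then 1 else 0)" for i r
    by (rule has_q8_series_cong[OF _ _ has_q8_series_add[OF s
          has_q8_series_cmult[OF has_q8_series_powi[of "- int d"], of "- (\<ee> l $ i)"]]])
       (auto simp: D_def e_def el)
  note Ds = D_series[OF fourier_series(1)[OF G] el(1)] D_series[OF fourier_series(2)[OF G] el(2)]
    D_series[OF fourier_series(3)[OF G] el(3)]
  have e0: "e m = 0" if "m mod 8 \<noteq> 1" "m mod 8 \<noteq> 7" "m mod 8 \<noteq> 5" for m
    using that cases by (auto simp: e_def fourier_coeff_other)
  have iff: "(\<forall>m<0. fourier_coeff G m = (if m = - int d then 1 else 0)) \<longleftrightarrow> (\<forall>m\<le>0. e m = 0)"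
  proof -
    have "e 0 = 0" by (rule e0) auto
    then show ?thesis by (auto simp: e_def le_less)
  qed
  have norm3: "norm x \<le> norm (x $ 1) + norm (x $ 2) + norm (x $ 3)" for x :: "complex^3"
    using L2_set_le_sum[of UNIV "\<lambda>i. norm (x $ i)"] by (simp add: norm_vec_def sum_3)
  have bigo: "has_principal_part d G \<longleftrightarrow>
      (\<exists>c>0. \<exists>Y. \<forall>\<tau>. Im \<tau> \<ge> Y \<longrightarrow> norm (D \<tau>) \<le> c * norm (q8 \<tau>))"
    unfolding has_principal_part_def bigo_def l_def [symmetric] D_def [symmetric]
    by (simp add: eventually_filtercomap_at_top_linorder D_def)
  show ?thesis
    unfolding iff bigo
  proof
    assume "\<exists>c>0. \<exists>Y. \<forall>\<tau>. Im \<tau> \<ge> Y \<longrightarrow> norm (D \<tau>) \<le> c * norm (q8 \<tau>)"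
    then obtain c Y where c: "\<And>\<tau>. Im \<tau> \<ge> Y \<Longrightarrow> norm (D \<tau>) \<le> c * norm (q8 \<tau>)" by blast
    have ci: "norm (D \<tau> $ i) \<le> c * norm (q8 \<tau>)" if "Im \<tau> \<ge> Y" for \<tau> i
      using Finite_Cartesian_Product.norm_nth_le[of "D \<tau>" i] c[OF that] by linarith
    show "\<forall>m\<le>0. e m = 0"
    proof (intro allI impI)
      fix m :: int assume m: "m \<le> 0"
      have "(if m mod 8 = 1 then e m else 0) = 0" "(if m mod 8 = 7 then e m else 0) = 0" "(if m mod 8 = 5 then e m else 0) = 0"
        using has_q8_series_growth[OF Ds(1) ci m] has_q8_series_growth[OF Ds(2) ci m] has_q8_series_growth[OF Ds(3) ci m]
        by blast+
      then show "e m = 0" using e0[of m] by (auto split: if_splits)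
    qed
  next
    assume z: "\<forall>m\<le>0. e m = 0"
    have z': "(if m mod 8 = r then e m else 0) = 0" if "m < 1" for m r using z that by simp
    obtain C1 C2 C3 where
      C: "\<And>\<tau>. Im \<tau> \<ge> 1 \<Longrightarrow> norm (D \<tau> $ 1) \<le> C1 * norm (q8 \<tau>) powi 1"
        "\<And>\<tau>. Im \<tau> \<ge> 1 \<Longrightarrow> norm (D \<tau> $ 2) \<le> C2 * norm (q8 \<tau>) powi 1"
        "\<And>\<tau>. Im \<tau> \<ge> 1 \<Longrightarrow> norm (D \<tau> $ 3) \<le> C3 * norm (q8 \<tau>) powi 1"
      using has_q8_series_bound[OF Ds(1), of 1] has_q8_series_bound[OF Ds(2), of 1] has_q8_series_bound[OF Ds(3), of 1] z'
      by blast
    have "norm (D \<tau>) \<le> (\<bar>C1\<bar> + \<bar>C2\<bar> + \<bar>C3\<bar> + 1) * norm (q8 \<tau>)" if "Im \<tau> \<ge> 1" for \<tau>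
    proof -
      have "norm (D \<tau>) \<le> (C1 + C2 + C3) * norm (q8 \<tau>)"
        using norm3[of "D \<tau>"] C[OF that] by (simp add: ring_distribs)
      also have "\<dots> \<le> (\<bar>C1\<bar> + \<bar>C2\<bar> + \<bar>C3\<bar> + 1) * norm (q8 \<tau>)" by (intro mult_right_mono) auto
      finally show ?thesis .
    qed
    then show "\<exists>c>0. \<exists>Y. \<forall>\<tau>. Im \<tau> \<ge> Y \<longrightarrow> norm (D \<tau>) \<le> c * norm (q8 \<tau>)"
      by (intro exI[of _ "\<bar>C1\<bar> + \<bar>C2\<bar> + \<bar>C3\<bar> + 1"] conjI exI[of _ 1]) (auto intro: add_nonneg_pos)
  qed
qed

end

subsection \<open>Laurent series with integral coefficients\<close>

definition integral_fls :: "complex fls \<Rightarrow> bool" where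
  "integral_fls F \<longleftrightarrow> (\<forall>n. fls_nth F n \<in> \<int>)"

definition monic_fls :: "int \<Rightarrow> complex fls \<Rightarrow> bool" where
  "monic_fls k F \<longleftrightarrow> integral_fls F \<and> (\<forall>n<k. fls_nth F n = 0) \<and> fls_nth F k = 1"

lemma integral_fls_mult: "integral_fls F \<Longrightarrow> integral_fls G \<Longrightarrow> integral_fls (F * G)"
  by (simp add: integral_fls_def fls_times_nth(2) Ints_sum)

lemma integral_fls_add: "integral_fls F \<Longrightarrow> integral_fls G \<Longrightarrow> integral_fls (F + G)"
  by (simp add: integral_fls_def)

lemma integral_fls_diff: "integral_fls F \<Longrightarrow> integral_fls G \<Longrightarrow> integral_fls (F - G)"
  by (simp add: integral_fls_def)

lemma integral_fls_const: "a \<in> \<int> \<Longrightarrow> integral_fls (fls_const a)"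
  by (simp add: integral_fls_def)

lemma monic_fls_integral: "monic_fls k F \<Longrightarrow> integral_fls F"
  by (simp add: monic_fls_def)

lemma monic_fls_nonzero: "monic_fls k F \<Longrightarrow> F \<noteq> 0"
  by (auto simp: monic_fls_def)

lemma monic_fls_subdegree: "monic_fls k F \<Longrightarrow> fls_subdegree F = k"
  unfolding monic_fls_def by (intro fls_subdegree_eqI) auto

lemma monic_fls_mult: "monic_fls k F \<Longrightarrow> monic_fls l G \<Longrightarrow> monic_fls (k + l) (F * G)"
proof -
  assume F: "monic_fls k F" and G: "monic_fls l G"
  note s = monic_fls_subdegree[OF F] monic_fls_subdegree[OF G]
  have "fls_nth (F * G) n = 0" if "n < k + l" for n
    using that fls_times_nth_eq0[of n F G] s by simp
  moreover have "fls_nth (F * G) (k + l) = 1"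
    using fls_times_base[of F G] F G unfolding s monic_fls_def by simp
  ultimately show ?thesis using F G by (simp add: monic_fls_def integral_fls_mult)
qed

lemma monic_fls_1: "monic_fls 0 1"
  by (simp add: monic_fls_def integral_fls_def)

text \<open>In the product with F, leading coefficient 1 lets each coefficient of the inverse be
  solved for from earlier ones by integer operations, without division.\<close>

lemma monic_fls_inverse:
  assumes F: "monic_fls k F"
  shows "monic_fls (- k) (inverse F)"
proof -
  define G where "G = inverse F"
  have F0: "F \<noteq> 0" by (rule monic_fls_nonzero[OF F])
  have FG: "F * G = 1" using F0 by (simp add: G_def)
  have sF: "fls_subdegree F = k" by (rule monic_fls_subdegree[OF F])
  have sG: "fls_subdegree G = - k" using F0 sF by (simp add: G_def fls_inverse_subdegree)
  have Fk: "fls_nth F k = 1" using F by (simp add: monic_fls_def)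
  have below: "fls_nth G n = 0" if "n < - k" for n using that sG by simp
  have rec: "fls_nth G n = fls_nth 1 (n + k) - (\<Sum>i\<in>{k<..n + 2 * k}. fls_nth F i * fls_nth G (n + k - i))" if "n \<ge> - k" for n
  proof -
    have "fls_nth (F * G) (n + k) = (\<Sum>i=k..n + k - (- k). fls_nth F i * fls_nth G (n + k - i))"
      unfolding fls_times_nth(2) sF sG ..
    also have "{k..n + k - (- k)} = insert k {k<..n + 2 * k}" using that by auto
    finally show ?thesis unfolding FG by (simp add: Fk algebra_simps)
  qed
  have "fls_nth G (int j - k) \<in> \<int>" for j
  proof (induction j rule: less_induct)
    case (less j)
    have "fls_nth F i * fls_nth G (int j - k + k - i) \<in> \<int>" if "i \<in> {k<..int j - k + 2 * k}" for i
    proof -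
      have "fls_nth G (int (nat (int j + k - i)) - k) \<in> \<int>" by (rule less) (use that in auto)
      moreover have "int (nat (int j + k - i)) - k = int j - k + k - i" using that by auto
      ultimately show ?thesis using F by (simp add: monic_fls_def integral_fls_def)
    qed
    moreover have "fls_nth (1 :: complex fls) m \<in> \<int>" for m by (simp add: fls_one_nth)
    ultimately show ?case by (subst rec) (auto intro!: Ints_diff Ints_sum)
  qed
  note Gint = this
  have "fls_nth G n \<in> \<int>" for n
  proof (cases "n < - k")
    case False
    then have "n = int (nat (n + k)) - k" by simp
    with Gint[of "nat (n + k)"] show ?thesis by simp
  qed (simp add: below)
  moreover have "fls_nth G (- k) = 1" using rec[of "- k"] by simp
  ultimately show ?thesis using below by (simp add: monic_fls_def integral_fls_def G_def)
qed

lemma monic_fls_power: "monic_fls k F \<Longrightarrow> monic_fls (int n * k) (F ^ n)"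
  by (induction n) (use monic_fls_mult in \<open>auto simp: monic_fls_1 ring_distribs\<close>)

lemma monic_fls_divide: "monic_fls k F \<Longrightarrow> monic_fls l G \<Longrightarrow> monic_fls (k - l) (F / G)"
  by (simp only: divide_inverse diff_conv_add_uminus) (rule monic_fls_mult[OF _ monic_fls_inverse])

lemma integral_const_mult_monic:
  "a \<in> \<int> \<Longrightarrow> monic_fls k F \<Longrightarrow> k > 0 \<Longrightarrow>
    integral_fls (fls_const a * F) \<and> (\<forall>n\<le>0. fls_nth (fls_const a * F) n = 0)"
  using integral_fls_mult[OF integral_fls_const monic_fls_integral, of a k F] by (simp add: monic_fls_def)

lemma monic_fls_cong: "monic_fls k F \<Longrightarrow> k = l \<Longrightarrow> monic_fls l F"
  by simp

text \<open>For k > 0 the solutions of n^2 = k come in pairs n, -n with equal weight.\<close>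

lemma theta_fps_even_coeffs:
  assumes even: "\<And>n. \<kappa> (- n) = \<kappa> n" and int: "\<And>n. \<kappa> n \<in> \<int>" and k: "k > 0"
  shows "\<exists>z\<in>\<int>. fps_nth (theta_fps \<kappa>) k = 2 * z"
proof -
  let ?S = "{n::int. n > 0 \<and> n\<^sup>2 = int k}"
  have fin: "finite ?S" by (rule finite_subset[OF _ finite_int_sqrt[of k]]) auto
  have S: "{n::int. n\<^sup>2 = int k} = ?S \<union> uminus ` ?S"
  proof (intro Set.set_eqI iffI)
    fix n assume n: "n \<in> {n::int. n\<^sup>2 = int k}"
    then have "n \<noteq> 0" using k by auto
    with n show "n \<in> ?S \<union> uminus ` ?S"
      by (cases "n > 0") (auto intro!: image_eqI[of _ uminus "- n"])
  qed auto
  have "fps_nth (theta_fps \<kappa>) k = sum \<kappa> ?S + sum \<kappa> (uminus ` ?S)"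
    unfolding theta_fps_nth S by (rule sum.union_disjoint[OF fin finite_imageI[OF fin]]) auto
  also have "sum \<kappa> (uminus ` ?S) = sum \<kappa> ?S"
    by (subst sum.reindex) (auto simp: inj_on_def even)
  finally have "fps_nth (theta_fps \<kappa>) k = 2 * sum \<kappa> ?S" by simp
  moreover have "sum \<kappa> ?S \<in> \<int>" by (intro Ints_sum int)
  ultimately show ?thesis by blast
qed

text \<open>Half of theta2. Its coefficients are still integers and its leading term is exactly
  \<open>q8\<close>, so all powers of 2 in the forms below become explicit constants.\<close>

abbreviation fls_u :: "complex fls" where "fls_u \<equiv> fls_const (1 / 2) * fps_to_fls (theta_fps chi2)"
abbreviation fls_t3 :: "complex fls" where "fls_t3 \<equiv> fps_to_fls (theta_fps chi3)"
abbreviation fls_t4 :: "complex fls" where "fls_t4 \<equiv> fps_to_fls (theta_fps chi4)"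

lemma chi_Ints: "chi2 n \<in> \<int>" "chi3 n \<in> \<int>" "chi4 n \<in> \<int>"
  by (simp_all add: chi2_def chi3_def chi4_def)

lemma monic_fls_u: "monic_fls 1 fls_u"
proof -
  have "1 / 2 * fps_nth (theta_fps chi2) k \<in> \<int>" for k
  proof (cases "k = 0")
    case False
    then obtain z where "z \<in> \<int>" "fps_nth (theta_fps chi2) k = 2 * z"
      using theta_fps_even_coeffs[of chi2 k] chi_even chi_Ints by auto
    then show ?thesis by simp
  qed (simp add: theta_fps_nth_0 chi2_def)
  moreover have "fps_nth (theta_fps chi2) (nat n) = 0" if "n < 1" for n :: int
    using that by (simp add: theta_fps_nth_0 chi2_def)
  moreover have "fps_nth (theta_fps chi2) 1 = 2" unfolding theta_fps_nth_1 by (simp add: chi2_def)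
  ultimately show ?thesis
    by (auto simp: monic_fls_def integral_fls_def)
qed

text \<open>Congruent to 1 modulo 2. The property passes to fourth powers and makes the sum of two
  such series divisible by 2, which is needed for (theta3^4 + theta4^4) / 2.\<close>

definition odd_fls :: "complex fls \<Rightarrow> bool" where
  "odd_fls F \<longleftrightarrow> (\<exists>A. integral_fls A \<and> F = 1 + fls_const 2 * A)"

lemma odd_fls_mult: "odd_fls F \<Longrightarrow> odd_fls G \<Longrightarrow> odd_fls (F * G)"
proof -
  assume "odd_fls F" "odd_fls G"
  then obtain A B where AB: "integral_fls A" "F = 1 + fls_const 2 * A" "integral_fls B" "G = 1 + fls_const 2 * B"
    unfolding odd_fls_def by blast
  have "F * G = 1 + fls_const 2 * (A + B + fls_const 2 * (A * B))" by (simp add: AB algebra_simps)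
  moreover have "integral_fls (A + B + fls_const 2 * (A * B))"
    by (intro integral_fls_add integral_fls_mult integral_fls_const AB) simp
  ultimately show ?thesis unfolding odd_fls_def by blast
qed

lemma odd_fls_power: "odd_fls F \<Longrightarrow> odd_fls (F ^ n)"
proof (induction n)
  case 0
  show ?case unfolding odd_fls_def by (intro exI[of _ 0]) (simp add: integral_fls_def)
qed (simp add: odd_fls_mult)

lemma odd_monic_theta_fps:
  assumes "\<And>n. \<kappa> (- n) = \<kappa> n" "\<And>n. \<kappa> n \<in> \<int>" "\<kappa> 0 = 1"
  shows "odd_fls (fps_to_fls (theta_fps \<kappa>))" "monic_fls 0 (fps_to_fls (theta_fps \<kappa>))"
proof -
  define A where "A = fls_const (1 / 2) * (fps_to_fls (theta_fps \<kappa>) - 1)"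
  have "fps_to_fls (theta_fps \<kappa>) = 1 + fls_const 2 * A"
    unfolding A_def mult.assoc [symmetric] fls_const_mult_const by simp
  moreover have "integral_fls A"
    unfolding integral_fls_def
  proof
    fix n :: int
    show "fls_nth A n \<in> \<int>"
    proof (cases "n > 0")
      case True
      then obtain z where "z \<in> \<int>" "fps_nth (theta_fps \<kappa>) (nat n) = 2 * z"
        using theta_fps_even_coeffs[of \<kappa>, OF assms(1,2), of "nat n"] by auto
      with True show ?thesis by (simp add: A_def fls_one_nth)
    next
      case False
      then show ?thesis using assms(3) by (cases "n = 0") (simp_all add: A_def fls_one_nth theta_fps_nth_0)
    qed
  qed
  ultimately show odd: "odd_fls (fps_to_fls (theta_fps \<kappa>))" unfolding odd_fls_def by blast
  have "integral_fls (fps_to_fls (theta_fps \<kappa>))"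
    using assms by (auto simp: integral_fls_def theta_fps_nth intro!: Ints_sum)
  then show "monic_fls 0 (fps_to_fls (theta_fps \<kappa>))"
    using assms(3) by (simp add: monic_fls_def theta_fps_nth_0)
qed

lemma odd_fls_t34: "odd_fls fls_t3" "odd_fls fls_t4"
  by (rule odd_monic_theta_fps(1); auto simp: chi_even chi_Ints chi3_def chi4_def)+

lemma monic_fls_t34: "monic_fls 0 fls_t3" "monic_fls 0 fls_t4"
  by (rule odd_monic_theta_fps(2); auto simp: chi_even chi_Ints chi3_def chi4_def)+

lemma monic_fls_even_part: "monic_fls 0 (fls_const (1 / 2) * (fls_t3 ^ 4 + fls_t4 ^ 4))"
proof -
  obtain A B where AB: "integral_fls A" "fls_t3 ^ 4 = 1 + fls_const 2 * A" "integral_fls B" "fls_t4 ^ 4 = 1 + fls_const 2 * B"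
    using odd_fls_power[OF odd_fls_t34(1), of 4] odd_fls_power[OF odd_fls_t34(2), of 4] unfolding odd_fls_def by blast
  have "fls_const (1 / 2) * (fls_t3 ^ 4 + fls_t4 ^ 4) = 1 + (A + B)"
  proof -
    have two: "1 + 1 = (fls_const 2 :: complex fls)" by simp
    have "1 + fls_const 2 * A + (1 + fls_const 2 * B) = (1 + 1) + fls_const 2 * (A + B)"
      by (simp only: distrib_left add_ac)
    also have "\<dots> = fls_const 2 * (1 + (A + B))" unfolding two by (simp only: distrib_left mult_1_right)
    finally show ?thesis unfolding AB by (simp only: mult.assoc [symmetric] fls_const_mult_const) simp
  qed
  moreover have "integral_fls (1 + (A + B))"
    by (intro integral_fls_add AB) (simp add: integral_fls_def fls_one_nth)
  ultimately have i: "integral_fls (fls_const (1 / 2) * (fls_t3 ^ 4 + fls_t4 ^ 4))" by simp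
  have "monic_fls 0 (fls_t3 ^ 4)" "monic_fls 0 (fls_t4 ^ 4)"
    using monic_fls_power[OF monic_fls_t34(1), of 4] monic_fls_power[OF monic_fls_t34(2), of 4] by simp_all
  with i show ?thesis by (simp add: monic_fls_def)
qed

text \<open>This is the expansion of theta4^4 - theta2^4, because 16 u^4 = theta2^4.\<close>

lemma monic_fls_t4_minus_u: "monic_fls 0 (fls_t4 ^ 4 - fls_const 16 * fls_u ^ 4)"
proof -
  have 1: "monic_fls 0 (fls_t4 ^ 4)" using monic_fls_power[OF monic_fls_t34(2), of 4] by simp
  have 2: "monic_fls 4 (fls_u ^ 4)" using monic_fls_power[OF monic_fls_u, of 4] by simp
  have "integral_fls (fls_t4 ^ 4 - fls_const 16 * fls_u ^ 4)"
    by (intro integral_fls_diff integral_fls_mult integral_fls_const monic_fls_integral[OF 1] monic_fls_integral[OF 2]) simp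
  with 1 2 show ?thesis unfolding monic_fls_def by simp
qed

subsection \<open>Explicit forms\<close>

text \<open>
  The arguments \<open>p\<close>, \<open>q\<close>, \<open>s\<close> stand for \<open>\<theta>2\<close>, \<open>\<theta>3\<close>, \<open>\<theta>4\<close>. The three factors raised to the power \<open>k\<close> are
  permuted by the modular group and have poles or zeros only at the cusps, so \<open>k\<close> shifts the pole order.
\<close>

definition trip_a :: "int \<Rightarrow> complex \<Rightarrow> complex \<Rightarrow> complex \<Rightarrow> complex" where
  "trip_a k p q s = (p * s / q) * (p ^ 4 - s ^ 4) * (- (q ^ 8 / (p ^ 4 * s ^ 4))) powi k / 2"

definition trip_b :: "int \<Rightarrow> complex \<Rightarrow> complex \<Rightarrow> complex \<Rightarrow> complex" where
  "trip_b k p q s = (p * q / s) * (- (p ^ 4 + q ^ 4)) * (s ^ 8 / (p ^ 4 * q ^ 4)) powi k / 2"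

definition trip_c :: "int \<Rightarrow> complex \<Rightarrow> complex \<Rightarrow> complex \<Rightarrow> complex" where
  "trip_c k p q s = (q * s / p) * (q ^ 4 + s ^ 4) * (p ^ 8 / (q ^ 4 * s ^ 4)) powi k / 2"

lemma trip_T:
  shows "trip_a k (\<zeta>8 * p) s q = \<zeta>8 * trip_b k p q s" "trip_b k (\<zeta>8 * p) s q = \<zeta>8 * trip_a k p q s"
    "trip_c k (\<zeta>8 * p) s q = inverse \<zeta>8 * trip_c k p q s"
proof -
  have z: "(\<zeta>8 * p) ^ 4 = - (p ^ 4)" "(\<zeta>8 * p) ^ 8 = p ^ 8"
    by (simp_all add: power_mult_distrib zeta8_power4 zeta8_power8)
  show "trip_a k (\<zeta>8 * p) s q = \<zeta>8 * trip_b k p q s" "trip_b k (\<zeta>8 * p) s q = \<zeta>8 * trip_a k p q s"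
    "trip_c k (\<zeta>8 * p) s q = inverse \<zeta>8 * trip_c k p q s"
    unfolding trip_a_def trip_b_def trip_c_def z by (simp_all add: field_simps)
qed

text \<open>Each expression is homogeneous of degree 1 + 4 + 0 in the theta constants, hence r^5.
  The sign in the first rule comes from the antisymmetric factor p^4 - s^4, in the other two from
  the sign that distinguishes the middle factors of \<open>trip_b\<close> and
  \<open>trip_c\<close>.\<close>

lemma trip_S:
  assumes "r \<noteq> 0"
  shows "trip_a k (r * s) (r * q) (r * p) = - (r ^ 5) * trip_a k p q s"
    "trip_b k (r * s) (r * q) (r * p) = - (r ^ 5) * trip_c k p q s"
    "trip_c k (r * s) (r * q) (r * p) = - (r ^ 5) * trip_b k p q s"
proof -
  have e: "(r * x) ^ 8 / ((r * y) ^ 4 * (r * z) ^ 4) = x ^ 8 / (y ^ 4 * z ^ 4)"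
    "(r * x) * (r * y) / (r * z) = r * (x * y / z)"
    "(r * x) ^ 4 - (r * y) ^ 4 = r ^ 4 * (x ^ 4 - y ^ 4)" "(r * x) ^ 4 + (r * y) ^ 4 = r ^ 4 * (x ^ 4 + y ^ 4)" for x y z
  proof -
    have "r ^ 8 = r ^ 4 * r ^ 4" by (simp add: power_add [symmetric])
    then show "(r * x) ^ 8 / ((r * y) ^ 4 * (r * z) ^ 4) = x ^ 8 / (y ^ 4 * z ^ 4)"
      using assms by (simp add: power_mult_distrib mult_ac)
  qed (use assms in \<open>simp_all add: power_mult_distrib algebra_simps\<close>)
  have r5: "r ^ 5 = r * r ^ 4" by (simp add: eval_nat_numeral)
  show "trip_a k (r * s) (r * q) (r * p) = - (r ^ 5) * trip_a k p q s"
    "trip_b k (r * s) (r * q) (r * p) = - (r ^ 5) * trip_c k p q s"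
    "trip_c k (r * s) (r * q) (r * p) = - (r ^ 5) * trip_b k p q s"
    unfolding trip_a_def trip_b_def trip_c_def e r5 by (simp_all add: algebra_simps)
qed

lemma theta_nonzero: "\<tau> \<in> \<H> \<Longrightarrow> \<theta>2 \<tau> \<noteq> 0" "\<tau> \<in> \<H> \<Longrightarrow> \<theta>3 \<tau> \<noteq> 0" "\<tau> \<in> \<H> \<Longrightarrow> \<theta>4 \<tau> \<noteq> 0"
  using theta_prod_nonzero[of \<tau>] unfolding theta_prod_def by simp_all

definition theta_form ::
    "(int \<Rightarrow> complex \<Rightarrow> complex \<Rightarrow> complex \<Rightarrow> complex) \<Rightarrow> complex \<Rightarrow> int \<Rightarrow> complex \<Rightarrow> complex" where
  "theta_form f l k \<tau> = l * f k (\<theta>2 \<tau>) (\<theta>3 \<tau>) (\<theta>4 \<tau>)"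

lemma theta_form_triple: "modular_triple (theta_form trip_a l k) (theta_form trip_b l k) (theta_form trip_c l k)"
  unfolding modular_triple_def
proof
  fix \<tau> assume \<tau>: "\<tau> \<in> \<H>"
  have r: "csqrt (- \<i> * \<tau>) \<noteq> 0" using H_not_0[OF \<tau>] by (simp del: csqrt.simps)
  show "theta_form trip_a l k (\<tau> + 1) = \<zeta>8 * theta_form trip_b l k \<tau> \<and>
      theta_form trip_b l k (\<tau> + 1) = \<zeta>8 * theta_form trip_a l k \<tau> \<and>
      theta_form trip_c l k (\<tau> + 1) = inverse \<zeta>8 * theta_form trip_c l k \<tau> \<and>
      theta_form trip_a l k (- 1 / \<tau>) = - (csqrt (- \<i> * \<tau>) ^ 5) * theta_form trip_a l k \<tau> \<and>
      theta_form trip_b l k (- 1 / \<tau>) = - (csqrt (- \<i> * \<tau>) ^ 5) * theta_form trip_c l k \<tau> \<and>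
      theta_form trip_c l k (- 1 / \<tau>) = - (csqrt (- \<i> * \<tau>) ^ 5) * theta_form trip_b l k \<tau>"
    unfolding theta_form_def theta_T theta_S[OF \<tau>] trip_T trip_S[OF r] by (simp add: mult_ac)
qed

lemma theta_form_holomorphic:
  "theta_form trip_a l k holomorphic_on \<H>" "theta_form trip_b l k holomorphic_on \<H>" "theta_form trip_c l k holomorphic_on \<H>"
proof -
  note h = theta_series_holomorphic[OF chi_bounded(1)] theta_series_holomorphic[OF chi_bounded(2)]
    theta_series_holomorphic[OF chi_bounded(3)]
  show "theta_form trip_a l k holomorphic_on \<H>" "theta_form trip_b l k holomorphic_on \<H>" "theta_form trip_c l k holomorphic_on \<H>"
    unfolding theta_form_def [abs_def] trip_a_def trip_b_def trip_c_def
    by (intro holomorphic_intros h; simp add: theta_nonzero)+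
qed

lemma u_has_expansion: "(\<lambda>\<tau>. 1 / 2 * \<theta>2 \<tau>) has_q8_expansion fls_u"
  by (intro has_q8_expansion_cmult theta_series_has_q8_expansion chi_bounded)

lemma t34_has_expansion: "\<theta>3 has_q8_expansion fls_t3" "\<theta>4 has_q8_expansion fls_t4"
  by (intro theta_series_has_q8_expansion chi_bounded)+

lemma has_q8_expansion_divide:
  "g has_q8_expansion F \<Longrightarrow> h has_q8_expansion G \<Longrightarrow> (\<lambda>\<tau>. g \<tau> / h \<tau>) has_q8_expansion F / G"
  using has_q8_expansion_mult[OF _ has_q8_expansion_inverse, of g F h G]
  by (simp add: field_class.field_divide_inverse)

lemma has_q8_expansion_diff:
  "g has_q8_expansion F \<Longrightarrow> h has_q8_expansion G \<Longrightarrow> (\<lambda>\<tau>. g \<tau> - h \<tau>) has_q8_expansion F - G"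
  using has_q8_expansion_add[OF _ has_q8_expansion_cmult[of h G "- 1"], of g F]
  by simp

lemma theta_quotient_expansions:
  shows "(\<lambda>\<tau>. (1 / 2 * \<theta>2 \<tau>) * \<theta>4 \<tau> / \<theta>3 \<tau> * (\<theta>4 \<tau> ^ 4 - 16 * (1 / 2 * \<theta>2 \<tau>) ^ 4)) has_q8_expansion
      fls_u * fls_t4 / fls_t3 * (fls_t4 ^ 4 - fls_const 16 * fls_u ^ 4)"
    and "(\<lambda>\<tau>. \<theta>3 \<tau> * \<theta>4 \<tau> / (1 / 2 * \<theta>2 \<tau>) * (1 / 2 * (\<theta>3 \<tau> ^ 4 + \<theta>4 \<tau> ^ 4))) has_q8_expansion
      fls_t3 * fls_t4 / fls_u * (fls_const (1 / 2) * (fls_t3 ^ 4 + fls_t4 ^ 4))"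
    and "(\<lambda>\<tau>. (\<theta>3 \<tau> ^ 8 / ((1 / 2 * \<theta>2 \<tau>) ^ 4 * \<theta>4 \<tau> ^ 4)) ^ k) has_q8_expansion
      (fls_t3 ^ 8 / (fls_u ^ 4 * fls_t4 ^ 4)) ^ k"
    and "(\<lambda>\<tau>. ((1 / 2 * \<theta>2 \<tau>) ^ 8 / (\<theta>3 \<tau> ^ 4 * \<theta>4 \<tau> ^ 4)) ^ k) has_q8_expansion
      (fls_u ^ 8 / (fls_t3 ^ 4 * fls_t4 ^ 4)) ^ k"
    and "(\<lambda>\<tau>. ((1 / 2 * \<theta>2 \<tau>) ^ 4 * \<theta>4 \<tau> ^ 4 / \<theta>3 \<tau> ^ 8) ^ k) has_q8_expansion
      (fls_u ^ 4 * fls_t4 ^ 4 / fls_t3 ^ 8) ^ k"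
    and "(\<lambda>\<tau>. (\<theta>3 \<tau> ^ 4 * \<theta>4 \<tau> ^ 4 / (1 / 2 * \<theta>2 \<tau>) ^ 8) ^ k) has_q8_expansion
      (fls_t3 ^ 4 * fls_t4 ^ 4 / fls_u ^ 8) ^ k"
proof -
  note u = u_has_expansion and t3 = t34_has_expansion(1) and t4 = t34_has_expansion(2)
  note mult = has_q8_expansion_mult and div = has_q8_expansion_divide and pow = has_q8_expansion_power
  note u4 = pow[OF u, of 4] and t34 = pow[OF t3, of 4] and t44 = pow[OF t4, of 4]
    and u8 = pow[OF u, of 8] and t38 = pow[OF t3, of 8]
  show "(\<lambda>\<tau>. (1 / 2 * \<theta>2 \<tau>) * \<theta>4 \<tau> / \<theta>3 \<tau> * (\<theta>4 \<tau> ^ 4 - 16 * (1 / 2 * \<theta>2 \<tau>) ^ 4)) has_q8_expansion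
      fls_u * fls_t4 / fls_t3 * (fls_t4 ^ 4 - fls_const 16 * fls_u ^ 4)"
    by (rule mult[OF div[OF mult[OF u t4] t3] has_q8_expansion_diff[OF t44 has_q8_expansion_cmult[OF u4]]])
  show "(\<lambda>\<tau>. \<theta>3 \<tau> * \<theta>4 \<tau> / (1 / 2 * \<theta>2 \<tau>) * (1 / 2 * (\<theta>3 \<tau> ^ 4 + \<theta>4 \<tau> ^ 4))) has_q8_expansion
      fls_t3 * fls_t4 / fls_u * (fls_const (1 / 2) * (fls_t3 ^ 4 + fls_t4 ^ 4))"
    by (rule mult[OF div[OF mult[OF t3 t4] u] has_q8_expansion_cmult[OF has_q8_expansion_add[OF t34 t44]]])
  show "(\<lambda>\<tau>. (\<theta>3 \<tau> ^ 8 / ((1 / 2 * \<theta>2 \<tau>) ^ 4 * \<theta>4 \<tau> ^ 4)) ^ k) has_q8_expansion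
      (fls_t3 ^ 8 / (fls_u ^ 4 * fls_t4 ^ 4)) ^ k"
    by (rule pow[OF div[OF t38 mult[OF u4 t44]]])
  show "(\<lambda>\<tau>. ((1 / 2 * \<theta>2 \<tau>) ^ 8 / (\<theta>3 \<tau> ^ 4 * \<theta>4 \<tau> ^ 4)) ^ k) has_q8_expansion
      (fls_u ^ 8 / (fls_t3 ^ 4 * fls_t4 ^ 4)) ^ k"
    by (rule pow[OF div[OF u8 mult[OF t34 t44]]])
  show "(\<lambda>\<tau>. ((1 / 2 * \<theta>2 \<tau>) ^ 4 * \<theta>4 \<tau> ^ 4 / \<theta>3 \<tau> ^ 8) ^ k) has_q8_expansion
      (fls_u ^ 4 * fls_t4 ^ 4 / fls_t3 ^ 8) ^ k"
    by (rule pow[OF div[OF mult[OF u4 t44] t38]])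
  show "(\<lambda>\<tau>. (\<theta>3 \<tau> ^ 4 * \<theta>4 \<tau> ^ 4 / (1 / 2 * \<theta>2 \<tau>) ^ 8) ^ k) has_q8_expansion
      (fls_t3 ^ 4 * fls_t4 ^ 4 / fls_u ^ 8) ^ k"
    by (rule pow[OF div[OF mult[OF t34 t44] u8]])
qed

lemma half_power: "(1 / 2 * p) ^ 4 = p ^ 4 / 16" "(1 / 2 * p) ^ 8 = p ^ 8 / 256" for p :: complex
  by (simp_all add: power_mult_distrib power_divide)

text \<open>For k > 0 the pole sits in the first and third components, of order 4 k - 1; this serves
  d = 3, 7 modulo 8. Writing theta2 = 2 u, the scaling l = -(-16)^k / 2 is the one that makes twice
  \<open>trip_a\<close> monic, and it turns \<open>trip_c\<close> into an integer multiple of a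
  monic series of order 8 k - 1.\<close>

lemma theta_form_expansion_pos:
  fixes k :: nat
  assumes k: "k > 0"
  defines "l \<equiv> - ((- 16) ^ k) / 2"
  shows "\<exists>A. (\<lambda>\<tau>. 2 * theta_form trip_a l (int k) \<tau>) has_q8_expansion A \<and> monic_fls (1 - 4 * int k) A"
    and "\<exists>C. theta_form trip_c l (int k) has_q8_expansion C \<and> integral_fls C \<and> (\<forall>n\<le>0. fls_nth C n = 0)"
proof -
  let ?A = "fls_u * fls_t4 / fls_t3 * (fls_t4 ^ 4 - fls_const 16 * fls_u ^ 4) * (fls_t3 ^ 8 / (fls_u ^ 4 * fls_t4 ^ 4)) ^ k"
  have "(\<lambda>\<tau>. (1 / 2 * \<theta>2 \<tau>) * \<theta>4 \<tau> / \<theta>3 \<tau> * (\<theta>4 \<tau> ^ 4 - 16 * (1 / 2 * \<theta>2 \<tau>) ^ 4) *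
      (\<theta>3 \<tau> ^ 8 / ((1 / 2 * \<theta>2 \<tau>) ^ 4 * \<theta>4 \<tau> ^ 4)) ^ k) has_q8_expansion ?A"
    by (rule has_q8_expansion_mult[OF theta_quotient_expansions(1,3)])
  moreover have "(1 / 2 * p) * s / q * (s ^ 4 - 16 * (1 / 2 * p) ^ 4) * (q ^ 8 / ((1 / 2 * p) ^ 4 * s ^ 4)) ^ k =
      2 * (l * trip_a (int k) p q s)" for p q s :: complex
  proof -
    have "q ^ 8 / ((1 / 2 * p) ^ 4 * s ^ 4) = - 16 * (- (q ^ 8 / (p ^ 4 * s ^ 4)))" unfolding half_power by simp
    then have Y: "(q ^ 8 / ((1 / 2 * p) ^ 4 * s ^ 4)) ^ k = (- 16) ^ k * (- (q ^ 8 / (p ^ 4 * s ^ 4))) ^ k"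
      by (simp only: power_mult_distrib)
    have d: "s ^ 4 - 16 * (1 / 2 * p) ^ 4 = - (p ^ 4 - s ^ 4)" unfolding half_power by simp
    have "(1 / 2 * p) * s / q * (- x) * (a * y) = 2 * (- a / 2 * (p * s / q * x * y / 2))" for x y a
      by simp
    then show ?thesis unfolding Y d trip_a_def l_def power_int_of_nat .
  qed
  ultimately have "(\<lambda>\<tau>. 2 * theta_form trip_a l (int k) \<tau>) has_q8_expansion ?A"
    unfolding theta_form_def by simp
  moreover have "monic_fls (1 - 4 * int k) ?A"
  proof (rule monic_fls_cong)
    show "monic_fls (1 + 0 - 0 + 0 + int k * (int 8 * 0 - (int 4 * 1 + int 4 * 0))) ?A"
      by (intro monic_fls_mult monic_fls_divide monic_fls_power monic_fls_u monic_fls_t34 monic_fls_t4_minus_u)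
  qed simp
  ultimately show "\<exists>A. (\<lambda>\<tau>. 2 * theta_form trip_a l (int k) \<tau>) has_q8_expansion A \<and> monic_fls (1 - 4 * int k) A"
    by blast
  let ?z = "- ((- 4096) ^ k) / 4 :: complex"
  let ?C = "fls_t3 * fls_t4 / fls_u * (fls_const (1 / 2) * (fls_t3 ^ 4 + fls_t4 ^ 4)) * (fls_u ^ 8 / (fls_t3 ^ 4 * fls_t4 ^ 4)) ^ k"
  have "(\<lambda>\<tau>. ?z * (\<theta>3 \<tau> * \<theta>4 \<tau> / (1 / 2 * \<theta>2 \<tau>) * (1 / 2 * (\<theta>3 \<tau> ^ 4 + \<theta>4 \<tau> ^ 4)) *
      ((1 / 2 * \<theta>2 \<tau>) ^ 8 / (\<theta>3 \<tau> ^ 4 * \<theta>4 \<tau> ^ 4)) ^ k)) has_q8_expansion fls_const ?z * ?C"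
    by (rule has_q8_expansion_cmult[OF has_q8_expansion_mult[OF theta_quotient_expansions(2,4)]])
  moreover have "?z * (q * s / (1 / 2 * p) * (1 / 2 * (q ^ 4 + s ^ 4)) * ((1 / 2 * p) ^ 8 / (q ^ 4 * s ^ 4)) ^ k) =
      l * trip_c (int k) p q s" for p q s :: complex
  proof -
    have X: "(1 / 2 * p) ^ 8 / (q ^ 4 * s ^ 4) = 1 / 256 * (p ^ 8 / (q ^ 4 * s ^ 4))" unfolding half_power by simp
    have "(- 4096 :: complex) ^ k * (1 / 256) ^ k = (- 16) ^ k" unfolding power_mult_distrib [symmetric] by simp
    moreover have "- m / 4 * (q * s / (1 / 2 * p) * (1 / 2 * x) * (w * y)) = - (m * w) / 2 * (q * s / p * x * y / 2)" for x y m w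
      by simp
    moreover have "((1 / 2 * p) ^ 8 / (q ^ 4 * s ^ 4)) ^ k = (1 / 256) ^ k * (p ^ 8 / (q ^ 4 * s ^ 4)) ^ k"
      unfolding X by (rule power_mult_distrib)
    ultimately show ?thesis unfolding trip_c_def l_def power_int_of_nat by (simp only:)
  qed
  ultimately have "theta_form trip_c l (int k) has_q8_expansion fls_const ?z * ?C"
    unfolding theta_form_def [abs_def] by simp
  moreover have "monic_fls (8 * int k - 1) ?C"
  proof (rule monic_fls_cong)
    show "monic_fls (0 + 0 - 1 + 0 + int k * (int 8 * 1 - (int 4 * 0 + int 4 * 0))) ?C"
      by (intro monic_fls_mult monic_fls_divide monic_fls_power monic_fls_u monic_fls_t34 monic_fls_even_part)
  qed simp
  \<comment> \<open>Here k > 0 matters: one factor 4096 absorbs the denominator 4.\<close>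
  moreover have "?z \<in> \<int>"
  proof -
    obtain j where j: "k = Suc j" using k by (cases k) auto
    have "?z = of_int (1024 * (- 4096) ^ j)" by (simp add: j)
    then show ?thesis by (simp only: Ints_of_int)
  qed
  ultimately show "\<exists>C. theta_form trip_c l (int k) has_q8_expansion C \<and> integral_fls C \<and> (\<forall>n\<le>0. fls_nth C n = 0)"
    using k by (intro exI[of _ "fls_const ?z * ?C"] conjI[OF _ integral_const_mult_monic[of _ "8 * int k - 1"]]) (assumption | simp)+
qed

text \<open>The mirror case with exponent -j <= 0: the pole moves to the second component and has
  order 8 j + 1, which serves d = 1 modulo 8. Now l = 2 * 256^j makes \<open>trip_c\<close> monic,
  while twice \<open>trip_a\<close> is -4 (-4096)^j times a monic series of order 1 + 4 j.\<close>

lemma theta_form_expansion_neg: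
  fixes j :: nat
  defines "l \<equiv> 2 * 256 ^ j"
  shows "\<exists>A. (\<lambda>\<tau>. 2 * theta_form trip_a l (- int j) \<tau>) has_q8_expansion A \<and> integral_fls A \<and> (\<forall>n\<le>0. fls_nth A n = 0)"
    and "\<exists>C. theta_form trip_c l (- int j) has_q8_expansion C \<and> monic_fls (- 1 - 8 * int j) C"
proof -
  let ?C = "fls_t3 * fls_t4 / fls_u * (fls_const (1 / 2) * (fls_t3 ^ 4 + fls_t4 ^ 4)) * (fls_t3 ^ 4 * fls_t4 ^ 4 / fls_u ^ 8) ^ j"
  have "(\<lambda>\<tau>. \<theta>3 \<tau> * \<theta>4 \<tau> / (1 / 2 * \<theta>2 \<tau>) * (1 / 2 * (\<theta>3 \<tau> ^ 4 + \<theta>4 \<tau> ^ 4)) *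
      (\<theta>3 \<tau> ^ 4 * \<theta>4 \<tau> ^ 4 / (1 / 2 * \<theta>2 \<tau>) ^ 8) ^ j) has_q8_expansion ?C"
    by (rule has_q8_expansion_mult[OF theta_quotient_expansions(2,6)])
  moreover have "q * s / (1 / 2 * p) * (1 / 2 * (q ^ 4 + s ^ 4)) * (q ^ 4 * s ^ 4 / (1 / 2 * p) ^ 8) ^ j =
      l * trip_c (- int j) p q s" for p q s :: complex
  proof -
    have "q ^ 4 * s ^ 4 / (1 / 2 * p) ^ 8 = 256 * inverse (p ^ 8 / (q ^ 4 * s ^ 4))"
      unfolding half_power by simp
    then have e: "(q ^ 4 * s ^ 4 / (1 / 2 * p) ^ 8) ^ j = 256 ^ j * (p ^ 8 / (q ^ 4 * s ^ 4)) powi (- int j)"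
      by (simp only: power_mult_distrib power_int_minus power_int_of_nat power_inverse)
    have "q * s / (1 / 2 * p) * (1 / 2 * x) * (a * y) = 2 * a * (q * s / p * x * y / 2)" for x y a
      by simp
    then show ?thesis unfolding e trip_c_def l_def .
  qed
  ultimately have "theta_form trip_c l (- int j) has_q8_expansion ?C"
    unfolding theta_form_def [abs_def] by simp
  moreover have "monic_fls (- 1 - 8 * int j) ?C"
  proof (rule monic_fls_cong)
    show "monic_fls (0 + 0 - 1 + 0 + int j * (int 4 * 0 + int 4 * 0 - int 8 * 1)) ?C"
      by (intro monic_fls_mult monic_fls_divide monic_fls_power monic_fls_u monic_fls_t34 monic_fls_even_part)
  qed simp
  ultimately show "\<exists>C. theta_form trip_c l (- int j) has_q8_expansion C \<and> monic_fls (- 1 - 8 * int j) C"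
    by blast
  let ?z = "- (4 * (- 4096) ^ j) :: complex"
  let ?A = "fls_u * fls_t4 / fls_t3 * (fls_t4 ^ 4 - fls_const 16 * fls_u ^ 4) * (fls_u ^ 4 * fls_t4 ^ 4 / fls_t3 ^ 8) ^ j"
  have "(\<lambda>\<tau>. ?z * ((1 / 2 * \<theta>2 \<tau>) * \<theta>4 \<tau> / \<theta>3 \<tau> * (\<theta>4 \<tau> ^ 4 - 16 * (1 / 2 * \<theta>2 \<tau>) ^ 4) *
      ((1 / 2 * \<theta>2 \<tau>) ^ 4 * \<theta>4 \<tau> ^ 4 / \<theta>3 \<tau> ^ 8) ^ j)) has_q8_expansion fls_const ?z * ?A"
    by (rule has_q8_expansion_cmult[OF has_q8_expansion_mult[OF theta_quotient_expansions(1,5)]])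
  moreover have "?z * ((1 / 2 * p) * s / q * (s ^ 4 - 16 * (1 / 2 * p) ^ 4) * ((1 / 2 * p) ^ 4 * s ^ 4 / q ^ 8) ^ j) =
      2 * (l * trip_a (- int j) p q s)" for p q s :: complex
  proof -
    have "(- 4096) * ((1 / 2 * p) ^ 4 * s ^ 4 / q ^ 8) = 256 * inverse (- (q ^ 8 / (p ^ 4 * s ^ 4)))"
      unfolding half_power by simp
    then have "((- 4096) * ((1 / 2 * p) ^ 4 * s ^ 4 / q ^ 8)) ^ j = (256 * inverse (- (q ^ 8 / (p ^ 4 * s ^ 4)))) ^ j"
      by (rule arg_cong)
    then have e: "(- 4096) ^ j * ((1 / 2 * p) ^ 4 * s ^ 4 / q ^ 8) ^ j = 256 ^ j * (- (q ^ 8 / (p ^ 4 * s ^ 4))) powi (- int j)"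
      unfolding power_mult_distrib [of "- 4096"] power_mult_distrib [of 256] power_int_minus power_int_of_nat power_inverse .
    have d: "s ^ 4 - 16 * (1 / 2 * p) ^ 4 = - (p ^ 4 - s ^ 4)" unfolding half_power by simp
    have g: "- (4 * a) * ((1 / 2 * p) * s / q * (- x) * y) = 2 * (p * s / q * x) * (a * y)" for a x y by simp
    have "2 * (p * s / q * x) * (a * y) = 2 * (2 * a * (p * s / q * x * y / 2))" for a x y by simp
    then show ?thesis unfolding d g e trip_a_def l_def .
  qed
  ultimately have "(\<lambda>\<tau>. 2 * theta_form trip_a l (- int j) \<tau>) has_q8_expansion fls_const ?z * ?A"
    unfolding theta_form_def by simp
  moreover have "monic_fls (1 + 4 * int j) ?A"
  proof (rule monic_fls_cong)
    show "monic_fls (1 + 0 - 0 + 0 + int j * (int 4 * 1 + int 4 * 0 - int 8 * 0)) ?A"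
      by (intro monic_fls_mult monic_fls_divide monic_fls_power monic_fls_u monic_fls_t34 monic_fls_t4_minus_u)
  qed simp
  moreover have "?z \<in> \<int>" by (auto intro!: Ints_minus Ints_mult Ints_power)
  ultimately show "\<exists>A. (\<lambda>\<tau>. 2 * theta_form trip_a l (- int j) \<tau>) has_q8_expansion A \<and> integral_fls A \<and> (\<forall>n\<le>0. fls_nth A n = 0)"
    by (intro exI[of _ "fls_const ?z * ?A"] conjI[OF _ integral_const_mult_monic[of _ "1 + 4 * int j"]]) (assumption | simp)+
qed

lemma modular_triple_cong:
  assumes "\<And>\<tau>. \<tau> \<in> \<H> \<Longrightarrow> a \<tau> = a' \<tau>" "\<And>\<tau>. \<tau> \<in> \<H> \<Longrightarrow> b \<tau> = b' \<tau>" "\<And>\<tau>. \<tau> \<in> \<H> \<Longrightarrow> c \<tau> = c' \<tau>"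
    and "modular_triple a b c"
  shows "modular_triple a' b' c'"
  unfolding modular_triple_def
proof
  fix \<tau> assume \<tau>: "\<tau> \<in> \<H>"
  then have \<tau>1: "\<tau> + 1 \<in> \<H>" by simp
  note e = assms(1-3)[OF \<tau>, symmetric] assms(1-3)[OF \<tau>1, symmetric]
    assms(1-3)[OF minus_inverse_in_H[OF \<tau>], symmetric]
  show "a' (\<tau> + 1) = \<zeta>8 * b' \<tau> \<and> b' (\<tau> + 1) = \<zeta>8 * a' \<tau> \<and> c' (\<tau> + 1) = inverse \<zeta>8 * c' \<tau> \<and>
     a' (- 1 / \<tau>) = - (csqrt (- \<i> * \<tau>) ^ 5) * a' \<tau> \<and>
     b' (- 1 / \<tau>) = - (csqrt (- \<i> * \<tau>) ^ 5) * c' \<tau> \<and>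
     c' (- 1 / \<tau>) = - (csqrt (- \<i> * \<tau>) ^ 5) * b' \<tau>"
    unfolding e using assms(4) \<tau> unfolding modular_triple_def by (rule bspec)
qed

lemma eexp_eighth:
  shows "m mod 8 = 1 \<Longrightarrow> eexp (of_int m / 8) = \<zeta>8" "m mod 8 = 5 \<Longrightarrow> eexp (of_int m / 8) = - \<zeta>8"
proof -
  have "eexp (of_int m / 8) = eexp (of_int (m mod 8) / 8)"
    using eexp_cong_int_div[of 8 m "m mod 8"] by (simp add: cong_def)
  moreover have "eexp (5 / 8) = - \<zeta>8"
    using zeta8_power_reduce by (simp add: zeta8_eexp eexp_power)
  ultimately show "m mod 8 = 1 \<Longrightarrow> eexp (of_int m / 8) = \<zeta>8" "m mod 8 = 5 \<Longrightarrow> eexp (of_int m / 8) = - \<zeta>8"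
    by (simp_all add: zeta8_eexp)
qed

section \<open>Construction of the basis over the integers\<close>

context weil_representation
begin

lemma weak_form_of_triple:
  assumes mt: "modular_triple a b c"
    and s: "(\<lambda>\<tau>. a \<tau> + b \<tau>) has_q8_series c1" "c has_q8_series c2" "(\<lambda>\<tau>. a \<tau> - b \<tau>) has_q8_series c3"
  shows "\<exists>G\<in>weak_forms \<rho>. \<forall>m. fourier_coeff G m =
    (if m mod 8 = 1 then c1 m else if m mod 8 = 7 then c2 m else if m mod 8 = 5 then c3 m else 0)"
proof -
  define G :: "complex \<Rightarrow> complex^3" where "G = on_\<H> (\<lambda>\<tau>. vector [a \<tau> + b \<tau>, c \<tau>, a \<tau> - b \<tau>])"
  have G1: "a \<tau> + b \<tau> = G \<tau> $ 1" and G2: "c \<tau> = G \<tau> $ 2" and G3: "a \<tau> - b \<tau> = G \<tau> $ 3" if "\<tau> \<in> \<H>" for \<tau>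
    using that by (simp_all add: G_def)
  note S = has_q8_series_cong[OF G1 refl s(1)] has_q8_series_cong[OF G2 refl s(2)] has_q8_series_cong[OF G3 refl s(3)]
  have "G = on_\<H> G" by (simp add: G_def on_\<H>_def fun_eq_iff)
  moreover have "(\<lambda>\<tau>. G \<tau> $ i) holomorphic_on \<H> \<and> meromorphic_at_cusp (\<lambda>\<tau>. G \<tau> $ i)" for i
  proof -
    have *: "g holomorphic_on \<H> \<and> meromorphic_at_cusp g" if "g has_q8_series k" for g k
      using has_q8_series_imp_expansion[OF that] unfolding meromorphic_at_cusp_iff by blast
    show ?thesis using exhaust_3[of i] *[OF S(1)] *[OF S(2)] *[OF S(3)] by (elim disjE) simp_all
  qed
  moreover have "modular_triple (\<lambda>\<tau>. (G \<tau> $ 1 + G \<tau> $ 3) / 2) (\<lambda>\<tau>. (G \<tau> $ 1 - G \<tau> $ 3) / 2) (\<lambda>\<tau>. G \<tau> $ 2)"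
    by (rule modular_triple_cong[OF _ _ _ mt]) (simp_all add: G_def)
  ultimately have G: "G \<in> weak_forms \<rho>" unfolding weak_forms_iff by blast
  show ?thesis by (rule bexI[OF _ G], intro allI, rule fourier_coeff_eqI[OF G S])
qed

text \<open>By the rule for T, b is \<zeta>8^-1 times a translated by 1. At exponents 1 modulo 8
  this makes the coefficients of b equal to those of a, at exponents 5 modulo 8 opposite. So a + b
  and a - b take their respective classes from the single series of 2 a, where no denominators
  remain.\<close>

lemma weak_form_of_expansions:
  assumes mt: "modular_triple a b c"
    and hol: "a holomorphic_on \<H>" "c holomorphic_on \<H>"
    and A: "(\<lambda>\<tau>. 2 * a \<tau>) has_q8_expansion A" and C: "c has_q8_expansion C"
  shows "\<exists>G\<in>weak_forms \<rho>. \<forall>m. fourier_coeff G m =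
    (if m mod 8 \<in> {1, 5} then fls_nth A m else if m mod 8 = 7 then fls_nth C m else 0)"
proof -
  have h2: "(\<lambda>\<tau>. 2 * a \<tau>) holomorphic_on \<H>" by (intro holomorphic_intros hol)
  note sA = has_q8_expansion_imp_series[OF h2 A] and sC = has_q8_expansion_imp_series[OF hol(2) C]
  have b: "b \<tau> = inverse \<zeta>8 * a (\<tau> + 1)" if "\<tau> \<in> \<H>" for \<tau>
    using mt that unfolding modular_triple_def by simp
  have sB: "(\<lambda>\<tau>. x * (2 * a \<tau>) + y * (2 * a (\<tau> + of_real 1))) has_q8_series
      (\<lambda>m. x * fls_nth A m + y * (eexp (of_int m * of_real 1 / 8) * fls_nth A m))" for x y
    by (rule has_q8_series_add[OF has_q8_series_cmult[OF sA] has_q8_series_cmult[OF has_q8_series_shift[OF sA]]])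
  let ?c = "\<lambda>y m. 1 / 2 * fls_nth A m + y * (eexp (of_int m * of_real 1 / 8) * fls_nth A m)"
  have "(\<lambda>\<tau>. a \<tau> + b \<tau>) has_q8_series ?c (inverse \<zeta>8 / 2)"
    by (rule has_q8_series_cong[OF _ refl sB]) (simp add: b)
  moreover have "(\<lambda>\<tau>. a \<tau> - b \<tau>) has_q8_series ?c (- inverse \<zeta>8 / 2)"
    by (rule has_q8_series_cong[OF _ refl sB]) (simp add: b)
  ultimately obtain G where "G \<in> weak_forms \<rho>" and G: "\<And>m. fourier_coeff G m =
      (if m mod 8 = 1 then ?c (inverse \<zeta>8 / 2) m else if m mod 8 = 7 then fls_nth C m
       else if m mod 8 = 5 then ?c (- inverse \<zeta>8 / 2) m else 0)"
    using weak_form_of_triple[OF mt _ sC] by blast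
  moreover have "fourier_coeff G m =
    (if m mod 8 \<in> {1, 5} then fls_nth A m else if m mod 8 = 7 then fls_nth C m else 0)" for m
  proof -
    have "\<zeta>8 \<noteq> 0" by (simp add: \<zeta>8_def)
    then show ?thesis unfolding G by (simp add: eexp_eighth field_simps)
  qed
  ultimately show ?thesis by blast
qed

lemma weak_forms_lincomb:
  assumes F: "F \<in> weak_forms \<rho>" and G: "G \<in> weak_forms \<rho>"
  shows "(\<lambda>\<tau>. x *s F \<tau> + y *s G \<tau>) \<in> weak_forms \<rho>"
    and "fourier_coeff (\<lambda>\<tau>. x *s F \<tau> + y *s G \<tau>) m = x * fourier_coeff F m + y * fourier_coeff G m"
proof -
  let ?H = "\<lambda>\<tau>. x *s F \<tau> + y *s G \<tau>"
  have "F = on_\<H> F" "G = on_\<H> G" using F G unfolding weak_forms_def by blast+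
  note on = this[THEN fun_cong, unfolded on_\<H>_def]
  have onH: "?H = on_\<H> ?H"
    unfolding on_\<H>_def
  proof (rule ext)
    show "?H \<tau> = (if \<tau> \<in> \<H> then ?H \<tau> else 0)" for \<tau>
      using on[of \<tau>] by (cases "\<tau> \<in> \<H>") simp_all
  qed
  have comp: "?H \<tau> $ i = x * F \<tau> $ i + y * G \<tau> $ i" for \<tau> i by simp
  have "(\<lambda>\<tau>. ?H \<tau> $ i) holomorphic_on \<H> \<and> meromorphic_at_cusp (\<lambda>\<tau>. ?H \<tau> $ i)" for i
  proof
    have h: "(\<lambda>\<tau>. F \<tau> $ i) holomorphic_on \<H>" "(\<lambda>\<tau>. G \<tau> $ i) holomorphic_on \<H>"
      using F G unfolding weak_forms_def by blast+
    show "(\<lambda>\<tau>. ?H \<tau> $ i) holomorphic_on \<H>" unfolding comp by (intro holomorphic_intros h)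
    obtain A B where "(\<lambda>\<tau>. F \<tau> $ i) has_q8_expansion A" "(\<lambda>\<tau>. G \<tau> $ i) has_q8_expansion B"
      using F G unfolding weak_forms_def meromorphic_at_cusp_iff by blast
    then show "meromorphic_at_cusp (\<lambda>\<tau>. ?H \<tau> $ i)"
      unfolding meromorphic_at_cusp_iff comp using has_q8_expansion_add has_q8_expansion_cmult by blast
  qed
  moreover have "(\<phi> \<tau> powi (-5)) *s ?H (moebius_act \<gamma> \<tau>) = \<rho> (\<gamma>, \<phi>) *v ?H \<tau>"
    if "(\<gamma>, \<phi>) \<in> carrier Mp2Z" "\<tau> \<in> \<H>" for \<gamma> \<phi> \<tau>
  proof -
    have "(\<phi> \<tau> powi (-5)) *s F (moebius_act \<gamma> \<tau>) = \<rho> (\<gamma>, \<phi>) *v F \<tau>"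
      "(\<phi> \<tau> powi (-5)) *s G (moebius_act \<gamma> \<tau>) = \<rho> (\<gamma>, \<phi>) *v G \<tau>"
      using F G that unfolding weak_forms_def by blast+
    note e = this[symmetric]
    show ?thesis unfolding matrix_vector_right_distrib matrix_vector_mult_scale e
      by (simp add: vec_eq_iff algebra_simps)
  qed
  ultimately show H: "?H \<in> weak_forms \<rho>" unfolding weak_forms_def using onH by blast
  have S: "(\<lambda>\<tau>. ?H \<tau> $ i) has_q8_series (\<lambda>m. x * c m + y * d m)"
    if "(\<lambda>\<tau>. F \<tau> $ i) has_q8_series c" "(\<lambda>\<tau>. G \<tau> $ i) has_q8_series d" for i c d
    unfolding comp by (intro has_q8_series_add has_q8_series_cmult that)
  note f = fourier_series[OF F] and g = fourier_series[OF G]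
  show "fourier_coeff ?H m = x * fourier_coeff F m + y * fourier_coeff G m"
    unfolding fourier_coeff_eqI[OF H S[OF f(1) g(1)] S[OF f(2) g(2)] S[OF f(3) g(3)]]
    by (auto simp: fourier_coeff_other)
qed

text \<open>A difference with no negative exponents has no exponent 0 either, since 0 is in none of
  the three classes modulo 8.\<close>

lemma weak_forms_eqI:
  assumes F: "F \<in> weak_forms \<rho>" and G: "G \<in> weak_forms \<rho>"
    and eq: "\<And>m. m < 0 \<Longrightarrow> fourier_coeff F m = fourier_coeff G m"
  shows "F = G"
proof -
  note D = weak_forms_lincomb[OF F G, of 1 "- 1"]
  have "(\<lambda>\<tau>. 1 *s F \<tau> + (- 1) *s G \<tau>) = (\<lambda>_. 0)"
  proof (rule weak_forms_eq_0[OF D(1)])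
    fix m :: int assume "m \<le> 0"
    then show "fourier_coeff (\<lambda>\<tau>. 1 *s F \<tau> + (- 1) *s G \<tau>) m = 0"
      unfolding D(2) using eq[of m] by (cases "m = 0") (simp_all add: fourier_coeff_other)
  qed
  then have "1 *s F \<tau> + (- 1) *s G \<tau> = 0" for \<tau> by (rule fun_cong)
  then show ?thesis by (auto simp: fun_eq_iff vec_eq_iff)
qed

lemma zero_weak_form: "(\<lambda>_. 0) \<in> weak_forms \<rho>" "fourier_coeff (\<lambda>_. 0) m = 0"
proof -
  have "\<exists>G\<in>weak_forms \<rho>. \<forall>m. fourier_coeff G m =
      (if m mod 8 = 1 then 0 else if m mod 8 = 7 then 0 else if m mod 8 = 5 then 0 else 0)"
    by (rule weak_form_of_triple[where a = "\<lambda>_. 0" and b = "\<lambda>_. 0" and c = "\<lambda>_. 0"])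
      (use has_q8_series_0 in \<open>simp_all add: modular_triple_def\<close>)
  then obtain G where G: "G \<in> weak_forms \<rho>" and c: "\<And>m. fourier_coeff G m = 0" by auto
  with weak_forms_eq_0[OF G] show "(\<lambda>_. 0) \<in> weak_forms \<rho>" "fourier_coeff (\<lambda>_. 0) m = 0" by auto
qed

lemma weak_forms_sum:
  assumes "finite I" "\<And>i. i \<in> I \<Longrightarrow> f i \<in> weak_forms \<rho>"
  shows "(\<Sum>i\<in>I. int_scale (z i) (f i)) \<in> weak_forms \<rho>"
    and "fourier_coeff (\<Sum>i\<in>I. int_scale (z i) (f i)) m = (\<Sum>i\<in>I. of_int (z i) * fourier_coeff (f i) m)"
proof -
  from assms have "(\<Sum>i\<in>I. int_scale (z i) (f i)) \<in> weak_forms \<rho> \<and>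
    (\<forall>m. fourier_coeff (\<Sum>i\<in>I. int_scale (z i) (f i)) m = (\<Sum>i\<in>I. of_int (z i) * fourier_coeff (f i) m))"
  proof (induction I rule: finite_induct)
    case empty
    have "(0 :: complex \<Rightarrow> complex^3) = (\<lambda>_. 0)" by (rule ext) simp
    then show ?case using zero_weak_form by simp
  next
    case (insert i I)
    define s where "s = (\<Sum>i\<in>I. int_scale (z i) (f i))"
    have "int_scale (z i) (f i) + s = (\<lambda>\<tau>. of_int (z i) *s f i \<tau> + 1 *s s \<tau>)"
      by (rule ext) (simp add: int_scale_def)
    with insert weak_forms_lincomb[of "f i" s "of_int (z i)" 1] show ?case
      by (simp add: s_def[symmetric])
  qed
  then show "(\<Sum>i\<in>I. int_scale (z i) (f i)) \<in> weak_forms \<rho>"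
    "fourier_coeff (\<Sum>i\<in>I. int_scale (z i) (f i)) m = (\<Sum>i\<in>I. of_int (z i) * fourier_coeff (f i) m)" by blast+
qed

lemma integral_subspace: "zmod.subspace (integral_weak_forms \<rho>)"
proof (rule zmod.subspaceI)
  have z: "(0 :: complex \<Rightarrow> complex^3) = (\<lambda>_. 0)" by (rule ext) simp
  show "0 \<in> integral_weak_forms \<rho>" unfolding z integral_weak_forms_def by (simp add: zero_weak_form)
next
  fix F G assume "F \<in> integral_weak_forms \<rho>" "G \<in> integral_weak_forms \<rho>"
  moreover have "F + G = (\<lambda>\<tau>. 1 *s F \<tau> + 1 *s G \<tau>)" by (rule ext) simp
  ultimately show "F + G \<in> integral_weak_forms \<rho>"
    using weak_forms_lincomb[of F G 1 1] by (simp add: integral_weak_forms_def)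
next
  fix k F assume "F \<in> integral_weak_forms \<rho>"
  moreover have "int_scale k F = (\<lambda>\<tau>. of_int k *s F \<tau> + 0 *s F \<tau>)" by (rule ext) (simp add: int_scale_def)
  ultimately show "int_scale k F \<in> integral_weak_forms \<rho>"
    using weak_forms_lincomb[of F F "of_int k" 0] by (simp add: integral_weak_forms_def)
qed

text \<open>The two families of theta products cover all indices: d = 8 j + 1 through the second
  component, since -d is 7 modulo 8, and d = 4 k - 1 through the first or third, since -d is then 5
  or 1. The component that carries no pole has only positive exponents, so the leading term is alone
  at the bottom.\<close>

lemma exists_leading_form:
  assumes d: "d \<in> admissible"
  shows "\<exists>F\<in>integral_weak_forms \<rho>. fourier_coeff F (- int d) = 1 \<and> (\<forall>m. m < - int d \<longrightarrow> fourier_coeff F m = 0)"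
proof (cases "d mod 8 = 1")
  case True
  define j where "j = d div 8"
  have dj: "- 1 - 8 * int j = - int d" using True unfolding j_def by presburger
  have dmod: "(- 1 - 8 * int j) mod 8 = 7" by presburger
  obtain A C where A: "(\<lambda>\<tau>. 2 * theta_form trip_a (2 * 256 ^ j) (- int j) \<tau>) has_q8_expansion A" "integral_fls A"
      "\<forall>n\<le>0. fls_nth A n = 0"
    and C: "theta_form trip_c (2 * 256 ^ j) (- int j) has_q8_expansion C" "monic_fls (- 1 - 8 * int j) C"
    using theta_form_expansion_neg[of j] by blast
  obtain F where F: "F \<in> weak_forms \<rho>" "\<And>m. fourier_coeff F m =
      (if m mod 8 \<in> {1, 5} then fls_nth A m else if m mod 8 = 7 then fls_nth C m else 0)"
    using weak_form_of_expansions[OF theta_form_triple theta_form_holomorphic(1,3) A(1) C(1)] by blast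
  have "F \<in> integral_weak_forms \<rho>"
    using F A(2) C(2) by (simp add: integral_weak_forms_def integral_fls_def monic_fls_def)
  moreover have "fourier_coeff F (- 1 - 8 * int j) = 1"
    unfolding F(2) dmod using C(2) by (simp add: monic_fls_def)
  moreover have "fourier_coeff F m = 0" if "m < - 1 - 8 * int j" for m
    unfolding F(2) using C(2) A(3) that by (simp add: monic_fls_def)
  ultimately show ?thesis unfolding dj by blast
next
  case False
  define k where "k = (d + 1) div 4"
  have d37: "d mod 8 = 3 \<or> d mod 8 = 7" using d False by (auto simp: admissible_def)
  then have dk: "1 - 4 * int k = - int d" unfolding k_def by presburger
  have k: "k > 0" using d37 unfolding k_def by presburger
  have dmod: "(1 - 4 * int k) mod 8 \<in> {1, 5}"
  proof -
    have "(1 - 4 * int k) mod 8 = 1 \<or> (1 - 4 * int k) mod 8 = 5" by presburger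
    then show ?thesis by blast
  qed
  obtain A C where A: "(\<lambda>\<tau>. 2 * theta_form trip_a (- ((- 16) ^ k) / 2) (int k) \<tau>) has_q8_expansion A"
      "monic_fls (1 - 4 * int k) A"
    and C: "theta_form trip_c (- ((- 16) ^ k) / 2) (int k) has_q8_expansion C" "integral_fls C" "\<forall>n\<le>0. fls_nth C n = 0"
    using theta_form_expansion_pos[OF k] by blast
  obtain F where F: "F \<in> weak_forms \<rho>" "\<And>m. fourier_coeff F m =
      (if m mod 8 \<in> {1, 5} then fls_nth A m else if m mod 8 = 7 then fls_nth C m else 0)"
    using weak_form_of_expansions[OF theta_form_triple theta_form_holomorphic(1,3) A(1) C(1)] by blast
  have "F \<in> integral_weak_forms \<rho>"
    using F A(2) C(2) by (simp add: integral_weak_forms_def integral_fls_def monic_fls_def)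
  moreover have "fourier_coeff F (1 - 4 * int k) = 1"
    unfolding F(2) using A(2) dmod by (simp add: monic_fls_def)
  moreover have "fourier_coeff F m = 0" if "m < 1 - 4 * int k" for m
    unfolding F(2) using C(3) A(2) that k by (simp add: monic_fls_def)
  ultimately show ?thesis unfolding dk by blast
qed

lemma admissible_neg_exponent:
  assumes "m < 0" "m mod 8 \<in> {1, 5, 7}"
  obtains d where "d \<in> admissible" "m = - int d"
proof -
  obtain d where m: "m = - int d" using assms(1) by (cases m rule: int_cases4) auto
  have "m mod 8 = 1 \<or> m mod 8 = 5 \<or> m mod 8 = 7" using assms(2) by blast
  then have "(- m) mod 8 = 7 \<or> (- m) mod 8 = 3 \<or> (- m) mod 8 = 1" by (auto simp: zmod_zminus1_eq_if)
  then have "int (d mod 8) = 7 \<or> int (d mod 8) = 3 \<or> int (d mod 8) = 1" by (simp add: m zmod_int)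
  then have "d \<in> admissible" using assms(1) m by (auto simp: admissible_def)
  with m that show thesis by blast
qed

text \<open>Triangular elimination by strong induction. The forms for smaller indices have a single
  negative exponent each, so one simultaneous subtraction clears all exponents between -d and 0
  without disturbing the others. The multipliers are coefficients of an integral form, so
  integrality is kept.\<close>

lemma exists_basis_form:
  assumes "d \<in> admissible"
  shows "\<exists>F\<in>integral_weak_forms \<rho>. \<forall>m<0. fourier_coeff F m = (if m = - int d then 1 else 0)"
  using assms
proof (induction d rule: less_induct)
  case (less d)
  define D where "D = {e \<in> admissible. e < d}"
  have "\<forall>e\<in>D. \<exists>F. F \<in> integral_weak_forms \<rho> \<and> (\<forall>m<0. fourier_coeff F m = (if m = - int e then 1 else 0))"
    using less.IH unfolding D_def by blast
  then obtain g where g: "\<And>e. e \<in> D \<Longrightarrow> g e \<in> integral_weak_forms \<rho>"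
      "\<And>e m. e \<in> D \<Longrightarrow> m < 0 \<Longrightarrow> fourier_coeff (g e) m = (if m = - int e then 1 else 0)"
    by (metis (no_types, lifting) bchoice)
  obtain F where F: "F \<in> integral_weak_forms \<rho>" "fourier_coeff F (- int d) = 1" "\<And>m. m < - int d \<Longrightarrow> fourier_coeff F m = 0"
    using exists_leading_form[OF less.prems] by blast
  have "\<exists>z. fourier_coeff F m = of_int z" for m
    using F(1) by (auto simp: integral_weak_forms_def elim: Ints_cases)
  then obtain z where z: "\<And>m. fourier_coeff F m = of_int (z m)" by metis
  have fin: "finite D" by (simp add: D_def)
  let ?s = "\<Sum>e\<in>D. int_scale (z (- int e)) (g e)"
  have gw: "g e \<in> weak_forms \<rho>" if "e \<in> D" for e using g(1)[OF that] by (simp add: integral_weak_forms_def)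
  have Fw: "F \<in> weak_forms \<rho>" using F(1) by (simp add: integral_weak_forms_def)
  have s: "?s \<in> weak_forms \<rho>" "fourier_coeff ?s m = (\<Sum>e\<in>D. of_int (z (- int e)) * fourier_coeff (g e) m)" for m
    by (rule weak_forms_sum(1)[OF fin gw], assumption) (rule weak_forms_sum(2)[OF fin gw], assumption)
  let ?H = "F - ?s"
  have "?H \<in> integral_weak_forms \<rho>"
    by (intro zmod.subspace_diff[OF integral_subspace] F(1) zmod.subspace_sum[OF integral_subspace]
        zmod.subspace_scale[OF integral_subspace] g(1))
  moreover have "fourier_coeff ?H m = (if m = - int d then 1 else 0)" if m: "m < 0" for m
  proof (cases "m mod 8 \<in> {1, 5, 7}")
    case True
    from admissible_neg_exponent[OF m True] obtain e where e: "e \<in> admissible" "m = - int e" .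
    have H: "?H = (\<lambda>\<tau>. 1 *s F \<tau> + (- 1) *s ?s \<tau>)" by (rule ext) simp
    have "(\<Sum>i\<in>D. of_int (z (- int i)) * fourier_coeff (g i) m) = (\<Sum>i\<in>D. if i = e then fourier_coeff F m else 0)"
      by (rule sum.cong) (use g(2) m in \<open>auto simp: e z\<close>)
    also have "\<dots> = (if e \<in> D then fourier_coeff F m else 0)" by (simp add: fin)
    finally have "fourier_coeff ?H m = fourier_coeff F m - (if e \<in> D then fourier_coeff F m else 0)"
      unfolding H weak_forms_lincomb(2)[OF Fw s(1)] s(2) by simp
    then show ?thesis using F(2,3) e unfolding D_def by (cases e d rule: linorder_cases) auto
  next
    case False
    have "(- int d) mod 8 \<in> {1, 5, 7}"
    proof -
      have "d mod 8 = 1 \<or> d mod 8 = 3 \<or> d mod 8 = 7" using less.prems by (auto simp: admissible_def)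
      then have "int d mod 8 = 1 \<or> int d mod 8 = 3 \<or> int d mod 8 = 7" by presburger
      then show ?thesis by (auto simp: zmod_zminus1_eq_if)
    qed
    with False show ?thesis by (auto simp: fourier_coeff_other)
  qed
  ultimately show ?case by blast
qed

definition basis_form :: "nat \<Rightarrow> complex \<Rightarrow> complex^3" where
  "basis_form d = (SOME F. F \<in> integral_weak_forms \<rho> \<and> (\<forall>m<0. fourier_coeff F m = (if m = - int d then 1 else 0)))"

lemma basis_form:
  assumes "d \<in> admissible"
  shows basis_form_integral: "basis_form d \<in> integral_weak_forms \<rho>"
    and basis_form_weak: "basis_form d \<in> weak_forms \<rho>"
    and basis_form_coeff: "m < 0 \<Longrightarrow> fourier_coeff (basis_form d) m = (if m = - int d then 1 else 0)"
proof -
  have "\<exists>F. F \<in> integral_weak_forms \<rho> \<and> (\<forall>m<0. fourier_coeff F m = (if m = - int d then 1 else 0))"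
    using exists_basis_form[OF assms] by blast
  from someI_ex[OF this]
  have "basis_form d \<in> integral_weak_forms \<rho> \<and> (\<forall>m<0. fourier_coeff (basis_form d) m = (if m = - int d then 1 else 0))"
    unfolding basis_form_def .
  then show "basis_form d \<in> integral_weak_forms \<rho>" "basis_form d \<in> weak_forms \<rho>"
    "m < 0 \<Longrightarrow> fourier_coeff (basis_form d) m = (if m = - int d then 1 else 0)"
    by (simp_all add: integral_weak_forms_def)
qed

lemma basis_form_characterization:
  assumes d: "d \<in> admissible"
  shows "F \<in> integral_weak_forms \<rho> \<and> has_principal_part d F \<longleftrightarrow> F = basis_form d"
proof
  assume "F \<in> integral_weak_forms \<rho> \<and> has_principal_part d F"
  then have F: "F \<in> weak_forms \<rho>" "has_principal_part d F" by (simp_all add: integral_weak_forms_def)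
  show "F = basis_form d"
    by (rule weak_forms_eqI[OF F(1) basis_form_weak[OF d]])
      (use F(2) has_principal_part_iff[OF F(1) d] basis_form_coeff[OF d] in simp)
next
  assume "F = basis_form d"
  then show "F \<in> integral_weak_forms \<rho> \<and> has_principal_part d F"
    using basis_form_integral[OF d] basis_form_coeff[OF d] has_principal_part_iff[OF basis_form_weak[OF d] d] by simp
qed

lemma basis_form_inj: "inj_on basis_form admissible"
proof (rule inj_onI)
  fix d e assume de: "d \<in> admissible" "e \<in> admissible" "basis_form d = basis_form e"
  then have "d > 0" by (simp add: admissible_def)
  then show "d = e"
    using basis_form_coeff[OF de(1), of "- int d"] basis_form_coeff[OF de(2), of "- int d"] de(3) by (auto split: if_splits)
qed

text \<open>The coefficient at -d is a functional dual to the basis: it is 1 on the form of index d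
  and 0 on the others.\<close>

lemma basis_form_independent: "zmod.independent (basis_form ` admissible)"
  unfolding zmod.independent_explicit_module
proof (intro allI impI)
  fix t u v
  assume t: "finite t" "t \<subseteq> basis_form ` admissible" and 0: "(\<Sum>v\<in>t. int_scale (u v) v) = 0" and v: "v \<in> t"
  obtain d where d: "d \<in> admissible" "v = basis_form d" using t(2) v by auto
  have neg: "- int d < 0" using d(1) by (simp add: admissible_def)
  have w: "x \<in> weak_forms \<rho>" if "x \<in> t" for x using t(2) that basis_form_weak by blast
  have "fourier_coeff x (- int d) = (if x = v then 1 else 0)" if "x \<in> t" for x
  proof -
    from t(2) that have "x \<in> basis_form ` admissible" by (rule subsetD)
    then obtain e where e: "e \<in> admissible" "x = basis_form e" by blast
    then show ?thesis using basis_form_coeff[OF e(1) neg] d inj_on_eq_iff[OF basis_form_inj e(1) d(1)] by auto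
  qed
  then have "(\<Sum>x\<in>t. of_int (u x) * fourier_coeff x (- int d)) = (\<Sum>x\<in>t. if x = v then of_int (u x) else 0)"
    by (intro sum.cong) auto
  also have "\<dots> = of_int (u v)" using t(1) v by simp
  finally have "of_int (u v) = fourier_coeff (\<Sum>x\<in>t. int_scale (u x) x) (- int d)"
    by (simp add: weak_forms_sum(2)[OF t(1) w])
  also have "\<dots> = 0"
  proof -
    have "(0 :: complex \<Rightarrow> complex^3) = (\<lambda>_. 0)" by (rule ext) simp
    then show ?thesis using 0 zero_weak_form(2) by simp
  qed
  finally show "u v = 0" by simp
qed

lemma weak_form_finite_principal_part:
  assumes "F \<in> weak_forms \<rho>"
  shows "\<exists>K. \<forall>m<K. fourier_coeff F m = 0"
proof -
  note s = fourier_series[OF assms]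
  from s obtain K1 K2 K3 where K: "\<And>m. m < K1 \<Longrightarrow> (if m mod 8 = 1 then fourier_coeff F m else 0) = 0"
      "\<And>m. m < K2 \<Longrightarrow> (if m mod 8 = 7 then fourier_coeff F m else 0) = 0"
      "\<And>m. m < K3 \<Longrightarrow> (if m mod 8 = 5 then fourier_coeff F m else 0) = 0"
    unfolding has_q8_series_def by blast
  have "fourier_coeff F m = 0" if "m < min K1 (min K2 K3)" for m
    using K[of m] that fourier_coeff_other[of m F] by (auto split: if_splits)
  then show ?thesis by blast
qed

text \<open>The principal part is finite and has integer coefficients; the combination with these
  coefficients has the same principal part, and uniqueness does the rest.\<close>

lemma basis_form_span: "zmod.span (basis_form ` admissible) = integral_weak_forms \<rho>"
proof
  show "zmod.span (basis_form ` admissible) \<subseteq> integral_weak_forms \<rho>"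
    by (rule zmod.span_minimal[OF _ integral_subspace]) (use basis_form_integral in blast)
  show "integral_weak_forms \<rho> \<subseteq> zmod.span (basis_form ` admissible)"
  proof
    fix F assume F: "F \<in> integral_weak_forms \<rho>"
    then have Fw: "F \<in> weak_forms \<rho>" by (simp add: integral_weak_forms_def)
    obtain K where K: "\<And>m. m < K \<Longrightarrow> fourier_coeff F m = 0" using weak_form_finite_principal_part[OF Fw] by blast
    define D where "D = {d \<in> admissible. d \<le> nat (- K)}"
    have fin: "finite D" by (simp add: D_def)
    have "\<exists>z. fourier_coeff F m = of_int z" for m
      using F by (auto simp: integral_weak_forms_def elim: Ints_cases)
    then obtain z where z: "\<And>m. fourier_coeff F m = of_int (z m)" by metis
    let ?s = "\<Sum>d\<in>D. int_scale (z (- int d)) (basis_form d)"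
    have w: "basis_form d \<in> weak_forms \<rho>" if "d \<in> D" for d using that by (simp add: D_def basis_form_weak)
    have s: "?s \<in> weak_forms \<rho>" "fourier_coeff ?s m = (\<Sum>d\<in>D. of_int (z (- int d)) * fourier_coeff (basis_form d) m)" for m
      by (rule weak_forms_sum(1)[OF fin w], assumption) (rule weak_forms_sum(2)[OF fin w], assumption)
    have "F = ?s"
    proof (rule weak_forms_eqI[OF Fw s(1)])
      fix m :: int assume m: "m < 0"
      show "fourier_coeff F m = fourier_coeff ?s m"
      proof (cases "m mod 8 \<in> {1, 5, 7}")
        case True
        from admissible_neg_exponent[OF m True] obtain e where e: "e \<in> admissible" "m = - int e" .
        have "fourier_coeff ?s m = (\<Sum>i\<in>D. if i = e then fourier_coeff F m else 0)"
          unfolding s(2) by (rule sum.cong) (use basis_form_coeff[OF _ m] in \<open>auto simp: e z D_def\<close>)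
        also have "\<dots> = (if e \<in> D then fourier_coeff F m else 0)" by (simp add: fin)
        also have "\<dots> = fourier_coeff F m" using K[of m] e by (auto simp: D_def)
        finally show ?thesis ..
      qed (simp add: fourier_coeff_other)
    qed
    moreover have "?s \<in> zmod.span (basis_form ` admissible)"
      by (intro zmod.span_sum zmod.span_scale zmod.span_base) (auto simp: D_def)
    ultimately show "F \<in> zmod.span (basis_form ` admissible)" by simp
  qed
qed

end

section \<open>Quadratic Gauss sums\<close>

lemma sum_scale_periodic:
  fixes f :: "int \<Rightarrow> 'a::comm_monoid_add"
  assumes N: "N > 0" and per: "\<And>n. f (n + N) = f n" and c: "coprime c N"
  shows "(\<Sum>u\<in>{0..<N}. f (c * u)) = (\<Sum>u\<in>{0..<N}. f u)"
proof -
  have inj: "inj_on (\<lambda>u. (c * u) mod N) {0..<N}"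
  proof (rule inj_onI)
    fix u v assume uv: "u \<in> {0..<N}" "v \<in> {0..<N}" "(c * u) mod N = (c * v) mod N"
    then have "[c * u = c * v] (mod N)" by (simp add: cong_def)
    then have "[u = v] (mod N)" using c by (simp add: cong_mult_lcancel coprime_commute)
    then show "u = v" using uv(1,2) by (simp add: cong_def)
  qed
  have img: "(\<lambda>u. (c * u) mod N) ` {0..<N} = {0..<N}"
    by (rule endo_inj_surj[OF _ _ inj]) (use N in auto)
  have "(\<Sum>u\<in>{0..<N}. f (c * u)) = (\<Sum>u\<in>{0..<N}. f ((c * u) mod N))"
    by (rule sum.cong) (simp_all add: periodic_mod[of f N, OF per])
  also have "\<dots> = (\<Sum>u\<in>(\<lambda>u. (c * u) mod N) ` {0..<N}. f u)"
    by (simp add: sum.reindex[OF inj])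
  finally show ?thesis unfolding img .
qed

lemma sum_product_split:
  fixes f :: "int \<Rightarrow> 'a::comm_monoid_add"
  assumes "M > 0" "N > 0"
  shows "(\<Sum>u\<in>{0..<M * N}. f u) = (\<Sum>x\<in>{0..<M}. \<Sum>y\<in>{0..<N}. f (x + M * y))"
proof -
  have "(\<Sum>u\<in>{0..<M * N}. f u) = (\<Sum>(x, y)\<in>{0..<M} \<times> {0..<N}. f (x + M * y))"
  proof (rule sum.reindex_bij_witness[of _ "\<lambda>(x, y). x + M * y" "\<lambda>u. (u mod M, u div M)"])
    fix u assume u: "u \<in> {0..<M * N}"
    have "u div M < N"
    proof (rule ccontr)
      assume "\<not> u div M < N"
      then have "M * N \<le> M * (u div M)" using assms by (intro mult_left_mono) auto
      also have "\<dots> \<le> u" using mult_div_mod_eq[of M u] pos_mod_sign[OF assms(1), of u] by linarith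
      finally show False using u by simp
    qed
    with u show "(u mod M, u div M) \<in> {0..<M} \<times> {0..<N}"
      using assms by (simp add: pos_imp_zdiv_nonneg_iff)
  next
    fix z assume "z \<in> {0..<M} \<times> {0..<N}"
    then obtain x y where z: "z = (x, y)" "0 \<le> x" "x < M" "0 \<le> y" "y < N" by auto
    have "x + M * y < M + M * y" using z by simp
    also have "M + M * y = M * (y + 1)" by (simp add: ring_distribs)
    also have "\<dots> \<le> M * N" using z assms by (intro mult_left_mono) auto
    finally show "(case z of (x, y) \<Rightarrow> x + M * y) \<in> {0..<M * N}" using z assms by simp
    show "((case z of (x, y) \<Rightarrow> x + M * y) mod M, (case z of (x, y) \<Rightarrow> x + M * y) div M) = z"
      using z assms by simp
  qed auto
  then show ?thesis by (simp add: sum.cartesian_product)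
qed

lemma gauss_sum_periodic:
  assumes "N > 0"
  shows "eexp (of_int (a * (u + N)\<^sup>2) / of_int N) = eexp (of_int (a * u\<^sup>2) / of_int N)"
  by (rule eexp_cong_int_div) (use assms in \<open>auto simp: cong_iff_dvd_diff power2_eq_square algebra_simps\<close>)

lemma gauss_sum_cong: "N > 0 \<Longrightarrow> [a = b] (mod N) \<Longrightarrow> gauss_sum N a = gauss_sum N b"
  unfolding gauss_sum_def by (intro sum.cong refl eexp_cong_int_div cong_mult) auto

lemma gauss_sum_square_mult:
  assumes N: "N > 0" and c: "coprime c N"
  shows "gauss_sum N (a * c\<^sup>2) = gauss_sum N a"
proof -
  have "gauss_sum N (a * c\<^sup>2) = (\<Sum>u\<in>{0..<N}. eexp (of_int (a * (c * u)\<^sup>2) / of_int N))"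
    unfolding gauss_sum_def by (simp only: power_mult_distrib mult.assoc)
  also have "\<dots> = gauss_sum N a"
    unfolding gauss_sum_def by (rule sum_scale_periodic[of N "\<lambda>u. eexp (of_int (a * u\<^sup>2) / of_int N)" c, OF N gauss_sum_periodic[OF N] c])
  finally show ?thesis .
qed

lemma cnj_gauss_sum: "cnj (gauss_sum N a) = gauss_sum N (- a)"
  unfolding gauss_sum_def cnj_sum by (rule sum.cong[OF refl]) (simp add: eexp_def exp_cnj)

text \<open>After the substitution u = w + v the squares of v cancel. The inner sum over v is then a
  sum of roots of unity in 2 a w v, which survives only for w = 0 since 2 a is a unit modulo
  N.\<close>

lemma gauss_sum_mult_minus:
  assumes N: "N > 0" and a: "coprime (2 * a) N"
  shows "gauss_sum N a * gauss_sum N (- a) = of_int N"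
proof -
  define f where "f u = eexp (of_int (a * u\<^sup>2) / of_int N)" for u
  define g where "g v = eexp (of_int (- a * v\<^sup>2) / of_int N)" for v
  have per: "f (u + N) = f u" for u unfolding f_def by (rule gauss_sum_periodic[OF N])
  have fg: "f (w + v) * g v = f w * eexp (of_int (2 * a * w * v) / of_int N)" for w v
  proof -
    have "of_int (a * (w + v)\<^sup>2) / of_int N + of_int (- a * v\<^sup>2) / of_int N =
        of_int (a * w\<^sup>2) / of_int N + (of_int (2 * a * w * v) / of_int N :: complex)"
      unfolding add_divide_distrib [symmetric] of_int_add [symmetric]
      by (rule arg_cong[where f = "\<lambda>x. of_int x / of_int N"]) (simp add: power2_eq_square algebra_simps)
    then show ?thesis unfolding f_def g_def eexp_add [symmetric] by (rule arg_cong)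
  qed
  have "gauss_sum N a * gauss_sum N (- a) = (\<Sum>v\<in>{0..<N}. (\<Sum>u\<in>{0..<N}. f u) * g v)"
    unfolding gauss_sum_def f_def g_def by (rule sum_distrib_left)
  also have "\<dots> = (\<Sum>v\<in>{0..<N}. (\<Sum>w\<in>{0..<N}. f (w + v)) * g v)"
    by (simp only: sum_shift_periodic[of N f, OF N per])
  also have "\<dots> = (\<Sum>v\<in>{0..<N}. \<Sum>w\<in>{0..<N}. f w * eexp (of_int (2 * a * w * v) / of_int N))"
    by (simp only: sum_distrib_right fg)
  also have "\<dots> = (\<Sum>w\<in>{0..<N}. f w * (\<Sum>v\<in>{0..<N}. eexp (of_int (2 * a * w * v) / of_int N)))"
    by (subst sum.swap) (simp only: sum_distrib_left)
  also have "\<dots> = (\<Sum>w\<in>{0..<N}. if w = 0 then of_int N else 0)"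
  proof (rule sum.cong[OF refl])
    fix w assume w: "w \<in> {0..<N}"
    have "N dvd 2 * a * w \<longleftrightarrow> N dvd w"
      using a by (simp add: coprime_dvd_mult_right_iff coprime_commute)
    also have "\<dots> \<longleftrightarrow> w = 0" using w zdvd_not_zless[of w N] by (cases "w = 0") auto
    finally show "f w * (\<Sum>v\<in>{0..<N}. eexp (of_int (2 * a * w * v) / of_int N)) = (if w = 0 then of_int N else 0)"
      unfolding sum_roots_of_unity[OF N, of "2 * a * w"] by (simp add: f_def)
  qed
  also have "\<dots> = of_int N" using N by simp
  finally show ?thesis .
qed

text \<open>Multiplying 16 b' by the square of 8 b does not change the Gauss sum, and 16 b' (8 b)^2
  = 16 b (64 b b') is -16 b modulo N.\<close>

lemma gauss_sum_conjugate_pair: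
  assumes N: "N > 0" "odd N" and b: "N dvd 64 * b * b' + 1"
  shows "gauss_sum N (16 * b) * gauss_sum N (16 * b') = of_int N"
proof -
  obtain k where k: "64 * b * b' + 1 = N * k" using b by auto
  have b_cop: "coprime b N"
  proof (rule coprimeI)
    fix d assume "d dvd b" "d dvd N"
    then have "d dvd N * k - 64 * b * b'" by auto
    moreover have "N * k - 64 * b * b' = 1" using k by simp
    ultimately show "is_unit d" by (simp only:)
  qed
  have two: "coprime 2 N" using N(2) by simp
  have "coprime (2 ^ 3 * b) N" using two b_cop by (simp only: coprime_mult_left_iff coprime_power_left_iff) simp
  then have c: "coprime (8 * b) N" by simp
  have "coprime (2 ^ 5 * b) N" using two b_cop by (simp only: coprime_mult_left_iff coprime_power_left_iff) simp
  then have c2: "coprime (2 * (16 * b)) N" by simp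
  have "gauss_sum N (16 * b') = gauss_sum N (16 * b' * (8 * b)\<^sup>2)"
    by (rule gauss_sum_square_mult[OF N(1) c, symmetric])
  also have "\<dots> = gauss_sum N (- (16 * b))"
  proof (rule gauss_sum_cong[OF N(1)])
    have "16 * b' * (8 * b)\<^sup>2 - - (16 * b) = 16 * b * (64 * b * b' + 1)" by (simp add: power2_eq_square algebra_simps)
    then show "[16 * b' * (8 * b)\<^sup>2 = - (16 * b)] (mod N)"
      unfolding cong_iff_dvd_diff using b by simp
  qed
  finally show ?thesis using gauss_sum_mult_minus[OF N(1) c2] by simp
qed

text \<open>With u = x + p y the term in y^2 is trivial modulo p^2, so the sum over y is linear and
  kills every x except 0, which contributes p.\<close>

lemma gauss_sum_prime_square:
  assumes p: "prime p" "p > (2::int)" and a: "\<not> p dvd a"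
  shows "gauss_sum (p * p) a = of_int p"
proof -
  have p0: "p > 0" using p by simp
  define f where "f u = eexp (of_int (a * u\<^sup>2) / of_int (p * p))" for u
  have "f (x + p * y) = f x * eexp (of_int (2 * a * x * y) / of_int p)" for x y
  proof -
    have "a * (x + p * y)\<^sup>2 = a * x\<^sup>2 + p * (2 * a * x * y) + (p * p) * (a * y\<^sup>2)"
      by (simp add: power2_eq_square algebra_simps)
    then have "[a * (x + p * y)\<^sup>2 = a * x\<^sup>2 + p * (2 * a * x * y)] (mod (p * p))"
      by (simp add: cong_iff_dvd_diff)
    then have "f (x + p * y) = eexp (of_int (a * x\<^sup>2 + p * (2 * a * x * y)) / of_int (p * p))"
      unfolding f_def by (intro eexp_cong_int_div) (use p0 in auto)
    also have "of_int (a * x\<^sup>2 + p * (2 * a * x * y)) / of_int (p * p) =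
        of_int (a * x\<^sup>2) / of_int (p * p) + (of_int (2 * a * x * y) / of_int p :: complex)"
      using p0 unfolding of_int_add of_int_mult[of p] add_divide_distrib by simp
    finally show ?thesis by (simp only: f_def eexp_add)
  qed
  then have "gauss_sum (p * p) a = (\<Sum>x\<in>{0..<p}. f x * (\<Sum>y\<in>{0..<p}. eexp (of_int (2 * a * x * y) / of_int p)))"
    unfolding gauss_sum_def f_def [symmetric] sum_product_split[OF p0 p0] by (simp only: sum_distrib_left)
  also have "\<dots> = (\<Sum>x\<in>{0..<p}. if x = 0 then of_int p else 0)"
  proof (rule sum.cong[OF refl])
    fix x assume x: "x \<in> {0..<p}"
    have "\<not> p dvd 2" using p zdvd_imp_le[of p 2] by auto
    then have "p dvd 2 * a * x \<longleftrightarrow> p dvd x" using a p(1) by (simp add: prime_dvd_mult_iff)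
    also have "\<dots> \<longleftrightarrow> x = 0" using x zdvd_not_zless[of x p] by (cases "x = 0") auto
    finally show "f x * (\<Sum>y\<in>{0..<p}. eexp (of_int (2 * a * x * y) / of_int p)) = (if x = 0 then of_int p else 0)"
      unfolding sum_roots_of_unity[OF p0, of "2 * a * x"] by (simp add: f_def)
  qed
  also have "\<dots> = of_int p" using p0 by simp
  finally show ?thesis .
qed

lemma odd_prime_coprime:
  assumes "prime p" "p > (2::int)" "\<not> p dvd a"
  shows "coprime (2 * a) p"
proof -
  have "\<not> p dvd 2" using assms zdvd_imp_le[of p 2] by auto
  then have "\<not> p dvd 2 * a" using assms by (simp add: prime_dvd_mult_iff)
  then show ?thesis using prime_imp_coprime[OF assms(1)] coprime_commute by blast
qed

text \<open>Summing t b over all b counts the zeros of a u^2 - c v^2, only the trivial one, and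
  gives p. Since t 0 = p^2, the remaining p - 1 terms, each of modulus p, add up to -p (p - 1).
  Equality in the triangle inequality forces every one of them to be -p, in particular t 1.\<close>

lemma gauss_sum_nonresidue:
  assumes p: "prime p" "p > (2::int)" and a: "\<not> p dvd a" and c: "\<not> p dvd c"
    and nonres: "\<And>u v. p dvd a * u\<^sup>2 - c * v\<^sup>2 \<Longrightarrow> p dvd u \<and> p dvd v"
  shows "gauss_sum p a * gauss_sum p (- c) = - of_int p"
proof -
  have p0: "p > 0" using p by simp
  define t where "t b = gauss_sum p (b * a) * gauss_sum p (- (b * c))" for b
  have t0: "t 0 = of_int p * of_int p" using p0 by (simp add: t_def gauss_sum_def eexp_0)
  have "(\<Sum>b\<in>{0..<p}. t b) =
      (\<Sum>b\<in>{0..<p}. \<Sum>u\<in>{0..<p}. \<Sum>v\<in>{0..<p}. eexp (of_int ((a * u\<^sup>2 - c * v\<^sup>2) * b) / of_int p))"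
  proof (rule sum.cong[OF refl])
    fix b
    have "eexp (of_int (b * a * u\<^sup>2) / of_int p) * eexp (of_int (- (b * c) * v\<^sup>2) / of_int p) =
        eexp (of_int ((a * u\<^sup>2 - c * v\<^sup>2) * b) / of_int p)" for u v
    proof -
      have "b * a * u\<^sup>2 + - (b * c) * v\<^sup>2 = (a * u\<^sup>2 - c * v\<^sup>2) * b" by (simp add: algebra_simps)
      then show ?thesis unfolding eexp_add [symmetric] add_divide_distrib [symmetric] of_int_add [symmetric] by simp
    qed
    then show "t b = (\<Sum>u\<in>{0..<p}. \<Sum>v\<in>{0..<p}. eexp (of_int ((a * u\<^sup>2 - c * v\<^sup>2) * b) / of_int p))"
      unfolding t_def gauss_sum_def sum_product by (simp only:)
  qed
  also have "\<dots> = (\<Sum>u\<in>{0..<p}. \<Sum>b\<in>{0..<p}. \<Sum>v\<in>{0..<p}. eexp (of_int ((a * u\<^sup>2 - c * v\<^sup>2) * b) / of_int p))"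
    by (rule sum.swap)
  also have "\<dots> = (\<Sum>u\<in>{0..<p}. \<Sum>v\<in>{0..<p}. \<Sum>b\<in>{0..<p}. eexp (of_int ((a * u\<^sup>2 - c * v\<^sup>2) * b) / of_int p))"
    by (rule sum.cong[OF refl]) (rule sum.swap)
  also have "\<dots> = (\<Sum>u\<in>{0..<p}. \<Sum>v\<in>{0..<p}. if u = 0 then (if v = 0 then of_int p else 0) else 0)"
  proof (intro sum.cong refl)
    fix u v assume uv: "u \<in> {0..<p}" "v \<in> {0..<p}"
    have "p dvd a * u\<^sup>2 - c * v\<^sup>2 \<longleftrightarrow> u = 0 \<and> v = 0"
    proof
      assume "p dvd a * u\<^sup>2 - c * v\<^sup>2"
      then have "p dvd u" "p dvd v" using nonres by blast+
      moreover have "x = 0" if "p dvd x" "x \<in> {0..<p}" for x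
        using that zdvd_not_zless[of x p] by (cases "x = 0") auto
      ultimately show "u = 0 \<and> v = 0" using uv by blast
    qed simp
    then show "(\<Sum>b\<in>{0..<p}. eexp (of_int ((a * u\<^sup>2 - c * v\<^sup>2) * b) / of_int p)) =
        (if u = 0 then (if v = 0 then of_int p else 0) else 0)"
      unfolding sum_roots_of_unity[OF p0] by auto
  qed
  also have "\<dots> = of_int p"
  proof -
    have "(\<Sum>v\<in>{0..<p}. if u = 0 then (if v = 0 then of_int p else 0) else 0) = (if u = 0 then of_int p else (0 :: complex))" for u :: int
      using p0 by (cases "u = 0") simp_all
    then show ?thesis using p0 by simp
  qed
  finally have "(\<Sum>b\<in>{0..<p}. t b) = of_int p" .
  moreover have "{0..<p} = insert 0 {1..<p}" using p0 by auto
  ultimately have "(\<Sum>b\<in>{1..<p}. t b) + of_int p * of_int p = of_int p" by (simp add: t0 add.commute)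
  then have sum: "(\<Sum>b\<in>{1..<p}. t b) = of_int p - of_int p * of_int p" by (simp only: eq_diff_eq)
  have norm: "norm (t b) = of_int p" if "b \<in> {1..<p}" for b
  proof -
    have b: "\<not> p dvd b" using that zdvd_not_zless[of b p] by auto
    have n: "norm (gauss_sum p x) ^ 2 = of_int p" if "\<not> p dvd x" for x
    proof -
      have "complex_of_real (norm (gauss_sum p x) ^ 2) = gauss_sum p x * cnj (gauss_sum p x)"
        by (simp only: complex_norm_square)
      also have "\<dots> = of_int p"
        unfolding cnj_gauss_sum by (rule gauss_sum_mult_minus[OF p0 odd_prime_coprime[OF p that]])
      also have "of_int p = complex_of_real (of_int p)" by simp
      finally show ?thesis unfolding of_real_eq_iff .
    qed
    have ndvd: "\<not> p dvd b * a" "\<not> p dvd - (b * c)" using a b c p(1) by (simp_all add: prime_dvd_mult_iff)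
    have "norm (t b) ^ 2 = (of_int p)\<^sup>2"
      unfolding t_def norm_mult power_mult_distrib n[OF ndvd(1)] n[OF ndvd(2)] by (simp add: power2_eq_square)
    then show ?thesis using p0 by simp
  qed
  have "(\<Sum>b\<in>{1..<p}. Re (t b) + of_int p) = Re (\<Sum>b\<in>{1..<p}. t b) + of_int (p - 1) * of_int p"
    using p0 by (simp add: sum.distrib)
  also have "\<dots> = 0" unfolding sum by (simp add: algebra_simps)
  finally have "(\<Sum>b\<in>{1..<p}. Re (t b) + of_int p) = 0" .
  moreover have "Re (t b) + of_int p \<ge> 0" if "b \<in> {1..<p}" for b
    using abs_Re_le_cmod[of "t b"] norm[OF that] by linarith
  moreover have one: "1 \<in> {1..<p}" using p by simp
  ultimately have "Re (t 1) + of_int p = 0"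
    using sum_nonneg_eq_0_iff[of "{1..<p}" "\<lambda>b. Re (t b) + of_int p"] by blast
  then have re: "Re (t 1) = - of_int p" by simp
  have "(of_int p)\<^sup>2 = Re (t 1) ^ 2 + Im (t 1) ^ 2" using norm[OF one] cmod_power2[of "t 1"] by simp
  then have "Im (t 1) = 0" by (simp add: re)
  with re have "t 1 = - of_int p" by (simp add: complex_eq_iff)
  then show ?thesis by (simp add: t_def)
qed

text \<open>This replaces the Legendre symbol. A nontrivial zero of a u^2 - c v^2 has u and v both
  prime to p, and scaling by squares gives equal sums; if there is none, the previous lemma gives
  opposite signs.\<close>

lemma gauss_sum_square_eq:
  assumes p: "prime p" "p > (2::int)" and a: "\<not> p dvd a" and c: "\<not> p dvd c"
  shows "gauss_sum p a = gauss_sum p c \<or> gauss_sum p a = - gauss_sum p c"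
proof -
  have p0: "p > 0" using p by simp
  note cc = gauss_sum_mult_minus[OF p0 odd_prime_coprime[OF p c]]
  show ?thesis
  proof (cases "\<exists>u v. p dvd a * u\<^sup>2 - c * v\<^sup>2 \<and> \<not> (p dvd u \<and> p dvd v)")
    case True
    then obtain u v where uv: "p dvd a * u\<^sup>2 - c * v\<^sup>2" "\<not> (p dvd u \<and> p dvd v)" by blast
    have "p dvd u \<longleftrightarrow> p dvd v"
    proof
      assume "p dvd u"
      then have "p dvd a * u\<^sup>2" by (simp add: power2_eq_square)
      then have "p dvd c * v\<^sup>2" using uv(1) dvd_diff[of p "a * u\<^sup>2" "a * u\<^sup>2 - c * v\<^sup>2"] by simp
      then show "p dvd v" using c p(1) by (auto simp: prime_dvd_mult_iff power2_eq_square)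
    next
      assume "p dvd v"
      then have "p dvd c * v\<^sup>2" by (simp add: power2_eq_square)
      then have "p dvd a * u\<^sup>2" using uv(1) dvd_add[of p "a * u\<^sup>2 - c * v\<^sup>2" "c * v\<^sup>2"] by simp
      then show "p dvd u" using a p(1) by (auto simp: prime_dvd_mult_iff power2_eq_square)
    qed
    with uv(2) have "\<not> p dvd u" "\<not> p dvd v" by blast+
    then have cop: "coprime u p" "coprime v p"
      using prime_imp_coprime[OF p(1)] coprime_commute by blast+
    have "gauss_sum p a = gauss_sum p (a * u\<^sup>2)" by (rule gauss_sum_square_mult[OF p0 cop(1), symmetric])
    also have "\<dots> = gauss_sum p (c * v\<^sup>2)" by (rule gauss_sum_cong[OF p0]) (use uv(1) in \<open>simp add: cong_iff_dvd_diff\<close>)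
    also have "\<dots> = gauss_sum p c" by (rule gauss_sum_square_mult[OF p0 cop(2)])
    finally show ?thesis ..
  next
    case False
    then have "gauss_sum p a * gauss_sum p (- c) = - of_int p"
      by (intro gauss_sum_nonresidue[OF p a c]) blast
    also have "\<dots> = - gauss_sum p c * gauss_sum p (- c)" using cc by simp
    finally have "gauss_sum p a * gauss_sum p (- c) = - gauss_sum p c * gauss_sum p (- c)" .
    moreover have "gauss_sum p (- c) \<noteq> 0" using cc p0 by auto
    ultimately have "gauss_sum p a = - gauss_sum p c" by (simp only: mult_right_cancel[of "gauss_sum p (- c)"] simp_thms)
    then show ?thesis ..
  qed
qed

text \<open>All these Gauss sums agree up to sign, so the square does not depend on a; comparing the
  values at 1 and -1 decides between p and -p.\<close>

lemma gauss_sum_squared: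
  assumes p: "prime p" "p > (2::int)"
  obtains \<epsilon> :: int where "\<And>a. \<not> p dvd a \<Longrightarrow> gauss_sum p a ^ 2 = of_int \<epsilon> * of_int p"
proof -
  have p0: "p > 0" using p by simp
  have 1: "\<not> p dvd 1" "\<not> p dvd - 1" using p by auto
  have sq: "gauss_sum p a ^ 2 = gauss_sum p 1 ^ 2" if "\<not> p dvd a" for a
    using gauss_sum_square_eq[OF p that 1(1)] by (auto simp: power2_eq_square)
  have m: "gauss_sum p 1 * gauss_sum p (- 1) = of_int p"
    by (rule gauss_sum_mult_minus[OF p0 odd_prime_coprime[OF p 1(1)]])
  show thesis
  proof (cases "gauss_sum p (- 1) = gauss_sum p 1")
    case True
    then have "gauss_sum p 1 ^ 2 = of_int 1 * of_int p" using m by (simp add: power2_eq_square)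
    with sq that[of 1] show thesis by simp
  next
    case False
    then have "gauss_sum p (- 1) = - gauss_sum p 1" using gauss_sum_square_eq[OF p 1(2) 1(1)] by blast
    then have "gauss_sum p 1 ^ 2 = - of_int p" using arg_cong[OF m, of uminus] by (simp add: power2_eq_square)
    with sq that[of "- 1"] show thesis by simp
  qed
qed

text \<open>Cubing replaces the Gauss sum by \<epsilon> p times itself. Opening the remaining sum
  and summing over b counts the u with 16 u^2 + m divisible by p, so that l m is \<epsilon> times
  this number minus 1. In this way both the factor p and integrality come out.\<close>

lemma hecke_eigenvalue:
  assumes p: "prime p" "p > (2::int)"
  obtains l :: "int \<Rightarrow> int" where
    "\<And>m. (\<Sum>b\<in>{1..<p}. gauss_sum p (16 * b) ^ 3 / of_int p * eexp (of_int (m * b) / of_int p)) = of_int p * of_int (l m)"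
proof -
  have p0: "p > 0" using p by simp
  obtain \<epsilon> where \<epsilon>: "\<And>a. \<not> p dvd a \<Longrightarrow> gauss_sum p a ^ 2 = of_int \<epsilon> * of_int p" using gauss_sum_squared[OF p] by blast
  have "(\<Sum>b\<in>{1..<p}. gauss_sum p (16 * b) ^ 3 / of_int p * eexp (of_int (m * b) / of_int p)) =
      of_int p * of_int (\<epsilon> * (\<Sum>u\<in>{0..<p}. (if p dvd 16 * u\<^sup>2 + m then 1 else 0)) - \<epsilon>)" for m
  proof -
    define e where "e u b = eexp (of_int ((16 * u\<^sup>2 + m) * b) / of_int p)" for u b
    have "gauss_sum p (16 * b) ^ 3 / of_int p * eexp (of_int (m * b) / of_int p) = of_int \<epsilon> * (\<Sum>u\<in>{0..<p}. e u b)"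
      if b: "b \<in> {1..<p}" for b
    proof -
      have "\<not> p dvd 2" using p zdvd_imp_le[of p 2] by auto
      then have "\<not> p dvd 2 ^ 4" using p(1) prime_dvd_power by blast
      then have "\<not> p dvd 16" by simp
      moreover have "\<not> p dvd b" using b zdvd_not_zless[of b p] by auto
      ultimately have "\<not> p dvd 16 * b" using p(1) by (simp only: prime_dvd_mult_iff) simp
      then have "gauss_sum p (16 * b) ^ 3 / of_int p = of_int \<epsilon> * gauss_sum p (16 * b)"
        using \<epsilon>[of "16 * b"] p0 by (simp add: power3_eq_cube power2_eq_square)
      moreover have "eexp (of_int (16 * b * u\<^sup>2) / of_int p) * eexp (of_int (m * b) / of_int p) = e u b" for u
      proof -
        have "16 * b * u\<^sup>2 + m * b = (16 * u\<^sup>2 + m) * b" by (simp add: algebra_simps)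
        then show ?thesis
          unfolding e_def eexp_add [symmetric] add_divide_distrib [symmetric] of_int_add [symmetric] by simp
      qed
      ultimately show ?thesis unfolding gauss_sum_def by (simp only: mult.assoc sum_distrib_right)
    qed
    then have "(\<Sum>b\<in>{1..<p}. gauss_sum p (16 * b) ^ 3 / of_int p * eexp (of_int (m * b) / of_int p)) =
        (\<Sum>b\<in>{1..<p}. of_int \<epsilon> * (\<Sum>u\<in>{0..<p}. e u b))" by (rule sum.cong[OF refl])
    also have "\<dots> = of_int \<epsilon> * (\<Sum>u\<in>{0..<p}. \<Sum>b\<in>{1..<p}. e u b)"
      unfolding sum_distrib_left [symmetric] by (subst sum.swap) (rule refl)
    also have "(\<Sum>u\<in>{0..<p}. \<Sum>b\<in>{1..<p}. e u b) = (\<Sum>u\<in>{0..<p}. (if p dvd 16 * u\<^sup>2 + m then of_int p else 0) - 1)"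
    proof (rule sum.cong[OF refl])
      fix u
      have "{0..<p} = insert 0 {1..<p}" using p0 by auto
      then have "(\<Sum>b\<in>{0..<p}. e u b) = (\<Sum>b\<in>{1..<p}. e u b) + 1" by (simp add: e_def eexp_0)
      moreover have "(\<Sum>b\<in>{0..<p}. e u b) = (if p dvd 16 * u\<^sup>2 + m then of_int p else 0)"
        unfolding e_def by (rule sum_roots_of_unity[OF p0])
      ultimately show "(\<Sum>b\<in>{1..<p}. e u b) = (if p dvd 16 * u\<^sup>2 + m then of_int p else 0) - 1" by (simp only: eq_diff_eq)
    qed
    also have "(\<Sum>u\<in>{0..<p}. (if p dvd 16 * u\<^sup>2 + m then of_int p else 0) - 1) =
        of_int p * (of_int (\<Sum>u\<in>{0..<p}. (if p dvd 16 * u\<^sup>2 + m then 1 else 0)) - (1 :: complex))"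
      using p0 by (simp add: sum_subtractf sum_distrib_left if_distrib[of "\<lambda>x. _ * x"] if_distrib[of of_int]
          right_diff_distrib cong: if_cong)
    finally show ?thesis by (simp add: algebra_simps)
  qed
  then show thesis by (rule that)
qed

section \<open>Weight 4 and level 4: transformation at rational points\<close>

definition ipow :: "int \<Rightarrow> complex" where
  "ipow n = eexp (of_int n / 4)"

lemma ipow_add: "ipow (m + n) = ipow m * ipow n"
  by (simp add: ipow_def eexp_add add_divide_distrib)

lemma ipow_4_mult: "ipow (4 * k) = 1"
  unfolding ipow_def by simp

lemma ipow_1: "ipow 1 = \<i>"
  by (simp add: ipow_def eexp_quarter)

lemma ipow_4dvd: "4 dvd n \<Longrightarrow> ipow n = 1"
  by (auto simp: ipow_4_mult)

lemma ipow_2mod4: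
  assumes "even n" "\<not> 4 dvd n"
  shows "ipow n = - 1"
proof -
  have "ipow 2 = - 1" using ipow_add[of 1 1] by (simp add: ipow_1)
  moreover obtain k where "n = 2 + 4 * k"
  proof
    show "n = 2 + 4 * (n div 4)" using assms by presburger
  qed
  ultimately show ?thesis by (simp add: ipow_add ipow_4_mult)
qed

lemma ipow_uminus_odd:
  assumes "odd n"
  shows "ipow (- n) = - ipow n"
proof -
  have "\<not> 4 dvd - 2 * n" using assms by presburger
  then have "ipow (- 2 * n) = - 1" by (intro ipow_2mod4) auto
  moreover have "- n = n + - 2 * n" by simp
  ultimately show ?thesis using ipow_add[of n "- 2 * n"] by simp
qed

lemma four_dvd_double: "(4::int) dvd 2 * m \<longleftrightarrow> even m"
  by presburger

text \<open>
  A holomorphic function on the upper half plane attached to a row vector \<open>(x, y)\<close>,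
  depending only on \<open>(x, y)\<close> modulo 4, with right multiplication of row vectors describing the
  action of the modular group.
\<close>

definition level4_form :: "(complex \<Rightarrow> complex) \<Rightarrow> (complex \<Rightarrow> complex) \<Rightarrow> (complex \<Rightarrow> complex) \<Rightarrow>
    int \<Rightarrow> int \<Rightarrow> complex \<Rightarrow> complex" where
  "level4_form A B C x y \<tau> =
     (if even x then (if 4 dvd x then C \<tau> else - C \<tau>)
      else - ipow (x * y) * (if even y then B \<tau> else A \<tau>))"

lemma level4_form_T:
  assumes "A (\<tau> + 1) = \<i> * B \<tau>" "B (\<tau> + 1) = \<i> * A \<tau>" "C (\<tau> + 1) = C \<tau>"
  shows "level4_form A B C x y (\<tau> + 1) = level4_form A B C x (x + y) \<tau>"
proof (cases "even x")
  case False
  then obtain k where k: "x = 2 * k + 1" by (elim oddE)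
  have "x * x = 1 + 4 * (k * k + k)" by (simp add: k algebra_simps)
  then have "ipow (x * x) = \<i>" by (simp only: ipow_add ipow_4_mult ipow_1 mult_1_right)
  then have "ipow (x * (x + y)) = \<i> * ipow (x * y)" by (simp add: distrib_left ipow_add)
  with False show ?thesis unfolding level4_form_def assms by simp
qed (simp add: level4_form_def assms)

lemma level4_form_S:
  assumes "A (- 1 / \<tau>) = - (\<tau> ^ 4) * A \<tau>" "B (- 1 / \<tau>) = - (\<tau> ^ 4) * C \<tau>" "C (- 1 / \<tau>) = - (\<tau> ^ 4) * B \<tau>"
    and xy: "\<not> (even x \<and> even y)"
  shows "level4_form A B C x y (- 1 / \<tau>) = \<tau> ^ 4 * level4_form A B C y (- x) \<tau>"
proof -
  consider "even x" "odd y" | "odd x" "even y" | "odd x" "odd y" using xy by blast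
  then show ?thesis
  proof cases
    case 1
    then obtain k where k: "x = 2 * k" by (elim evenE)
    have e: "y * - x = 2 * - (y * k)" by (simp add: k)
    have d: "4 dvd y * - x \<longleftrightarrow> 4 dvd x" unfolding e four_dvd_double using 1 by (simp add: k four_dvd_double)
    have "ipow (y * - x) = (if 4 dvd x then 1 else - 1)"
      using ipow_4dvd[of "y * - x"] ipow_2mod4[of "y * - x"] 1 unfolding d by simp
    with 1 show ?thesis unfolding level4_form_def assms by simp
  next
    case 2
    then obtain k where k: "y = 2 * k" by (elim evenE)
    have e: "x * y = 2 * (x * k)" by (simp add: k)
    have d: "4 dvd x * y \<longleftrightarrow> 4 dvd y" unfolding e four_dvd_double using 2 by (simp add: k four_dvd_double)
    have "ipow (x * y) = (if 4 dvd y then 1 else - 1)"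
      using ipow_4dvd[of "x * y"] ipow_2mod4[of "x * y"] 2 unfolding d by simp
    with 2 show ?thesis unfolding level4_form_def assms by simp
  next
    case 3
    then have "ipow (y * - x) = - ipow (x * y)"
      using ipow_uminus_odd[of "x * y"] by (simp add: mult.commute)
    with 3 show ?thesis unfolding level4_form_def assms by simp
  qed
qed

lemma not_both_even_mult:
  fixes a b c d :: int
  assumes det: "a * d - b * c = 1" and xy: "\<not> (even x \<and> even y)"
  shows "\<not> (even (x * a + y * c) \<and> even (x * b + y * d))"
proof
  assume e: "even (x * a + y * c) \<and> even (x * b + y * d)"
  have "d * (x * a + y * c) - c * (x * b + y * d) = x * (a * d - b * c)" by (simp add: algebra_simps)
  then have "even x" using e det by (metis dvd_diff dvd_mult mult_1_right)
  have "a * (x * b + y * d) - b * (x * a + y * c) = y * (a * d - b * c)" by (simp add: algebra_simps)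
  then have "even y" using e det by (metis dvd_diff dvd_mult mult_1_right)
  with \<open>even x\<close> xy show False by blast
qed

text \<open>Word induction, with the matrix acting on the row (x, y) from the right. Rows with both
  entries even have to stay excluded, because \<open>level4_form_S\<close> fails for them; a matrix
  of determinant 1 preserves the exclusion.\<close>

lemma level4_form_mob:
  assumes T: "\<And>\<tau>. \<tau> \<in> \<H> \<Longrightarrow> A (\<tau> + 1) = \<i> * B \<tau> \<and> B (\<tau> + 1) = \<i> * A \<tau> \<and> C (\<tau> + 1) = C \<tau>"
    and S: "\<And>\<tau>. \<tau> \<in> \<H> \<Longrightarrow> A (- 1 / \<tau>) = - (\<tau> ^ 4) * A \<tau> \<and> B (- 1 / \<tau>) = - (\<tau> ^ 4) * C \<tau> \<and>
        C (- 1 / \<tau>) = - (\<tau> ^ 4) * B \<tau>"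
    and det: "a * d - b * c = 1" and xy: "\<not> (even x \<and> even y)" and \<tau>: "\<tau> \<in> \<H>"
  shows "level4_form A B C x y (mob a b c d \<tau>) =
    (of_int c * \<tau> + of_int d) ^ 4 * level4_form A B C (x * a + y * c) (x * b + y * d) \<tau>"
proof -
  let ?g = "level4_form A B C"
  have gT: "?g X Y (\<tau> + 1) = ?g X (X + Y) \<tau>" if "\<tau> \<in> \<H>" for X Y \<tau>
    by (rule level4_form_T) (use T[OF that] in blast)+
  have gS: "?g X Y (- 1 / \<tau>) = \<tau> ^ 4 * ?g Y (- X) \<tau>" if "\<tau> \<in> \<H>" "\<not> (even X \<and> even Y)" for X Y \<tau>
    by (rule level4_form_S[OF _ _ _ that(2)]) (use S[OF that(1)] in blast)+
  from det have "\<forall>\<tau>\<in>\<H>. ?g x y (mob a b c d \<tau>) = (of_int c * \<tau> + of_int d) ^ 4 * ?g (x * a + y * c) (x * b + y * d) \<tau>"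
  proof (induction rule: sl2_induct)
    case one
    show ?case by (simp add: mob_def)
  next
    case (T a b c d)
    show ?case
    proof
      fix \<tau> assume \<tau>: "\<tau> \<in> \<H>"
      have "?g x y (mob a (b + a) c (d + c) \<tau>) = (of_int c * (\<tau> + 1) + of_int d) ^ 4 * ?g (x * a + y * c) (x * b + y * d) (\<tau> + 1)"
        unfolding mob_T using T(2) \<tau> by simp
      also have "?g (x * a + y * c) (x * b + y * d) (\<tau> + 1) = ?g (x * a + y * c) ((x * a + y * c) + (x * b + y * d)) \<tau>"
        by (rule gT[OF \<tau>])
      also have "(x * a + y * c) + (x * b + y * d) = x * (b + a) + y * (d + c)" by (simp add: algebra_simps)
      also have "of_int c * (\<tau> + 1) + of_int d = of_int c * \<tau> + of_int (d + c)" by (simp add: algebra_simps)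
      finally show "?g x y (mob a (b + a) c (d + c) \<tau>) =
        (of_int c * \<tau> + of_int (d + c)) ^ 4 * ?g (x * a + y * c) (x * (b + a) + y * (d + c)) \<tau>" .
    qed
  next
    case (T' a b c d)
    show ?case
    proof
      fix \<tau> assume \<tau>: "\<tau> \<in> \<H>"
      then have \<tau>1: "\<tau> - 1 \<in> \<H>" by simp
      have "?g x y (mob a (b - a) c (d - c) \<tau>) = (of_int c * (\<tau> - 1) + of_int d) ^ 4 * ?g (x * a + y * c) (x * b + y * d) (\<tau> - 1)"
        unfolding mob_T' using T'(2) \<tau>1 by simp
      also have "?g (x * a + y * c) (x * b + y * d) (\<tau> - 1) = ?g (x * a + y * c) ((x * b + y * d) - (x * a + y * c)) \<tau>"
        using gT[OF \<tau>1, of "x * a + y * c" "(x * b + y * d) - (x * a + y * c)"] by simp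
      also have "(x * b + y * d) - (x * a + y * c) = x * (b - a) + y * (d - c)" by (simp add: algebra_simps)
      also have "of_int c * (\<tau> - 1) + of_int d = of_int c * \<tau> + of_int (d - c)" by (simp add: algebra_simps)
      finally show "?g x y (mob a (b - a) c (d - c) \<tau>) =
        (of_int c * \<tau> + of_int (d - c)) ^ 4 * ?g (x * a + y * c) (x * (b - a) + y * (d - c)) \<tau>" .
    qed
  next
    case (S a b c d)
    show ?case
    proof
      fix \<tau> assume \<tau>: "\<tau> \<in> \<H>"
      have "?g x y (mob b (- a) d (- c) \<tau>) =
          (of_int c * (- 1 / \<tau>) + of_int d) ^ 4 * ?g (x * a + y * c) (x * b + y * d) (- 1 / \<tau>)"
        unfolding mob_S[OF \<tau>] using S(2) minus_inverse_in_H[OF \<tau>] by blast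
      also have "\<dots> = (of_int c * (- 1 / \<tau>) + of_int d) ^ 4 * (\<tau> ^ 4 * ?g (x * b + y * d) (- (x * a + y * c)) \<tau>)"
        by (simp only: gS[OF \<tau> not_both_even_mult[OF S(1) xy]])
      also have "\<dots> = ((of_int c * (- 1 / \<tau>) + of_int d) * \<tau>) ^ 4 * ?g (x * b + y * d) (- (x * a + y * c)) \<tau>"
        by (simp only: power_mult_distrib mult.assoc)
      also have "(of_int c * (- 1 / \<tau>) + of_int d) * \<tau> = of_int d * \<tau> + of_int (- c)"
        using H_not_0[OF \<tau>] by (simp add: field_simps)
      also have "- (x * a + y * c) = x * - a + y * - c" by simp
      finally show "?g x y (mob b (- a) d (- c) \<tau>) =
        (of_int d * \<tau> + of_int (- c)) ^ 4 * ?g (x * b + y * d) (x * - a + y * - c) \<tau>" .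
    qed
  qed
  with \<tau> show ?thesis by blast
qed

text \<open>After multiplication by \<open>theta_prod\<close> the triple has weight 4 and transforms
  by matrices modulo 4, where the matrix taking z' to z behaves like S. Dividing by the known
  transformation of \<open>theta_prod\<close> brings back weight 5/2, together with the cube of the
  Gauss sum, so no multiplier of the triple itself has to be computed.\<close>

lemma modular_triple_gauss:
  assumes abc: "modular_triple a b c"
    and N: "N > 0" "odd N" and uv: "N dvd 64 * u * v + 1" and w: "w \<in> \<H>"
  defines "z \<equiv> 8 * of_int u / of_int N - 1 / ((of_int N)\<^sup>2 * w)"
    and "k \<equiv> of_int N ^ 4 * csqrt (- \<i> * w) ^ 5 / gauss_sum N (16 * u) ^ 3"
    and "z' \<equiv> w + 8 * of_int v / of_int N"
  shows "a z = - k * a z'" "b z = - k * c z'" "c z = - k * b z'"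
proof -
  define r where "r = (\<lambda>\<tau>. csqrt (- \<i> * \<tau>))"
  have T: "a (\<tau> + 1) = \<zeta>8 * b \<tau>" "b (\<tau> + 1) = \<zeta>8 * a \<tau>" "c (\<tau> + 1) = inverse \<zeta>8 * c \<tau>"
    and S: "a (- 1 / \<tau>) = - (r \<tau> ^ 5) * a \<tau>" "b (- 1 / \<tau>) = - (r \<tau> ^ 5) * c \<tau>" "c (- 1 / \<tau>) = - (r \<tau> ^ 5) * b \<tau>"
    if "\<tau> \<in> \<H>" for \<tau> using abc that unfolding modular_triple_def r_def by blast+
  have r8: "r \<tau> ^ 8 = \<tau> ^ 4" for \<tau>
  proof -
    have "r \<tau> ^ 8 = (r \<tau> ^ 2) ^ 4" by (simp add: power_mult [symmetric])
    also have "r \<tau> ^ 2 = - \<i> * \<tau>" unfolding r_def by (rule power2_csqrt)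
    finally show ?thesis by (simp add: power_mult_distrib)
  qed
  have z8: "\<zeta>8 * x * (\<zeta>8 * y) = \<i> * (x * y)" "inverse \<zeta>8 * x * (\<zeta>8 * y) = x * y" for x y
  proof -
    have "\<zeta>8 * x * (\<zeta>8 * y) = \<zeta>8\<^sup>2 * (x * y)" by (simp add: power2_eq_square)
    then show "\<zeta>8 * x * (\<zeta>8 * y) = \<i> * (x * y)" by (simp only: zeta8_squared)
    have "\<zeta>8 \<noteq> 0" by (simp add: \<zeta>8_def)
    then show "inverse \<zeta>8 * x * (\<zeta>8 * y) = x * y" by (simp add: field_simps)
  qed
  have rr: "- (r \<tau> ^ 5) * x * (r \<tau> ^ 3 * y) = - (\<tau> ^ 4) * (x * y)" for \<tau> x y
  proof -
    have "- (r \<tau> ^ 5) * x * (r \<tau> ^ 3 * y) = - (r \<tau> ^ 5 * r \<tau> ^ 3) * (x * y)" by (simp add: mult_ac)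
    also have "r \<tau> ^ 5 * r \<tau> ^ 3 = r \<tau> ^ 8" by (simp add: power_add [symmetric])
    finally show ?thesis unfolding r8 .
  qed
  define A B C where "A = (\<lambda>\<tau>. a \<tau> * theta_prod \<tau>)" and "B = (\<lambda>\<tau>. b \<tau> * theta_prod \<tau>)" and "C = (\<lambda>\<tau>. c \<tau> * theta_prod \<tau>)"
  have hS: "theta_prod (- 1 / \<tau>) = r \<tau> ^ 3 * theta_prod \<tau>" if "\<tau> \<in> \<H>" for \<tau>
    unfolding r_def by (rule theta_prod_S[OF that])
  have T': "A (\<tau> + 1) = \<i> * B \<tau> \<and> B (\<tau> + 1) = \<i> * A \<tau> \<and> C (\<tau> + 1) = C \<tau>" if "\<tau> \<in> \<H>" for \<tau>
    unfolding A_def B_def C_def T[OF that] theta_prod_T z8 by simp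
  have S': "A (- 1 / \<tau>) = - (\<tau> ^ 4) * A \<tau> \<and> B (- 1 / \<tau>) = - (\<tau> ^ 4) * C \<tau> \<and> C (- 1 / \<tau>) = - (\<tau> ^ 4) * B \<tau>"
    if "\<tau> \<in> \<H>" for \<tau>
    unfolding A_def B_def C_def S[OF that] hS[OF that] rr by simp
  from uv obtain e where e: "64 * u * v + 1 = N * e" by (elim dvdE)
  \<comment> \<open>The matrix with rows (8 u, -e) and (N, -8 v) sends z' to z, and its denominator
    at z' is N z' - 8 v = N w.\<close>
  have det: "(8 * u) * (- 8 * v) - (- e) * N = 1" using e by (simp add: algebra_simps)
  have N0: "(of_int N :: complex) \<noteq> 0" using N by simp
  have w0: "w \<noteq> 0" by (rule H_not_0[OF w])
  have z'H: "z' \<in> \<H>" using add_real_in_H(1)[of w "8 * of_int v / of_int N"] w by (simp add: z'_def)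
  have den: "of_int N * z' + of_int (- 8 * v) = of_int N * w" using N0 by (simp add: z'_def field_simps)
  have z: "mob (8 * u) (- e) N (- 8 * v) z' = z"
  proof -
    have "of_int (8 * u) * z' + of_int (- e) = 8 * of_int u * w + (64 * of_int u * of_int v - of_int N * of_int e) / (of_int N :: complex)"
      using N0 by (simp add: z'_def field_simps)
    also have "64 * of_int u * of_int v - of_int N * of_int e = (- 1 :: complex)"
    proof -
      have "of_int (64 * u * v + 1) = (of_int (N * e) :: complex)" unfolding e ..
      then have *: "64 * of_int u * of_int v + 1 = (of_int N * of_int e :: complex)" by simp
      show ?thesis unfolding * [symmetric] by simp
    qed
    finally have num: "of_int (8 * u) * z' + of_int (- e) = 8 * of_int u * w + - 1 / (of_int N :: complex)" .
    show ?thesis unfolding mob_def num den z_def using N0 w0 by (simp add: field_simps power2_eq_square)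
  qed
  have odd_e: "odd e"
  proof
    assume "even e"
    then have "even (64 * u * v + 1)" unfolding e by simp
    then show False by simp
  qed
  \<comment> \<open>Modulo 4 only N e matters in the second product, and N e = 64 u v + 1 is 1
    modulo 4.\<close>
  have par: "ipow (N * (- 8 * v)) = 1" "ipow ((8 * u + N) * (- e + - 8 * v)) = - \<i>"
  proof -
    show "ipow (N * (- 8 * v)) = 1" by (rule ipow_4dvd) (auto intro: dvd_mult dvd_mult2)
    have "(8 * u + N) * (- e + - 8 * v) = - (N * e) + 4 * (- 2 * u * e - 16 * u * v - 2 * N * v)"
      by (simp add: algebra_simps)
    also have "\<dots> = - 1 + 4 * (- 16 * u * v - 2 * u * e - 16 * u * v - 2 * N * v)"
      unfolding e [symmetric] by simp
    finally have "ipow ((8 * u + N) * (- e + - 8 * v)) = ipow (- 1)"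
      by (simp only: ipow_add ipow_4_mult mult_1_right)
    also have "\<dots> = - \<i>" using ipow_uminus_odd[of 1] by (simp add: ipow_1)
    finally show "ipow ((8 * u + N) * (- e + - 8 * v)) = - \<i>" .
  qed
  have M: "level4_form A B C x y z = (of_int N * w) ^ 4 * level4_form A B C (x * (8 * u) + y * N) (x * - e + y * (- 8 * v)) z'"
    if "\<not> (even x \<and> even y)" for x y
    using level4_form_mob[OF T' S' det that z'H] unfolding z den .
  \<comment> \<open>The rows (1, 0), (0, 1) and (1, 1) isolate B, C and A. Their images under the
    matrix have the parities of (0, 1), (1, 0) and (1, 1).\<close>
  have "level4_form A B C 1 0 z = - B z" "level4_form A B C 0 1 z = C z" "level4_form A B C 1 1 z = - \<i> * A z"
    by (simp_all add: level4_form_def ipow_1 ipow_4dvd)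
  moreover have "level4_form A B C (1 * (8 * u) + 0 * N) (1 * - e + 0 * (- 8 * v)) z' = C z'"
    by (simp add: level4_form_def)
  moreover have "level4_form A B C (0 * (8 * u) + 1 * N) (0 * - e + 1 * (- 8 * v)) z' = - B z'"
    using N(2) par(1) by (simp add: level4_form_def)
  moreover have "level4_form A B C (1 * (8 * u) + 1 * N) (1 * - e + 1 * (- 8 * v)) z' = \<i> * A z'"
    using N(2) odd_e par(2) by (simp add: level4_form_def)
  ultimately have F: "- B z = (of_int N * w) ^ 4 * C z'" "C z = (of_int N * w) ^ 4 * - B z'"
      "- \<i> * A z = (of_int N * w) ^ 4 * (\<i> * A z')"
    using M[of 1 0] M[of 0 1] M[of 1 1] by simp_all
  have F': "A z = - ((of_int N * w) ^ 4) * A z'" "B z = - ((of_int N * w) ^ 4) * C z'" "C z = - ((of_int N * w) ^ 4) * B z'"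
  proof -
    have neg: "x = - y" if "- x = y" for x y :: complex using that by auto
    have "\<i> * A z = - ((of_int N * w) ^ 4 * (\<i> * A z'))" by (rule neg) (use F(3) in simp)
    also have "\<dots> = \<i> * (- ((of_int N * w) ^ 4) * A z')" by (simp add: mult_ac)
    finally show "A z = - ((of_int N * w) ^ 4) * A z'" by (simp only: mult_cancel_left) simp
    show "B z = - ((of_int N * w) ^ 4) * C z'" using neg[OF F(1)] by simp
    show "C z = - ((of_int N * w) ^ 4) * B z'" using F(2) by simp
  qed
  have hg: "theta_prod z = r w ^ 3 * gauss_sum N (16 * u) ^ 3 * theta_prod z'"
    unfolding z_def z'_def r_def by (rule theta_prod_gauss[OF N uv w])
  have zH: "z \<in> \<H>" using mob_in_H[OF det z'H] unfolding z .
  have h0: "theta_prod z' \<noteq> 0" by (rule theta_prod_nonzero[OF z'H])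
  have g0: "gauss_sum N (16 * u) \<noteq> 0" "r w \<noteq> 0" using theta_prod_nonzero[OF zH] unfolding hg by auto
  \<comment> \<open>With r w = \<open>csqrt (- \<i> * w)\<close> the factor (N w)^4 is N^4 (r w)^8.
    Three of the eight powers cancel against \<open>theta_prod\<close> and five remain, the weight
    5/2.\<close>
  have fin: "x = - k * y" if "x * theta_prod z = - ((of_int N * w) ^ 4) * (y * theta_prod z')" for x y
  proof -
    have "(of_int N * w) ^ 4 = of_int N ^ 4 * (r w ^ 5 * r w ^ 3)"
      unfolding power_mult_distrib r8 [of w, symmetric] by (simp add: power_add [symmetric])
    with that have *: "x * (r w ^ 3 * gauss_sum N (16 * u) ^ 3 * theta_prod z') =
        - (of_int N ^ 4 * (r w ^ 5 * r w ^ 3)) * (y * theta_prod z')" unfolding hg by simp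
    have "(x * gauss_sum N (16 * u) ^ 3) * (r w ^ 3 * theta_prod z') =
        x * (r w ^ 3 * gauss_sum N (16 * u) ^ 3 * theta_prod z')" by (simp only: mult_ac)
    also have "\<dots> = (- (of_int N ^ 4 * r w ^ 5) * y) * (r w ^ 3 * theta_prod z')"
      unfolding * by simp
    finally have "(x * gauss_sum N (16 * u) ^ 3) * (r w ^ 3 * theta_prod z') =
        (- (of_int N ^ 4 * r w ^ 5) * y) * (r w ^ 3 * theta_prod z')" .
    then have "x * gauss_sum N (16 * u) ^ 3 = - (of_int N ^ 4 * r w ^ 5) * y" using h0 g0 by (simp only: mult_cancel_right) simp
    then have "x = - (of_int N ^ 4 * r w ^ 5) * y / gauss_sum N (16 * u) ^ 3"
      using g0(1) by (subst nonzero_eq_divide_eq) simp_all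
    then show ?thesis unfolding k_def r_def by simp
  qed
  note F'' = F'[unfolded A_def B_def C_def]
  show "a z = - k * a z'" by (rule fin[OF F''(1)])
  show "b z = - k * c z'" by (rule fin[OF F''(2)])
  show "c z = - k * b z'" by (rule fin[OF F''(3)])
qed

section \<open>The Hecke operator for the square of an odd prime\<close>

text \<open>The three parts belong to the upper triangular matrices of determinant p^2 with
  diagonals (1, p^2), (p, p) and (p^2, 1). Upper right entries are multiples of 8 because the
  components have period 8. The weights in the middle part are fixed by the cubed Gauss sum in
  \<open>modular_triple_gauss\<close>.\<close>

definition hecke :: "int \<Rightarrow> (complex \<Rightarrow> complex) \<Rightarrow> complex \<Rightarrow> complex" where
  "hecke p f \<tau> =
     inverse (of_int (p * p)) * (\<Sum>b\<in>{0..<p * p}. f ((\<tau> + 8 * of_int b) / of_int (p * p))) +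
     (\<Sum>b\<in>{1..<p}. gauss_sum p (16 * b) ^ 3 / of_int p * f (\<tau> + 8 * of_int b / of_int p)) +
     of_int p ^ 3 * f (of_int (p * p) * \<tau>)"

lemma hecke_add: "hecke p (\<lambda>\<tau>. f \<tau> + g \<tau>) \<tau> = hecke p f \<tau> + hecke p g \<tau>"
  by (simp add: hecke_def sum.distrib distrib_left)

lemma hecke_diff: "hecke p (\<lambda>\<tau>. f \<tau> - g \<tau>) \<tau> = hecke p f \<tau> - hecke p g \<tau>"
  by (simp add: hecke_def sum_subtractf right_diff_distrib)

lemma hecke_has_q8_series:
  assumes f: "f has_q8_series c" and p: "p > 0"
  shows "hecke p f has_q8_series (\<lambda>m. c (p * p * m) +
    (\<Sum>b\<in>{1..<p}. gauss_sum p (16 * b) ^ 3 / of_int p * eexp (of_int (m * b) / of_int p)) * c m +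
    of_int p ^ 3 * (if p * p dvd m then c (m div (p * p)) else 0))"
proof -
  have pp: "p * p > 0" using p by simp
  have mid: "(\<lambda>\<tau>. gauss_sum p (16 * b) ^ 3 / of_int p * f (\<tau> + 8 * of_int b / of_int p)) has_q8_series
      (\<lambda>m. gauss_sum p (16 * b) ^ 3 / of_int p * eexp (of_int (m * b) / of_int p) * c m)" for b
    by (rule has_q8_series_cong[OF _ _ has_q8_series_cmult[OF has_q8_series_shift[OF f,
          of "8 * of_int b / of_int p"], of "gauss_sum p (16 * b) ^ 3 / of_int p"]]) simp_all
  have "(\<lambda>\<tau>. hecke p f \<tau>) has_q8_series (\<lambda>m. c (p * p * m) +
    (\<Sum>b\<in>{1..<p}. gauss_sum p (16 * b) ^ 3 / of_int p * eexp (of_int (m * b) / of_int p) * c m) +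
    of_int p ^ 3 * (if p * p dvd m then c (m div (p * p)) else 0))"
    unfolding hecke_def
    by (rule has_q8_series_add[OF has_q8_series_add[OF has_q8_series_contract[OF f pp] has_q8_series_sum[OF mid]]
          has_q8_series_cmult[OF has_q8_series_dilate[OF f pp]]])
  then show ?thesis by (simp only: sum_distrib_right)
qed

text \<open>The map is b to -1 / (64 b) modulo N, with values reduced to a fixed system of residues.
  The relation is symmetric in b and its image, hence an involution, and it will reindex the sums
  over b.\<close>

lemma units_involution:
  assumes N: "N > 1" "odd (N::int)"
  defines "U \<equiv> {b \<in> {0..<N}. coprime b N}"
  obtains \<sigma> where "\<And>b. b \<in> U \<Longrightarrow> \<sigma> b \<in> U" "\<And>b. b \<in> U \<Longrightarrow> N dvd 64 * b * \<sigma> b + 1" "\<And>b. b \<in> U \<Longrightarrow> \<sigma> (\<sigma> b) = b"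
proof -
  have cop64: "coprime (64 * b) N" if "coprime b N" for b
  proof -
    have "coprime 2 N" using N(2) by simp
    then have "coprime (2 ^ 6 * b) N" using that by (simp only: coprime_mult_left_iff coprime_power_left_iff) simp
    then show ?thesis by simp
  qed
  have "\<forall>b\<in>U. \<exists>x. x \<in> U \<and> N dvd 64 * b * x + 1"
  proof
    fix b assume "b \<in> U"
    then have "coprime b N" by (simp add: U_def)
    then have "coprime (64 * b) N" by (rule cop64)
    then obtain y where "[64 * b * y = 1] (mod N)" using cong_solve_coprime_int by blast
    then have y: "N dvd 64 * b * y - 1" by (simp add: cong_iff_dvd_diff)
    define x where "x = (- y) mod N"
    have "N dvd (- y) - x" unfolding x_def by (rule dvd_minus_mod)
    then have "N dvd 64 * b * ((- y) - x)" by (rule dvd_mult)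
    with y have "N dvd (64 * b * y - 1) + 64 * b * ((- y) - x)" by (rule dvd_add)
    then have "N dvd - (64 * b * x + 1)" by (simp add: algebra_simps)
    then have x: "N dvd 64 * b * x + 1" by (simp only: dvd_minus_iff)
    have "coprime x N"
    proof (rule coprimeI)
      fix d assume "d dvd x" "d dvd N"
      then have "d dvd 64 * b * x + 1" "d dvd 64 * b * x" using x by (auto intro: dvd_trans)
      then have "d dvd (64 * b * x + 1) - 64 * b * x" by (rule dvd_diff)
      then show "is_unit d" by simp
    qed
    moreover have "x \<in> {0..<N}" using N by (simp add: x_def)
    ultimately show "\<exists>x. x \<in> U \<and> N dvd 64 * b * x + 1" using x by (auto simp: U_def)
  qed
  then obtain \<sigma> where \<sigma>: "\<forall>b\<in>U. \<sigma> b \<in> U \<and> N dvd 64 * b * \<sigma> b + 1" using bchoice[of U] by metis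
  have "\<sigma> (\<sigma> b) = b" if b: "b \<in> U" for b
  proof -
    have s: "\<sigma> b \<in> U" "N dvd 64 * b * \<sigma> b + 1" using \<sigma> b by blast+
    have ss: "\<sigma> (\<sigma> b) \<in> U" "N dvd 64 * \<sigma> b * \<sigma> (\<sigma> b) + 1" using \<sigma> s(1) by blast+
    have "N dvd (64 * \<sigma> b * \<sigma> (\<sigma> b) + 1) - (64 * b * \<sigma> b + 1)" using ss(2) s(2) by (rule dvd_diff)
    then have "N dvd (64 * \<sigma> b) * (\<sigma> (\<sigma> b) - b)" by (simp add: algebra_simps)
    moreover have "coprime N (64 * \<sigma> b)"
    proof -
      have "coprime (\<sigma> b) N" using s(1) by (simp add: U_def)
      then have "coprime (64 * \<sigma> b) N" by (rule cop64)
      then show ?thesis by (simp only: coprime_commute)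
    qed
    ultimately have "N dvd \<sigma> (\<sigma> b) - b" by (simp only: coprime_dvd_mult_right_iff)
    then have "\<sigma> (\<sigma> b) mod N = b mod N" by (simp add: mod_eq_dvd_iff)
    then show ?thesis using ss(1) b by (simp add: U_def)
  qed
  with that \<sigma> show thesis by blast
qed

lemma modular_triple_periodic:
  assumes abc: "modular_triple a b c" and \<tau>: "\<tau> \<in> \<H>"
  shows "a (\<tau> + 8 * of_int n) = a \<tau>" "b (\<tau> + 8 * of_int n) = b \<tau>" "c (\<tau> + 8 * of_int n) = c \<tau>"
proof -
  have T: "a (\<tau> + 1) = \<zeta>8 * b \<tau>" "b (\<tau> + 1) = \<zeta>8 * a \<tau>" "c (\<tau> + 1) = inverse \<zeta>8 * c \<tau>"
    if "\<tau> \<in> \<H>" for \<tau> using abc that unfolding modular_triple_def by blast+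
  have z: "\<zeta>8 ^ 8 = 1" by (rule zeta8_power8)
  have step: "f (\<tau> + 8) = f \<tau>"
    if f: "\<And>\<tau>. \<tau> \<in> \<H> \<Longrightarrow> f (\<tau> + 1) = \<omega> * g \<tau>" "\<And>\<tau>. \<tau> \<in> \<H> \<Longrightarrow> g (\<tau> + 1) = \<omega> * f \<tau>" and \<omega>: "\<omega> ^ 8 = 1"
      and \<tau>: "\<tau> \<in> \<H>" for f g :: "complex \<Rightarrow> complex" and \<omega> \<tau> :: complex
  proof -
    have two: "f (\<tau> + 2) = \<omega> * (\<omega> * f \<tau>)" if "\<tau> \<in> \<H>" for \<tau>
      using f(1)[of "\<tau> + 1"] f(2)[of \<tau>] that by (simp add: add.assoc)
    have H: "\<tau> + 2 \<in> \<H>" "\<tau> + 4 \<in> \<H>" "\<tau> + 6 \<in> \<H>" using \<tau> by (simp_all add: in_H_iff)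
    have "f (\<tau> + 8) = f (\<tau> + 6 + 2)" by (simp add: add.assoc)
    also have "\<dots> = \<omega> * (\<omega> * f (\<tau> + 4 + 2))" unfolding two[OF H(3)] by (simp add: add.assoc)
    also have "\<dots> = \<omega> * (\<omega> * (\<omega> * (\<omega> * f (\<tau> + 2 + 2))))" unfolding two[OF H(2)] by (simp add: add.assoc)
    also have "\<dots> = \<omega> ^ 8 * f \<tau>" unfolding two[OF H(1)] two[OF \<tau>] by (simp add: eval_nat_numeral)
    finally show ?thesis using \<omega> by simp
  qed
  have all: "f (\<tau> + 8 * of_int n) = f \<tau>" if f: "\<And>\<tau>. \<tau> \<in> \<H> \<Longrightarrow> f (\<tau> + 8) = f \<tau>" and \<tau>: "\<tau> \<in> \<H>"
    for f :: "complex \<Rightarrow> complex" and \<tau> n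
  proof (induction n rule: int_induct[of _ 0])
    case (step1 i)
    have "\<tau> + 8 * of_int i \<in> \<H>" using \<tau> by (simp add: in_H_iff)
    from f[OF this] step1 show ?case by (simp add: algebra_simps)
  next
    case (step2 i)
    have "\<tau> + 8 * of_int (i - 1) \<in> \<H>" using \<tau> by (simp add: in_H_iff)
    from f[OF this] step2 show ?case by (simp add: algebra_simps)
  qed simp
  have zi: "inverse \<zeta>8 ^ 8 = 1" using z by (simp add: power_inverse)
  show "a (\<tau> + 8 * of_int n) = a \<tau>" by (rule all[OF _ \<tau>]) (rule step[where f = a and g = b and \<omega> = "\<zeta>8", OF T(1) T(2) z])
  show "b (\<tau> + 8 * of_int n) = b \<tau>" by (rule all[OF _ \<tau>]) (rule step[where f = b and g = a and \<omega> = "\<zeta>8", OF T(2) T(1) z])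
  show "c (\<tau> + 8 * of_int n) = c \<tau>" by (rule all[OF _ \<tau>]) (rule step[where f = c and g = c and \<omega> = "inverse \<zeta>8", OF T(3) T(3) zi])
qed

text \<open>Write P = p^2 = 1 + 8 k. Then (\<tau> + 1 + 8 b) / P = (\<tau> + 8 (b - k)) / P + 1 and
  P (\<tau> + 1) = P \<tau> + 1 + 8 k. So in each part \<tau> + 1 is a translation by 1, up to
  reindexing and the period 8.\<close>

lemma hecke_T:
  assumes p: "odd p" "p > 0"
    and f: "\<And>\<tau>. \<tau> \<in> \<H> \<Longrightarrow> f (\<tau> + 1) = \<omega> * f' \<tau>"
    and per: "\<And>\<tau> n. \<tau> \<in> \<H> \<Longrightarrow> f (\<tau> + 8 * of_int n) = f \<tau>" "\<And>\<tau> n. \<tau> \<in> \<H> \<Longrightarrow> f' (\<tau> + 8 * of_int n) = f' \<tau>"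
    and \<tau>: "\<tau> \<in> \<H>"
  shows "hecke p f (\<tau> + 1) = \<omega> * hecke p f' \<tau>"
proof -
  obtain j where j: "p = 2 * j + 1" using p(1) by (elim oddE)
  obtain i where i: "j * (j + 1) = 2 * i" by (meson evenE even_mult_iff even_plus_one_iff)
  define k where "k = i"
  have "p * p = 4 * (j * (j + 1)) + 1" by (simp add: j algebra_simps)
  then have pk: "p * p = 1 + 8 * k" by (simp add: i k_def)
  define P where "P = p * p"
  have P0: "P > 0" using p(2) by (simp add: P_def)
  then have P0': "(of_int P :: complex) \<noteq> 0" by simp
  have Pk: "(of_int P :: complex) = 1 + 8 * of_int k" using pk unfolding P_def by (metis of_int_1 of_int_add of_int_mult of_int_numeral)
  have inH: "(\<tau> + 8 * of_int b) / of_int P \<in> \<H>" for b :: int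
  proof -
    have "\<tau> + 8 * of_int b \<in> \<H>" using \<tau> by (simp add: in_H_iff)
    from scale_in_H[OF _ this, of "1 / of_int P"] P0 show ?thesis by simp
  qed
  have t1: "f ((\<tau> + 1 + 8 * of_int b) / of_int P) = \<omega> * f' ((\<tau> + 8 * of_int (b + - k)) / of_int P)" for b
  proof -
    have "(\<tau> + 1 + 8 * of_int b) / of_int P = (\<tau> + 8 * of_int (b + - k)) / of_int P + 1"
      using P0' Pk by (simp add: field_simps)
    then show ?thesis using f[OF inH[of "b + - k"]] by simp
  qed
  have perF: "f' ((\<tau> + 8 * of_int (n + P)) / of_int P) = f' ((\<tau> + 8 * of_int n) / of_int P)" for n
  proof -
    have "(\<tau> + 8 * of_int (n + P)) / of_int P = (\<tau> + 8 * of_int n) / of_int P + 8 * of_int 1"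
      using P0' by (simp add: field_simps)
    then show ?thesis using per(2)[OF inH[of n], of 1] by simp
  qed
  have "(\<Sum>b\<in>{0..<P}. f ((\<tau> + 1 + 8 * of_int b) / of_int P)) = \<omega> * (\<Sum>b\<in>{0..<P}. f' ((\<tau> + 8 * of_int (b + - k)) / of_int P))"
    unfolding t1 sum_distrib_left ..
  also have "(\<Sum>b\<in>{0..<P}. f' ((\<tau> + 8 * of_int (b + - k)) / of_int P)) = (\<Sum>b\<in>{0..<P}. f' ((\<tau> + 8 * of_int b) / of_int P))"
    by (rule sum_shift_periodic[of P "\<lambda>b. f' ((\<tau> + 8 * of_int b) / of_int P)", OF P0 perF])
  finally have S1: "(\<Sum>b\<in>{0..<P}. f ((\<tau> + 1 + 8 * of_int b) / of_int P)) = \<omega> * (\<Sum>b\<in>{0..<P}. f' ((\<tau> + 8 * of_int b) / of_int P))" .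
  have S2: "f (\<tau> + 1 + 8 * of_int b / of_int p) = \<omega> * f' (\<tau> + 8 * of_int b / of_int p)" for b
  proof -
    have "\<tau> + of_real (8 * of_int b / of_int p) \<in> \<H>" using \<tau> by (simp only: add_real_in_H)
    from f[OF this] show ?thesis by (simp add: add_ac)
  qed
  have PH: "of_int P * \<tau> \<in> \<H>" using scale_in_H[of "of_int P" \<tau>] P0 \<tau> by simp
  have "of_int P * (\<tau> + 1) = (of_int P * \<tau> + 1) + 8 * of_int k" using Pk by (simp add: algebra_simps)
  then have S3: "f (of_int P * (\<tau> + 1)) = \<omega> * f' (of_int P * \<tau>)" using per(1)[of "of_int P * \<tau> + 1" k] f[OF PH] PH by simp
  show ?thesis
    unfolding hecke_def P_def[symmetric] S1 S2 S3
    by (simp add: distrib_left sum_distrib_left mult_ac)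
qed

text \<open>S permutes the terms. The residue b = 0 is exchanged with the dilation by p^2, the
  residues p c with the middle terms through \<sigma>, and the units modulo p^2 among themselves
  through \<open>\<sigma>2\<close>. The hypothesis \<open>S0\<close> covers the first exchange,
  \<open>St\<close> with N = p and N = p^2 the others.\<close>

lemma hecke_S:
  assumes p: "prime p" "p > (2::int)"
    and S0: "\<And>\<tau>. \<tau> \<in> \<H> \<Longrightarrow> f (- 1 / \<tau>) = - (csqrt (- \<i> * \<tau>) ^ 5) * f' \<tau>"
    and St: "\<And>N u v w. N > 0 \<Longrightarrow> odd N \<Longrightarrow> N dvd 64 * u * v + 1 \<Longrightarrow> w \<in> \<H> \<Longrightarrow>
      f (8 * of_int u / of_int N - 1 / ((of_int N)\<^sup>2 * w)) =
        - (of_int N ^ 4 * csqrt (- \<i> * w) ^ 5 / gauss_sum N (16 * u) ^ 3) * f' (w + 8 * of_int v / of_int N)"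
    and \<tau>: "\<tau> \<in> \<H>"
  shows "hecke p f (- 1 / \<tau>) = - (csqrt (- \<i> * \<tau>) ^ 5) * hecke p f' \<tau>"
proof -
  define r where "r = (\<lambda>\<tau>. csqrt (- \<i> * \<tau>))"
  define q where "q = (of_int p :: complex)"
  define P where "P = p * p"
  have p0: "p > 0" and p1: "p > 1" using p by simp_all
  have odd_p: "odd p" using p prime_odd_int by blast
  have q0: "q \<noteq> 0" using p0 by (simp add: q_def)
  have P0: "P > 0" "P > 1" using p1 by (simp_all add: P_def less_1_mult)
  have Pq: "(of_int P :: complex) = q * q" by (simp add: P_def q_def)
  have odd_P: "odd P" using odd_p by (simp add: P_def)
  have \<tau>0: "\<tau> \<noteq> 0" by (rule H_not_0[OF \<tau>])
  \<comment> \<open>With \<tau> = p^2 w the points -1/\<tau> + 8 b / p and (-1/\<tau> + 8 b) / p^2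
    get the shape required by \<open>St\<close> at w, for N = p and N = p^2 respectively.\<close>
  define w where "w = \<tau> / (q * q)"
  have w: "w \<in> \<H>" using scale_in_H[of "1 / of_int P" \<tau>] P0 \<tau> by (simp add: w_def Pq)
  have PH: "q * q * \<tau> \<in> \<H>" using scale_in_H[of "of_int P" \<tau>] P0 \<tau> by (simp add: Pq)
  have rP: "r (q * q * z) = q * r z" for z
    using csqrt_of_int_square_mult[OF p0, of "- \<i> * z"] unfolding r_def q_def power2_eq_square by (simp only: mult_ac)
  have rw: "r \<tau> = q * r w" using rP[of w] q0 by (simp add: w_def)
  define R where "R = r w"
  have r: "csqrt (- \<i> * z) = r z" for z by (simp only: r_def)
  note S0' = S0[unfolded r] and St' = St[unfolded r]
  define g where "g c = gauss_sum p (16 * c)" for c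
  define U where "U = {b \<in> {0..<P}. coprime b P}"
  have Up: "{b \<in> {0..<p}. coprime b p} = {1..<p}"
  proof
    show "{b \<in> {0..<p}. coprime b p} \<subseteq> {1..<p}"
    proof
      fix b assume b: "b \<in> {b \<in> {0..<p}. coprime b p}"
      then have "b \<noteq> 0" using p1 by auto
      with b show "b \<in> {1..<p}" by auto
    qed
    show "{1..<p} \<subseteq> {b \<in> {0..<p}. coprime b p}"
    proof
      fix b assume b: "b \<in> {1..<p}"
      then have "\<not> p dvd b" using zdvd_not_zless[of b p] by auto
      then have "coprime b p" using prime_imp_coprime[OF p(1)] coprime_commute by blast
      with b show "b \<in> {b \<in> {0..<p}. coprime b p}" by auto
    qed
  qed
  obtain \<sigma> where \<sigma>: "\<And>b. b \<in> {1..<p} \<Longrightarrow> \<sigma> b \<in> {1..<p}" "\<And>b. b \<in> {1..<p} \<Longrightarrow> p dvd 64 * b * \<sigma> b + 1"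
      "\<And>b. b \<in> {1..<p} \<Longrightarrow> \<sigma> (\<sigma> b) = b"
    using units_involution[OF p1 odd_p] unfolding Up by blast
  obtain \<sigma>2 where \<sigma>2: "\<And>b. b \<in> U \<Longrightarrow> \<sigma>2 b \<in> U" "\<And>b. b \<in> U \<Longrightarrow> P dvd 64 * b * \<sigma>2 b + 1"
      "\<And>b. b \<in> U \<Longrightarrow> \<sigma>2 (\<sigma>2 b) = b"
    using units_involution[OF P0(2) odd_P] unfolding U_def by blast
  \<comment> \<open>The three orbits of residues modulo p^2: zero, proper multiples of p, and units.
    Each is treated by a different rule below.\<close>
  have split: "(\<Sum>b\<in>{0..<P}. F b) = F 0 + (\<Sum>c\<in>{1..<p}. F (p * c)) + (\<Sum>b\<in>U. F b)" for F :: "int \<Rightarrow> complex"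
  proof -
    have copP: "coprime b P \<longleftrightarrow> \<not> p dvd b" for b
    proof -
      have "coprime b P \<longleftrightarrow> coprime b p" by (simp add: P_def)
      also have "\<dots> \<longleftrightarrow> \<not> p dvd b"
        using prime_imp_coprime[OF p(1), of b] coprime_commute[of b p] p1 by (auto simp: coprime_absorb_left)
      finally show ?thesis .
    qed
    have inj: "inj_on (\<lambda>c. p * c) {1..<p}" using p0 by (auto simp: inj_on_def)
    have "{0..<P} = insert 0 ((\<lambda>c. p * c) ` {1..<p}) \<union> U"
    proof (intro Set.set_eqI iffI)
      fix b assume b: "b \<in> {0..<P}"
      show "b \<in> insert 0 ((\<lambda>c. p * c) ` {1..<p}) \<union> U"
      proof (cases "p dvd b")
        case True
        then obtain c where c: "b = p * c" by (elim dvdE)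
        have "0 \<le> c" "c < p" using b p0 by (simp_all add: c P_def zero_le_mult_iff)
        then show ?thesis by (cases "c = 0") (auto simp: c)
      qed (use b copP in \<open>auto simp: U_def\<close>)
    qed (use p0 in \<open>auto simp: U_def P_def\<close>)
    moreover have "0 \<notin> (\<lambda>c. p * c) ` {1..<p}" using p0 by auto
    moreover have "insert 0 ((\<lambda>c. p * c) ` {1..<p}) \<inter> U = {}" by (auto simp: U_def copP)
    moreover have "finite U" by (rule finite_subset[of _ "{0..<P}"]) (auto simp: U_def)
    ultimately show ?thesis by (simp add: sum.union_disjoint sum.reindex[OF inj])
  qed
  \<comment> \<open>Modulo p^2 the Gauss sum is p for every unit b, so the terms of the first part
    carry equal weights and can be permuted freely.\<close>
  have gU: "gauss_sum P (16 * b) = q" if "b \<in> U" for b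
  proof -
    have "\<not> p dvd 2" using p zdvd_imp_le[of p 2] by auto
    then have "\<not> p dvd 2 ^ 4" using p(1) prime_dvd_power by blast
    then have "\<not> p dvd 16" by simp
    moreover have "\<not> p dvd b"
    proof
      assume "p dvd b"
      moreover have "p dvd P" by (simp add: P_def)
      moreover have "coprime b P" using that by (simp add: U_def)
      ultimately have "is_unit p" using coprime_common_divisor by blast
      then show False using p1 by simp
    qed
    ultimately have "\<not> p dvd 16 * b" using p(1) by (simp only: prime_dvd_mult_iff) simp
    then show ?thesis unfolding P_def q_def by (rule gauss_sum_prime_square[OF p])
  qed
  have gg: "g c * g (\<sigma> c) = q" if "c \<in> {1..<p}" for c
    unfolding g_def q_def by (rule gauss_sum_conjugate_pair[OF p0 odd_p \<sigma>(2)[OF that]])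
  have g0: "g c \<noteq> 0" if "c \<in> {1..<p}" for c using gg[OF that] q0 by auto
  define i where "i = inverse (q * q)"
  have iq: "i * q ^ 5 = q ^ 3"
  proof -
    have "i * q ^ 5 = (i * (q * q)) * q ^ 3" by (simp add: eval_nat_numeral)
    also have "i * (q * q) = 1" unfolding i_def by (rule left_inverse) (use q0 in simp)
    finally show ?thesis by simp
  qed
  have iq': "i * (- ((q * x) ^ 5) * y) = - (x ^ 5) * (q ^ 3 * y)" "- ((q * x) ^ 5) * (i * y) = - (x ^ 5) * (q ^ 3 * y)" for x y
    unfolding iq [symmetric] power_mult_distrib by simp_all
  define \<Phi> where "\<Phi> b = f' ((\<tau> + 8 * of_int b) / (q * q))" for b :: int
  define \<Psi> where "\<Psi> c = g c ^ 3 / q * f' (\<tau> + 8 * of_int c / q)" for c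
  have L0: "i * f ((- 1 / \<tau> + 8 * of_int 0) / (q * q)) = - (r \<tau> ^ 5) * (q ^ 3 * f' (q * q * \<tau>))"
  proof -
    have "(- 1 / \<tau> + 8 * of_int 0) / (q * q) = - 1 / (q * q * \<tau>)" by (simp add: mult_ac)
    then have "f ((- 1 / \<tau> + 8 * of_int 0) / (q * q)) = - (r (q * q * \<tau>) ^ 5) * f' (q * q * \<tau>)"
      using S0'[OF PH] by (simp only:)
    also have "r (q * q * \<tau>) = q * r \<tau>" by (rule rP)
    also have "i * (- ((q * r \<tau>) ^ 5) * y) = - (r \<tau> ^ 5) * (q ^ 3 * y)" for y
      by (rule iq')
    finally show ?thesis by (simp only:)
  qed
  have L1: "i * f ((- 1 / \<tau> + 8 * of_int (p * c)) / (q * q)) = - (r \<tau> ^ 5) * \<Psi> (\<sigma> c)" if c: "c \<in> {1..<p}" for c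
  proof -
    have "(- 1 / \<tau> + 8 * of_int (p * c)) / (q * q) = 8 * of_int c / of_int p - 1 / ((of_int p)\<^sup>2 * \<tau>)"
      using q0 \<tau>0 by (simp add: q_def[symmetric] field_simps power2_eq_square)
    then have e: "f ((- 1 / \<tau> + 8 * of_int (p * c)) / (q * q)) =
        - (q ^ 4 * r \<tau> ^ 5 / g c ^ 3) * f' (\<tau> + 8 * of_int (\<sigma> c) / q)"
      using St'[OF p0 odd_p \<sigma>(2)[OF c] \<tau>] by (simp only: q_def g_def)
    have "(g c * g (\<sigma> c)) ^ 3 = q ^ 3" using gg[OF c] by simp
    then have "g (\<sigma> c) ^ 3 = q ^ 3 / g c ^ 3" using g0[OF c] by (simp add: power_mult_distrib field_simps)
    \<comment> \<open>The cube in the denominator produced by \<open>St\<close> becomes a cube in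
      the numerator at the partner \<sigma> c, because g c * g (\<sigma> c) = p. This is exactly the
      weight of the middle term.\<close>
    then have k: "g (\<sigma> c) ^ 3 / q = i * (q ^ 4 / g c ^ 3)" using q0 by (simp add: i_def field_simps eval_nat_numeral)
    show ?thesis unfolding e \<Psi>_def k by (simp add: mult_ac)
  qed
  have L2: "i * f ((- 1 / \<tau> + 8 * of_int b) / (q * q)) = - (r \<tau> ^ 5) * (i * \<Phi> (\<sigma>2 b))" if b: "b \<in> U" for b
  proof -
    have "(- 1 / \<tau> + 8 * of_int b) / (q * q) = 8 * of_int b / of_int P - 1 / ((of_int P)\<^sup>2 * w)"
      unfolding Pq w_def using q0 \<tau>0 by (simp add: field_simps power2_eq_square)
    then have e: "f ((- 1 / \<tau> + 8 * of_int b) / (q * q)) =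
        - ((q * q) ^ 4 * R ^ 5 / q ^ 3) * f' (w + 8 * of_int (\<sigma>2 b) / (q * q))"
      using St'[OF P0(1) odd_P \<sigma>2(2)[OF b] w] by (simp only: Pq gU[OF b] R_def)
    have a: "w + 8 * of_int (\<sigma>2 b) / (q * q) = (\<tau> + 8 * of_int (\<sigma>2 b)) / (q * q)"
      by (simp add: w_def add_divide_distrib)
    have k: "(q * q) ^ 4 * R ^ 5 / q ^ 3 = r \<tau> ^ 5"
    proof -
      have q8: "(q * q) ^ 4 = q ^ 5 * q ^ 3" by (simp add: eval_nat_numeral)
      have cancel: "x * y * z / y = x * z" if "y \<noteq> 0" for x y z :: complex using that by simp
      show ?thesis unfolding rw R_def q8 power_mult_distrib [of q "r w"] by (rule cancel) (use q0 in simp)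
    qed
    show ?thesis unfolding e a k \<Phi>_def by (simp add: mult_ac)
  qed
  have L3: "g b ^ 3 / q * f (- 1 / \<tau> + 8 * of_int b / q) = - (r \<tau> ^ 5) * (i * \<Phi> (p * \<sigma> b))" if b: "b \<in> {1..<p}" for b
  proof -
    have "- 1 / \<tau> + 8 * of_int b / q = 8 * of_int b / of_int p - 1 / ((of_int p)\<^sup>2 * w)"
      unfolding w_def using q0 \<tau>0 by (simp add: q_def[symmetric] power2_eq_square)
    then have e: "f (- 1 / \<tau> + 8 * of_int b / q) = - (q ^ 4 * R ^ 5 / g b ^ 3) * f' (w + 8 * of_int (\<sigma> b) / q)"
      using St'[OF p0 odd_p \<sigma>(2)[OF b] w] by (simp only: q_def g_def R_def)
    have a: "w + 8 * of_int (\<sigma> b) / q = (\<tau> + 8 * of_int (p * \<sigma> b)) / (q * q)"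
      using q0 by (simp add: w_def add_divide_distrib q_def[symmetric])
    have "g b ^ 3 / q * (- (q ^ 4 * R ^ 5 / g b ^ 3) * y) = - (r \<tau> ^ 5) * (i * y)" for y
    proof -
      have "g b ^ 3 / q * (- (q ^ 4 * R ^ 5 / g b ^ 3) * y) = - (q ^ 4 / q * R ^ 5 * y)"
        using g0[OF b] by simp
      also have "q ^ 4 / q = q ^ 3" using q0 by (simp add: eval_nat_numeral)
      finally show ?thesis unfolding rw R_def iq' by simp
    qed
    then show ?thesis unfolding e a \<Phi>_def .
  qed
  have L4: "q ^ 3 * f (q * q * (- 1 / \<tau>)) = - (r \<tau> ^ 5) * (i * \<Phi> 0)"
  proof -
    have "q * q * (- 1 / \<tau>) = - 1 / w" using q0 by (simp add: w_def)
    then have e: "f (q * q * (- 1 / \<tau>)) = - (R ^ 5) * f' w" using S0'[OF w] by (simp only: R_def)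
    have "q ^ 3 * (- (R ^ 5) * y) = - (r \<tau> ^ 5) * (i * y)" for y
      unfolding rw R_def iq' by simp
    then show ?thesis unfolding e \<Phi>_def w_def by simp
  qed
  have re: "(\<Sum>c\<in>{1..<p}. F (\<sigma> c)) = (\<Sum>c\<in>{1..<p}. F c)" for F :: "int \<Rightarrow> complex"
    by (rule sum.reindex_bij_witness[of _ \<sigma> \<sigma>]) (use \<sigma> in auto)
  have re2: "(\<Sum>c\<in>U. F (\<sigma>2 c)) = (\<Sum>c\<in>U. F c)" for F :: "int \<Rightarrow> complex"
    by (rule sum.reindex_bij_witness[of _ \<sigma>2 \<sigma>2]) (use \<sigma>2 in auto)
  have M1: "(\<Sum>c\<in>{1..<p}. i * f ((- 1 / \<tau> + 8 * of_int (p * c)) / (q * q))) = - (r \<tau> ^ 5) * (\<Sum>c\<in>{1..<p}. \<Psi> c)"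
    unfolding re[of \<Psi>, symmetric] sum_distrib_left by (rule sum.cong[OF refl L1])
  have M2: "(\<Sum>b\<in>U. i * f ((- 1 / \<tau> + 8 * of_int b) / (q * q))) = - (r \<tau> ^ 5) * (\<Sum>b\<in>U. i * \<Phi> b)"
    unfolding re2[of "\<lambda>b. i * \<Phi> b", symmetric] sum_distrib_left by (rule sum.cong[OF refl L2])
  have M3: "(\<Sum>b\<in>{1..<p}. g b ^ 3 / q * f (- 1 / \<tau> + 8 * of_int b / q)) = - (r \<tau> ^ 5) * (\<Sum>b\<in>{1..<p}. i * \<Phi> (p * b))"
    unfolding re[of "\<lambda>b. i * \<Phi> (p * b)", symmetric] sum_distrib_left by (rule sum.cong[OF refl L3])
  have "hecke p f (- 1 / \<tau>) =
      (i * f ((- 1 / \<tau> + 8 * of_int 0) / (q * q)) +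
       (\<Sum>c\<in>{1..<p}. i * f ((- 1 / \<tau> + 8 * of_int (p * c)) / (q * q))) +
       (\<Sum>b\<in>U. i * f ((- 1 / \<tau> + 8 * of_int b) / (q * q)))) +
      (\<Sum>b\<in>{1..<p}. g b ^ 3 / q * f (- 1 / \<tau> + 8 * of_int b / q)) + q ^ 3 * f (q * q * (- 1 / \<tau>))"
    unfolding hecke_def P_def[symmetric] split Pq q_def[symmetric] g_def[symmetric] i_def[symmetric]
    by (simp only: distrib_left sum_distrib_left)
  also have "\<dots> = - (r \<tau> ^ 5) *
     ((i * \<Phi> 0 + (\<Sum>b\<in>{1..<p}. i * \<Phi> (p * b)) + (\<Sum>b\<in>U. i * \<Phi> b)) + (\<Sum>c\<in>{1..<p}. \<Psi> c) + q ^ 3 * f' (q * q * \<tau>))"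
    unfolding L0 M1 M2 M3 L4 by (simp only: distrib_left add_ac)
  also have "(i * \<Phi> 0 + (\<Sum>b\<in>{1..<p}. i * \<Phi> (p * b)) + (\<Sum>b\<in>U. i * \<Phi> b)) + (\<Sum>c\<in>{1..<p}. \<Psi> c) + q ^ 3 * f' (q * q * \<tau>) = hecke p f' \<tau>"
    unfolding hecke_def P_def[symmetric] split Pq q_def[symmetric] \<Phi>_def \<Psi>_def g_def i_def
    by (simp only: distrib_left sum_distrib_left)
  finally show ?thesis unfolding r_def .
qed

lemma modular_triple_hecke:
  assumes p: "prime p" "p > (2::int)" and abc: "modular_triple a b c"
  shows "modular_triple (hecke p a) (hecke p b) (hecke p c)"
  unfolding modular_triple_def
proof (intro ballI conjI)
  fix \<tau> assume \<tau>: "\<tau> \<in> \<H>"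
  have p0: "p > 0" and odd_p: "odd p" using p prime_odd_int by simp_all
  have T: "a (\<tau> + 1) = \<zeta>8 * b \<tau>" "b (\<tau> + 1) = \<zeta>8 * a \<tau>" "c (\<tau> + 1) = inverse \<zeta>8 * c \<tau>"
    and S: "a (- 1 / \<tau>) = - (csqrt (- \<i> * \<tau>) ^ 5) * a \<tau>" "b (- 1 / \<tau>) = - (csqrt (- \<i> * \<tau>) ^ 5) * c \<tau>"
      "c (- 1 / \<tau>) = - (csqrt (- \<i> * \<tau>) ^ 5) * b \<tau>"
    if "\<tau> \<in> \<H>" for \<tau> using abc that unfolding modular_triple_def by blast+
  note per = modular_triple_periodic[OF abc]
  note gs = modular_triple_gauss[OF abc]
  show "hecke p a (\<tau> + 1) = \<zeta>8 * hecke p b \<tau>" by (rule hecke_T[OF odd_p p0 T(1) per(1) per(2) \<tau>])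
  show "hecke p b (\<tau> + 1) = \<zeta>8 * hecke p a \<tau>" by (rule hecke_T[OF odd_p p0 T(2) per(2) per(1) \<tau>])
  show "hecke p c (\<tau> + 1) = inverse \<zeta>8 * hecke p c \<tau>" by (rule hecke_T[OF odd_p p0 T(3) per(3) per(3) \<tau>])
  show "hecke p a (- 1 / \<tau>) = - (csqrt (- \<i> * \<tau>) ^ 5) * hecke p a \<tau>" by (rule hecke_S[OF p S(1) gs(1) \<tau>])
  show "hecke p b (- 1 / \<tau>) = - (csqrt (- \<i> * \<tau>) ^ 5) * hecke p c \<tau>" by (rule hecke_S[OF p S(2) gs(2) \<tau>])
  show "hecke p c (- 1 / \<tau>) = - (csqrt (- \<i> * \<tau>) ^ 5) * hecke p b \<tau>" by (rule hecke_S[OF p S(3) gs(3) \<tau>])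
qed

lemma odd_prime_square_mod_8:
  assumes "odd (p::int)"
  shows "(p * p * m) mod 8 = m mod 8"
proof -
  obtain j where j: "p = 2 * j + 1" using assms by (elim oddE)
  have "even (j * (j + 1))" by simp
  then obtain i where i: "j * (j + 1) = 2 * i" by (elim evenE)
  have "p * p * m = 8 * (i * m) + m"
  proof -
    have "p * p = 4 * (j * (j + 1)) + 1" by (simp add: j algebra_simps)
    then have "p * p = 8 * i + 1" by (simp add: i)
    then show ?thesis by (simp add: algebra_simps)
  qed
  then show ?thesis by simp
qed

section \<open>Hecke relations between the basis forms and divisibility of coefficients\<close>

context weil_representation
begin

text \<open>An odd square is 1 modulo 8, so p^2 m, m and, when it is an integer, m / p^2 lie in the
  same class, and the operator acts within each component. The function l depends on p only and is
  fixed before G, so one l serves all basis forms.\<close>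

lemma weak_form_hecke:
  assumes p: "prime p" "p > (2::int)"
  obtains l :: "int \<Rightarrow> int" where
    "\<And>G. G \<in> weak_forms \<rho> \<Longrightarrow> \<exists>H\<in>weak_forms \<rho>. \<forall>m. fourier_coeff H m =
       fourier_coeff G (p * p * m) + of_int (p * l m) * fourier_coeff G m +
       of_int (p ^ 3) * (if p * p dvd m then fourier_coeff G (m div (p * p)) else 0)"
proof -
  have p0: "p > 0" and odd_p: "odd p" using p prime_odd_int by simp_all
  obtain l where l: "\<And>m. (\<Sum>b\<in>{1..<p}. gauss_sum p (16 * b) ^ 3 / of_int p * eexp (of_int (m * b) / of_int p)) =
      of_int p * of_int (l m)" using hecke_eigenvalue[OF p] by blast
  note sq = odd_prime_square_mod_8[OF odd_p]
  have "\<exists>H\<in>weak_forms \<rho>. \<forall>m. fourier_coeff H m =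
       fourier_coeff G (p * p * m) + of_int (p * l m) * fourier_coeff G m +
       of_int (p ^ 3) * (if p * p dvd m then fourier_coeff G (m div (p * p)) else 0)"
    if G: "G \<in> weak_forms \<rho>" for G
  proof -
    let ?a = "\<lambda>\<tau>. (G \<tau> $ 1 + G \<tau> $ 3) / 2" and ?b = "\<lambda>\<tau>. (G \<tau> $ 1 - G \<tau> $ 3) / 2" and ?c = "\<lambda>\<tau>. G \<tau> $ 2"
    have "modular_triple ?a ?b ?c" using G unfolding weak_forms_iff by blast
    then have mt: "modular_triple (hecke p ?a) (hecke p ?b) (hecke p ?c)" by (rule modular_triple_hecke[OF p])
    define T where "T c m = c (p * p * m) + of_int p * of_int (l m) * c m +
        of_int p ^ 3 * (if p * p dvd m then c (m div (p * p)) else 0)" for c :: "int \<Rightarrow> complex" and m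
    have hs: "hecke p f has_q8_series T c" if "f has_q8_series c" for f c
      using hecke_has_q8_series[OF that p0] unfolding l T_def .
    have s1: "(\<lambda>\<tau>. hecke p ?a \<tau> + hecke p ?b \<tau>) has_q8_series T (\<lambda>m. if m mod 8 = 1 then fourier_coeff G m else 0)"
    proof (rule has_q8_series_cong[OF _ refl hs[OF fourier_series(1)[OF G]]])
      fix \<tau>
      have "(\<lambda>\<tau>. G \<tau> $ 1) = (\<lambda>\<tau>. ?a \<tau> + ?b \<tau>)" by (rule ext) (simp add: field_simps)
      then show "hecke p (\<lambda>\<tau>. G \<tau> $ 1) \<tau> = hecke p ?a \<tau> + hecke p ?b \<tau>" by (simp only: hecke_add)
    qed
    have s3: "(\<lambda>\<tau>. hecke p ?a \<tau> - hecke p ?b \<tau>) has_q8_series T (\<lambda>m. if m mod 8 = 5 then fourier_coeff G m else 0)"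
    proof (rule has_q8_series_cong[OF _ refl hs[OF fourier_series(3)[OF G]]])
      fix \<tau>
      have "(\<lambda>\<tau>. G \<tau> $ 3) = (\<lambda>\<tau>. ?a \<tau> - ?b \<tau>)" by (rule ext) (simp add: field_simps)
      then show "hecke p (\<lambda>\<tau>. G \<tau> $ 3) \<tau> = hecke p ?a \<tau> - hecke p ?b \<tau>" by (simp only: hecke_diff)
    qed
    obtain H where H: "H \<in> weak_forms \<rho>" "\<And>m. fourier_coeff H m =
        (if m mod 8 = 1 then T (\<lambda>m. if m mod 8 = 1 then fourier_coeff G m else 0) m
         else if m mod 8 = 7 then T (\<lambda>m. if m mod 8 = 7 then fourier_coeff G m else 0) m
         else if m mod 8 = 5 then T (\<lambda>m. if m mod 8 = 5 then fourier_coeff G m else 0) m else 0)"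
      using weak_form_of_triple[OF mt s1 hs[OF fourier_series(2)[OF G]] s3] by blast
    have Tr: "T (\<lambda>m. if m mod 8 = r then fourier_coeff G m else 0) m = T (fourier_coeff G) m" if "m mod 8 = r" for m r
    proof -
      have "(m div (p * p)) mod 8 = m mod 8" if "p * p dvd m"
        using sq[of "m div (p * p)"] that by simp
      then show ?thesis unfolding T_def using that sq[of m] by simp
    qed
    have T0: "T (fourier_coeff G) m = 0" if m: "m mod 8 \<notin> {1, 5, 7}" for m
    proof -
      have "(m div (p * p)) mod 8 = m mod 8" if "p * p dvd m"
        using sq[of "m div (p * p)"] that by simp
      then show ?thesis unfolding T_def using m sq[of m] by (auto simp: fourier_coeff_other)
    qed
    have "fourier_coeff H m = T (fourier_coeff G) m" for m
      unfolding H(2) using Tr[of m] T0[of m] by auto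
    with H(1) show ?thesis unfolding T_def by (intro bexI[of _ H]) simp_all
  qed
  with that show thesis by blast
qed

lemma admissible_square_mult:
  assumes d: "d \<in> admissible" and p: "odd (p::nat)"
  shows "d * p\<^sup>2 \<in> admissible"
proof -
  have "int (d * p\<^sup>2 mod 8) = (int p * int p * int d) mod 8"
    by (simp add: zmod_int power2_eq_square mult_ac)
  also have "\<dots> = int d mod 8" using p by (intro odd_prime_square_mod_8) simp
  also have "\<dots> = int (d mod 8)" by (simp add: zmod_int)
  finally have "d * p\<^sup>2 mod 8 = d mod 8" by (simp only: of_nat_eq_iff)
  moreover have "d * p\<^sup>2 \<ge> 1" using d p by (auto simp: admissible_def Suc_le_eq odd_pos)
  ultimately show ?thesis using d by (simp add: admissible_def)
qed

definition coeff :: "nat \<Rightarrow> int \<Rightarrow> int" where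
  "coeff d m = (THE z. fourier_coeff (basis_form d) m = of_int z)"

lemma coeff:
  assumes "d \<in> admissible"
  shows "fourier_coeff (basis_form d) m = of_int (coeff d m)"
proof -
  have "fourier_coeff (basis_form d) m \<in> \<int>"
    using basis_form_integral[OF assms] by (simp add: integral_weak_forms_def)
  then obtain z where z: "fourier_coeff (basis_form d) m = of_int z" by (elim Ints_cases)
  then have "coeff d m = z" unfolding coeff_def by (intro the_equality) simp_all
  with z show ?thesis by simp
qed

lemma coeff_neg:
  assumes "d \<in> admissible" "m < 0"
  shows "coeff d m = (if m = - int d then 1 else 0)"
  using basis_form_coeff[OF assms] unfolding coeff[OF assms(1)] by (simp split: if_splits)

text \<open>
  The image of a basis form under the Hecke operator is determined by its principal part, which has
  at most three terms.
\<close>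

lemma hecke_relation:
  assumes p: "prime (p::nat)" "p > 2"
  obtains l :: "int \<Rightarrow> int" where
    "\<And>d j m. d \<in> admissible \<Longrightarrow> squarefree d \<Longrightarrow>
      coeff (d * p ^ (2 * j)) ((int p)\<^sup>2 * m) + int p * l m * coeff (d * p ^ (2 * j)) m +
        int p ^ 3 * (if (int p)\<^sup>2 dvd m then coeff (d * p ^ (2 * j)) (m div (int p)\<^sup>2) else 0) =
      (if j > 0 then coeff (d * p ^ (2 * (j - 1))) m else 0) +
        int p * l (- int (d * p ^ (2 * j))) * coeff (d * p ^ (2 * j)) m + int p ^ 3 * coeff (d * p ^ (2 * (j + 1))) m"
proof -
  have ip: "prime (int p)" "int p > 2" using p by simp_all
  have odd_p: "odd p" using p prime_odd_nat by blast
  obtain l where l: "\<And>G. G \<in> weak_forms \<rho> \<Longrightarrow> \<exists>H\<in>weak_forms \<rho>. \<forall>m. fourier_coeff H m =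
       fourier_coeff G (int p * int p * m) + of_int (int p * l m) * fourier_coeff G m +
       of_int (int p ^ 3) * (if int p * int p dvd m then fourier_coeff G (m div (int p * int p)) else 0)"
    using weak_form_hecke[OF ip] by blast
  have "coeff (d * p ^ (2 * j)) ((int p)\<^sup>2 * m) + int p * l m * coeff (d * p ^ (2 * j)) m +
        int p ^ 3 * (if (int p)\<^sup>2 dvd m then coeff (d * p ^ (2 * j)) (m div (int p)\<^sup>2) else 0) =
      (if j > 0 then coeff (d * p ^ (2 * (j - 1))) m else 0) +
        int p * l (- int (d * p ^ (2 * j))) * coeff (d * p ^ (2 * j)) m + int p ^ 3 * coeff (d * p ^ (2 * (j + 1))) m"
    if d: "d \<in> admissible" and sf: "squarefree d" for d j m
  proof -
    have adm: "d * p ^ (2 * i) \<in> admissible" for i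
      using admissible_square_mult[OF d, of "p ^ i"] odd_p by (simp add: power_mult [symmetric] mult.commute)
    define P where "P = (int p)\<^sup>2"
    have P0: "P > 0" using p by (simp add: P_def)
    have PP: "int p * int p = P" by (simp add: P_def power2_eq_square)
    define D where "D i = d * p ^ (2 * i)" for i
    have D: "D i \<in> admissible" for i unfolding D_def by (rule adm)
    have D_Suc: "int (D (Suc i)) = P * int (D i)" for i
      by (simp add: D_def P_def power_add power2_eq_square mult_ac)
    define c where "c = coeff (D j)"
    \<comment> \<open>Multipliers and indices of the three terms of the principal part, listed by i
      < 3. For j = 0 the first multiplier is 0, and the index D (j - 1) truncates to D 0, which
      keeps it admissible.\<close>
    define z where "z = (\<lambda>i::nat. if i = 0 then (if j > 0 then 1 else 0) else if i = 1 then int p * l (- int (D j)) else int p ^ 3)"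
    define e where "e = (\<lambda>i::nat. if i = 0 then D (j - 1) else if i = 1 then D j else D (j + 1))"
    obtain H where Hw: "H \<in> weak_forms \<rho>" and H': "\<And>m. fourier_coeff H m =
        fourier_coeff (basis_form (D j)) (P * m) + of_int (int p * l m) * fourier_coeff (basis_form (D j)) m +
        of_int (int p ^ 3) * (if P dvd m then fourier_coeff (basis_form (D j)) (m div P) else 0)"
      using l[OF basis_form_weak[OF D[of j]]] unfolding PP by blast
    define h where "h m = c (P * m) + int p * l m * c m + int p ^ 3 * (if P dvd m then c (m div P) else 0)" for m
    have H: "fourier_coeff H m = of_int (h m)" for m
      unfolding H' coeff[OF D[of j]] h_def c_def by simp
    let ?s = "\<Sum>i\<in>{..<3}. int_scale (z i) (basis_form (e i))"
    have ew: "basis_form (e i) \<in> weak_forms \<rho>" for i unfolding e_def by (simp add: basis_form_weak D)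
    have sw: "?s \<in> weak_forms \<rho>" by (rule weak_forms_sum(1)) (simp_all add: ew)
    define t where "t m = (if j > 0 then coeff (D (j - 1)) m else 0) + int p * l (- int (D j)) * c m + int p ^ 3 * coeff (D (j + 1)) m" for m
    have s: "fourier_coeff ?s m = of_int (t m)" for m
    proof -
      have "fourier_coeff ?s m = (\<Sum>i\<in>{..<3}. of_int (z i) * fourier_coeff (basis_form (e i)) m)"
        by (rule weak_forms_sum(2)) (simp_all add: ew)
      also have "\<dots> = of_int (t m)"
        by (simp add: eval_nat_numeral z_def e_def t_def c_def coeff D)
      finally show ?thesis .
    qed
    have "h m = t m" if m: "m < 0" for m
    proof -
      have Pm: "P * m < 0" using m P0 by (simp add: mult_pos_neg)
      have cneg: "coeff (D i) n = (if n = - int (D i) then 1 else 0)" if "n < 0" for i n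
        by (rule coeff_neg[OF D that])
      have 1: "c (P * m) = (if j > 0 then coeff (D (j - 1)) m else 0)"
      proof (cases j)
        case 0
        \<comment> \<open>This is where square-freeness of d enters: no form stands below the index
          d in the chain.\<close>
        have "P * m \<noteq> - int (D 0)"
        proof
          assume "P * m = - int (D 0)"
          then have "int d = P * (- m)" by (simp add: D_def)
          then have "P dvd int d" by (rule dvdI)
          then have "p\<^sup>2 dvd d" unfolding P_def by (simp flip: of_nat_power)
          with sf have "is_unit p" unfolding squarefree_def by blast
          then show False using p by simp
        qed
        then show ?thesis unfolding c_def using cneg[OF Pm] 0 by simp
      next
        case (Suc i)
        have "P * m = - int (D (Suc i)) \<longleftrightarrow> m = - int (D i)"
          unfolding D_Suc using P0 by (metis mult_left_cancel mult_minus_right less_irrefl)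
        then show ?thesis unfolding c_def cneg[OF Pm] using Suc cneg[OF m, of i] by simp
      qed
      \<comment> \<open>At negative exponents c is nonzero only at -D j, so the varying l m can be
        replaced by its value there.\<close>
      have 2: "l m * c m = l (- int (D j)) * c m" unfolding c_def cneg[OF m] by simp
      have 3: "(if P dvd m then c (m div P) else 0) = coeff (D (j + 1)) m"
      proof (cases "P dvd m")
        case True
        then obtain n where n: "m = P * n" by (elim dvdE)
        then have n0: "n < 0" using m P0 by (simp add: mult_less_0_iff)
        have "P * n = - int (D (Suc j)) \<longleftrightarrow> n = - int (D j)"
          unfolding D_Suc using P0 by (metis mult_left_cancel mult_minus_right less_irrefl)
        then show ?thesis using True P0 cneg[OF n0, of j] cneg[OF m, of "Suc j"] by (simp add: n c_def)
      next
        case False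
        then have "m \<noteq> - int (D (Suc j))" unfolding D_Suc by auto
        then show ?thesis using False cneg[OF m, of "Suc j"] by simp
      qed
      show ?thesis unfolding h_def t_def 1 3 using 2 by (simp add: mult.assoc)
    qed
    then have "H = ?s" by (intro weak_forms_eqI[OF Hw sw]) (simp only: H s)
    then have "of_int (h m) = (of_int (t m) :: complex)" using H[of m] s[of m] by simp
    then have "h m = t m" by simp
    then show ?thesis unfolding h_def t_def c_def D_def P_def .
  qed
  then show thesis by (rule that)
qed

text \<open>The weight p^j compensates the change of index. In the relation multiplied by p^j, the
  neighbour j - 1 leaves one factor p, the middle term has its own p, and the neighbour j + 1 uses
  one factor of p^3 and leaves two. The last term goes back from k to k - 2, for which p^3 is again
  enough; hence strong induction on k.\<close>

lemma prime_power_dvd_coeff: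
  assumes p: "prime (p::nat)" "p > 2" and d: "d \<in> admissible" "squarefree d"
  shows "int p ^ k dvd int p ^ j * coeff (d * p ^ (2 * j)) (int p ^ (2 * k) * n)"
proof -
  obtain l where l: "\<And>j m. coeff (d * p ^ (2 * j)) ((int p)\<^sup>2 * m) + int p * l m * coeff (d * p ^ (2 * j)) m +
        int p ^ 3 * (if (int p)\<^sup>2 dvd m then coeff (d * p ^ (2 * j)) (m div (int p)\<^sup>2) else 0) =
      (if j > 0 then coeff (d * p ^ (2 * (j - 1))) m else 0) +
        int p * l (- int (d * p ^ (2 * j))) * coeff (d * p ^ (2 * j)) m + int p ^ 3 * coeff (d * p ^ (2 * (j + 1))) m"
    using hecke_relation[OF p] d by metis
  define C where "C j m = coeff (d * p ^ (2 * j)) m" for j m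
  define q where "q = int p"
  have q0: "q \<noteq> 0" using p by (simp add: q_def)
  define \<mu> where "\<mu> j m = l (- int (d * p ^ (2 * j))) - l m" for j m
  have rec: "C j (q\<^sup>2 * m) = (if j > 0 then C (j - 1) m else 0) + q * \<mu> j m * C j m + q ^ 3 * C (j + 1) m -
      q ^ 3 * (if q\<^sup>2 dvd m then C j (m div q\<^sup>2) else 0)" for j m
    using l[of j m] unfolding C_def q_def \<mu>_def by (simp add: algebra_simps)
  have "q ^ k dvd q ^ j * C j (q ^ (2 * k) * n)" for j
  proof (induction k arbitrary: j rule: less_induct)
    case (less k)
    show ?case
    proof (cases k)
      case (Suc i)
      define m where "m = q ^ (2 * i) * n"
      have km: "q ^ (2 * Suc i) * n = q\<^sup>2 * m" by (simp add: m_def power_add power2_eq_square mult_ac)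
      have IH: "q ^ i dvd q ^ j' * C j' m" for j' using less[of i j'] by (simp add: Suc m_def)
      have t1: "q ^ Suc i dvd q ^ j * (if j > 0 then C (j - 1) m else 0)"
      proof (cases j)
        case (Suc j')
        have "q ^ Suc i dvd q * (q ^ j' * C j' m)" using IH[of j'] by (simp add: mult_dvd_mono)
        then show ?thesis by (simp add: Suc mult_ac)
      qed simp
      have "q ^ Suc i dvd q * (q ^ j * C j m)" using IH[of j] by (simp add: mult_dvd_mono)
      then have "q ^ Suc i dvd \<mu> j m * (q * (q ^ j * C j m))" by (rule dvd_mult)
      then have t2: "q ^ Suc i dvd q ^ j * (q * \<mu> j m * C j m)" by (simp only: mult_ac)
      have "q ^ Suc i dvd q * (q ^ (j + 1) * C (j + 1) m)" using IH[of "j + 1"] by (simp add: mult_dvd_mono)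
      then have "q ^ Suc i dvd q * (q * (q ^ (j + 1) * C (j + 1) m))" by (rule dvd_mult)
      then have t3: "q ^ Suc i dvd q ^ j * (q ^ 3 * C (j + 1) m)" by (simp add: eval_nat_numeral mult_ac)
      \<comment> \<open>For i = 0 only one factor p is required and p^3 supplies it, whatever the
        coefficient at m / p^2 is. For larger i the exponent m is divisible by p^2 and the
        hypothesis two steps down applies.\<close>
      have t4: "q ^ Suc i dvd q ^ j * (q ^ 3 * (if q\<^sup>2 dvd m then C j (m div q\<^sup>2) else 0))"
      proof (cases i)
        case 0
        have "q ^ Suc i dvd q * (q * q * (q ^ j * (if q\<^sup>2 dvd m then C j (m div q\<^sup>2) else 0)))" by (simp add: 0)
        then show ?thesis by (simp add: eval_nat_numeral mult_ac)
      next
        case (Suc i')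
        have "m = q\<^sup>2 * (q ^ (2 * i') * n)" by (simp add: Suc m_def power_add power2_eq_square mult_ac)
        then have m: "q\<^sup>2 dvd m" "m div q\<^sup>2 = q ^ (2 * i') * n" using q0 by simp_all
        have "q ^ i' dvd q ^ j * C j (q ^ (2 * i') * n)" using less[of i' j] by (simp add: \<open>k = Suc i\<close> Suc)
        then have "q ^ 3 * q ^ i' dvd q ^ 3 * (q ^ j * C j (q ^ (2 * i') * n))" by (rule mult_dvd_mono[OF dvd_refl])
        moreover have "q ^ Suc i dvd q ^ 3 * q ^ i'" unfolding Suc by (simp add: eval_nat_numeral mult_ac)
        ultimately have "q ^ Suc i dvd q ^ 3 * (q ^ j * C j (q ^ (2 * i') * n))" using dvd_trans by blast
        then show ?thesis by (simp add: m mult_ac)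
      qed
      have "q ^ j * C j (q\<^sup>2 * m) = q ^ j * (if j > 0 then C (j - 1) m else 0) + q ^ j * (q * \<mu> j m * C j m) +
          q ^ j * (q ^ 3 * C (j + 1) m) - q ^ j * (q ^ 3 * (if q\<^sup>2 dvd m then C j (m div q\<^sup>2) else 0))"
        unfolding rec by (simp only: distrib_left right_diff_distrib)
      then show ?thesis unfolding Suc km by (simp only: dvd_diff dvd_add t1 t2 t3 t4)
    qed simp
  qed
  then show ?thesis unfolding C_def q_def .
qed

text \<open>For odd m divisibility is tested prime by prime: if p^k is the exact power of p in m and
  m = p^k n, the previous lemma with j = 0 applies at p^(2k) n^2. For even m the square lies in the
  class 0 or 4 modulo 8, where no coefficient lives.\<close>

lemma coeff_square_dvd:
  assumes d: "d \<in> admissible" "squarefree d" and m: "m \<ge> 1"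
  shows "int m dvd coeff d ((int m)\<^sup>2)"
proof (cases "even m")
  case True
  then obtain k where k: "int m = 2 * k" by (metis even_of_nat evenE)
  have "(int m)\<^sup>2 mod 8 = 0 \<or> (int m)\<^sup>2 mod 8 = 4"
  proof -
    have "(int m)\<^sup>2 = 4 * (k * k)" by (simp add: k power2_eq_square)
    then show ?thesis by presburger
  qed
  then have "fourier_coeff (basis_form d) ((int m)\<^sup>2) = 0" by (intro fourier_coeff_other) auto
  then have "coeff d ((int m)\<^sup>2) = 0" unfolding coeff[OF d(1)] by simp
  then show ?thesis by simp
next
  case False
  define x where "x = nat \<bar>coeff d ((int m)\<^sup>2)\<bar>"
  have "m dvd x"
  proof (cases "x = 0")
    case False
    show ?thesis
    proof (rule multiplicity_le_imp_dvd)
      show "m \<noteq> 0" using m by simp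
      fix p :: nat assume p: "prime p"
      define k where "k = multiplicity p m"
      show "multiplicity p m \<le> multiplicity p x"
      proof (cases "p dvd m")
        case True
        then have "p \<noteq> 2" using \<open>odd m\<close> by auto
        then have p2: "p > 2" using prime_ge_2_nat[OF p] by simp
        have "p ^ k dvd m" unfolding k_def by (rule multiplicity_dvd)
        then obtain n where n: "m = p ^ k * n" by (elim dvdE)
        have "(int m)\<^sup>2 = int p ^ (2 * k) * (int n)\<^sup>2"
          by (simp add: n power_mult_distrib power_mult [symmetric] mult.commute)
        then have "int p ^ k dvd coeff d ((int m)\<^sup>2)"
          using prime_power_dvd_coeff[OF p p2 d, of k 0 "(int n)\<^sup>2"] by simp
        then have "int (p ^ k) dvd int x" by (simp add: x_def)
        then have "p ^ k dvd x" by (simp only: int_dvd_int_iff)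
        then show ?thesis unfolding k_def [symmetric] using \<open>x \<noteq> 0\<close> p
          by (intro multiplicity_geI) auto
      qed (simp add: not_dvd_imp_multiplicity_0)
    qed
  qed simp
  then have "int m dvd int x" by (simp only: int_dvd_int_iff)
  then show ?thesis by (simp add: x_def)
qed

end

theorem theorem1p4:
  fixes \<rho> :: "(int^2^2) \<times> (complex \<Rightarrow> complex) \<Rightarrow> complex^3^3"
  assumes "\<rho> \<in> hom Mp2Z GL3C"
    and "\<rho> Mp2_T = rho_T"
    and "\<rho> Mp2_S = rho_S"
  shows "\<exists>G :: nat \<Rightarrow> complex \<Rightarrow> complex^3.
           (\<forall>d\<in>admissible. \<forall>F. F \<in> integral_weak_forms \<rho> \<and> has_principal_part d F \<longleftrightarrow> F = G d) \<and>
           inj_on G admissible \<and>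
           zmod.independent (G ` admissible) \<and>
           zmod.span (G ` admissible) = integral_weak_forms \<rho> \<and>
           (\<forall>m::nat. \<forall>d\<in>admissible. m \<ge> 1 \<longrightarrow> squarefree d \<longrightarrow>
              (\<exists>k::int. fourier_coeff (G d) ((int m)\<^sup>2) = of_int (int m * k)))"
proof -
  interpret weil_representation \<rho> by unfold_locales (fact assms)+
  have "\<exists>k::int. fourier_coeff (basis_form d) ((int m)\<^sup>2) = of_int (int m * k)"
    if m: "m \<ge> 1" and d: "d \<in> admissible" "squarefree d" for m d
  proof -
    obtain k where "coeff d ((int m)\<^sup>2) = int m * k" using coeff_square_dvd[OF d m] by (elim dvdE)
    then show ?thesis unfolding coeff[OF d(1)] by (intro exI[of _ k]) (simp only:)
  qed
  then show ?thesis
    using basis_form_characterization basis_form_inj basis_form_independent basis_form_span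
    by (intro exI[of _ basis_form] conjI) blast+
qed

end
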